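(* For every connected, finite dimensional manifold with generalized corners $M$ (with embedded boundary faces), the collection $$\mathcal{P}_M=\{W(F)^\vee: F\in\mathcal{F}(M)\},\qquad {}^b\mathcal{M}F\cong F\times W(F)^\vee,$$ indexed by the boundary faces of $M$, with arrows $W(F)^\vee\rightharpoonup W(G)^\vee$ for $G\le F$ induced by the natural homomorphisms ${}^b\mathcal{M}_xF\to{}^b\mathcal{M}_xG$, $x\in G$, is a monoidal complex. Every interior b-map $f:M\to N$ induces a morphism of monoidal complexes $$f_\natural:\mathcal{P}_M\to\mathcal{P}_N.$$ The association $M\mapsto\mathcal{P}_M$, $f\mapsto f_\natural$ is a functor from the category of manifolds with generalized corners and interior b-maps to the category of monoidal complexes.
   Context: **Monoids.** "Monoid" means toric monoid: a commutative monoid $(P,+,0)$ that is finitely generated, integral ($p+r=q+r\Rightarrow p=q$), torsion free (the group completion $P^{gp}$ is torsion free) and saturated ($p\in P^{gp}$, $np\in P$ for some $n\ge1$ implies $p\in P$). $\dim P=\operatorname{rank}P^{gp}$. $P^\times$ is the group of units and $P^\sharp=P/P^\times$, where for a submonoid $S\subset P$ the quotient $P/S$ is the set of classes of $p\sim p'\iff p+q=p'+q'$ for some $q,q'\in S$. A face $S\le P$ is a submonoid such that $p+q\in S$ implies $p,q\in S$. $P^\vee=\operatorname{Hom}(P;\mathbb{N})$. The interior $P^\circ$ is the complement in $P$ of the union of all proper faces. A homomorphism $f:Q\to P$ is interior if $f(Q^\circ)\subset P^\circ$. **Model spaces.** $\mathbb{R}_+=([0,\infty),\cdot,1)$ and $X_P=\operatorname{Hom}(P;\mathbb{R}_+)$.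 For $p\in P$ let $x_p(x)=x(p)$; $X_P$ has the weakest topology making all $x_p$ continuous. For $O\subset X_P$ open, $f:O\to\mathbb{R}$ is smooth if $f=g(x_{p_1},\dots,x_{p_n})$ for some $p_i\in P$ and smooth $g$ on the image of $O$ in $\mathbb{R}_+^n$ (locally the restriction of a smooth function on an open subset of $\mathbb R^n$). A b-function on $O$ is a function $b:O\to\mathbb{R}_+$ locally of the form $h\,x_p$ with $p\in P$ and $h>0$ smooth. A map $f:O\subset X_P\to X_Q$ is an interior b-map if for each $q\in Q$, $f^*x_q=h\,x_p$ for some $p\in P$ and smooth $h>0$. A diffeomorphism is an invertible interior b-map whose inverse is an interior b-map. **Manifolds.** A manifold with generalized corners is a second countable Hausdorff space $M$ with a maximal atlas of charts to open sets $O\subset X_P$ (various $P$) with transition maps diffeomorphisms. b-functions and interior b-maps are defined via charts; $\mathcal{B}_M$ is the sheaf of multiplicative monoids of b-functions, with stalks $\mathcal{B}_{M,x}$. $\mathcal{B}_{M,x}^\sharp$ is a sharp toric monoid, $\operatorname{codim}(x)=\dim\mathcal{B}_{M,x}^\sharp$, and $S^l(M)=\{x:\operatorname{codim}(x)=l\}$. A boundary face of codimension $l$ is the closure $F$ of a connected component $F^\circ$ of $S^l(M)$. Boundary faces are required, as part of the definition of a manifold, to be embedded: for each $l$ and $x\in M$, distinct consistent choices (over small neighborhoods $U$ of $x$) of a connected component of $S^l(M)\cap U$ adherent to $x$ lie in distinct components of $S^l(M)$. Manifolds are assumed connected. $\mathcal{F}(M)$ is the set of boundary faces (including $M$), and $G\le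 F$ means $G\subset F$. $W(F)$ denotes the monoid $\mathcal{B}_{M,x}^\sharp$ for $x\in F^\circ$, which is independent of $x$. For an interior b-map $f:M\to N$ and $F\in\mathcal{F}(M)$, $\mathcal{F}(f)(F)$ is the unique $G\in\mathcal{F}(N)$ with $f(F^\circ)\subset G^\circ$. **Normal monoids.** For $x\in F\in\mathcal{F}(M)$, let $\mathcal{T}(F,x)\subset\mathcal{B}_{M,x}$ be the submonoid of germs of b-functions which do not vanish identically on any neighborhood of $x$ in $F$, and ${}^b\mathcal{M}_xF=\operatorname{Hom}(\mathcal{B}_{M,x}/\mathcal{T}(F,x);\mathbb{N})$. These are the fibers of a bundle of monoids ${}^b\mathcal{M}F\to F$ which is canonically trivial, ${}^b\mathcal{M}F\cong F\times W(F)^\vee$. For $x\in G\le F$, the inclusion $\mathcal{T}(G,x)\subset\mathcal{T}(F,x)$ induces the natural homomorphism ${}^b\mathcal{M}_xF\to{}^b\mathcal{M}_xG$. For an interior b-map $f:M\to N$, pull-back of germs induces homomorphisms ${}^b\mathcal{M}_xF\to{}^b\mathcal{M}_{f(x)}G$, $G=\mathcal{F}(f)(F)$; these are locally constant in $x$ with respect to the trivializations, so reduce to a fixed homomorphism $f_{\natural,F}:W(F)^\vee\to W(G)^\vee$, and $f_\natural=(f_{\natural,F})_{F\in\mathcal{F}(M)}$. **Monoidal complexes.** A monoidal complex is a category $\mathcal{P}$ whose objects are monoids and whose arrows, written $Q\rightharpoonup P$, are homomorphisms which are isomorphisms onto a face of $P$, such that for each object $P$ and face $S\le P$ there is a unique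 object $Q$ and arrow $Q\rightharpoonup P$ which is an isomorphism onto $S$. A morphism $\phi:\mathcal{P}\to\mathcal{Q}$ assigns to each $P\in\mathcal{P}$ an interior homomorphism $\phi_P:P\to Q$ for some $Q\in\mathcal{Q}$, such that for each arrow $S\rightharpoonup P$ with $\phi_S:S\to T$, $\phi_P:P\to Q$, the square formed with an arrow $T\rightharpoonup Q$ of $\mathcal{Q}$ commutes. *)

theory Defs
  imports "HOL-Analysis.Analysis" "HOL-Algebra.FiniteProduct"
begin

section \<open>Toric monoids\<close>

text \<open>Commutative monoids are monoid records of HOL-Algebra, hence written multiplicatively.
  A homomorphism of monoids has to preserve the unit, which \<^term>\<open>hom\<close> does not demand;
  homomorphisms are extensional, so that equality of homomorphisms is equality on the carrier.\<close>

definition mon_hom :: "'a monoid \<Rightarrow> 'b monoid \<Rightarrow> ('a \<Rightarrow> 'b) set" where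
  "mon_hom P Q = {h \<in> hom P Q. h \<in> extensional (carrier P) \<and> h \<one>\<^bsub>P\<^esub> = \<one>\<^bsub>Q\<^esub>}"

definition nat_monoid :: "nat monoid" where
  "nat_monoid = \<lparr>carrier = UNIV, mult = (+), one = 0\<rparr>"

definition nonneg_real_monoid :: "real monoid" where
  "nonneg_real_monoid = \<lparr>carrier = {0..}, mult = (*), one = 1\<rparr>"

definition dual :: "'a monoid \<Rightarrow> ('a \<Rightarrow> nat) monoid" where
  "dual P = \<lparr>carrier = mon_hom P nat_monoid,
             mult = (\<lambda>\<phi> \<psi>. \<lambda>p\<in>carrier P. \<phi> p + \<psi> p),
             one = (\<lambda>p\<in>carrier P. 0)\<rparr>"

text \<open>\<open>dual_map P h\<close> is precomposition with a homomorphism \<open>h\<close> defined on \<open>P\<close>.\<close>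

definition dual_map :: "'a monoid \<Rightarrow> ('a \<Rightarrow> 'b) \<Rightarrow> ('b \<Rightarrow> nat) \<Rightarrow> 'a \<Rightarrow> nat" where
  "dual_map P h \<phi> = (\<lambda>p\<in>carrier P. \<phi> (h p))"

definition quot_rel :: "'a monoid \<Rightarrow> 'a set \<Rightarrow> ('a \<times> 'a) set" where
  "quot_rel P S = {(p, p'). p \<in> carrier P \<and> p' \<in> carrier P \<and>
                     (\<exists>q\<in>S. \<exists>q'\<in>S. p \<otimes>\<^bsub>P\<^esub> q = p' \<otimes>\<^bsub>P\<^esub> q')}"

definition quot_class :: "'a monoid \<Rightarrow> 'a set \<Rightarrow> 'a \<Rightarrow> 'a set" where
  "quot_class P S p = quot_rel P S `` {p}"

definition mon_quot :: "'a monoid \<Rightarrow> 'a set \<Rightarrow> 'a set monoid" where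
  "mon_quot P S = \<lparr>carrier = carrier P // quot_rel P S,
                   mult = (\<lambda>A B. \<Union>a\<in>A. \<Union>b\<in>B. quot_class P S (a \<otimes>\<^bsub>P\<^esub> b)),
                   one = quot_class P S \<one>\<^bsub>P\<^esub>\<rparr>"

text \<open>The homomorphism from a quotient of some monoid to \<open>P/S\<close> that is induced by \<open>h\<close>.\<close>

definition quot_map :: "'b monoid \<Rightarrow> 'b set \<Rightarrow> ('a \<Rightarrow> 'b) \<Rightarrow> 'a set \<Rightarrow> 'b set" where
  "quot_map P S h A = (\<Union>a\<in>A. quot_class P S (h a))"

definition sharp :: "'a monoid \<Rightarrow> 'a set monoid" where
  "sharp P = mon_quot P (Units P)"

definition gp_rel :: "'a monoid \<Rightarrow> (('a \<times> 'a) \<times> ('a \<times> 'a)) set" where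
  "gp_rel P = {((a, b), (c, d)). a \<in> carrier P \<and> b \<in> carrier P \<and> c \<in> carrier P \<and> d \<in> carrier P \<and>
                 (\<exists>k\<in>carrier P. a \<otimes>\<^bsub>P\<^esub> d \<otimes>\<^bsub>P\<^esub> k = c \<otimes>\<^bsub>P\<^esub> b \<otimes>\<^bsub>P\<^esub> k)}"

definition gp :: "'a monoid \<Rightarrow> ('a \<times> 'a) set monoid" where
  "gp P = \<lparr>carrier = (carrier P \<times> carrier P) // gp_rel P,
           mult = (\<lambda>A B. \<Union>(a, b)\<in>A. \<Union>(c, d)\<in>B. gp_rel P `` {(a \<otimes>\<^bsub>P\<^esub> c, b \<otimes>\<^bsub>P\<^esub> d)}),
           one = gp_rel P `` {(\<one>\<^bsub>P\<^esub>, \<one>\<^bsub>P\<^esub>)}\<rparr>"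

definition gp_of :: "'a monoid \<Rightarrow> 'a \<Rightarrow> ('a \<times> 'a) set" where
  "gp_of P p = gp_rel P `` {(p, \<one>\<^bsub>P\<^esub>)}"

definition fin_gen :: "'a monoid \<Rightarrow> bool" where
  "fin_gen P \<longleftrightarrow> (\<exists>A. finite A \<and> A \<subseteq> carrier P \<and>
                     (\<forall>H. submonoid H P \<and> A \<subseteq> H \<longrightarrow> H = carrier P))"

definition integral_monoid :: "'a monoid \<Rightarrow> bool" where
  "integral_monoid P \<longleftrightarrow> (\<forall>p\<in>carrier P. \<forall>q\<in>carrier P. \<forall>r\<in>carrier P.
                            p \<otimes>\<^bsub>P\<^esub> r = q \<otimes>\<^bsub>P\<^esub> r \<longrightarrow> p = q)"

definition torsion_free_monoid :: "'a monoid \<Rightarrow> bool" where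
  "torsion_free_monoid P \<longleftrightarrow> (\<forall>a\<in>carrier (gp P). \<forall>n::nat. n \<ge> 1 \<and>
                                a [^]\<^bsub>gp P\<^esub> n = \<one>\<^bsub>gp P\<^esub> \<longrightarrow> a = \<one>\<^bsub>gp P\<^esub>)"

definition saturated_monoid :: "'a monoid \<Rightarrow> bool" where
  "saturated_monoid P \<longleftrightarrow> (\<forall>a\<in>carrier (gp P). \<forall>n::nat. n \<ge> 1 \<and>
                             a [^]\<^bsub>gp P\<^esub> n \<in> gp_of P ` carrier P \<longrightarrow> a \<in> gp_of P ` carrier P)"

definition toric :: "'a monoid \<Rightarrow> bool" where
  "toric P \<longleftrightarrow> comm_monoid P \<and> fin_gen P \<and> integral_monoid P \<and>
               torsion_free_monoid P \<and> saturated_monoid P"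

text \<open>Rank of an abelian group: the maximal number of elements independent over the integers.\<close>

definition int_independent :: "'a monoid \<Rightarrow> 'a set \<Rightarrow> bool" where
  "int_independent G A \<longleftrightarrow> finite A \<and> A \<subseteq> carrier G \<and>
     (\<forall>c::'a \<Rightarrow> int. finprod G (\<lambda>a. a [^]\<^bsub>G\<^esub> c a) A = \<one>\<^bsub>G\<^esub> \<longrightarrow> (\<forall>a\<in>A. c a = 0))"

definition group_rank :: "'a monoid \<Rightarrow> nat" where
  "group_rank G = Sup {card A | A. int_independent G A}"

definition mon_dim :: "'a monoid \<Rightarrow> nat" where
  "mon_dim P = group_rank (gp P)"

definition mon_face :: "'a set \<Rightarrow> 'a monoid \<Rightarrow> bool" where
  "mon_face S P \<longleftrightarrow> submonoid S P \<and>
     (\<forall>p\<in>carrier P. \<forall>q\<in>carrier P. p \<otimes>\<^bsub>P\<^esub> q \<in> S \<longrightarrow> p \<in> S \<and> q \<in> S)"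

definition mon_interior :: "'a monoid \<Rightarrow> 'a set" where
  "mon_interior P = carrier P - \<Union>{S. mon_face S P \<and> S \<noteq> carrier P}"

definition interior_hom :: "'a monoid \<Rightarrow> 'b monoid \<Rightarrow> ('a \<Rightarrow> 'b) set" where
  "interior_hom Q P = {h \<in> mon_hom Q P. h ` mon_interior Q \<subseteq> mon_interior P}"


section \<open>Model spaces\<close>

definition model_space :: "'p monoid \<Rightarrow> ('p \<Rightarrow> real) set" where
  "model_space P = mon_hom P nonneg_real_monoid"

text \<open>The subspace topology of the product is the weakest topology for which all evaluations
  \<open>x \<mapsto> x p\<close> are continuous.\<close>

definition model_top :: "'p monoid \<Rightarrow> ('p \<Rightarrow> real) topology" where
  "model_top P = subtopology (product_topology (\<lambda>_. euclideanreal) (carrier P)) (model_space P)"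

text \<open>Smooth functions on open subsets of \<^term>\<open>Euclidean_space n\<close>, which is the space of
  real sequences that vanish from index \<open>n\<close> on: all iterated partial derivatives exist and are
  continuous.\<close>

fun iter_partial :: "nat list \<Rightarrow> ((nat \<Rightarrow> real) \<Rightarrow> real) \<Rightarrow> (nat \<Rightarrow> real) \<Rightarrow> real" where
  "iter_partial [] g = g"
| "iter_partial (i # js) g = (\<lambda>x. deriv (\<lambda>t. iter_partial js g (x(i := t))) (x i))"

definition smooth_Rn :: "nat \<Rightarrow> (nat \<Rightarrow> real) set \<Rightarrow> ((nat \<Rightarrow> real) \<Rightarrow> real) \<Rightarrow> bool" where
  "smooth_Rn n V g \<longleftrightarrow> openin (Euclidean_space n) V \<and>
     (\<forall>js. set js \<subseteq> {..<n} \<longrightarrow>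
        continuous_map (subtopology (Euclidean_space n) V) euclideanreal (iter_partial js g) \<and>
        (\<forall>i<n. \<forall>x\<in>V. (\<lambda>t. iter_partial js g (x(i := t))) field_differentiable at (x i)))"

definition eval_tuple :: "'p list \<Rightarrow> ('p \<Rightarrow> real) \<Rightarrow> nat \<Rightarrow> real" where
  "eval_tuple ps x = (\<lambda>i. if i < length ps then x (ps ! i) else 0)"

definition model_smooth :: "'p monoid \<Rightarrow> ('p \<Rightarrow> real) set \<Rightarrow> (('p \<Rightarrow> real) \<Rightarrow> real) \<Rightarrow> bool" where
  "model_smooth P D f \<longleftrightarrow> (\<exists>ps g. set ps \<subseteq> carrier P \<and> (\<forall>x\<in>D. f x = g (eval_tuple ps x)) \<and>
     (\<forall>y\<in>eval_tuple ps ` D. \<exists>V g'. y \<in> V \<and> smooth_Rn (length ps) V g' \<and>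
        (\<forall>z\<in>V \<inter> eval_tuple ps ` D. g' z = g z)))"

definition model_bfun :: "'p monoid \<Rightarrow> ('p \<Rightarrow> real) set \<Rightarrow> (('p \<Rightarrow> real) \<Rightarrow> real) \<Rightarrow> bool" where
  "model_bfun P D b \<longleftrightarrow> (\<forall>x\<in>D. \<exists>V p h. openin (model_top P) V \<and> x \<in> V \<and> V \<subseteq> D \<and>
     p \<in> carrier P \<and> model_smooth P V h \<and> (\<forall>y\<in>V. h y > 0 \<and> b y = h y * y p))"

text \<open>The condition on the pull-backs \<open>y \<mapsto> f y q\<close> of the functions \<open>x\<^sub>q\<close> is local, like that on
  b-functions: the monoid element may change from one part of \<open>D\<close> to another. Only so is
  compatibility of charts a local condition, as it has to be for every atlas to lie in exactly
  one maximal atlas.\<close>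

definition model_bmap ::
    "'p monoid \<Rightarrow> ('p \<Rightarrow> real) set \<Rightarrow> 'q monoid \<Rightarrow> (('p \<Rightarrow> real) \<Rightarrow> ('q \<Rightarrow> real)) \<Rightarrow> bool" where
  "model_bmap P D Q f \<longleftrightarrow> f ` D \<subseteq> model_space Q \<and> (\<forall>q\<in>carrier Q. model_bfun P D (\<lambda>y. f y q))"

definition model_diffeo ::
    "'p monoid \<Rightarrow> ('p \<Rightarrow> real) set \<Rightarrow> 'q monoid \<Rightarrow> ('q \<Rightarrow> real) set
      \<Rightarrow> (('p \<Rightarrow> real) \<Rightarrow> ('q \<Rightarrow> real)) \<Rightarrow> bool" where
  "model_diffeo P D Q E f \<longleftrightarrow> bij_betw f D E \<and> model_bmap P D Q f \<and> model_bmap Q E P (inv_into D f)"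


section \<open>Manifolds with generalized corners\<close>

text \<open>A chart is a triple of its domain, the monoid of its model space and the coordinate map.
  The type \<open>'p\<close> is the universe from which these monoids are taken; any infinite type contains a
  copy of every toric monoid.\<close>

type_synonym ('m, 'p) chart = "'m set \<times> 'p monoid \<times> ('m \<Rightarrow> 'p \<Rightarrow> real)"

record ('m, 'p) gc_space =
  gtop :: "'m topology"
  charts :: "('m, 'p) chart set"

definition is_chart :: "'m topology \<Rightarrow> ('m, 'p) chart \<Rightarrow> bool" where
  "is_chart T = (\<lambda>(U, P, \<phi>). openin T U \<and> toric P \<and> \<phi> \<in> extensional U \<and>
     openin (model_top P) (\<phi> ` U) \<and>
     homeomorphic_map (subtopology T U) (subtopology (model_top P) (\<phi> ` U)) \<phi>)"

definition compatible :: "('m, 'p) chart \<Rightarrow> ('m, 'p) chart \<Rightarrow> bool" where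
  "compatible = (\<lambda>(U, P, \<phi>) (V, Q, \<psi>).
     model_diffeo P (\<phi> ` (U \<inter> V)) Q (\<psi> ` (U \<inter> V)) (\<psi> \<circ> inv_into U \<phi>))"

definition max_atlas :: "('m, 'p) gc_space \<Rightarrow> bool" where
  "max_atlas M \<longleftrightarrow> (\<forall>c\<in>charts M. is_chart (gtop M) c) \<and>
     (\<Union>(U, P, \<phi>)\<in>charts M. U) = topspace (gtop M) \<and>
     (\<forall>c\<in>charts M. \<forall>c'\<in>charts M. compatible c c') \<and>
     (\<forall>c. is_chart (gtop M) c \<and> (\<forall>c'\<in>charts M. compatible c c' \<and> compatible c' c)
            \<longrightarrow> c \<in> charts M)"

definition bfun :: "('m, 'p) gc_space \<Rightarrow> 'm set \<Rightarrow> ('m \<Rightarrow> real) \<Rightarrow> bool" where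
  "bfun M U b \<longleftrightarrow> (\<forall>(V, P, \<phi>)\<in>charts M. model_bfun P (\<phi> ` (U \<inter> V)) (b \<circ> inv_into V \<phi>))"

definition interior_bmap ::
    "('m, 'p) gc_space \<Rightarrow> ('n, 'q) gc_space \<Rightarrow> ('m \<Rightarrow> 'n) set" where
  "interior_bmap M N = {f \<in> extensional (topspace (gtop M)). continuous_map (gtop M) (gtop N) f \<and>
     (\<forall>(U, P, \<phi>)\<in>charts M. \<forall>(V, Q, \<psi>)\<in>charts N.
        model_bmap P (\<phi> ` (U \<inter> f -` V)) Q (\<psi> \<circ> f \<circ> inv_into U \<phi>))}"

text \<open>The germ of \<open>b\<close> at \<open>x\<close> is represented by the set of all functions that agree with \<open>b\<close>
  near \<open>x\<close>.\<close>

definition germ :: "('m, 'p) gc_space \<Rightarrow> 'm \<Rightarrow> ('m \<Rightarrow> real) \<Rightarrow> ('m \<Rightarrow> real) set" where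
  "germ M x b = {c. \<forall>\<^sub>F y in nhdsin (gtop M) x. c y = b y}"

definition stalk :: "('m, 'p) gc_space \<Rightarrow> 'm \<Rightarrow> ('m \<Rightarrow> real) set monoid" where
  "stalk M x = \<lparr>carrier = {germ M x b | b U. openin (gtop M) U \<and> x \<in> U \<and> bfun M U b},
                mult = (\<lambda>A B. \<Union>a\<in>A. \<Union>b\<in>B. germ M x (\<lambda>y. a y * b y)),
                one = germ M x (\<lambda>_. 1)\<rparr>"

definition codim :: "('m, 'p) gc_space \<Rightarrow> 'm \<Rightarrow> nat" where
  "codim M x = mon_dim (sharp (stalk M x))"

definition stratum :: "('m, 'p) gc_space \<Rightarrow> nat \<Rightarrow> 'm set" where
  "stratum M l = {x \<in> topspace (gtop M). codim M x = l}"

definition components_in :: "('m, 'p) gc_space \<Rightarrow> 'm set \<Rightarrow> 'm set set" where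
  "components_in M S = connected_components_of (subtopology (gtop M) S)"

definition faces :: "('m, 'p) gc_space \<Rightarrow> 'm set set" where
  "faces M = {gtop M closure_of C | C l. C \<in> components_in M (stratum M l)}"

definition face_interior :: "('m, 'p) gc_space \<Rightarrow> 'm set \<Rightarrow> 'm set" where
  "face_interior M F = (THE C. \<exists>l. C \<in> components_in M (stratum M l) \<and> F = gtop M closure_of C)"

definition local_choice ::
    "('m, 'p) gc_space \<Rightarrow> nat \<Rightarrow> 'm \<Rightarrow> ('m set \<Rightarrow> 'm set) \<Rightarrow> bool" where
  "local_choice M l x c \<longleftrightarrow>
     (\<forall>U. openin (gtop M) U \<and> x \<in> U \<longrightarrow>
        c U \<in> components_in M (stratum M l \<inter> U) \<and> x \<in> gtop M closure_of c U) \<and>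
     (\<forall>U V. openin (gtop M) U \<and> openin (gtop M) V \<and> x \<in> V \<and> V \<subseteq> U \<longrightarrow> c V \<subseteq> c U)"

text \<open>The value of a consistent choice at the whole space is the component of the stratum in
  which the choice lies.\<close>

definition embedded_faces :: "('m, 'p) gc_space \<Rightarrow> bool" where
  "embedded_faces M \<longleftrightarrow> (\<forall>l. \<forall>x\<in>topspace (gtop M). \<forall>c c'.
     local_choice M l x c \<and> local_choice M l x c' \<and>
     (\<exists>U. openin (gtop M) U \<and> x \<in> U \<and> c U \<noteq> c' U) \<longrightarrow>
       c (topspace (gtop M)) \<noteq> c' (topspace (gtop M)))"

definition gc_manifold :: "('m, 'p) gc_space \<Rightarrow> bool" where
  "gc_manifold M \<longleftrightarrow> Hausdorff_space (gtop M) \<and> second_countable (gtop M) \<and> max_atlas M \<and>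
     embedded_faces M \<and> connected_space (gtop M) \<and>
     (\<exists>n. \<forall>(U, P, \<phi>)\<in>charts M. U \<noteq> {} \<longrightarrow> mon_dim P \<le> n)"


section \<open>Normal monoids of boundary faces\<close>

text \<open>The monoid \<open>W(F)\<close>, independent of the point of \<open>F\<^sup>\<circ>\<close>, is realized by the sections over
  \<open>F\<^sup>\<circ>\<close> of the sharpened stalks that are locally given by a single b-function.\<close>

definition W :: "('m, 'p) gc_space \<Rightarrow> 'm set \<Rightarrow> ('m \<Rightarrow> ('m \<Rightarrow> real) set set) monoid" where
  "W M F = \<lparr>carrier = {w \<in> extensional (face_interior M F).
                 \<forall>x\<in>face_interior M F. \<exists>U b. openin (gtop M) U \<and> x \<in> U \<and> bfun M U b \<and>
                   (\<forall>y\<in>U \<inter> face_interior M F.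
                      w y = quot_class (stalk M y) (Units (stalk M y)) (germ M y b))},
            mult = (\<lambda>v w. \<lambda>x\<in>face_interior M F. v x \<otimes>\<^bsub>sharp (stalk M x)\<^esub> w x),
            one = (\<lambda>x\<in>face_interior M F. \<one>\<^bsub>sharp (stalk M x)\<^esub>)\<rparr>"

definition nonvanishing :: "('m, 'p) gc_space \<Rightarrow> 'm set \<Rightarrow> 'm \<Rightarrow> ('m \<Rightarrow> real) set set" where
  "nonvanishing M F x = {A \<in> carrier (stalk M x).
     \<forall>b\<in>A. \<not> (\<exists>V. openin (gtop M) V \<and> x \<in> V \<and> (\<forall>y\<in>V \<inter> F. b y = 0))}"

definition conormal :: "('m, 'p) gc_space \<Rightarrow> 'm set \<Rightarrow> 'm \<Rightarrow> ('m \<Rightarrow> real) set set monoid" where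
  "conormal M F x = mon_quot (stalk M x) (nonvanishing M F x)"

definition normal_monoid ::
    "('m, 'p) gc_space \<Rightarrow> 'm set \<Rightarrow> 'm \<Rightarrow> (('m \<Rightarrow> real) set set \<Rightarrow> nat) monoid" where
  "normal_monoid M F x = dual (conormal M F x)"

text \<open>A class in \<open>\<B>\<^sub>x / \<T>(F,x)\<close> is sent to the section in \<open>W(F)\<close> that is given near \<open>x\<close> by a
  b-function representing it. The trivialization at \<open>x\<close> is the dual of this isomorphism.\<close>

definition extend :: "('m, 'p) gc_space \<Rightarrow> 'm set \<Rightarrow> 'm \<Rightarrow> ('m \<Rightarrow> real) set set
    \<Rightarrow> 'm \<Rightarrow> ('m \<Rightarrow> real) set set" where
  "extend M F x A = (THE w. w \<in> carrier (W M F) \<and>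
     (\<exists>B\<in>A. \<exists>b\<in>B. \<forall>\<^sub>F y in nhdsin (gtop M) x. y \<in> face_interior M F \<longrightarrow>
        w y = quot_class (stalk M y) (Units (stalk M y)) (germ M y b)))"

definition triv :: "('m, 'p) gc_space \<Rightarrow> 'm set \<Rightarrow> 'm \<Rightarrow> (('m \<Rightarrow> ('m \<Rightarrow> real) set set) \<Rightarrow> nat)
    \<Rightarrow> ('m \<Rightarrow> real) set set \<Rightarrow> nat" where
  "triv M F x = dual_map (conormal M F x) (extend M F x)"

text \<open>The natural homomorphism \<open>\<^bold>b\<M>\<^sub>xF \<rightarrow> \<^bold>b\<M>\<^sub>xG\<close> for \<open>x \<in> G \<le> F\<close>, and the homomorphism
  \<open>\<^bold>b\<M>\<^sub>xF \<rightarrow> \<^bold>b\<M>\<^sub>yG\<close>, \<open>y = f x\<close>, induced by pull-back along a map \<open>f\<close>.\<close>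

definition normal_incl :: "('m, 'p) gc_space \<Rightarrow> 'm set \<Rightarrow> 'm set \<Rightarrow> 'm
    \<Rightarrow> (('m \<Rightarrow> real) set set \<Rightarrow> nat) \<Rightarrow> ('m \<Rightarrow> real) set set \<Rightarrow> nat" where
  "normal_incl M F G x =
     dual_map (conormal M G x) (quot_map (stalk M x) (nonvanishing M F x) (\<lambda>A. A))"

definition pull_germ ::
    "('m, 'p) gc_space \<Rightarrow> ('m \<Rightarrow> 'n) \<Rightarrow> 'm \<Rightarrow> ('n \<Rightarrow> real) set \<Rightarrow> ('m \<Rightarrow> real) set" where
  "pull_germ M f x A = (\<Union>b\<in>A. germ M x (b \<circ> f))"

definition normal_push ::
    "('m, 'p) gc_space \<Rightarrow> ('n, 'q) gc_space \<Rightarrow> ('m \<Rightarrow> 'n) \<Rightarrow> 'm set \<Rightarrow> 'n set \<Rightarrow> 'm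
      \<Rightarrow> (('m \<Rightarrow> real) set set \<Rightarrow> nat) \<Rightarrow> ('n \<Rightarrow> real) set set \<Rightarrow> nat" where
  "normal_push M N f F G x =
     dual_map (conormal N G (f x)) (quot_map (stalk M x) (nonvanishing M F x) (pull_germ M f x))"

text \<open>Transport of these homomorphisms to the trivializations; by \<open>THE\<close> the result is the same
  for all base points.\<close>

definition induces_arrow :: "('m, 'p) gc_space \<Rightarrow> 'm set \<Rightarrow> 'm set \<Rightarrow>
    ((('m \<Rightarrow> ('m \<Rightarrow> real) set set) \<Rightarrow> nat) \<Rightarrow> (('m \<Rightarrow> ('m \<Rightarrow> real) set set) \<Rightarrow> nat)) \<Rightarrow> bool" where
  "induces_arrow M F G \<alpha> \<longleftrightarrow> \<alpha> \<in> mon_hom (dual (W M F)) (dual (W M G)) \<and>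
     (\<forall>x\<in>G. \<forall>\<phi>\<in>carrier (dual (W M F)). triv M G x (\<alpha> \<phi>) = normal_incl M F G x (triv M F x \<phi>))"

definition face_arrow :: "('m, 'p) gc_space \<Rightarrow> 'm set \<Rightarrow> 'm set
    \<Rightarrow> (('m \<Rightarrow> ('m \<Rightarrow> real) set set) \<Rightarrow> nat) \<Rightarrow> (('m \<Rightarrow> ('m \<Rightarrow> real) set set) \<Rightarrow> nat)" where
  "face_arrow M F G = (THE \<alpha>. induces_arrow M F G \<alpha>)"

definition face_map ::
    "('m, 'p) gc_space \<Rightarrow> ('n, 'q) gc_space \<Rightarrow> ('m \<Rightarrow> 'n) \<Rightarrow> 'm set \<Rightarrow> 'n set" where
  "face_map M N f F = (THE G. G \<in> faces N \<and> f ` face_interior M F \<subseteq> face_interior N G)"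

definition induces_natural :: "('m, 'p) gc_space \<Rightarrow> ('n, 'q) gc_space \<Rightarrow> ('m \<Rightarrow> 'n) \<Rightarrow> 'm set \<Rightarrow>
    ((('m \<Rightarrow> ('m \<Rightarrow> real) set set) \<Rightarrow> nat) \<Rightarrow> (('n \<Rightarrow> ('n \<Rightarrow> real) set set) \<Rightarrow> nat)) \<Rightarrow> bool" where
  "induces_natural M N f F \<beta> \<longleftrightarrow>
     \<beta> \<in> mon_hom (dual (W M F)) (dual (W N (face_map M N f F))) \<and>
     (\<forall>x\<in>F. \<forall>\<phi>\<in>carrier (dual (W M F)).
        triv N (face_map M N f F) (f x) (\<beta> \<phi>) =
        normal_push M N f F (face_map M N f F) x (triv M F x \<phi>))"

definition natural_hom :: "('m, 'p) gc_space \<Rightarrow> ('n, 'q) gc_space \<Rightarrow> ('m \<Rightarrow> 'n) \<Rightarrow> 'm set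
    \<Rightarrow> (('m \<Rightarrow> ('m \<Rightarrow> real) set set) \<Rightarrow> nat) \<Rightarrow> (('n \<Rightarrow> ('n \<Rightarrow> real) set set) \<Rightarrow> nat)" where
  "natural_hom M N f F = (THE \<beta>. induces_natural M N f F \<beta>)"


section \<open>Monoidal complexes\<close>

text \<open>The objects are indexed by a set \<open>Obj\<close>, \<open>Mon i\<close> being the monoid with index \<open>i\<close>;
  \<open>Arr i j\<close> is the set of arrows from \<open>Mon i\<close> to \<open>Mon j\<close>.\<close>

record ('i, 'a) complex_data =
  Obj :: "'i set"
  Mon :: "'i \<Rightarrow> 'a monoid"
  Arr :: "'i \<Rightarrow> 'i \<Rightarrow> ('a \<Rightarrow> 'a) set"

definition monoidal_complex :: "('i, 'a) complex_data \<Rightarrow> bool" where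
  "monoidal_complex P \<longleftrightarrow>
     (\<forall>i\<in>Obj P. toric (Mon P i)) \<and>
     (\<forall>i j. \<forall>\<alpha>\<in>Arr P i j. i \<in> Obj P \<and> j \<in> Obj P \<and> \<alpha> \<in> mon_hom (Mon P i) (Mon P j) \<and>
        inj_on \<alpha> (carrier (Mon P i)) \<and> mon_face (\<alpha> ` carrier (Mon P i)) (Mon P j)) \<and>
     (\<forall>i\<in>Obj P. (\<lambda>a\<in>carrier (Mon P i). a) \<in> Arr P i i) \<and>
     (\<forall>i j k. \<forall>\<alpha>\<in>Arr P i j. \<forall>\<beta>\<in>Arr P j k. compose (carrier (Mon P i)) \<beta> \<alpha> \<in> Arr P i k) \<and>
     (\<forall>j\<in>Obj P. \<forall>S. mon_face S (Mon P j) \<longrightarrow>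
        (\<exists>!(i, \<alpha>). i \<in> Obj P \<and> \<alpha> \<in> Arr P i j \<and> \<alpha> ` carrier (Mon P i) = S))"

text \<open>A morphism consists of a map of objects and a family of homomorphisms.\<close>

type_synonym ('i, 'a, 'j, 'b) complex_map = "('i \<Rightarrow> 'j) \<times> ('i \<Rightarrow> 'a \<Rightarrow> 'b)"

definition complex_morphism ::
    "('i, 'a) complex_data \<Rightarrow> ('j, 'b) complex_data \<Rightarrow> ('i, 'a, 'j, 'b) complex_map set" where
  "complex_morphism P Q = {(\<phi>\<^sub>0, \<phi>). \<phi>\<^sub>0 \<in> extensional (Obj P) \<and> \<phi> \<in> extensional (Obj P) \<and>
     (\<forall>i\<in>Obj P. \<phi>\<^sub>0 i \<in> Obj Q \<and> \<phi> i \<in> interior_hom (Mon P i) (Mon Q (\<phi>\<^sub>0 i))) \<and>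
     (\<forall>i j. \<forall>\<alpha>\<in>Arr P i j. \<exists>\<beta>\<in>Arr Q (\<phi>\<^sub>0 i) (\<phi>\<^sub>0 j).
        \<forall>a\<in>carrier (Mon P i). \<beta> (\<phi> i a) = \<phi> j (\<alpha> a))}"

definition face_complex ::
    "('m, 'p) gc_space \<Rightarrow> ('m set, ('m \<Rightarrow> ('m \<Rightarrow> real) set set) \<Rightarrow> nat) complex_data" where
  "face_complex M = \<lparr>Obj = faces M,
     Mon = (\<lambda>F. dual (W M F)),
     Arr = (\<lambda>F G. if F \<in> faces M \<and> G \<in> faces M \<and> G \<subseteq> F then {face_arrow M F G} else {})\<rparr>"

definition natural :: "('m, 'p) gc_space \<Rightarrow> ('n, 'q) gc_space \<Rightarrow> ('m \<Rightarrow> 'n) \<Rightarrow>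
    ('m set, ('m \<Rightarrow> ('m \<Rightarrow> real) set set) \<Rightarrow> nat,
     'n set, ('n \<Rightarrow> ('n \<Rightarrow> real) set set) \<Rightarrow> nat) complex_map" where
  "natural M N f = (\<lambda>F\<in>faces M. face_map M N f F, \<lambda>F\<in>faces M. natural_hom M N f F)"


section \<open>Categories and functors\<close>

record ('o, 'a) cat =
  Ob :: "'o set"
  Hom :: "'o \<Rightarrow> 'o \<Rightarrow> 'a set"
  Ident :: "'o \<Rightarrow> 'a"
  Comp :: "'o \<Rightarrow> 'o \<Rightarrow> 'o \<Rightarrow> 'a \<Rightarrow> 'a \<Rightarrow> 'a"

definition is_category :: "('o, 'a) cat \<Rightarrow> bool" where
  "is_category C \<longleftrightarrow>
     (\<forall>A\<in>Ob C. Ident C A \<in> Hom C A A) \<and>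
     (\<forall>A\<in>Ob C. \<forall>B\<in>Ob C. \<forall>D\<in>Ob C. \<forall>f\<in>Hom C A B. \<forall>g\<in>Hom C B D. Comp C A B D g f \<in> Hom C A D) \<and>
     (\<forall>A\<in>Ob C. \<forall>B\<in>Ob C. \<forall>f\<in>Hom C A B.
        Comp C A A B f (Ident C A) = f \<and> Comp C A B B (Ident C B) f = f) \<and>
     (\<forall>A\<in>Ob C. \<forall>B\<in>Ob C. \<forall>D\<in>Ob C. \<forall>E\<in>Ob C. \<forall>f\<in>Hom C A B. \<forall>g\<in>Hom C B D. \<forall>h\<in>Hom C D E.
        Comp C A B E (Comp C B D E h g) f = Comp C A D E h (Comp C A B D g f))"

definition is_functor ::
    "('o, 'a) cat \<Rightarrow> ('u, 'b) cat \<Rightarrow> ('o \<Rightarrow> 'u) \<Rightarrow> ('o \<Rightarrow> 'o \<Rightarrow> 'a \<Rightarrow> 'b) \<Rightarrow> bool" where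
  "is_functor C D F\<^sub>0 F\<^sub>1 \<longleftrightarrow> is_category C \<and> is_category D \<and>
     (\<forall>A\<in>Ob C. F\<^sub>0 A \<in> Ob D) \<and>
     (\<forall>A\<in>Ob C. \<forall>B\<in>Ob C. \<forall>f\<in>Hom C A B. F\<^sub>1 A B f \<in> Hom D (F\<^sub>0 A) (F\<^sub>0 B)) \<and>
     (\<forall>A\<in>Ob C. F\<^sub>1 A A (Ident C A) = Ident D (F\<^sub>0 A)) \<and>
     (\<forall>A\<in>Ob C. \<forall>B\<in>Ob C. \<forall>E\<in>Ob C. \<forall>f\<in>Hom C A B. \<forall>g\<in>Hom C B E.
        F\<^sub>1 A E (Comp C A B E g f) = Comp D (F\<^sub>0 A) (F\<^sub>0 B) (F\<^sub>0 E) (F\<^sub>1 B E g) (F\<^sub>1 A B f))"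

text \<open>The manifolds whose points lie in the type \<open>'m\<close>.\<close>

definition gc_category :: "(('m, 'p) gc_space, 'm \<Rightarrow> 'm) cat" where
  "gc_category = \<lparr>Ob = {M. gc_manifold M},
     Hom = interior_bmap,
     Ident = (\<lambda>M. \<lambda>x\<in>topspace (gtop M). x),
     Comp = (\<lambda>M N K g f. compose (topspace (gtop M)) g f)\<rparr>"

definition complex_category :: "(('i, 'a) complex_data, ('i, 'a, 'i, 'a) complex_map) cat" where
  "complex_category = \<lparr>Ob = {P. monoidal_complex P},
     Hom = complex_morphism,
     Ident = (\<lambda>P. (\<lambda>i\<in>Obj P. i, \<lambda>i\<in>Obj P. \<lambda>a\<in>carrier (Mon P i). a)),
     Comp = (\<lambda>P Q R (\<psi>\<^sub>0, \<psi>) (\<phi>\<^sub>0, \<phi>).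
       (compose (Obj P) \<psi>\<^sub>0 \<phi>\<^sub>0, \<lambda>i\<in>Obj P. compose (carrier (Mon P i)) (\<psi> (\<phi>\<^sub>0 i)) (\<phi> i)))\<rparr>"

end

theory Submission
  imports Defs "HOL-Real_Asymp.Real_Asymp"
begin

text \<open>In a chart modelled on \<open>P\<close> the strata adherent to a point \<open>x\<close> are indexed by the faces of \<open>P\<close>
  that contain the monomials not vanishing at \<open>x\<close>. Embeddedness makes them correspond to the boundary
  faces through \<open>x\<close>: two strata in the same boundary face would give two consistent choices of local
  components. Hence \<open>\<B>\<^sub>x / \<T>(F,x)\<close> is \<open>P/T\<close> for a face \<open>T\<close> of \<open>P\<close>, and by Farkas' lemma the faces of
  its dual are the annihilators of the faces of \<open>P\<close> containing \<open>T\<close>. The germs in \<open>W(F)\<close> at one point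
  extend over the interior of \<open>F\<close> without monodromy because they are determined by their orders of
  vanishing along the boundary faces containing \<open>F\<close>, which can be compared at different points.
  Both the arrows and \<open>f\<^sub>\<natural>\<close> are dual to the pull-back of sections of \<open>W\<close>, represented by b-functions.
  This pull-back is unique and locally constant in the base point, hence independent of it, and
  its uniqueness gives the commuting squares and functoriality.\<close>

text \<open>The sharpened stalks, the quotients by \<open>nonvanishing\<close> and the monoids
  \<open>W M F\<close> are built quite differently, but near a point x all of them receive a
  surjection from the chart monoid P whose fibres are the classes modulo a face of P. This is
  \<open>presents\<close>: such a monoid is known once its face is, homomorphisms out of it are
  defined on P, and maps given by descriptions are checked on monomials only. The exponent of a
  b-function is determined up to the monomials that do not vanish at x. The positive factors are
  merely smooth, so this is no algebraic fact; it is tested along curves that approach x from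
  inside. Conversely, neighbourhoods that are convex in logarithmic coordinates give every face
  above x a connected nonempty stratum. One pull-back serves for arrows and for f: a pair (F, G) is
  admissible at x if germs not vanishing on G pull back to germs not vanishing on F. The arrow for G
  in F is the case of the identity, with base points in G. The squares of a morphism use the mixed
  pair of F and the image face of G, in which both cases meet.\<close>

abbreviation (input) "points M \<equiv> topspace (gtop M)"
abbreviation (input) "opn M \<equiv> openin (gtop M)"
abbreviation (input) "nbh M \<equiv> nhdsin (gtop M)"
abbreviation (input) "fint \<equiv> face_interior"
abbreviation (input) "duals R \<equiv> carrier (dual R)"
abbreviation (input) "germs M x \<equiv> carrier (stalk M x)"
abbreviation (input) "eopn n \<equiv> openin (Euclidean_space n)"
abbreviation (input) "mopn P \<equiv> openin (model_top P)"
abbreviation (input) "econt n V \<equiv> continuous_map (subtopology (Euclidean_space n) V) euclideanreal"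
abbreviation (input) "mcont P D \<equiv> continuous_map (subtopology (model_top P) D) euclideanreal"
abbreviation (input) "nrel M F x \<equiv> quot_rel (stalk M x) (nonvanishing M F x)"
abbreviation (input) "ncls M F x b \<equiv> quot_class (stalk M x) (nonvanishing M F x) (germ M x b)"

section \<open>Smooth functions\<close>

text \<open>Padding by zeros keeps the values in \<open>Euclidean_space m\<close> and makes
  \<open>eval_tuple\<close> an instance.\<close>

definition tup :: "nat \<Rightarrow> (nat \<Rightarrow> 'a \<Rightarrow> real) \<Rightarrow> 'a \<Rightarrow> nat \<Rightarrow> real" where
 "tup m F x = (\<lambda>j. if j < m then F j x else 0)"

abbreviation "pd i g \<equiv> iter_partial [i] g"

lemma iter_partial_append: "iter_partial (js @ ks) g = iter_partial js (iter_partial ks g)"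
 by (induction js) auto

lemma in_Euclidean_space: "x \<in> topspace (Euclidean_space n) \<longleftrightarrow> (\<forall>i\<ge>n. x i = 0)"
 by (simp add: topspace_Euclidean_space)

lemma continuous_map_Euclidean_space:
 "continuous_map X (Euclidean_space n) f \<longleftrightarrow>
   (\<forall>j. continuous_map X euclideanreal (\<lambda>x. f x j)) \<and> (\<forall>x\<in>topspace X. \<forall>i\<ge>n. f x i = 0)"
 unfolding Euclidean_space_def continuous_map_in_subtopology continuous_map_componentwise_UNIV by auto

lemma continuous_map_Euclidean_coord:
 "econt n V (\<lambda>x. x i)" unfolding Euclidean_space_def subtopology_subtopology
 by (intro continuous_map_from_subtopology continuous_map_product_projection) auto

lemma continuous_map_tup:
 assumes "\<And>j. j < m \<Longrightarrow> continuous_map X euclideanreal (F j)"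
 shows "continuous_map X (Euclidean_space m) (tup m F)"
 unfolding continuous_map_Euclidean_space tup_def using assms by auto

lemma openin_tup_preimage:
 assumes "openin X S" "eopn m V" and "\<And>j. j < m \<Longrightarrow> continuous_map (subtopology X S) euclideanreal (F j)"
 shows "openin X {x \<in> S. tup m F x \<in> V}"
proof -
 have "openin (subtopology X S) {x \<in> topspace (subtopology X S). tup m F x \<in> V}"
  by (rule openin_continuous_map_preimage[OF continuous_map_tup]) (use assms in auto)
 moreover have "topspace (subtopology X S) = S" using openin_subset[OF assms(1)] by auto
 ultimately show ?thesis using assms(1) openin_trans_full by fastforce
qed

text \<open>Partial derivatives at a point of V may thus be computed from any function that agrees
  on V.\<close>

lemma slice_eventually:
 assumes "eopn n V" "x \<in> V" "i < n"
 shows "\<forall>\<^sub>F t in nhds (x i). x(i := t) \<in> V"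
proof -
 have x: "\<forall>j\<ge>n. x j = 0" using assms openin_subset in_Euclidean_space by blast
 have "continuous_map euclideanreal (Euclidean_space n) (\<lambda>t. x(i := t))"
  unfolding continuous_map_Euclidean_space using x assms(3) by (auto simp: fun_upd_def)
 from openin_continuous_map_preimage[OF this assms(1)]
 have "open {t. x(i := t) \<in> V}" by simp
 moreover have "x i \<in> {t. x(i := t) \<in> V}" using assms by simp
 ultimately show ?thesis unfolding eventually_nhds by auto
qed

lemma smooth_RnD:
 assumes "smooth_Rn n V g"
 shows "eopn n V" and "econt n V g"
  and "i < n \<Longrightarrow> x \<in> V \<Longrightarrow> ((\<lambda>t. g (x(i := t))) has_field_derivative pd i g x) (at (x i))"
  and "i < n \<Longrightarrow> smooth_Rn n V (pd i g)"
proof -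
 note * = assms[unfolded smooth_Rn_def]
 show "eopn n V" using * by blast
 have "econt n V (iter_partial [] g)" using * by (metis empty_subsetI set_empty)
 then show "econt n V g" by simp
 show "((\<lambda>t. g (x(i := t))) has_field_derivative pd i g x) (at (x i))" if "i < n" "x \<in> V"
 proof -
  have "(\<lambda>t. iter_partial [] g (x(i := t))) field_differentiable at (x i)"
   using * that by (metis empty_subsetI set_empty)
  then show ?thesis by (simp add: DERIV_deriv_iff_field_differentiable)
 qed
 show "smooth_Rn n V (pd i g)" if "i < n" unfolding smooth_Rn_def iter_partial_append[symmetric]
 proof (intro conjI allI impI ballI)
  fix js k x assume "set js \<subseteq> {..<n}"
  then have "set (js @ [i]) \<subseteq> {..<n}" using that by auto
  then show "econt n V (iter_partial (js @ [i]) g)"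
   "k < n \<Longrightarrow> x \<in> V \<Longrightarrow> (\<lambda>t. iter_partial (js @ [i]) g (x(k := t))) field_differentiable at (x k)"
   using * by blast+
 qed (use * in blast)
qed

text \<open>A coinduction principle: iterated partial derivatives cannot leave a class that is
  closed under differentiation. They need to agree with members of the class on V only, as their
  values off V are meaningless.\<close>

lemma smooth_RnI:
 assumes V: "eopn n V" and g: "g \<in> \<S>" and cont: "\<And>u. u \<in> \<S> \<Longrightarrow> econt n V u"
  and part: "\<And>u i. u \<in> \<S> \<Longrightarrow> i < n \<Longrightarrow>
   \<exists>w\<in>\<S>. \<forall>x\<in>V. ((\<lambda>t. u (x(i := t))) has_field_derivative w x) (at (x i))"
 shows "smooth_Rn n V g"
proof -
 have D: "((\<lambda>t. f (x(i := t))) has_field_derivative w x) (at (x i))"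
  if "\<forall>y\<in>V. f y = u y" "\<forall>y\<in>V. ((\<lambda>t. u (y(i := t))) has_field_derivative w y) (at (y i))" "x \<in> V" "i < n"
  for f u w x i
 proof -
  have "\<forall>\<^sub>F t in nhds (x i). f (x(i := t)) = u (x(i := t))"
   using slice_eventually[OF V that(3,4)] by eventually_elim (use that in auto)
  then show ?thesis by (subst DERIV_cong_ev[OF refl _ refl]) (use that in auto)
 qed
 have *: "\<exists>u\<in>\<S>. \<forall>x\<in>V. iter_partial js g x = u x" if "set js \<subseteq> {..<n}" for js using that
 proof (induction js)
  case Nil
  then show ?case using g by auto
 next
  case (Cons i js)
  then obtain u where u: "u \<in> \<S>" "\<forall>x\<in>V. iter_partial js g x = u x" by auto
  obtain w where w: "w \<in> \<S>" "\<forall>x\<in>V. ((\<lambda>t. u (x(i := t))) has_field_derivative w x) (at (x i))"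
   using part[OF u(1), of i] Cons.prems by force
  have "\<forall>x\<in>V. iter_partial (i # js) g x = w x"
   using D[OF u(2) w(2)] Cons.prems by (auto intro!: DERIV_imp_deriv)
  with w show ?case by blast
 qed
 show ?thesis unfolding smooth_Rn_def
 proof (intro conjI allI impI ballI V)
  fix js assume js: "set js \<subseteq> {..<n}"
  obtain u where u: "u \<in> \<S>" "\<forall>x\<in>V. iter_partial js g x = u x" using *[OF js] by auto
  show "econt n V (iter_partial js g)" by (rule continuous_map_eq[OF cont[OF u(1)]]) (use u in auto)
  fix i x assume i: "i < n" "x \<in> V"
  obtain w where w: "w \<in> \<S>" "\<forall>x\<in>V. ((\<lambda>t. u (x(i := t))) has_field_derivative w x) (at (x i))"
   using part[OF u(1)] i by auto
  show "(\<lambda>t. iter_partial js g (x(i := t))) field_differentiable at (x i)"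
   using D[OF u(2) w(2) i(2,1)] field_differentiable_def by blast
 qed
qed

lemma smooth_Rn_subset:
 assumes "smooth_Rn n V g" "eopn n V'" "V' \<subseteq> V"
 shows "smooth_Rn n V' g" using assms unfolding smooth_Rn_def
 by (auto intro: continuous_map_from_subtopology_mono)

lemma smooth_coord: "eopn n V \<Longrightarrow> smooth_Rn n V (\<lambda>x. x i)"
proof (rule smooth_RnI[where \<S> = "range (\<lambda>j x. x j) \<union> range (\<lambda>c x. c)"])
 fix u :: "(nat \<Rightarrow> real) \<Rightarrow> real" and k
 assume u: "u \<in> range (\<lambda>j x. x j) \<union> range (\<lambda>c x. c)"
 then show "econt n V u" by (auto intro: continuous_map_Euclidean_coord)
 from u consider j where "u = (\<lambda>x. x j)" | c where "u = (\<lambda>x. c)" by blast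
 then show "\<exists>w\<in>range (\<lambda>j x. x j) \<union> range (\<lambda>c x. c).
   \<forall>x\<in>V. ((\<lambda>t. u (x(k := t))) has_field_derivative w x) (at (x k))"
 proof cases
  case (1 j)
  then show ?thesis by (intro bexI[of _ "\<lambda>x. if j = k then 1 else 0"]) (auto intro: derivative_eq_intros)
 next
  case 2
  then show ?thesis by (intro bexI[of _ "\<lambda>x. 0"]) auto
 qed
qed auto

lemma Euclidean_box:
 assumes "eopn m V" "a \<in> V"
 obtains e where "e > 0" "\<And>z. \<lbrakk>\<And>j. j < m \<Longrightarrow> \<bar>z j - a j\<bar> < e; \<And>j. j \<ge> m \<Longrightarrow> z j = 0\<rbrakk> \<Longrightarrow> z \<in> V"
proof -
 obtain U where U: "openin (powertop_real UNIV) U" "V = U \<inter> {x. \<forall>i\<ge>m. x i = 0}"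
  using assms(1) unfolding Euclidean_space_def openin_subtopology by blast
 have "a \<in> U" using assms U by blast
 then obtain X where X: "a \<in> (\<Pi>\<^sub>E i\<in>UNIV. X i)" "\<And>i. open (X i)" "(\<Pi>\<^sub>E i\<in>UNIV. X i) \<subseteq> U"
  using product_topology_open_contains_basis[OF U(1)] by (metis open_openin)
 have "\<exists>e>0. \<forall>y. \<bar>y - a j\<bar> < e \<longrightarrow> y \<in> X j" for j
  using X(1) X(2)[of j] unfolding open_dist dist_real_def by (auto simp: PiE_def)
 then obtain e where e: "\<And>j. e j > 0" "\<And>j y. \<bar>y - a j\<bar> < e j \<Longrightarrow> y \<in> X j" by metis
 \<comment> \<open>The 1 keeps the minimum defined for m = 0; coordinates from m on vanish and
   impose nothing.\<close>
 define d where "d = Min (insert 1 (e ` {..<m}))"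
 show thesis
 proof (rule that)
  show "d > 0" unfolding d_def using e by (subst Min_gr_iff) auto
  fix z assume z: "\<And>j. j < m \<Longrightarrow> \<bar>z j - a j\<bar> < d" "\<And>j. j \<ge> m \<Longrightarrow> z j = 0"
  have "z j \<in> X j" for j
  proof (cases "j < m")
   case True
   then have "d \<le> e j" unfolding d_def by (intro Min_le) auto
   with z(1)[OF True] e(2) show ?thesis by force
  next
   case False
   then have "z j = a j" using z assms U by auto
   with X(1) show ?thesis by (auto simp: PiE_def)
  qed
  then have "z \<in> U" using X(3) by (auto simp: PiE_def)
  with z U show "z \<in> V" by auto
 qed
qed

text \<open>The mean value theorem without knowledge of the order of a and b; a coordinate of a
  curve may move to either side of its base value.\<close>

lemma MVT_sym:
 fixes h :: "real \<Rightarrow> real"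
 assumes "\<And>u. \<bar>u - a\<bar> \<le> \<bar>b - a\<bar> \<Longrightarrow> (h has_field_derivative h' u) (at u)"
 shows "\<exists>\<xi>. \<bar>\<xi> - a\<bar> \<le> \<bar>b - a\<bar> \<and> h b - h a = (b - a) * h' \<xi>"
proof -
 consider "a < b" | "b < a" | "a = b" by linarith
 then show ?thesis
 proof cases
  case 1
  have "\<exists>z>a. z < b \<and> h b - h a = (b - a) * h' z" by (rule MVT2[OF 1]) (use assms in auto)
  then show ?thesis by force
 next
  case 2
  have "\<exists>z>b. z < a \<and> h a - h b = (a - b) * h' z" by (rule MVT2[OF 2]) (use assms in auto)
  then obtain z where "z > b" "z < a" "h a - h b = (a - b) * h' z" by blast
  then show ?thesis by (intro exI[of _ z]) (auto simp: algebra_simps)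
 qed auto
qed

text \<open>The increment is telescoped over the coordinates; the mean value theorem in each coordinate
 turns continuity of the partial derivatives into the limit of the difference quotient.\<close>

lemma smooth_chain_rule:
 assumes w: "smooth_Rn m V w" and s: "c s \<in> V" and c0: "\<And>t j. j \<ge> m \<Longrightarrow> c t j = 0"
  and d: "\<And>j. j < m \<Longrightarrow> ((\<lambda>t. c t j) has_field_derivative d j) (at s)"
 shows "((\<lambda>t. w (c t)) has_field_derivative (\<Sum>j<m. pd j w (c s) * d j)) (at s)"
proof -
 note V = smooth_RnD(1)[OF w]
 define a where "a = c s"
 \<comment> \<open>In \<open>z j t\<close> the first j coordinates have moved to time t and the
   others are still at the base point; \<open>q j t\<close> is the j-th difference quotient,
   completed by the partial derivative where the coordinate has not moved.\<close>
 define z where "z = (\<lambda>j t i. if i < j then c t i else a i)"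
 define q where "q = (\<lambda>j t. if c t j = a j then pd j w a else (w (z (Suc j) t) - w (z j t)) / (c t j - a j))"
 have zs: "z (Suc j) t = (z j t)(j := c t j)" for j t by (auto simp: z_def)
 have zj: "z j t j = a j" for j t by (simp add: z_def)
 have step: "w (z (Suc j) t) - w (z j t) = q j t * (c t j - a j)" for j t
  using zj[of j t] by (auto simp: q_def zs fun_upd_idem)
 have "z m t = c t" "z 0 t = a" for t using c0 by (auto simp: z_def a_def fun_eq_iff not_less)
 then have tele: "w (c t) - w a = (\<Sum>j<m. q j t * (c t j - a j))" for t
  using sum_lessThan_telescope[of "\<lambda>j. w (z j t)" m] by (simp add: step)
 have q: "(q j \<longlongrightarrow> pd j w a) (at s)" if j: "j < m" for j
 proof (rule tendstoI)
  fix e :: real assume "e > 0"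
  let ?B = "{y \<in> V. pd j w y \<in> ball (pd j w a) e}"
  have "openin (subtopology (Euclidean_space m) V) {y \<in> topspace (subtopology (Euclidean_space m) V). pd j w y \<in> ball (pd j w a) e}"
   by (rule openin_continuous_map_preimage[OF smooth_RnD(2)[OF smooth_RnD(4)[OF w j]]]) auto
  moreover have "topspace (subtopology (Euclidean_space m) V) = V" using openin_subset[OF V] by auto
  ultimately have "eopn m ?B" using V openin_trans_full by fastforce
  moreover have "a \<in> ?B" using s \<open>e > 0\<close> by (simp add: a_def)
  ultimately obtain r where r: "r > 0"
   "\<And>y. \<lbrakk>\<And>j. j < m \<Longrightarrow> \<bar>y j - a j\<bar> < r; \<And>j. j \<ge> m \<Longrightarrow> y j = 0\<rbrakk> \<Longrightarrow> y \<in> ?B" by (rule Euclidean_box) blast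
  have "\<forall>\<^sub>F t in at s. \<bar>c t i - a i\<bar> < r" if "i < m" for i
  proof -
   have "((\<lambda>t. c t i) \<longlongrightarrow> c s i) (at s)" using DERIV_isCont[OF d[OF that]] by (simp add: isCont_def)
   from tendstoD[OF this r(1)] show ?thesis by (simp add: dist_real_def a_def)
  qed
  then have "\<forall>\<^sub>F t in at s. \<forall>i<m. \<bar>c t i - a i\<bar> < r"
   by (simp add: eventually_all_finite eventually_ball_finite_distrib flip: lessThan_iff Ball_def)
  then show "\<forall>\<^sub>F t in at s. dist (q j t) (pd j w a) < e"
  proof eventually_elim
   case (elim t)
   have box: "(z j t)(j := u) \<in> ?B" if "\<bar>u - a j\<bar> \<le> \<bar>c t j - a j\<bar>" for u
   proof (rule r(2))
    show "\<bar>((z j t)(j := u)) i - a i\<bar> < r" if "i < m" for i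
     using elim j that \<open>\<bar>u - a j\<bar> \<le> _\<close> r(1) by (force simp: z_def)
    show "((z j t)(j := u)) i = 0" if "i \<ge> m" for i using j that c0 by (auto simp: z_def a_def)
   qed
   show ?case
   proof (cases "c t j = a j")
    case True
    then show ?thesis using \<open>e > 0\<close> by (simp add: q_def)
   next
    case False
    have "\<exists>\<xi>. \<bar>\<xi> - a j\<bar> \<le> \<bar>c t j - a j\<bar> \<and>
      w ((z j t)(j := c t j)) - w ((z j t)(j := a j)) = (c t j - a j) * pd j w ((z j t)(j := \<xi>))"
    proof (rule MVT_sym)
     fix u assume "\<bar>u - a j\<bar> \<le> \<bar>c t j - a j\<bar>"
     from box[OF this] smooth_RnD(3)[OF w j, of "(z j t)(j := u)"]
     show "((\<lambda>u. w ((z j t)(j := u))) has_field_derivative pd j w ((z j t)(j := u))) (at u)"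
      by simp
    qed
    then obtain \<xi> where \<xi>: "\<bar>\<xi> - a j\<bar> \<le> \<bar>c t j - a j\<bar>"
     "w (z (Suc j) t) - w (z j t) = (c t j - a j) * pd j w ((z j t)(j := \<xi>))"
     using zj[of j t] by (auto simp: zs fun_upd_idem)
    then have "q j t = pd j w ((z j t)(j := \<xi>))" using False by (simp add: q_def)
    then show ?thesis using box[OF \<xi>(1)] by (simp add: dist_commute)
   qed
  qed
 qed
 have "((\<lambda>t. \<Sum>j<m. q j t * ((c t j - c s j) / (t - s))) \<longlongrightarrow> (\<Sum>j<m. pd j w a * d j)) (at s)"
  by (intro tendsto_sum tendsto_mult q) (use d in \<open>auto simp: has_field_derivative_iff\<close>)
 moreover have "(\<Sum>j<m. q j t * ((c t j - c s j) / (t - s))) = (w (c t) - w (c s)) / (t - s)" for t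
  using tele[of t] by (simp add: a_def sum_divide_distrib)
 ultimately show ?thesis by (simp add: has_field_derivative_iff a_def)
qed

text \<open>Iterated partial derivatives of a composite stay in this class of functions.\<close>

inductive_set smooth_closure ::
  "nat \<Rightarrow> (nat \<Rightarrow> real) set \<Rightarrow> nat \<Rightarrow> (nat \<Rightarrow> real) set \<Rightarrow> (nat \<Rightarrow> (nat \<Rightarrow> real) \<Rightarrow> real)
   \<Rightarrow> ((nat \<Rightarrow> real) \<Rightarrow> real) set" for n V m V' F where
 base: "smooth_Rn n V u \<Longrightarrow> u \<in> smooth_closure n V m V' F"
| comp: "smooth_Rn m V' w \<Longrightarrow> (\<lambda>x. w (tup m F x)) \<in> smooth_closure n V m V' F"
| const: "(\<lambda>x. a) \<in> smooth_closure n V m V' F"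
| add: "u \<in> smooth_closure n V m V' F \<Longrightarrow> v \<in> smooth_closure n V m V' F \<Longrightarrow>
  (\<lambda>x. u x + v x) \<in> smooth_closure n V m V' F"
| mult: "u \<in> smooth_closure n V m V' F \<Longrightarrow> v \<in> smooth_closure n V m V' F \<Longrightarrow>
  (\<lambda>x. u x * v x) \<in> smooth_closure n V m V' F"
| inv: "u \<in> smooth_closure n V m V' F \<Longrightarrow> (\<forall>x\<in>V. u x \<noteq> 0) \<Longrightarrow>
  (\<lambda>x. inverse (u x)) \<in> smooth_closure n V m V' F"

lemma smooth_closure_sum:
 assumes "\<And>j. j < (k::nat) \<Longrightarrow> u j \<in> smooth_closure n V m V' F"
 shows "(\<lambda>x. \<Sum>j<k. u j x) \<in> smooth_closure n V m V' F"
 using assms by (induction k) (auto intro: smooth_closure.const smooth_closure.add)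

text \<open>The class itself serves in \<open>smooth_RnI\<close>; the chain rule is what keeps
  composites inside it, at the price of sums and products.\<close>

lemma smooth_closure_smooth:
 assumes V: "eopn n V" and F: "\<And>j. j < m \<Longrightarrow> smooth_Rn n V (F j)" and FV: "\<And>x. x \<in> V \<Longrightarrow> tup m F x \<in> V'"
  and g: "g \<in> smooth_closure n V m V' F"
 shows "smooth_Rn n V g"
proof (rule smooth_RnI[OF V g])
 let ?E = "subtopology (Euclidean_space n) V"
 have top: "topspace ?E = V" using openin_subset[OF V] by auto
 fix u assume "u \<in> smooth_closure n V m V' F"
 then show "continuous_map ?E euclideanreal u"
 proof induction
  case (comp w)
  have "continuous_map ?E (subtopology (Euclidean_space m) V') (tup m F)"
   using F FV top by (auto simp: continuous_map_in_subtopology intro!: continuous_map_tup smooth_RnD)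
  from continuous_map_compose[OF this smooth_RnD(2)[OF comp]] show ?case by (simp add: o_def)
 next
  case (inv u)
  then show ?case by (intro continuous_map_real_inverse) (auto simp: top)
 qed (auto intro: smooth_RnD continuous_map_add continuous_map_real_mult)
next
 fix u i assume "u \<in> smooth_closure n V m V' F" and i: "i < n"
 then show "\<exists>w\<in>smooth_closure n V m V' F. \<forall>x\<in>V. ((\<lambda>t. u (x(i := t))) has_field_derivative w x) (at (x i))"
 proof induction
  case (base u)
  then show ?case using i smooth_RnD(3,4) smooth_closure.base by blast
 next
  case (comp w)
  show ?case
  proof (intro bexI ballI)
   show "(\<lambda>x. \<Sum>j<m. pd j w (tup m F x) * pd i (F j) x) \<in> smooth_closure n V m V' F"
    by (intro smooth_closure_sum smooth_closure.mult)
     (use F i comp in \<open>auto intro!: smooth_closure.base smooth_closure.comp smooth_RnD(4) simp del: iter_partial.simps\<close>)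
   fix x assume x: "x \<in> V"
   have "((\<lambda>t. w (tup m F (x(i := t)))) has_field_derivative
     (\<Sum>j<m. pd j w (tup m F (x(i := x i))) * pd i (F j) x)) (at (x i))"
   proof (rule smooth_chain_rule[OF comp(1)])
    fix j assume j: "j < m"
    show "((\<lambda>t. tup m F (x(i := t)) j) has_field_derivative pd i (F j) x) (at (x i))"
     using smooth_RnD(3)[OF F[OF j] i x] j by (simp add: tup_def)
   qed (use FV x in \<open>auto simp: tup_def\<close>)
   then show "((\<lambda>t. w (tup m F (x(i := t)))) has_field_derivative
     (\<Sum>j<m. pd j w (tup m F x) * pd i (F j) x)) (at (x i))" by simp
  qed
 next
  case (const a)
  show ?case by (intro bexI[of _ "\<lambda>_. 0"]) (auto intro: smooth_closure.const)
 next
  case (add u v)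
  then obtain u' v' where *: "u' \<in> smooth_closure n V m V' F" "v' \<in> smooth_closure n V m V' F"
   "\<forall>x\<in>V. ((\<lambda>t. u (x(i := t))) has_field_derivative u' x) (at (x i))"
   "\<forall>x\<in>V. ((\<lambda>t. v (x(i := t))) has_field_derivative v' x) (at (x i))" by blast
  show ?case
  proof (rule bexI[of _ "\<lambda>x. u' x + v' x"])
   show "\<forall>x\<in>V. ((\<lambda>t. u (x(i := t)) + v (x(i := t))) has_field_derivative u' x + v' x) (at (x i))"
    using * DERIV_add by blast
  qed (use * in \<open>auto intro: smooth_closure.intros\<close>)
 next
  case (mult u v)
  then obtain u' v' where *: "u' \<in> smooth_closure n V m V' F" "v' \<in> smooth_closure n V m V' F"
   "\<forall>x\<in>V. ((\<lambda>t. u (x(i := t))) has_field_derivative u' x) (at (x i))"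
   "\<forall>x\<in>V. ((\<lambda>t. v (x(i := t))) has_field_derivative v' x) (at (x i))" by blast
  show ?case
  proof (rule bexI[of _ "\<lambda>x. u' x * v x + v' x * u x"])
   show "\<forall>x\<in>V. ((\<lambda>t. u (x(i := t)) * v (x(i := t))) has_field_derivative u' x * v x + v' x * u x) (at (x i))"
   proof
    fix x assume "x \<in> V"
    with * DERIV_mult[of "\<lambda>t. u (x(i := t))" "u' x" "x i" UNIV "\<lambda>t. v (x(i := t))" "v' x"]
    show "((\<lambda>t. u (x(i := t)) * v (x(i := t))) has_field_derivative u' x * v x + v' x * u x) (at (x i))"
     by (simp add: fun_upd_idem)
   qed
  qed (use * mult in \<open>auto intro: smooth_closure.intros\<close>)
 next
  case (inv u)
  then obtain u' where *: "u' \<in> smooth_closure n V m V' F"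
   "\<forall>x\<in>V. ((\<lambda>t. u (x(i := t))) has_field_derivative u' x) (at (x i))" by blast
  show ?case
  proof (rule bexI[of _ "\<lambda>x. (- 1) * (inverse (u x) * (u' x * inverse (u x)))"])
   show "\<forall>x\<in>V. ((\<lambda>t. inverse (u (x(i := t)))) has_field_derivative
     (- 1) * (inverse (u x) * (u' x * inverse (u x)))) (at (x i))"
   proof
    fix x assume x: "x \<in> V"
    with * inv have "((\<lambda>t. u (x(i := t))) has_field_derivative u' x) (at (x i))" "u (x(i := x i)) \<noteq> 0"
     by (auto simp: fun_upd_idem)
    from DERIV_inverse'[where f = "\<lambda>t. u (x(i := t))", OF this]
    show "((\<lambda>t. inverse (u (x(i := t)))) has_field_derivative
      (- 1) * (inverse (u x) * (u' x * inverse (u x)))) (at (x i))"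
     by (simp add: fun_upd_idem mult.assoc)
   qed
  qed (intro smooth_closure.mult smooth_closure.inv smooth_closure.const *(1) inv(1,2))
 qed
qed

lemma smooth_comp:
 assumes "eopn n V" "\<And>j. j < m \<Longrightarrow> smooth_Rn n V (F j)" "\<And>x. x \<in> V \<Longrightarrow> tup m F x \<in> V'" "smooth_Rn m V' w"
 shows "smooth_Rn n V (\<lambda>x. w (tup m F x))"
 using smooth_closure_smooth[OF assms(1-3)] smooth_closure.comp[OF assms(4)] by blast

lemma smooth_mult:
 assumes "smooth_Rn n V u" "smooth_Rn n V v"
 shows "smooth_Rn n V (\<lambda>x. u x * v x)"
\<comment> \<open>With an empty inner family no composites arise, and only the algebraic closure of
  the class is used.\<close>
proof (rule smooth_closure_smooth[where m = 0 and V' = UNIV and F = "\<lambda>_ _. 0"])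
 show "(\<lambda>x. u x * v x) \<in> smooth_closure n V 0 UNIV (\<lambda>_ _. 0)"
  by (intro smooth_closure.mult smooth_closure.base assms)
qed (use assms in \<open>auto dest: smooth_RnD(1)\<close>)

lemma smooth_inverse:
 assumes "smooth_Rn n V u" "\<And>x. x \<in> V \<Longrightarrow> u x \<noteq> 0"
 shows "smooth_Rn n V (\<lambda>x. inverse (u x))"
proof (rule smooth_closure_smooth[where m = 0 and V' = UNIV and F = "\<lambda>_ _. 0"])
 show "(\<lambda>x. inverse (u x)) \<in> smooth_closure n V 0 UNIV (\<lambda>_ _. 0)"
  by (intro smooth_closure.inv smooth_closure.base ballI assms)
qed (use assms in \<open>auto dest: smooth_RnD(1)\<close>)

section \<open>Smooth functions and b-functions on model spaces\<close>

text \<open>Unlike \<open>model_smooth\<close> this asks for one smooth extension on one open set,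
  not for an extension near each point. After shrinking the domain the two notions agree, and this
  one is stable under composition without gluing.\<close>

definition sm :: "'p monoid \<Rightarrow> ('p \<Rightarrow> real) set \<Rightarrow> (('p \<Rightarrow> real) \<Rightarrow> real) \<Rightarrow> bool" where
 "sm P D f \<longleftrightarrow> (\<exists>ps V g. set ps \<subseteq> carrier P \<and> smooth_Rn (length ps) V g \<and>
   (\<forall>y\<in>D. eval_tuple ps y \<in> V \<and> f y = g (eval_tuple ps y)))"

lemma eval_tuple_tup: "eval_tuple ps = tup (length ps) (\<lambda>j x. x (ps ! j))"
 by (auto simp: eval_tuple_def tup_def fun_eq_iff)

lemma continuous_map_model_eval:
 "p \<in> carrier P \<Longrightarrow> continuous_map (model_top P) euclideanreal (\<lambda>y. y p)" unfolding model_top_def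
 by (intro continuous_map_from_subtopology continuous_map_product_projection)

lemma topspace_model_top: "topspace (model_top P) = model_space P"
 unfolding model_top_def model_space_def mon_hom_def by (auto simp: extensional_def PiE_def)

lemma openin_eval_preimage:
 assumes "mopn P D" "set ps \<subseteq> carrier P" "openin (Euclidean_space (length ps)) V"
 shows "mopn P {y \<in> D. eval_tuple ps y \<in> V}" unfolding eval_tuple_tup
 by (rule openin_tup_preimage[OF assms(1,3)])
  (use assms(2) in \<open>auto intro!: continuous_map_from_subtopology continuous_map_model_eval\<close>)

lemma sm_imp_model_smooth: "sm P D f \<Longrightarrow> model_smooth P D f"
proof -
 assume "sm P D f"
 then obtain ps V g where *: "set ps \<subseteq> carrier P" "smooth_Rn (length ps) V g"
  "\<forall>y\<in>D. eval_tuple ps y \<in> V \<and> f y = g (eval_tuple ps y)" unfolding sm_def by blast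
 then have "\<forall>y\<in>eval_tuple ps ` D. \<exists>V g'. y \<in> V \<and> smooth_Rn (length ps) V g' \<and>
   (\<forall>z\<in>V \<inter> eval_tuple ps ` D. g' z = g z)" by (intro ballI exI[of _ V] exI[of _ g]) auto
 with * show "model_smooth P D f" unfolding model_smooth_def by blast
qed

lemma model_smooth_imp_sm:
 assumes f: "model_smooth P D f" and D: "mopn P D" "x \<in> D"
 obtains D' where "mopn P D'" "x \<in> D'" "D' \<subseteq> D" "sm P D' f"
proof -
 obtain ps g where *: "set ps \<subseteq> carrier P" "\<forall>x\<in>D. f x = g (eval_tuple ps x)"
  "\<forall>y\<in>eval_tuple ps ` D. \<exists>V g'. y \<in> V \<and> smooth_Rn (length ps) V g' \<and>
    (\<forall>z\<in>V \<inter> eval_tuple ps ` D. g' z = g z)" using f unfolding model_smooth_def by blast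
 obtain V g' where V: "eval_tuple ps x \<in> V" "smooth_Rn (length ps) V g'"
  "\<forall>z\<in>V \<inter> eval_tuple ps ` D. g' z = g z" using *(3) D(2) by blast
 show thesis
 proof
  show "mopn P {y \<in> D. eval_tuple ps y \<in> V}"
   by (rule openin_eval_preimage[OF D(1) *(1) smooth_RnD(1)[OF V(2)]])
  show "sm P {y \<in> D. eval_tuple ps y \<in> V} f"
   unfolding sm_def using * V by (intro exI[of _ ps] exI[of _ V] exI[of _ g']) auto
 qed (use D V in auto)
qed

lemma sm_subset: "sm P D f \<Longrightarrow> D' \<subseteq> D \<Longrightarrow> sm P D' f"
 unfolding sm_def by (meson subsetD)

lemma sm_cong: "sm P D f \<Longrightarrow> (\<And>y. y \<in> D \<Longrightarrow> f y = g y) \<Longrightarrow> sm P D g"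
 unfolding sm_def by (elim exE) (rule exI, rule exI, rule exI, force)

lemma sm_reindex:
 assumes ps: "set ps \<subseteq> set qs" and g: "smooth_Rn (length ps) V g"
 obtains V' g' where "smooth_Rn (length qs) V' g'"
  "\<And>y. eval_tuple ps y \<in> V \<Longrightarrow> eval_tuple qs y \<in> V' \<and> g' (eval_tuple qs y) = g (eval_tuple ps y)"
proof -
 have "\<exists>k<length qs. qs ! k = ps ! j" if "j < length ps" for j
  using ps that by (metis in_set_conv_nth subsetD)
 then obtain \<sigma> where \<sigma>: "\<And>j. j < length ps \<Longrightarrow> \<sigma> j < length qs \<and> qs ! \<sigma> j = ps ! j" by metis
 let ?E = "Euclidean_space (length qs)" and ?F = "\<lambda>j z::nat \<Rightarrow> real. z (\<sigma> j)"
 let ?V = "{z \<in> topspace ?E. tup (length ps) ?F z \<in> V}"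
 have V: "openin ?E ?V"
  by (rule openin_tup_preimage[OF openin_topspace smooth_RnD(1)[OF g]]) (rule continuous_map_Euclidean_coord)
 have tup: "tup (length ps) ?F (eval_tuple qs y) = eval_tuple ps y" for y
  using \<sigma> by (auto simp: tup_def eval_tuple_def fun_eq_iff)
 show thesis
 proof
  show "smooth_Rn (length qs) ?V (\<lambda>z. g (tup (length ps) ?F z))"
   by (rule smooth_comp[OF V _ _ g]) (use V in \<open>auto intro: smooth_coord\<close>)
  show "eval_tuple ps y \<in> V \<Longrightarrow> eval_tuple qs y \<in> ?V \<and>
    g (tup (length ps) ?F (eval_tuple qs y)) = g (eval_tuple ps y)" for y
   by (simp add: tup in_Euclidean_space) (simp add: eval_tuple_def)
 qed
qed

text \<open>All inner functions are first rewritten in the concatenation of their coordinate lists;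
  what remains is composition in Euclidean space.\<close>

lemma sm_comp:
 assumes f: "\<And>j. j < m \<Longrightarrow> sm P D (f j)" and w: "smooth_Rn m V w" and V: "\<And>y. y \<in> D \<Longrightarrow> tup m f y \<in> V"
 shows "sm P D (\<lambda>y. w (tup m f y))"
proof -
 have "\<forall>j. \<exists>ps. j < m \<longrightarrow> set ps \<subseteq> carrier P \<and> (\<exists>V g. smooth_Rn (length ps) V g \<and>
   (\<forall>y\<in>D. eval_tuple ps y \<in> V \<and> f j y = g (eval_tuple ps y)))" using f unfolding sm_def by meson
 then obtain ps where ps: "\<And>j. j < m \<Longrightarrow> set (ps j) \<subseteq> carrier P \<and>
  (\<exists>V g. smooth_Rn (length (ps j)) V g \<and> (\<forall>y\<in>D. eval_tuple (ps j) y \<in> V \<and> f j y = g (eval_tuple (ps j) y)))"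
  by metis
 define qs where "qs = concat (map ps [0..<m])"
 have "\<exists>V g. smooth_Rn (length qs) V g \<and> (\<forall>y\<in>D. eval_tuple qs y \<in> V \<and> f j y = g (eval_tuple qs y))"
  if j: "j < m" for j
 proof -
  obtain V g where *: "smooth_Rn (length (ps j)) V g" "\<forall>y\<in>D. eval_tuple (ps j) y \<in> V \<and> f j y = g (eval_tuple (ps j) y)"
   using ps[OF j] by blast
  have "set (ps j) \<subseteq> set qs" using j by (auto simp: qs_def)
  from sm_reindex[OF this *(1)] * show ?thesis by metis
 qed
 then obtain V' g where g: "\<And>j. j < m \<Longrightarrow> smooth_Rn (length qs) (V' j) (g j)"
  "\<And>j y. j < m \<Longrightarrow> y \<in> D \<Longrightarrow> eval_tuple qs y \<in> V' j \<and> f j y = g j (eval_tuple qs y)" by metis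
 let ?E = "Euclidean_space (length qs)"
 \<comment> \<open>Intersecting with the whole space covers m = 0, where the intersection of the
   \<open>V' j\<close> is everything.\<close>
 define O' where "O' = topspace ?E \<inter> (\<Inter>j<m. V' j)"
 have O': "openin ?E O'"
 proof (cases "m = 0")
  case False
  then show ?thesis unfolding O'_def
   by (intro openin_Int openin_INT) (auto intro: smooth_RnD(1)[OF g(1)])
 qed (simp add: O'_def)
 have gO: "smooth_Rn (length qs) O' (g j)" if "j < m" for j
  by (rule smooth_Rn_subset[OF g(1)[OF that] O']) (use that in \<open>auto simp: O'_def\<close>)
 define V'' where "V'' = {z \<in> O'. tup m g z \<in> V}"
 have V'': "openin ?E V''" unfolding V''_def
  by (rule openin_tup_preimage[OF O' smooth_RnD(1)[OF w]]) (rule smooth_RnD(2)[OF gO])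
 have "smooth_Rn (length qs) V'' (\<lambda>z. w (tup m g z))"
 proof (rule smooth_comp[OF V'' _ _ w])
  show "smooth_Rn (length qs) V'' (g j)" if "j < m" for j
   by (rule smooth_Rn_subset[OF gO[OF that] V'']) (auto simp: V''_def)
 qed (auto simp: V''_def)
 moreover have tup: "tup m g (eval_tuple qs y) = tup m f y" if "y \<in> D" for y
  using g(2) that by (auto simp: tup_def fun_eq_iff)
 moreover have "eval_tuple qs y \<in> V''" if "y \<in> D" for y
  using that g(2) V tup by (auto simp: V''_def O'_def in_Euclidean_space eval_tuple_def)
 moreover have "set qs \<subseteq> carrier P" using ps by (fastforce simp: qs_def)
 ultimately show ?thesis unfolding sm_def
  by (intro exI[of _ qs] exI[of _ V''] exI[of _ "\<lambda>z. w (tup m g z)"]) auto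
qed

lemma sm_mult:
 assumes "sm P D f" "sm P D g"
 shows "sm P D (\<lambda>y. f y * g y)"
proof -
 have "sm P D (\<lambda>y. (\<lambda>z. z 0 * z 1) (tup 2 (\<lambda>j. if j = 0 then f else g) y))"
  by (rule sm_comp[where V = "topspace (Euclidean_space 2)"])
   (use assms in \<open>auto intro!: smooth_mult smooth_coord simp: in_Euclidean_space tup_def\<close>)
 then show ?thesis by (simp add: tup_def)
qed

lemma sm_inverse:
 assumes "sm P D f" "\<And>y. y \<in> D \<Longrightarrow> f y \<noteq> 0"
 shows "sm P D (\<lambda>y. inverse (f y))"
proof -
 let ?V = "{x \<in> topspace (Euclidean_space 1). tup 1 (\<lambda>_ x. x 0) x \<in> topspace (Euclidean_space 1) \<inter> {x. x 0 \<noteq> 0}}"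
 have "eopn 1 {x \<in> topspace (Euclidean_space 1). x 0 \<in> - {0}}"
  by (rule openin_continuous_map_preimage[OF continuous_map_Euclidean_coord[where V = UNIV, simplified]]) auto
 then have V: "eopn 1 {x \<in> topspace (Euclidean_space 1). x 0 \<noteq> 0}" by simp
 have "sm P D (\<lambda>y. (\<lambda>z. inverse (z 0)) (tup 1 (\<lambda>j. f) y))"
  by (rule sm_comp[where V = "{x \<in> topspace (Euclidean_space 1). x 0 \<noteq> 0}"])
   (use assms V in \<open>auto intro!: smooth_inverse smooth_coord simp: in_Euclidean_space tup_def\<close>)
 then show ?thesis by (simp add: tup_def)
qed

lemma sm_eval: "p \<in> carrier P \<Longrightarrow> sm P D (\<lambda>y. y p)"
 unfolding sm_def
 by (intro exI[of _ "[p]"] exI[of _ "topspace (Euclidean_space 1)"] exI[of _ "\<lambda>z. z 0"])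
  (auto intro!: smooth_coord simp: in_Euclidean_space eval_tuple_def)

lemma sm_const: "sm P D (\<lambda>y. c)"
proof -
 have "smooth_Rn 0 (topspace (Euclidean_space 0)) (\<lambda>_. c)"
  by (rule smooth_closure_smooth[where m = 0 and V' = UNIV and F = "\<lambda>_ _. 0"])
   (auto intro: smooth_closure.const)
 then show ?thesis unfolding sm_def
  by (intro exI[of _ "[]"] exI[of _ "topspace (Euclidean_space 0)"] exI[of _ "\<lambda>z. c"])
   (auto simp: in_Euclidean_space eval_tuple_def)
qed

lemma sm_continuous:
 assumes "sm P D f"
 shows "mcont P D f"
proof -
 obtain ps V g where *: "set ps \<subseteq> carrier P" "smooth_Rn (length ps) V g"
  "\<forall>y\<in>D. eval_tuple ps y \<in> V \<and> f y = g (eval_tuple ps y)" using assms unfolding sm_def by blast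
 have "continuous_map (subtopology (model_top P) D) (subtopology (Euclidean_space (length ps)) V) (eval_tuple ps)"
  unfolding continuous_map_in_subtopology eval_tuple_tup
  by (intro conjI continuous_map_tup continuous_map_from_subtopology continuous_map_model_eval)
   (use * in \<open>auto simp: eval_tuple_tup\<close>)
 from continuous_map_compose[OF this smooth_RnD(2)[OF *(2)]] show ?thesis
  by (rule continuous_map_eq) (use * in auto)
qed

section \<open>b-functions on model spaces and their pull-back\<close>

lemma model_bfun_iff:
 "model_bfun P D b \<longleftrightarrow> (\<forall>x\<in>D. \<exists>V p h. mopn P V \<and> x \<in> V \<and> V \<subseteq> D \<and>
   p \<in> carrier P \<and> sm P V h \<and> (\<forall>y\<in>V. h y > 0 \<and> b y = h y * y p))"
 (is "_ \<longleftrightarrow> (\<forall>x\<in>D. ?Q x)")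
proof
 assume b: "model_bfun P D b"
 show "\<forall>x\<in>D. ?Q x"
 proof
  fix x assume "x \<in> D"
  obtain V p h where *: "mopn P V" "x \<in> V" "V \<subseteq> D" "p \<in> carrier P"
   "model_smooth P V h" "\<forall>y\<in>V. h y > 0 \<and> b y = h y * y p"
   using b[unfolded model_bfun_def, rule_format, OF \<open>x \<in> D\<close>] by (elim exE conjE) (rule that)
  obtain V' where "mopn P V'" "x \<in> V'" "V' \<subseteq> V" "sm P V' h" by (rule model_smooth_imp_sm[OF *(5,1,2)])
  with * show "?Q x" by (intro exI[of _ V'] exI[of _ p] exI[of _ h]) auto
 qed
next
 assume *: "\<forall>x\<in>D. ?Q x"
 show "model_bfun P D b" unfolding model_bfun_def
 proof
  fix x assume "x \<in> D"
  from *[rule_format, OF this]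
  obtain V p h where **: "mopn P V" "x \<in> V" "V \<subseteq> D" "p \<in> carrier P"
   "sm P V h" "\<forall>y\<in>V. h y > 0 \<and> b y = h y * y p" by (elim exE conjE) (rule that)
  show "\<exists>V p h. mopn P V \<and> x \<in> V \<and> V \<subseteq> D \<and>
    p \<in> carrier P \<and> model_smooth P V h \<and> (\<forall>y\<in>V. h y > 0 \<and> b y = h y * y p)"
   by (intro exI[of _ V] exI[of _ p] exI[of _ h]) (simp add: ** sm_imp_model_smooth)
 qed
qed

lemma model_bfunE:
 assumes "model_bfun P D b" "x \<in> D"
 obtains V p h where "mopn P V" "x \<in> V" "V \<subseteq> D" "p \<in> carrier P" "sm P V h"
  "\<forall>y\<in>V. h y > 0 \<and> b y = h y * y p"
proof -
 from assms(1)[unfolded model_bfun_iff, rule_format, OF assms(2)]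
 show thesis by (elim exE conjE) (rule that)
qed

lemma model_bfun_open: "model_bfun P D b \<Longrightarrow> mopn P D"
 unfolding model_bfun_def by (subst openin_subopen) blast

lemma model_bfun_continuous:
 assumes "model_bfun P D b"
 shows "mcont P D b"
proof -
 have top: "topspace (subtopology (model_top P) D) = D"
  using openin_subset[OF model_bfun_open[OF assms]] by auto
 have "mopn P {y \<in> D. b y \<in> S}" if "open S" for S
 proof (subst openin_subopen, intro ballI)
  fix x assume x: "x \<in> {y \<in> D. b y \<in> S}"
  then have "x \<in> D" by simp
  with assms obtain V p h where V: "mopn P V" "x \<in> V" "V \<subseteq> D" "p \<in> carrier P"
   "sm P V h" "\<forall>y\<in>V. h y > 0 \<and> b y = h y * y p" by (rule model_bfunE)
  have topV: "topspace (subtopology (model_top P) V) = V" using openin_subset[OF V(1)] by auto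
  have "mcont P V b"
   by (rule continuous_map_eq[OF sm_continuous[OF sm_mult[OF V(5) sm_eval[OF V(4)]]]]) (use V in auto)
  from openin_continuous_map_preimage[OF this, of S] that
  have "openin (subtopology (model_top P) V) {y \<in> V. b y \<in> S}" unfolding topV by simp
  then have "mopn P {y \<in> V. b y \<in> S}" using openin_trans_full V(1) by blast
  then show "\<exists>T. mopn P T \<and> x \<in> T \<and> T \<subseteq> {y \<in> D. b y \<in> S}"
   using V x by (intro exI[of _ "{y \<in> V. b y \<in> S}"]) auto
 qed
 then show ?thesis
  unfolding continuous_map top by (auto intro: openin_subset_topspace_eq[THEN iffD2] simp: openin_open_subtopology model_bfun_open[OF assms] top)
qed

lemma model_bmap_continuous:
 assumes "model_bmap P D Q f"
 shows "continuous_map (subtopology (model_top P) D) (model_top Q) f"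
 unfolding model_top_def[of Q] continuous_map_in_subtopology continuous_map_componentwise
 using assms unfolding model_bmap_def
 by (auto intro!: model_bfun_continuous simp: model_space_def mon_hom_def image_subset_iff)

text \<open>The positive factor h depends on finitely many monomials, each of which pulls back to a
  smooth function, so h pulls back to a smooth one by \<open>sm_comp\<close>. The monomial q itself
  supplies a further positive factor k0 and the new exponent p0.\<close>

lemma model_bfun_pullback:
 assumes f: "model_bmap P D Q f" and D: "mopn P D" and b: "model_bfun Q E b" and E: "f ` D \<subseteq> E"
 shows "model_bfun P D (b \<circ> f)" unfolding model_bfun_iff
proof
 fix x assume x: "x \<in> D"
 then have "f x \<in> E" using E by auto
 with b obtain W q h where W: "mopn Q W" "f x \<in> W" "W \<subseteq> E" "q \<in> carrier Q" "sm Q W h"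
  "\<forall>y\<in>W. h y > 0 \<and> b y = h y * y q" by (rule model_bfunE)
 obtain ps V g where ps: "set ps \<subseteq> carrier Q" "smooth_Rn (length ps) V g"
  "\<forall>y\<in>W. eval_tuple ps y \<in> V \<and> h y = g (eval_tuple ps y)" using W(5) unfolding sm_def by blast
 have loc: "\<exists>U p k. mopn P U \<and> x \<in> U \<and> U \<subseteq> D \<and> p \<in> carrier P \<and> sm P U k \<and>
   (\<forall>y\<in>U. k y > 0 \<and> f y r = k y * y p)" if "r \<in> carrier Q" for r
 proof -
  have "model_bfun P D (\<lambda>y. f y r)" using f that unfolding model_bmap_def by blast
  from this[unfolded model_bfun_iff, rule_format, OF x] show ?thesis .
 qed
 obtain U0 p0 k0 where 0: "mopn P U0" "x \<in> U0" "U0 \<subseteq> D" "p0 \<in> carrier P" "sm P U0 k0"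
  "\<forall>y\<in>U0. k0 y > 0 \<and> f y q = k0 y * y p0" using loc[OF W(4)] by blast
 have "\<forall>j. \<exists>U p k. j < length ps \<longrightarrow> mopn P U \<and> x \<in> U \<and> U \<subseteq> D \<and> p \<in> carrier P \<and> sm P U k \<and>
   (\<forall>y\<in>U. k y > 0 \<and> f y (ps ! j) = k y * y p)" using loc ps(1) by (meson nth_mem subsetD)
 then obtain U p k where U: "\<And>j. j < length ps \<Longrightarrow> mopn P (U j) \<and> x \<in> U j \<and> U j \<subseteq> D \<and>
   p j \<in> carrier P \<and> sm P (U j) (k j) \<and> (\<forall>y\<in>U j. k j y > 0 \<and> f y (ps ! j) = k j y * y (p j))"
  by metis
 define N where "N = {y \<in> D. f y \<in> W} \<inter> U0 \<inter> (D \<inter> (\<Inter>j<length ps. U j))"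
 have "openin (subtopology (model_top P) D) {y \<in> topspace (subtopology (model_top P) D). f y \<in> W}"
  by (rule openin_continuous_map_preimage[OF model_bmap_continuous[OF f] W(1)])
 moreover have "topspace (subtopology (model_top P) D) = D" using openin_subset[OF D] by auto
 ultimately have "mopn P {y \<in> D. f y \<in> W}" using openin_trans_full D by fastforce
 moreover have "mopn P (D \<inter> (\<Inter>j<length ps. U j))"
 proof (cases "length ps = 0")
  case False
  then show ?thesis using U by (intro openin_Int D openin_INT) auto
 qed (use D in simp)
 ultimately have N: "mopn P N" unfolding N_def using 0(1) by blast
 have xN: "x \<in> N" using x 0 U W by (auto simp: N_def)
 have ND: "N \<subseteq> D" by (auto simp: N_def)
 have "sm P N (\<lambda>y. g (tup (length ps) (\<lambda>j y. k j y * y (p j)) y))"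
 proof (rule sm_comp[OF _ ps(2)])
  show "sm P N (\<lambda>y. k j y * y (p j))" if "j < length ps" for j
   using U[OF that] that by (intro sm_mult sm_eval) (auto simp: N_def elim!: sm_subset)
  fix y assume y: "y \<in> N"
  have "tup (length ps) (\<lambda>j y. k j y * y (p j)) y = eval_tuple ps (f y)"
   using U y by (auto simp: tup_def eval_tuple_def fun_eq_iff N_def)
  then show "tup (length ps) (\<lambda>j y. k j y * y (p j)) y \<in> V" using ps(3) y by (simp add: N_def)
 qed
 moreover have "g (tup (length ps) (\<lambda>j y. k j y * y (p j)) y) = h (f y)" if "y \<in> N" for y
 proof -
  have "tup (length ps) (\<lambda>j y. k j y * y (p j)) y = eval_tuple ps (f y)"
   using U that by (auto simp: tup_def eval_tuple_def fun_eq_iff N_def)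
  then show ?thesis using ps(3) that by (simp add: N_def)
 qed
 ultimately have "sm P N (\<lambda>y. h (f y))" by (rule sm_cong)
 then have "sm P N (\<lambda>y. h (f y) * k0 y)"
  using 0(5) by (intro sm_mult) (auto simp: N_def elim!: sm_subset)
 moreover have "h (f y) * k0 y > 0 \<and> (b \<circ> f) y = h (f y) * k0 y * y p0" if "y \<in> N" for y
  using that W(6) 0(6) by (auto simp: N_def)
 ultimately show "\<exists>V p h. mopn P V \<and> x \<in> V \<and> V \<subseteq> D \<and> p \<in> carrier P \<and> sm P V h \<and>
   (\<forall>y\<in>V. h y > 0 \<and> (b \<circ> f) y = h y * y p)" using N xN ND 0(4) by blast
qed

section \<open>Quotients, group completions and duals of commutative monoids\<close>

lemma (in comm_monoid) mult_swap4:
 assumes "a \<in> carrier G" "b \<in> carrier G" "c \<in> carrier G" "d \<in> carrier G"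
 shows "(a \<otimes> b) \<otimes> (c \<otimes> d) = (a \<otimes> c) \<otimes> (b \<otimes> d)" using assms by (simp add: m_ac)

locale comm_quot = comm_monoid P + submonoid S P for P :: "'a monoid" (structure) and S
begin

lemma S_carrier: "s \<in> S \<Longrightarrow> s \<in> carrier P"
 using subset by blast

lemma P_closed: "p \<in> carrier P \<Longrightarrow> q \<in> carrier P \<Longrightarrow> p \<otimes> q \<in> carrier P"
 by (rule monoid.m_closed[OF monoid_axioms])

lemma S_closed: "p \<in> S \<Longrightarrow> q \<in> S \<Longrightarrow> p \<otimes> q \<in> S"
 by (rule submonoid.m_closed[OF submonoid_axioms])

lemma quot_rel_iff:
 "(p, p') \<in> quot_rel P S \<longleftrightarrow> p \<in> carrier P \<and> p' \<in> carrier P \<and> (\<exists>q\<in>S. \<exists>q'\<in>S. p \<otimes> q = p' \<otimes> q')"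
 by (simp add: quot_rel_def)

lemma quot_rel_refl: "p \<in> carrier P \<Longrightarrow> (p, p) \<in> quot_rel P S"
 unfolding quot_rel_iff using one_closed by blast

lemma quot_rel_sym: "(p, q) \<in> quot_rel P S \<Longrightarrow> (q, p) \<in> quot_rel P S"
 unfolding quot_rel_iff by metis

lemma quot_rel_trans:
 assumes "(p, q) \<in> quot_rel P S" "(q, r) \<in> quot_rel P S"
 shows "(p, r) \<in> quot_rel P S"
proof -
 obtain s s' t t' where *: "s \<in> S" "s' \<in> S" "t \<in> S" "t' \<in> S" "p \<otimes> s = q \<otimes> s'" "q \<otimes> t = r \<otimes> t'"
  "p \<in> carrier P" "q \<in> carrier P" "r \<in> carrier P" using assms unfolding quot_rel_iff by blast
 note c = *(7-9) *(1-4)[THEN S_carrier]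
 have "p \<otimes> (s \<otimes> t) = (q \<otimes> s') \<otimes> t" using c by (simp add: m_assoc flip: *(5))
 also have "\<dots> = (q \<otimes> t) \<otimes> s'" using c by (simp add: m_ac)
 also have "\<dots> = r \<otimes> (t' \<otimes> s')" using c by (simp add: *(6) m_assoc)
 finally show ?thesis unfolding quot_rel_iff using * S_closed by blast
qed

lemma quot_rel_mult:
 assumes "(p, q) \<in> quot_rel P S" "(p', q') \<in> quot_rel P S"
 shows "(p \<otimes> p', q \<otimes> q') \<in> quot_rel P S"
proof -
 obtain s s' t t' where *: "s \<in> S" "s' \<in> S" "t \<in> S" "t' \<in> S" "p \<otimes> s = q \<otimes> s'" "p' \<otimes> t = q' \<otimes> t'"
  "p \<in> carrier P" "q \<in> carrier P" "p' \<in> carrier P" "q' \<in> carrier P"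
  using assms unfolding quot_rel_iff by blast
 have "(p \<otimes> p') \<otimes> (s \<otimes> t) = (p \<otimes> s) \<otimes> (p' \<otimes> t)" using * S_carrier by (intro mult_swap4) auto
 also have "\<dots> = (q \<otimes> q') \<otimes> (s' \<otimes> t')" unfolding *(5,6) using * S_carrier by (intro mult_swap4) auto
 finally show ?thesis unfolding quot_rel_iff using * S_closed P_closed by blast
qed

lemma mem_quot_class: "a \<in> quot_class P S p \<longleftrightarrow> (p, a) \<in> quot_rel P S"
 by (simp add: quot_class_def)

lemma quot_class_eq_iff:
 "p \<in> carrier P \<Longrightarrow> p' \<in> carrier P \<Longrightarrow>
  quot_class P S p = quot_class P S p' \<longleftrightarrow> (p, p') \<in> quot_rel P S"
 unfolding set_eq_iff mem_quot_class using quot_rel_refl quot_rel_sym quot_rel_trans by blast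

lemma quot_class_cong: "(p, p') \<in> quot_rel P S \<Longrightarrow> quot_class P S p = quot_class P S p'"
 using quot_class_eq_iff quot_rel_iff by blast

lemma carrier_mon_quot: "carrier (mon_quot P S) = quot_class P S ` carrier P"
 by (auto simp: mon_quot_def quotient_def quot_class_def)

lemma one_mon_quot: "\<one>\<^bsub>mon_quot P S\<^esub> = quot_class P S \<one>"
 by (simp add: mon_quot_def)

text \<open>\<open>quot_map\<close> unites the classes of all images; the union collapses to one
  class once h respects the relation.\<close>

lemma quot_map_class:
 assumes "p \<in> carrier P" "\<And>a. (p, a) \<in> quot_rel P S \<Longrightarrow> quot_class R U (h a) = quot_class R U (h p)"
 shows "quot_map R U h (quot_class P S p) = quot_class R U (h p)"
proof -
 have "p \<in> quot_class P S p" using quot_rel_refl[OF assms(1)] by (simp add: mem_quot_class)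
 moreover have "quot_class R U (h a) = quot_class R U (h p)" if "a \<in> quot_class P S p" for a
  using that assms(2) by (simp add: mem_quot_class)
 ultimately show ?thesis unfolding quot_map_def by blast
qed

lemma mult_mon_quot:
 assumes "p \<in> carrier P" "p' \<in> carrier P"
 shows "quot_class P S p \<otimes>\<^bsub>mon_quot P S\<^esub> quot_class P S p' = quot_class P S (p \<otimes> p')"
proof -
 have "quot_class P S (a \<otimes> b) = quot_class P S (p \<otimes> p')"
  if "a \<in> quot_class P S p" "b \<in> quot_class P S p'" for a b
  using quot_class_cong[OF quot_rel_mult[of p a p' b]] that by (simp add: mem_quot_class)
 moreover have "p \<in> quot_class P S p" "p' \<in> quot_class P S p'"
  using assms by (auto simp: mem_quot_class quot_rel_refl)
 ultimately have "(\<Union>a\<in>quot_class P S p. \<Union>b\<in>quot_class P S p'. quot_class P S (a \<otimes> b)) = quot_class P S (p \<otimes> p')"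
  by blast
 then show ?thesis by (simp add: mon_quot_def)
qed

lemma comm_monoid_mon_quot: "comm_monoid (mon_quot P S)"
 by unfold_locales (auto simp: carrier_mon_quot one_mon_quot mult_mon_quot m_ac)

end

text \<open>R is P/T up to isomorphism, without being made of classes of P. Monoids of different
  origin, presented by the same P, are compared by comparing their T.\<close>

definition presents :: "'a monoid \<Rightarrow> 'a set \<Rightarrow> ('a \<Rightarrow> 'b) \<Rightarrow> 'b monoid \<Rightarrow> bool" where
 "presents P T \<kappa> R \<longleftrightarrow> comm_monoid R \<and> \<kappa> \<in> hom P R \<and> \<kappa> \<one>\<^bsub>P\<^esub> = \<one>\<^bsub>R\<^esub> \<and> \<kappa> ` carrier P = carrier R \<and>
   (\<forall>p\<in>carrier P. \<forall>p'\<in>carrier P. \<kappa> p = \<kappa> p' \<longleftrightarrow> (p, p') \<in> quot_rel P T)"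

lemma presentsD:
 assumes "presents P T \<kappa> R"
 shows "comm_monoid R" "\<kappa> \<one>\<^bsub>P\<^esub> = \<one>\<^bsub>R\<^esub>" "carrier R = \<kappa> ` carrier P" "p \<in> carrier P \<Longrightarrow> \<kappa> p \<in> carrier R"
  "p \<in> carrier P \<Longrightarrow> q \<in> carrier P \<Longrightarrow> \<kappa> (p \<otimes>\<^bsub>P\<^esub> q) = \<kappa> p \<otimes>\<^bsub>R\<^esub> \<kappa> q"
  "p \<in> carrier P \<Longrightarrow> q \<in> carrier P \<Longrightarrow> \<kappa> p = \<kappa> q \<longleftrightarrow> (p, q) \<in> quot_rel P T"
 using assms unfolding presents_def hom_def by auto

text \<open>Elements of B need to come from P only up to factors in S: for stalks this absorbs the
  positive factors of b-functions.\<close>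

lemma presents_quot:
 assumes B: "comm_quot B S" and P: "comm_monoid P" and k: "k \<in> hom P B" "k \<one>\<^bsub>P\<^esub> = \<one>\<^bsub>B\<^esub>"
  and surj: "\<And>b. b \<in> carrier B \<Longrightarrow> \<exists>p\<in>carrier P. (k p, b) \<in> quot_rel B S"
  and eq: "\<And>p p'. p \<in> carrier P \<Longrightarrow> p' \<in> carrier P \<Longrightarrow>
   (k p, k p') \<in> quot_rel B S \<longleftrightarrow> (p, p') \<in> quot_rel P T"
 shows "presents P T (\<lambda>p. quot_class B S (k p)) (mon_quot B S)"
proof -
 interpret B: comm_quot B S by fact
 have kc: "k p \<in> carrier B" if "p \<in> carrier P" for p using k that by (auto simp: hom_def)
 have "\<exists>p\<in>carrier P. quot_class B S b = quot_class B S (k p)" if "b \<in> carrier B" for b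
  using surj[OF that] B.quot_class_cong by metis
 then have "(\<lambda>p. quot_class B S (k p)) ` carrier P = carrier (mon_quot B S)"
  using kc by (fastforce simp: B.carrier_mon_quot)
 then show ?thesis unfolding presents_def using B.comm_monoid_mon_quot k kc eq
  by (auto simp: hom_def B.one_mon_quot B.mult_mon_quot B.quot_class_eq_iff B.carrier_mon_quot)
qed

lemma presents_factor:
 assumes \<kappa>: "presents P T \<kappa> R" and P: "comm_monoid P" and h: "h \<in> hom P X" "h \<one>\<^bsub>P\<^esub> = \<one>\<^bsub>X\<^esub>"
  and eq: "\<And>p q. (p, q) \<in> quot_rel P T \<Longrightarrow> h p = h q"
 obtains g where "g \<in> mon_hom R X" "\<forall>p\<in>carrier P. g (\<kappa> p) = h p"
proof -
 interpret P: comm_monoid P by fact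
 note \<kappa> = presentsD[OF \<kappa>]
 define g where "g = (\<lambda>r\<in>carrier R. h (inv_into (carrier P) \<kappa> r))"
 have g: "g (\<kappa> p) = h p" if p: "p \<in> carrier P" for p
 proof -
  have "\<kappa> p \<in> \<kappa> ` carrier P" using p by blast
  then have "inv_into (carrier P) \<kappa> (\<kappa> p) \<in> carrier P" "\<kappa> (inv_into (carrier P) \<kappa> (\<kappa> p)) = \<kappa> p"
   by (auto intro: inv_into_into f_inv_into_f)
  then show ?thesis using eq \<kappa>(4,6) p by (simp add: g_def)
 qed
 have "g (x \<otimes>\<^bsub>R\<^esub> y) = g x \<otimes>\<^bsub>X\<^esub> g y" if xy: "x \<in> carrier R" "y \<in> carrier R" for x y
 proof -
  obtain p q where "p \<in> carrier P" "q \<in> carrier P" "x = \<kappa> p" "y = \<kappa> q"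
   using xy unfolding \<kappa>(3) by blast
  then show ?thesis using g h P.m_closed by (simp flip: \<kappa>(5) add: hom_def)
 qed
 moreover have "g \<one>\<^bsub>R\<^esub> = \<one>\<^bsub>X\<^esub>" using g[OF P.one_closed] h \<kappa>(2) by simp
 moreover have "g \<in> carrier R \<rightarrow> carrier X"
 proof
  fix x assume "x \<in> carrier R"
  then obtain p where "p \<in> carrier P" "x = \<kappa> p" unfolding \<kappa>(3) by blast
  then show "g x \<in> carrier X" using g h by (auto simp: hom_def)
 qed
 moreover have "g \<in> extensional (carrier R)" by (simp add: g_def)
 ultimately have "g \<in> mon_hom R X" by (auto simp: mon_hom_def hom_def)
 with g that show thesis by blast
qed

text \<open>Both presentations identify the same pairs of P, so a map that matches them is
  automatically well behaved. It may be given by a description about which nothing else is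
  known.\<close>

lemma presents_iso:
 assumes 1: "presents P T \<kappa> R" and 2: "presents P T \<kappa>' R'" and P: "comm_monoid P"
  and e: "\<And>p. p \<in> carrier P \<Longrightarrow> e (\<kappa> p) = \<kappa>' p"
 shows "e \<in> iso R R'" "e \<one>\<^bsub>R\<^esub> = \<one>\<^bsub>R'\<^esub>"
proof -
 interpret P: comm_monoid P by fact
 note \<kappa> = presentsD[OF 1] and \<kappa>' = presentsD[OF 2]
 show "e \<one>\<^bsub>R\<^esub> = \<one>\<^bsub>R'\<^esub>" using e[OF P.one_closed] \<kappa>(2) \<kappa>'(2) by simp
 have "bij_betw e (carrier R) (carrier R')"
  unfolding bij_betw_def inj_on_def \<kappa>(3) \<kappa>'(3) image_image using e \<kappa>(6) \<kappa>'(6) by auto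
 moreover have "e \<in> hom R R'" unfolding hom_def using e \<kappa>'(4,5) by (auto simp: \<kappa>(3) simp flip: \<kappa>(5))
 ultimately show "e \<in> iso R R'" by (simp add: iso_def)
qed

subsection \<open>Duals\<close>

lemma dual_carrier_iff:
 "\<phi> \<in> duals P \<longleftrightarrow> \<phi> \<in> extensional (carrier P) \<and> \<phi> \<one>\<^bsub>P\<^esub> = 0 \<and>
  (\<forall>p\<in>carrier P. \<forall>q\<in>carrier P. \<phi> (p \<otimes>\<^bsub>P\<^esub> q) = \<phi> p + \<phi> q)"
 by (auto simp: dual_def mon_hom_def hom_def nat_monoid_def)

lemma dual_mult: "\<phi> \<otimes>\<^bsub>dual P\<^esub> \<psi> = (\<lambda>p\<in>carrier P. \<phi> p + \<psi> p)"
 by (simp add: dual_def)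

lemma dual_one: "\<one>\<^bsub>dual P\<^esub> = (\<lambda>p\<in>carrier P. 0)"
 by (simp add: dual_def)

lemma dual_ext:
 "\<phi> \<in> duals P \<Longrightarrow> \<psi> \<in> duals P \<Longrightarrow> (\<And>p. p \<in> carrier P \<Longrightarrow> \<phi> p = \<psi> p) \<Longrightarrow> \<phi> = \<psi>"
 by (auto simp: dual_carrier_iff intro: extensionalityI)

lemma comm_monoid_dual:
 assumes "comm_monoid P"
 shows "comm_monoid (dual P)"
proof -
 interpret comm_monoid P by fact
 show ?thesis by unfold_locales
   (auto simp: dual_carrier_iff dual_mult dual_one fun_eq_iff restrict_def extensional_def)
qed

lemma dual_pow:
 assumes "comm_monoid P" "\<phi> \<in> duals P" "p \<in> carrier P"
 shows "(\<phi> [^]\<^bsub>dual P\<^esub> (n::nat)) p = n * \<phi> p"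
proof -
 interpret D: comm_monoid "dual P" by (rule comm_monoid_dual) fact
 show ?thesis using assms(2,3) by (induction n) (auto simp: dual_mult dual_one)
qed

lemma dual_map_hom:
 assumes "comm_monoid R" "comm_monoid R'" "h \<in> hom R R'" "h \<one>\<^bsub>R\<^esub> = \<one>\<^bsub>R'\<^esub>" "\<phi> \<in> duals R'"
 shows "dual_map R h \<phi> \<in> duals R"
proof -
 interpret R: comm_monoid R by fact
 show ?thesis using assms(3-) by (auto simp: dual_carrier_iff dual_map_def hom_def Pi_iff)
qed

lemma dual_map_mon_hom:
 assumes "comm_monoid R" "comm_monoid R'" "h \<in> hom R R'" "h \<one>\<^bsub>R\<^esub> = \<one>\<^bsub>R'\<^esub>"
 shows "(\<lambda>\<phi>\<in>duals R'. dual_map R h \<phi>) \<in> mon_hom (dual R') (dual R)"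
proof -
 interpret D: comm_monoid "dual R'" by (rule comm_monoid_dual) fact
 have h: "h p \<in> carrier R'" if "p \<in> carrier R" for p using assms(3) that by (auto simp: hom_def)
 have "dual_map R h (\<phi> \<otimes>\<^bsub>dual R'\<^esub> \<psi>) = dual_map R h \<phi> \<otimes>\<^bsub>dual R\<^esub> dual_map R h \<psi>" for \<phi> \<psi>
  using h by (auto simp: dual_mult dual_map_def fun_eq_iff)
 moreover have "dual_map R h \<one>\<^bsub>dual R'\<^esub> = \<one>\<^bsub>dual R\<^esub>"
  using h by (auto simp: dual_one dual_map_def fun_eq_iff)
 ultimately show ?thesis using dual_map_hom[OF assms] by (simp add: mon_hom_def hom_def)
qed

lemma dual_map_iso:
 assumes R: "comm_monoid R" "comm_monoid R'" and e: "e \<in> iso R R'" "e \<one>\<^bsub>R\<^esub> = \<one>\<^bsub>R'\<^esub>"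
 shows "dual_map R e \<in> iso (dual R') (dual R)"
proof -
 have e': "e \<in> hom R R'" "bij_betw e (carrier R) (carrier R')" using e by (auto simp: iso_def)
 interpret R: comm_monoid R by fact
 interpret R': comm_monoid R' by fact
 have ec: "e p \<in> carrier R'" if "p \<in> carrier R" for p using e' that by (auto simp: hom_def)
 have surj: "\<exists>p\<in>carrier R. r = e p" if "r \<in> carrier R'" for r
  using e'(2) that by (auto simp: bij_betw_def)
 have "inj_on (dual_map R e) (duals R')"
 proof (rule inj_onI)
  fix \<phi> \<psi> assume *: "\<phi> \<in> duals R'" "\<psi> \<in> duals R'" "dual_map R e \<phi> = dual_map R e \<psi>"
  show "\<phi> = \<psi>"
  proof (rule dual_ext[OF *(1,2)])
   fix r assume "r \<in> carrier R'"
   then obtain p where "p \<in> carrier R" "r = e p" using surj by blast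
   then show "\<phi> r = \<psi> r" using fun_cong[OF *(3), of p] by (simp add: dual_map_def)
  qed
 qed
 moreover have "dual_map R e ` duals R' = duals R"
 proof (intro equalityI subsetI)
  fix \<psi> assume \<psi>: "\<psi> \<in> duals R"
  define i where "i = inv_into (carrier R) e"
  have i: "i r \<in> carrier R" "e (i r) = r" if "r \<in> carrier R'" for r
   using e'(2) that by (auto simp: i_def bij_betw_def intro: inv_into_into f_inv_into_f)
  have ie: "i (e p) = p" if "p \<in> carrier R" for p using e'(2) that by (simp add: i_def bij_betw_def)
  have "i (r \<otimes>\<^bsub>R'\<^esub> s) = i r \<otimes>\<^bsub>R\<^esub> i s" if "r \<in> carrier R'" "s \<in> carrier R'" for r s
   using i[OF that(1)] i[OF that(2)] ie[of "i r \<otimes>\<^bsub>R\<^esub> i s"] e'(1) by (auto simp: hom_def)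
  moreover have "i \<one>\<^bsub>R'\<^esub> = \<one>\<^bsub>R\<^esub>" using ie[of "\<one>\<^bsub>R\<^esub>"] e(2) by simp
  ultimately have "dual_map R' i \<psi> \<in> duals R'"
   using i by (intro dual_map_hom[OF R(2,1) _ _ \<psi>]) (auto simp: hom_def)
  moreover have "dual_map R e (dual_map R' i \<psi>) = \<psi>"
   using \<psi> ie ec by (intro extensionalityI[of _ "carrier R"])
    (auto simp: dual_map_def dual_carrier_iff)
  ultimately show "\<psi> \<in> dual_map R e ` duals R'" by (metis imageI)
 qed (use dual_map_hom[OF R e'(1) e(2)] in auto)
 moreover have "dual_map R e \<in> hom (dual R') (dual R)" using dual_map_hom[OF R e'(1) e(2)] ec
  by (auto simp: hom_def dual_mult dual_map_def fun_eq_iff restrict_def)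
 ultimately show ?thesis by (simp add: iso_def bij_betw_def)
qed

text \<open>With \<open>presents_push\<close> this identifies the dual of R with the functionals on
  P that vanish on T.\<close>

lemma presents_pull:
 assumes \<kappa>: "presents P T \<kappa> R" and P: "comm_quot P T" and \<psi>: "\<psi> \<in> duals R"
 shows "dual_map P \<kappa> \<psi> \<in> duals P" "t \<in> T \<Longrightarrow> \<psi> (\<kappa> t) = 0"
proof -
 interpret P: comm_quot P T by fact
 show "dual_map P \<kappa> \<psi> \<in> duals P"
  using \<kappa> \<psi> P.comm_monoid_axioms unfolding presents_def by (intro dual_map_hom[where R' = R]) auto
 have "\<kappa> t = \<kappa> \<one>\<^bsub>P\<^esub>" if "t \<in> T" using presentsD(6)[OF \<kappa>] that P.S_carrier P.one_closed
  by (auto simp: P.quot_rel_iff intro!: bexI[of _ "\<one>\<^bsub>P\<^esub>"] bexI[of _ t])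
 then show "t \<in> T \<Longrightarrow> \<psi> (\<kappa> t) = 0" using presentsD(2)[OF \<kappa>] \<psi> by (simp add: dual_carrier_iff)
qed

lemma presents_push:
 assumes \<kappa>: "presents P T \<kappa> R" and P: "comm_quot P T" and \<phi>: "\<phi> \<in> duals P" "\<And>t. t \<in> T \<Longrightarrow> \<phi> t = 0"
 obtains \<psi> where "\<psi> \<in> duals R" "\<And>p. p \<in> carrier P \<Longrightarrow> \<psi> (\<kappa> p) = \<phi> p"
proof -
 interpret P: comm_quot P T by fact
 have eq: "\<phi> p = \<phi> q" if pq: "(p, q) \<in> quot_rel P T" for p q
 proof -
  obtain t t' where t: "p \<in> carrier P" "q \<in> carrier P" "t \<in> T" "t' \<in> T" "p \<otimes>\<^bsub>P\<^esub> t = q \<otimes>\<^bsub>P\<^esub> t'"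
   using pq unfolding P.quot_rel_iff by blast
  have "\<phi> (p \<otimes>\<^bsub>P\<^esub> t) = \<phi> p" "\<phi> (q \<otimes>\<^bsub>P\<^esub> t') = \<phi> q"
   using \<phi> t(1-4) P.S_carrier by (auto simp: dual_carrier_iff)
  with t(5) show ?thesis by metis
 qed
 have h: "\<phi> \<in> hom P nat_monoid" "\<phi> \<one>\<^bsub>P\<^esub> = \<one>\<^bsub>nat_monoid\<^esub>"
  using \<phi>(1) by (auto simp: dual_def mon_hom_def)
 obtain g where "g \<in> mon_hom R nat_monoid" "\<forall>p\<in>carrier P. g (\<kappa> p) = \<phi> p"
  by (rule presents_factor[OF \<kappa> P.comm_monoid_axioms h eq])
 then show thesis by (intro that) (auto simp: dual_def)
qed

subsection \<open>Group completions\<close>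

text \<open>Makes the group completion an instance of \<open>comm_quot\<close>, from which its
  product and unit are taken over.\<close>

lemma gp_rel_diag:
 fixes P (structure)
 assumes "comm_monoid P"
 shows "gp_rel P = quot_rel (P \<times>\<times> P) ((\<lambda>q. (q, q)) ` carrier P)"
proof -
 interpret comm_monoid P by fact
 have "(\<exists>k\<in>carrier P. a \<otimes> d \<otimes> k = c \<otimes> b \<otimes> k) \<longleftrightarrow>
   (\<exists>q\<in>carrier P. \<exists>q'\<in>carrier P. a \<otimes> q = c \<otimes> q' \<and> b \<otimes> q = d \<otimes> q')"
  if c: "a \<in> carrier P" "b \<in> carrier P" "c \<in> carrier P" "d \<in> carrier P" for a b c d
 proof
  assume "\<exists>k\<in>carrier P. a \<otimes> d \<otimes> k = c \<otimes> b \<otimes> k"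
  then obtain k where k: "k \<in> carrier P" "a \<otimes> d \<otimes> k = c \<otimes> b \<otimes> k" by blast
  \<comment> \<open>Cross-multiplication: (a, b) times d k and (c, d) times b k agree in both
    entries.\<close>
  then show "\<exists>q\<in>carrier P. \<exists>q'\<in>carrier P. a \<otimes> q = c \<otimes> q' \<and> b \<otimes> q = d \<otimes> q'"
   using c by (intro bexI[of _ "d \<otimes> k"] bexI[of _ "b \<otimes> k"]) (auto simp: m_assoc m_lcomm)
 next
  assume "\<exists>q\<in>carrier P. \<exists>q'\<in>carrier P. a \<otimes> q = c \<otimes> q' \<and> b \<otimes> q = d \<otimes> q'"
  then obtain q q' where q: "q \<in> carrier P" "q' \<in> carrier P" "a \<otimes> q = c \<otimes> q'" "b \<otimes> q = d \<otimes> q'"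
   by blast
  have "a \<otimes> d \<otimes> (q \<otimes> q') = (a \<otimes> q) \<otimes> (d \<otimes> q')" using q(1,2) c by (intro mult_swap4)
  also have "\<dots> = (c \<otimes> q') \<otimes> (b \<otimes> q)" by (simp only: q)
  also have "\<dots> = c \<otimes> b \<otimes> (q \<otimes> q')" using q(1,2) c by (simp add: m_ac)
  finally show "\<exists>k\<in>carrier P. a \<otimes> d \<otimes> k = c \<otimes> b \<otimes> k" using q by blast
 qed
 note * = this
 have "((a, b), (c, d)) \<in> gp_rel P \<longleftrightarrow> ((a, b), (c, d)) \<in> quot_rel (P \<times>\<times> P) ((\<lambda>q. (q, q)) ` carrier P)" for a b c d
 proof (cases "a \<in> carrier P \<and> b \<in> carrier P \<and> c \<in> carrier P \<and> d \<in> carrier P")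
  case True
  then show ?thesis using *[of a b c d] by (simp add: gp_rel_def quot_rel_def DirProd_def)
 qed (auto simp: gp_rel_def quot_rel_def DirProd_def)
 then show ?thesis by auto
qed

lemma gp_eq_quot:
 assumes "comm_monoid P"
 shows "gp P = mon_quot (P \<times>\<times> P) ((\<lambda>q. (q, q)) ` carrier P)"
 unfolding gp_def mon_quot_def gp_rel_diag[OF assms] quot_class_def
 by (auto simp: DirProd_def fun_eq_iff)

locale gp_completion = comm_monoid P for P :: "'a monoid" (structure)
begin

definition cls where "cls a b = gp_rel P `` {(a, b)}"

sublocale diag: comm_quot "P \<times>\<times> P" "(\<lambda>q. (q, q)) ` carrier P"
 by unfold_locales (auto simp: DirProd_def m_ac)

lemma cls_quot: "cls a b = quot_class (P \<times>\<times> P) ((\<lambda>q. (q, q)) ` carrier P) (a, b)"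
 by (simp add: cls_def quot_class_def gp_rel_diag[OF comm_monoid_axioms])

lemma carrier_gp: "carrier (gp P) = {cls a b | a b. a \<in> carrier P \<and> b \<in> carrier P}"
 unfolding gp_eq_quot[OF comm_monoid_axioms] diag.carrier_mon_quot cls_quot by (auto simp: DirProd_def)

lemma cls_closed [simp]: "a \<in> carrier P \<Longrightarrow> b \<in> carrier P \<Longrightarrow> cls a b \<in> carrier (gp P)"
 using carrier_gp by blast

lemma cls_mult:
 "a \<in> carrier P \<Longrightarrow> b \<in> carrier P \<Longrightarrow> c \<in> carrier P \<Longrightarrow> d \<in> carrier P \<Longrightarrow>
  cls a b \<otimes>\<^bsub>gp P\<^esub> cls c d = cls (a \<otimes> c) (b \<otimes> d)" unfolding gp_eq_quot[OF comm_monoid_axioms] cls_quot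
 by (subst diag.mult_mon_quot) (auto simp: DirProd_def)

lemma one_gp: "\<one>\<^bsub>gp P\<^esub> = cls \<one> \<one>"
 unfolding gp_eq_quot[OF comm_monoid_axioms] cls_quot diag.one_mon_quot by (simp add: DirProd_def)

lemma gp_of_cls: "gp_of P p = cls p \<one>"
 by (simp add: gp_of_def cls_def)

lemma cls_eq_iff:
 "a \<in> carrier P \<Longrightarrow> b \<in> carrier P \<Longrightarrow> c \<in> carrier P \<Longrightarrow> d \<in> carrier P \<Longrightarrow>
  cls a b = cls c d \<longleftrightarrow> (\<exists>k\<in>carrier P. a \<otimes> d \<otimes> k = c \<otimes> b \<otimes> k)" unfolding cls_quot
 by (subst diag.quot_class_eq_iff, simp_all add: gp_rel_diag[OF comm_monoid_axioms, symmetric])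
  (simp add: gp_rel_def)

lemma comm_group_gp: "comm_group (gp P)"
proof -
 interpret G: comm_monoid "gp P"
  unfolding gp_eq_quot[OF comm_monoid_axioms] by (rule diag.comm_monoid_mon_quot)
 show ?thesis
 proof (rule comm_groupI)
  fix x assume "x \<in> carrier (gp P)"
  then obtain a b where "x = cls a b" "a \<in> carrier P" "b \<in> carrier P" unfolding carrier_gp by blast
  then show "\<exists>y\<in>carrier (gp P). y \<otimes>\<^bsub>gp P\<^esub> x = \<one>\<^bsub>gp P\<^esub>" by (intro bexI[of _ "cls b a"])
    (auto simp: cls_mult one_gp cls_eq_iff m_comm intro!: bexI[of _ \<one>])
 qed (auto simp: G.m_ac)
qed

lemma cls_pow:
 assumes "a \<in> carrier P" "b \<in> carrier P"
 shows "cls a b [^]\<^bsub>gp P\<^esub> (n::nat) = cls (a [^] n) (b [^] n)"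
proof -
 interpret G: comm_group "gp P" by (rule comm_group_gp)
 show ?thesis using assms by (induction n) (auto simp: one_gp cls_mult)
qed

end

subsection \<open>Finite generation\<close>

lemma fin_gen_induct:
 assumes "comm_monoid P" "\<And>H. submonoid H P \<Longrightarrow> A \<subseteq> H \<Longrightarrow> H = carrier P"
  and "p \<in> carrier P" "Q \<one>\<^bsub>P\<^esub>" "\<And>a. a \<in> A \<Longrightarrow> Q a" "A \<subseteq> carrier P"
  and "\<And>p q. p \<in> carrier P \<Longrightarrow> q \<in> carrier P \<Longrightarrow> Q p \<Longrightarrow> Q q \<Longrightarrow> Q (p \<otimes>\<^bsub>P\<^esub> q)"
 shows "Q p"
proof -
 interpret comm_monoid P by fact
 have "submonoid {p \<in> carrier P. Q p} P" by unfold_locales (use assms in auto)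
 from assms(2)[OF this] show ?thesis using assms by blast
qed

text \<open>Induction gives a finite Y0 that dominates from below in all coordinates but the new
  one, a. If y in Y0 serves for x except at a, then v x a < v y a, so x lies in one of finitely many
  level sets of the coordinate a, and induction applies to each of them.\<close>

lemma Dickson:
 fixes v :: "'b \<Rightarrow> 'a \<Rightarrow> nat"
 assumes "finite A"
 shows "\<exists>Y. finite Y \<and> Y \<subseteq> X \<and> (\<forall>x\<in>X. \<exists>y\<in>Y. \<forall>a\<in>A. v y a \<le> v x a)" using assms
proof (induction A arbitrary: X)
 case empty
 show ?case
 proof (cases "X = {}")
  case False
  then obtain x where "x \<in> X" by blast
  then show ?thesis by (intro exI[of _ "{x}"]) auto
 qed auto
next
 case (insert a A)
 obtain Y0 where Y0: "finite Y0" "Y0 \<subseteq> X" "\<forall>x\<in>X. \<exists>y\<in>Y0. \<forall>a\<in>A. v y a \<le> v x a"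
  using insert.IH[of X] by (elim exE conjE) (rule that)
 have "\<forall>k. \<exists>Y. finite Y \<and> Y \<subseteq> {x \<in> X. v x a = k} \<and> (\<forall>x\<in>{x \<in> X. v x a = k}. \<exists>y\<in>Y. \<forall>a\<in>A. v y a \<le> v x a)"
  by (intro allI insert.IH)
 then obtain Y where "\<forall>k. finite (Y k) \<and> Y k \<subseteq> {x \<in> X. v x a = k} \<and>
   (\<forall>x\<in>{x \<in> X. v x a = k}. \<exists>y\<in>Y k. \<forall>a\<in>A. v y a \<le> v x a)" by (elim exE[OF choice]) (rule that)
 then have Y: "\<And>k. finite (Y k)" "\<And>k. Y k \<subseteq> {x \<in> X. v x a = k}"
  "\<And>k x. x \<in> X \<Longrightarrow> v x a = k \<Longrightarrow> \<exists>y\<in>Y k. \<forall>a\<in>A. v y a \<le> v x a" by simp_all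
 define Z where "Z = Y0 \<union> (\<Union>y\<in>Y0. \<Union>k<v y a. Y k)"
 have "\<exists>z\<in>Z. \<forall>b\<in>insert a A. v z b \<le> v x b" if x: "x \<in> X" for x
 proof -
  obtain y where y: "y \<in> Y0" "\<forall>a\<in>A. v y a \<le> v x a" using Y0 x by blast
  show ?thesis
  proof (cases "v y a \<le> v x a")
   case True
   then show ?thesis using y by (auto simp: Z_def)
  next
   case False
   obtain z where z: "z \<in> Y (v x a)" "\<forall>a\<in>A. v z a \<le> v x a" using Y(3)[OF x refl] by blast
   moreover have "z \<in> Z" using z y False by (auto simp: Z_def)
   moreover have "v z a = v x a" using Y(2) z(1) by blast
   ultimately show ?thesis by (intro bexI[of _ z]) auto
  qed
 qed
 moreover have "finite Z" using Y0(1) Y(1) by (simp add: Z_def)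
 moreover have "Z \<subseteq> X" using Y0(2) Y(2) by (force simp: Z_def)
 ultimately show ?case by blast
qed

lemma dual_diff:
 assumes "\<phi> \<in> duals R" "\<psi> \<in> duals R" "\<And>p. p \<in> carrier R \<Longrightarrow> \<psi> p \<le> \<phi> p" "comm_monoid R"
 shows "(\<lambda>p\<in>carrier R. \<phi> p - \<psi> p) \<in> duals R"
proof -
 interpret R: comm_monoid R by fact
 have "\<phi> (p \<otimes>\<^bsub>R\<^esub> q) - \<psi> (p \<otimes>\<^bsub>R\<^esub> q) = (\<phi> p - \<psi> p) + (\<phi> q - \<psi> q)" if "p \<in> carrier R" "q \<in> carrier R" for p q
  using that assms(1,2) assms(3)[of p] assms(3)[of q] by (simp add: dual_carrier_iff)
 then show ?thesis using assms by (simp add: dual_carrier_iff)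
qed

text \<open>Functionals take values in the natural numbers, and cancellation, torsion freeness and
  saturation are inherited value by value. For finite generation, \<open>Dickson\<close> yields
  finitely many nonzero functionals such that each nonzero functional dominates one of them on the
  generators, hence everywhere; subtracting it decreases the sum of the values on the
  generators.\<close>

lemma toric_dual:
 assumes R: "comm_monoid R" and fg: "fin_gen R"
 shows "toric (dual R)"
proof -
 interpret R: comm_monoid R by fact
 interpret D: gp_completion "dual R" unfolding gp_completion_def by (rule comm_monoid_dual[OF R])
 obtain A where A: "finite A" "A \<subseteq> carrier R" "\<And>H. submonoid H R \<Longrightarrow> A \<subseteq> H \<Longrightarrow> H = carrier R"
  using fg unfolding fin_gen_def by blast
 have cancel: "\<phi> = \<psi>"
  if "\<phi> \<otimes>\<^bsub>dual R\<^esub> \<xi> = \<psi> \<otimes>\<^bsub>dual R\<^esub> \<xi>" "\<phi> \<in> duals R" "\<psi> \<in> duals R" for \<phi> \<psi> \<xi>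
 proof (rule dual_ext[OF that(2,3)])
  fix p assume "p \<in> carrier R"
  then show "\<phi> p = \<psi> p" using fun_cong[OF that(1), of p] by (simp add: dual_mult)
 qed
 have diff_mult: "(\<lambda>p\<in>carrier R. \<phi> p - \<psi> p) \<otimes>\<^bsub>dual R\<^esub> \<psi> = \<phi>"
  if "\<phi> \<in> duals R" "\<psi> \<in> duals R" "\<And>p. p \<in> carrier R \<Longrightarrow> \<psi> p \<le> \<phi> p" for \<phi> \<psi>
  using that by (intro extensionalityI[of _ "carrier R"]) (auto simp: dual_mult dual_carrier_iff)
 have "fin_gen (dual R)"
 proof -
  define X where "X = {\<phi> \<in> duals R. \<phi> \<noteq> \<one>\<^bsub>dual R\<^esub>}"
  obtain Y where Y: "finite Y" "Y \<subseteq> X" "\<forall>x\<in>X. \<exists>y\<in>Y. \<forall>a\<in>A. y a \<le> x a"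
   using Dickson[OF A(1), of X "\<lambda>\<phi>. \<phi>"] by blast
  have "\<phi> \<in> H" if H: "submonoid H (dual R)" "Y \<subseteq> H" and "\<phi> \<in> duals R" for H \<phi> using that(3)
  proof (induction "\<Sum>a\<in>A. \<phi> a" arbitrary: \<phi> rule: less_induct)
   case less
   show ?case
   proof (cases "\<phi> = \<one>\<^bsub>dual R\<^esub>")
    case True
    then show ?thesis using H submonoid.one_closed by blast
   next
    case False
    then obtain y where y: "y \<in> Y" "\<forall>a\<in>A. y a \<le> \<phi> a" using Y less.prems by (auto simp: X_def)
    then have yc: "y \<in> duals R" "y \<noteq> \<one>\<^bsub>dual R\<^esub>" using Y by (auto simp: X_def)
    have le: "y p \<le> \<phi> p" if "p \<in> carrier R" for p
     by (rule fin_gen_induct[OF R A(3) that, where Q = "\<lambda>p. y p \<le> \<phi> p"])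
      (use y A(2) yc less.prems in \<open>auto simp: dual_carrier_iff intro: add_mono\<close>)
    define \<xi> where "\<xi> = (\<lambda>p\<in>carrier R. \<phi> p - y p)"
    have \<xi>: "\<xi> \<in> duals R" "\<xi> \<otimes>\<^bsub>dual R\<^esub> y = \<phi>"
     unfolding \<xi>_def using dual_diff[OF _ _ _ R] diff_mult less.prems yc le by blast+
    have "\<exists>a\<in>A. y a > 0"
    proof (rule ccontr)
     assume "\<not> (\<exists>a\<in>A. 0 < y a)"
     then have "y p = 0" if "p \<in> carrier R" for p
      by (intro fin_gen_induct[OF R A(3) that, where Q = "\<lambda>p. y p = 0"])
       (use A(2) yc in \<open>auto simp: dual_carrier_iff\<close>)
     then have "y = \<one>\<^bsub>dual R\<^esub>"
      using yc(1) by (intro dual_ext[OF yc(1) D.one_closed]) (simp add: dual_one)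
     with yc show False by simp
    qed
    then obtain a where a: "a \<in> A" "y a > 0" by blast
    have "(\<Sum>a\<in>A. \<xi> a) < (\<Sum>a\<in>A. \<phi> a)"
    proof (rule sum_strict_mono_ex1[OF A(1)])
     show "\<exists>a\<in>A. \<xi> a < \<phi> a" using a y(2) A(2) by (intro bexI[of _ a]) (force simp: \<xi>_def)+
    qed (use A(2) in \<open>auto simp: \<xi>_def\<close>)
    then have "\<xi> \<in> H" using less.hyps \<xi>(1) by blast
    moreover have "y \<in> H" using y(1) H(2) by blast
    ultimately have "\<xi> \<otimes>\<^bsub>dual R\<^esub> y \<in> H" by (rule submonoid.m_closed[OF H(1)])
    then show ?thesis by (simp add: \<xi>(2))
   qed
  qed
  then show ?thesis unfolding fin_gen_def
   using Y by (intro exI[of _ Y]) (auto simp: X_def dest: submonoid.subset)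
 qed
 moreover have "integral_monoid (dual R)" unfolding integral_monoid_def using cancel by blast
 moreover have "torsion_free_monoid (dual R)" unfolding torsion_free_monoid_def
 proof (intro ballI allI impI, elim conjE)
  fix a and n :: nat assume a: "a \<in> carrier (gp (dual R))" "n \<ge> 1" "a [^]\<^bsub>gp (dual R)\<^esub> n = \<one>\<^bsub>gp (dual R)\<^esub>"
  obtain \<phi> \<psi> where *: "a = D.cls \<phi> \<psi>" "\<phi> \<in> duals R" "\<psi> \<in> duals R"
   using a(1) unfolding D.carrier_gp by blast
  have "D.cls (\<phi> [^]\<^bsub>dual R\<^esub> n) (\<psi> [^]\<^bsub>dual R\<^esub> n) = D.cls \<one>\<^bsub>dual R\<^esub> \<one>\<^bsub>dual R\<^esub>"
   using a(3) * by (simp add: D.cls_pow D.one_gp)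
  then obtain k where "k \<in> duals R" "\<phi> [^]\<^bsub>dual R\<^esub> n \<otimes>\<^bsub>dual R\<^esub> k = \<psi> [^]\<^bsub>dual R\<^esub> n \<otimes>\<^bsub>dual R\<^esub> k"
   using * by (auto simp: D.cls_eq_iff)
  then have "\<phi> [^]\<^bsub>dual R\<^esub> n = \<psi> [^]\<^bsub>dual R\<^esub> n" using * cancel by blast
  then have "\<phi> p = \<psi> p" if "p \<in> carrier R" for p
   using dual_pow[OF R *(2) that, of n] dual_pow[OF R *(3) that, of n] a(2) by simp
  then have "\<phi> = \<psi>" using * by (intro dual_ext)
  then show "a = \<one>\<^bsub>gp (dual R)\<^esub>" using * D.one_closed by (auto simp add: D.one_gp D.cls_eq_iff)
 qed
 moreover have "saturated_monoid (dual R)" unfolding saturated_monoid_def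
 proof (intro ballI allI impI, elim conjE)
  fix a and n :: nat assume a: "a \<in> carrier (gp (dual R))" "n \<ge> 1"
   "a [^]\<^bsub>gp (dual R)\<^esub> n \<in> gp_of (dual R) ` duals R"
  obtain \<phi> \<psi> where *: "a = D.cls \<phi> \<psi>" "\<phi> \<in> duals R" "\<psi> \<in> duals R"
   using a(1) unfolding D.carrier_gp by blast
  obtain \<xi> where \<xi>: "\<xi> \<in> duals R" "D.cls (\<phi> [^]\<^bsub>dual R\<^esub> n) (\<psi> [^]\<^bsub>dual R\<^esub> n) = D.cls \<xi> \<one>\<^bsub>dual R\<^esub>"
   using a(3) * by (auto simp: D.cls_pow D.gp_of_cls)
  then have **: "\<phi> [^]\<^bsub>dual R\<^esub> n = \<xi> \<otimes>\<^bsub>dual R\<^esub> \<psi> [^]\<^bsub>dual R\<^esub> n"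
  proof -
   obtain k where k: "k \<in> duals R"
    "\<phi> [^]\<^bsub>dual R\<^esub> n \<otimes>\<^bsub>dual R\<^esub> k = (\<xi> \<otimes>\<^bsub>dual R\<^esub> \<psi> [^]\<^bsub>dual R\<^esub> n) \<otimes>\<^bsub>dual R\<^esub> k"
    using * \<xi> by (auto simp: D.cls_eq_iff)
   show ?thesis by (rule cancel[OF k(2)]) (use *(2,3) \<xi>(1) in simp_all)
  qed
  have le: "\<psi> p \<le> \<phi> p" if p: "p \<in> carrier R" for p
  proof -
   have "n * \<phi> p = \<xi> p + n * \<psi> p"
    using dual_pow[OF R *(2) p, of n] dual_pow[OF R *(3) p, of n] fun_cong[OF **, of p] p
    by (simp add: dual_mult)
   then have "n * \<psi> p \<le> n * \<phi> p" by linarith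
   then show ?thesis using a(2) by simp
  qed
  define \<eta> where "\<eta> = (\<lambda>p\<in>carrier R. \<phi> p - \<psi> p)"
  have \<eta>: "\<eta> \<in> duals R" "\<eta> \<otimes>\<^bsub>dual R\<^esub> \<psi> = \<phi>"
   unfolding \<eta>_def using dual_diff[OF _ _ _ R] diff_mult * le by blast+
  have "a = gp_of (dual R) \<eta>"
   unfolding *(1) D.gp_of_cls using * \<eta> D.one_closed by (auto simp add: D.cls_eq_iff)
  then show "a \<in> gp_of (dual R) ` duals R" using \<eta> by blast
 qed
 ultimately show ?thesis unfolding toric_def using D.comm_monoid_axioms by blast
qed

section \<open>Faces and duals of toric monoids\<close>

text \<open>An additive function on a subgroup H of the lattice of integer vectors is a linear form.
  If l works on the subgroup where the coordinate a vanishes, then the remainder f' depends on that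
  coordinate only and is a multiple of it. The field is rational in \<open>Farkas\<close> and real
  in \<open>real_extension\<close>.\<close>

lemma additive_extension:
 fixes H :: "('a \<Rightarrow> int) set" and f :: "('a \<Rightarrow> int) \<Rightarrow> 'k::field_char_0"
 assumes "finite A" and "\<And>u v m k. u \<in> H \<Longrightarrow> v \<in> H \<Longrightarrow> (\<lambda>g. m * u g + k * v g) \<in> H"
  and "\<And>u v m k. u \<in> H \<Longrightarrow> v \<in> H \<Longrightarrow> f (\<lambda>g. m * u g + k * v g) = of_int m * f u + of_int k * f v"
  and "\<And>v. v \<in> H \<Longrightarrow> (\<forall>g\<in>A. v g = 0) \<Longrightarrow> f v = 0"
 shows "\<exists>l. \<forall>v\<in>H. f v = (\<Sum>g\<in>A. of_int (v g) * l g)" using assms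
proof (induction A arbitrary: H)
 case empty
 then show ?case by auto
next
 case (insert a A)
 define H0 where "H0 = {v \<in> H. v a = 0}"
 have "\<exists>l. \<forall>v\<in>H0. f v = (\<Sum>g\<in>A. of_int (v g) * l g)"
 proof (rule insert.IH)
  show "(\<lambda>g. m * u g + k * v g) \<in> H0" if "u \<in> H0" "v \<in> H0" for u v m k
   using that insert.prems(1) by (auto simp: H0_def)
  show "f (\<lambda>g. m * u g + k * v g) = of_int m * f u + of_int k * f v" if "u \<in> H0" "v \<in> H0" for u v m k
   using that insert.prems(2) by (auto simp: H0_def)
  show "f v = 0" if "v \<in> H0" "\<forall>g\<in>A. v g = 0" for v using that insert.prems(3) by (auto simp: H0_def)
 qed
 then obtain l where l: "\<And>v. v \<in> H0 \<Longrightarrow> f v = (\<Sum>g\<in>A. of_int (v g) * l g)" by blast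
 define f' where "f' v = f v - (\<Sum>g\<in>A. of_int (v g) * l g)" for v
 have sum: "(\<Sum>g\<in>insert a A. of_int (v g) * (l(a := L)) g) = of_int (v a) * L + (\<Sum>g\<in>A. of_int (v g) * l g)"
  for v L
 proof -
  have "(\<Sum>g\<in>A. of_int (v g) * (l(a := L)) g) = (\<Sum>g\<in>A. of_int (v g) * l g)"
   using insert.hyps by (intro sum.cong) auto
  then show ?thesis using insert.hyps by simp
 qed
 show ?case
 proof (cases "\<forall>v\<in>H. v a = 0")
  case True
  then have "f v = (\<Sum>g\<in>insert a A. of_int (v g) * (l(a := 0)) g)" if "v \<in> H" for v
   unfolding sum using l[of v] that by (simp add: H0_def)
  then show ?thesis by blast
 next
  case False
  then obtain u where u: "u \<in> H" "u a \<noteq> 0" by blast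
  define L where "L = f' u / of_int (u a)"
  have "f v = (\<Sum>g\<in>insert a A. of_int (v g) * (l(a := L)) g)" if v: "v \<in> H" for v
  proof -
   \<comment> \<open>This combination has coordinate a equal to zero, so that l computes f on
     it.\<close>
   let ?w = "\<lambda>g. u a * v g + (- v a) * u g"
   have "?w \<in> H" by (intro insert.prems(1) u v)
   then have "f ?w = (\<Sum>g\<in>A. of_int (?w g) * l g)" by (intro l) (simp add: H0_def)
   moreover have "f ?w = of_int (u a) * f v + of_int (- v a) * f u"
    by (rule insert.prems(2)[OF v u(1)])
   moreover have "(\<Sum>g\<in>A. of_int (?w g) * l g) =
     of_int (u a) * (\<Sum>g\<in>A. of_int (v g) * l g) + of_int (- v a) * (\<Sum>g\<in>A. of_int (u g) * l g)"
    by (simp add: sum_distrib_left sum.distrib algebra_simps sum_subtractf sum_negf)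
   ultimately have "of_int (u a) * f v + of_int (- v a) * f u =
     of_int (u a) * (\<Sum>g\<in>A. of_int (v g) * l g) + of_int (- v a) * (\<Sum>g\<in>A. of_int (u g) * l g)"
    by metis
   then have "of_int (u a) * f' v = of_int (v a) * f' u" by (simp add: f'_def algebra_simps)
   then have "f' v = of_int (v a) * L" using u(2) by (simp add: L_def field_simps)
   then show ?thesis unfolding sum by (simp add: f'_def algebra_simps)
  qed
  then show ?thesis by blast
 qed
qed

lemma common_denominator:
 fixes l :: "'a \<Rightarrow> rat"
 assumes "finite A"
 shows "\<exists>N>0. \<exists>l'::'a \<Rightarrow> int. \<forall>g\<in>A. of_int (l' g) = of_int N * l g" using assms
proof induction
 case (insert a A)
 then obtain N l' where N: "N > 0" "\<And>g. g \<in> A \<Longrightarrow> rat_of_int (l' g) = of_int N * l g" by blast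
 obtain p q where q: "l a = of_int p / of_int q" "q > 0"
  using quotient_of_div[of "l a"] quotient_of_denom_pos'[of "l a"] by (cases "quotient_of (l a)") auto
 have "rat_of_int (if g = a then N * p else q * l' g) = of_int (q * N) * l g" if "g \<in> insert a A" for g
  using that q insert.hyps N(2) by auto
 then show ?case using q N(1)
  by (intro exI[of _ "q * N"] conjI exI[of _ "\<lambda>g. if g = a then N * p else q * l' g"]) auto
qed (auto intro: exI[of _ 1])

text \<open>Farkas' lemma modulo a subgroup \<open>E\<close>. If \<open>\<lambda>\<close> is a functional that separates \<open>t\<close> from all
 generators but the last one, \<open>s\<close>, with \<open>\<lambda>(s) < 0\<close>, then the induction hypothesis is applied
 to the projections \<open>-\<lambda>(s) v + \<lambda>(v) s\<close> to the kernel of \<open>\<lambda>\<close>.\<close>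

lemma Farkas:
 fixes E :: "('a \<Rightarrow> int) set" and t :: "'a \<Rightarrow> int" and v :: "'i \<Rightarrow> 'a \<Rightarrow> int"
 assumes A: "finite A" and E: "\<And>u v m k. u \<in> E \<Longrightarrow> v \<in> E \<Longrightarrow> (\<lambda>g. m * u g + k * v g) \<in> E"
  and E0: "\<And>v. (\<forall>g\<in>A. v g = 0) \<Longrightarrow> v \<in> E" and I: "finite I"
 shows "(\<exists>n>0. \<exists>c. (\<forall>i\<in>I. c i \<ge> 0) \<and> (\<lambda>g. n * t g - (\<Sum>i\<in>I. c i * v i g)) \<in> E) \<or>
   (\<exists>l::'a \<Rightarrow> int. (\<forall>e\<in>E. (\<Sum>g\<in>A. e g * l g) = 0) \<and>
    (\<forall>i\<in>I. (\<Sum>g\<in>A. v i g * l g) \<ge> 0) \<and> (\<Sum>g\<in>A. t g * l g) < 0)" using I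
proof (induction I arbitrary: t v)
 case empty
 show ?case
 proof (cases "\<exists>n>0. (\<lambda>g. n * t g) \<in> E")
  case False
  have uniq: "m = k" if mk: "(\<lambda>g. u g - m * t g) \<in> E" "(\<lambda>g. u g - k * t g) \<in> E" for u m k
  proof (rule ccontr)
   assume "m \<noteq> k"
   have "(\<lambda>g. (m - k) * t g) \<in> E" "(\<lambda>g. (k - m) * t g) \<in> E"
    using E[OF mk, of "-1" 1] E[OF mk, of 1 "-1"] by (simp_all add: algebra_simps)
   then show False using False \<open>m \<noteq> k\<close> by (metis diff_gt_0_iff_gt linorder_neqE_linordered_idom)
  qed
  \<comment> \<open>No positive multiple of t lies in E, so the coefficient of t is well defined on
    the group spanned by E and t. Its negative is additive there; the linear form extending it, with
    denominators cleared, is the functional sought.\<close>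
  define H where "H = {u. \<exists>m. (\<lambda>g. u g - m * t g) \<in> E}"
  define f where "f u = rat_of_int (- (THE m. (\<lambda>g. u g - m * t g) \<in> E))" for u
  have f: "f u = rat_of_int (- m)" if "(\<lambda>g. u g - m * t g) \<in> E" for u m
   unfolding f_def using uniq that by (subst the_equality[of _ m]) auto
  have comb: "(\<lambda>g. (m * u g + k * w g) - (m * a + k * b) * t g) \<in> E"
   if "(\<lambda>g. u g - a * t g) \<in> E" "(\<lambda>g. w g - b * t g) \<in> E" for u w m k a b
   using E[OF that, of m k] by (simp add: algebra_simps)
  have "\<exists>l. \<forall>u\<in>H. f u = (\<Sum>g\<in>A. of_int (u g) * l g)"
  proof (rule additive_extension[OF A])
   show "(\<lambda>g. m * u g + k * w g) \<in> H" if "u \<in> H" "w \<in> H" for u w m k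
    using that comb unfolding H_def by blast
   show "f (\<lambda>g. m * u g + k * w g) = of_int m * f u + of_int k * f w" if uw: "u \<in> H" "w \<in> H" for u w m k
   proof -
    obtain a b where ab: "(\<lambda>g. u g - a * t g) \<in> E" "(\<lambda>g. w g - b * t g) \<in> E"
     using uw unfolding H_def by blast
    show ?thesis using f[OF comb[OF ab, of m k]] f[OF ab(1)] f[OF ab(2)] by simp
   qed
   show "f u = 0" if "u \<in> H" "\<forall>g\<in>A. u g = 0" for u using f[of u 0] E0[of u] that by simp
  qed
  then obtain l where l: "\<And>u. u \<in> H \<Longrightarrow> f u = (\<Sum>g\<in>A. of_int (u g) * l g)" by blast
  obtain N l' where N: "N > 0" "\<And>g. g \<in> A \<Longrightarrow> rat_of_int (l' g) = of_int N * l g"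
   using common_denominator[OF A] by metis
  have l': "rat_of_int (\<Sum>g\<in>A. u g * l' g) = of_int N * f u" if "u \<in> H" for u
   using l[OF that] N(2) by (simp add: sum_distrib_left ac_simps cong: sum.cong)
  have "(\<Sum>g\<in>A. u g * l' g) = 0" if "u \<in> E" for u
  proof -
   have "(\<lambda>g. u g - 0 * t g) \<in> E" using that by simp
   then have "u \<in> H" "f u = 0" using f[of u 0] unfolding H_def by (blast, simp)
   then show ?thesis using l'[of u] by (metis mult_zero_right of_int_eq_0_iff)
  qed
  moreover have "(\<Sum>g\<in>A. t g * l' g) < 0"
  proof -
   have "(\<lambda>g. t g - 1 * t g) \<in> E" using E0 by simp
   then have "t \<in> H" "f t = -1" using f[of t 1] unfolding H_def by (blast, simp)
   then have "rat_of_int (\<Sum>g\<in>A. t g * l' g) < 0" using l'[of t] N(1) by simp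
   then show ?thesis by linarith
  qed
  ultimately show ?thesis by blast
 qed auto
next
 case (insert i I)
 show ?case
 proof (cases "\<exists>n>0. \<exists>c. (\<forall>i\<in>I. c i \<ge> 0) \<and> (\<lambda>g. n * t g - (\<Sum>i\<in>I. c i * v i g)) \<in> E")
  case True
  then obtain n c where c: "n > 0" "\<forall>i\<in>I. c i \<ge> 0" "(\<lambda>g. n * t g - (\<Sum>i\<in>I. c i * v i g)) \<in> E" by blast
  have "(\<Sum>j\<in>insert i I. (c(i := 0)) j * v j g) = (\<Sum>j\<in>I. c j * v j g)" for g
   using insert.hyps by (simp, intro sum.cong) auto
  then show ?thesis using c by (intro disjI1 exI[of _ n] conjI exI[of _ "c(i := 0)"]) auto
 next
  case False
  then obtain l where l: "\<forall>e\<in>E. (\<Sum>g\<in>A. e g * l g) = 0" "\<forall>i\<in>I. (\<Sum>g\<in>A. v i g * l g) \<ge> 0"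
   "(\<Sum>g\<in>A. t g * l g) < 0" using insert.IH[of t v] by blast
  define ev where "ev u = (\<Sum>g\<in>A. u g * l g)" for u
  show ?thesis
  proof (cases "ev (v i) \<ge> 0")
   case True
   then show ?thesis using l by (intro disjI2 exI[of _ l]) (auto simp: ev_def)
  next
   case neg: False
   define m where "m = - ev (v i)"
   have m: "m > 0" using neg by (simp add: m_def)
   define pr where "pr u = (\<lambda>g. m * u g + ev u * v i g)" for u
   from insert.IH[of "pr t" "\<lambda>j. pr (v j)"] show ?thesis
   proof (elim disjE exE conjE)
    fix n c assume n: "n > 0" "\<forall>i\<in>I. c i \<ge> 0" "(\<lambda>g. n * pr t g - (\<Sum>j\<in>I. c j * pr (v j) g)) \<in> E"
    \<comment> \<open>Undoing the projections leaves this multiple of \<open>v i\<close>. It is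
      nonnegative because \<open>ev\<close> is nonnegative on the \<open>v j\<close> and negative on
      t.\<close>
    define d where "d = (\<Sum>j\<in>I. c j * ev (v j)) - n * ev t"
    have "d \<ge> 0" using l(2,3) n(1,2) unfolding d_def ev_def
     by (smt (verit) mult_nonneg_nonneg mult_pos_neg sum_nonneg)
    have "(\<Sum>j\<in>insert i I. (if j = i then d else m * c j) * v j g) =
      d * v i g + (\<Sum>j\<in>I. m * c j * v j g)" for g
    proof -
     have "(\<Sum>j\<in>I. (if j = i then d else m * c j) * v j g) = (\<Sum>j\<in>I. m * c j * v j g)"
      using insert.hyps by (intro sum.cong) auto
     then show ?thesis using insert.hyps by simp
    qed
    moreover have "n * pr t g - (\<Sum>j\<in>I. c j * pr (v j) g) =
      (n * m) * t g - (d * v i g + (\<Sum>j\<in>I. m * c j * v j g))" for g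
     by (simp add: pr_def d_def algebra_simps sum.distrib sum_distrib_left sum_distrib_right sum_subtractf)
    ultimately have "(\<lambda>g. (n * m) * t g - (\<Sum>j\<in>insert i I. (if j = i then d else m * c j) * v j g)) \<in> E"
     using n(3) by simp
    then show ?thesis using n m \<open>d \<ge> 0\<close>
     by (intro disjI1 exI[of _ "n * m"] conjI exI[of _ "\<lambda>j. if j = i then d else m * c j"]) auto
   next
    fix \<mu> :: "'a \<Rightarrow> int"
    assume \<mu>: "\<forall>e\<in>E. (\<Sum>g\<in>A. e g * \<mu> g) = 0" "\<forall>j\<in>I. (\<Sum>g\<in>A. pr (v j) g * \<mu> g) \<ge> 0"
     "(\<Sum>g\<in>A. pr t g * \<mu> g) < 0"
    define s where "s = (\<Sum>g\<in>A. v i g * \<mu> g)"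
    \<comment> \<open>The adjoint of \<open>pr\<close>: evaluating \<nu> on u is evaluating \<mu> on
      \<open>pr u\<close>.\<close>
    define \<nu> where "\<nu> g = m * \<mu> g + s * l g" for g
    have \<nu>: "(\<Sum>g\<in>A. u g * \<nu> g) = (\<Sum>g\<in>A. pr u g * \<mu> g)" for u
    proof -
     have "(\<Sum>g\<in>A. u g * \<nu> g) = m * (\<Sum>g\<in>A. u g * \<mu> g) + s * ev u"
      by (simp add: \<nu>_def ev_def algebra_simps sum.distrib sum_distrib_left)
     also have "\<dots> = (\<Sum>g\<in>A. pr u g * \<mu> g)"
      by (simp add: pr_def s_def algebra_simps sum.distrib sum_distrib_left)
     finally show ?thesis .
    qed
    have "pr (v i) g = 0" for g by (simp add: pr_def m_def)
    moreover have "(\<Sum>g\<in>A. e g * \<nu> g) = 0" if "e \<in> E" for e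
    proof -
     have "(\<Sum>g\<in>A. e g * \<nu> g) = m * (\<Sum>g\<in>A. e g * \<mu> g) + s * (\<Sum>g\<in>A. e g * l g)"
      by (simp add: \<nu>_def algebra_simps sum.distrib sum_distrib_left)
     then show ?thesis using \<mu>(1) l(1) that by simp
    qed
    ultimately show ?thesis using \<mu> by (intro disjI2 exI[of _ \<nu>]) (auto simp: \<nu>)
   qed
  qed
 qed
qed

section \<open>Integral monoids by generators and relations\<close>

locale fg_monoid = comm_monoid P for P :: "'a monoid" (structure) and A :: "'a set" +
 assumes finite_gens: "finite A" and gens: "A \<subseteq> carrier P"
  and generate: "\<And>H. submonoid H P \<Longrightarrow> A \<subseteq> H \<Longrightarrow> H = carrier P"
  and integral: "\<And>p q r. p \<in> carrier P \<Longrightarrow> q \<in> carrier P \<Longrightarrow> r \<in> carrier P \<Longrightarrow> p \<otimes> r = q \<otimes> r \<Longrightarrow> p = q"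
begin

definition mon :: "('a \<Rightarrow> nat) \<Rightarrow> 'a" where
 "mon c = finprod P (\<lambda>g. g [^] c g) A"

lemma gens_induct:
 assumes "p \<in> carrier P" "Q \<one>" "\<And>a. a \<in> A \<Longrightarrow> Q a"
  and "\<And>p q. p \<in> carrier P \<Longrightarrow> q \<in> carrier P \<Longrightarrow> Q p \<Longrightarrow> Q q \<Longrightarrow> Q (p \<otimes> q)"
 shows "Q p"
 by (rule fin_gen_induct[OF comm_monoid_axioms generate assms(1), where A = A and Q = Q]) (use assms gens in auto)

lemma mon_closed [simp]: "mon c \<in> carrier P"
 unfolding mon_def using gens by (intro finprod_closed) auto

lemma mon_add: "mon (\<lambda>g. c g + d g) = mon c \<otimes> mon d"
 unfolding mon_def using gens
 by (subst finprod_multf[symmetric]) (auto intro!: finprod_cong' simp: nat_pow_mult)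

lemma mon_zero: "mon (\<lambda>g. 0) = \<one>"
 unfolding mon_def by (simp add: finprod_one_eqI)

lemma mon_cong: "(\<And>g. g \<in> A \<Longrightarrow> c g = d g) \<Longrightarrow> mon c = mon d"
 unfolding mon_def using gens by (intro finprod_cong') auto

lemma mon_pow: "mon (\<lambda>g. n * c g) = mon c [^] n"
 by (induction n) (simp_all add: mon_zero mon_add m_comm)

lemma mon_single:
 assumes "a \<in> A"
 shows "mon (\<lambda>g. if g = a then 1 else 0) = a"
proof -
 have "mon (\<lambda>g. if g = a then 1 else 0) = finprod P (\<lambda>g. if a = g then g else \<one>) A"
  unfolding mon_def using gens assms by (intro finprod_cong') auto
 also have "\<dots> = a" using finprod_singleton[OF assms finite_gens, of "\<lambda>g. g"] gens by auto
 finally show ?thesis .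
qed

lemma mon_surj: "p \<in> carrier P \<Longrightarrow> \<exists>c. p = mon c"
 by (erule gens_induct) (metis mon_zero, metis mon_single, metis mon_add)

text \<open>Generators with exponent zero contribute the factor one, so additivity on T suffices.
  This covers functions such as ln x, which are additive on a face only.\<close>

lemma hom_mon_on:
 fixes \<phi> :: "'a \<Rightarrow> 'k::semiring_1"
 assumes T: "submonoid T P" and "\<phi> \<one> = 0" and add: "\<And>p q. p \<in> T \<Longrightarrow> q \<in> T \<Longrightarrow> \<phi> (p \<otimes> q) = \<phi> p + \<phi> q"
  and c: "\<And>g. g \<in> A \<Longrightarrow> c g > 0 \<Longrightarrow> g \<in> T"
 shows "mon c \<in> T" "\<phi> (mon c) = (\<Sum>g\<in>A. of_nat (c g) * \<phi> g)"
proof -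
 interpret T: comm_quot P T by (intro comm_quot.intro comm_monoid_axioms T)
 have pow: "g [^] n \<in> T \<and> \<phi> (g [^] n) = of_nat n * \<phi> g" if "g \<in> T" for g and n :: nat
  using that assms(2) by (induction n) (auto simp: T.one_closed T.S_closed add algebra_simps)
 have pow': "g [^] c g \<in> T \<and> \<phi> (g [^] c g) = of_nat (c g) * \<phi> g" if "g \<in> A" for g
  using pow[OF c[OF that]] assms(2) T.one_closed by (cases "c g > 0") auto
 have "finprod P (\<lambda>g. g [^] c g) B \<in> T \<and> \<phi> (finprod P (\<lambda>g. g [^] c g) B) = (\<Sum>g\<in>B. of_nat (c g) * \<phi> g)"
  if "finite B" "B \<subseteq> A" for B using that
 proof induction
  case (insert b B)
  then have "(\<lambda>g. g [^] c g) \<in> B \<rightarrow> carrier P" "b \<in> carrier P" using gens by auto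
  then show ?case using insert add pow'[of b] T.S_closed by simp
 qed (simp add: assms T.one_closed)
 from this[OF finite_gens subset_refl]
 show "mon c \<in> T" "\<phi> (mon c) = (\<Sum>g\<in>A. of_nat (c g) * \<phi> g)" unfolding mon_def by auto
qed

text \<open>Coordinates outside \<open>A\<close> are irrelevant.\<close>

definition relations :: "('a \<Rightarrow> int) set" where
 "relations = {v. \<exists>c d. (\<forall>g\<in>A. v g = int (c g) - int (d g)) \<and> mon c = mon d}"

lemma relationsD:
 assumes "v \<in> relations" "\<And>g. g \<in> A \<Longrightarrow> v g = int (c g) - int (d g)"
 shows "mon c = mon d"
proof -
 obtain c' d' where *: "\<forall>g\<in>A. v g = int (c' g) - int (d' g)" "mon c' = mon d'"
  using assms(1) unfolding relations_def by blast
 have "mon c \<otimes> mon d' = mon d \<otimes> mon c'" unfolding mon_add[symmetric]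
 proof (rule mon_cong)
  fix g assume "g \<in> A"
  then show "c g + d' g = d g + c' g" using *(1)[rule_format, of g] assms(2)[of g] by simp
 qed
 then show ?thesis using *(2) integral[of "mon c" "mon d" "mon d'"] by simp
qed

lemma relations_comb:
 assumes "u \<in> relations" "v \<in> relations"
 shows "(\<lambda>g. m * u g + k * v g) \<in> relations"
proof -
 have smult: "\<exists>c d. (\<forall>g\<in>A. m * u g = int (c g) - int (d g)) \<and> mon c = mon d" if u: "u \<in> relations" for u m
 proof -
  obtain c d where *: "\<forall>g\<in>A. u g = int (c g) - int (d g)" "mon c = mon d"
   using u unfolding relations_def by blast
  show ?thesis
  proof (cases "m \<ge> 0")
   case True
   then show ?thesis by (intro exI[of _ "\<lambda>g. nat m * c g"] exI[of _ "\<lambda>g. nat m * d g"])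
    (simp add: mon_pow * right_diff_distrib)
  next
   case False
   define k where "k = nat (- m)"
   have m: "m = - int k" using False by (simp add: k_def)
   show ?thesis unfolding m by (intro exI[of _ "\<lambda>g. k * d g"] exI[of _ "\<lambda>g. k * c g"])
    (simp add: mon_pow * algebra_simps)
  qed
 qed
 obtain c d where 1: "\<forall>g\<in>A. m * u g = int (c g) - int (d g)" "mon c = mon d"
  using smult[OF assms(1)] by blast
 obtain c' d' where 2: "\<forall>g\<in>A. k * v g = int (c' g) - int (d' g)" "mon c' = mon d'"
  using smult[OF assms(2)] by blast
 show ?thesis unfolding relations_def mem_Collect_eq
  by (rule exI[of _ "\<lambda>g. c g + c' g"], rule exI[of _ "\<lambda>g. d g + d' g"]) (use 1 2 in \<open>auto simp: mon_add\<close>)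
qed

lemma relations_zero: "\<forall>g\<in>A. v g = 0 \<Longrightarrow> v \<in> relations"
 unfolding relations_def by (auto intro!: exI[of _ "\<lambda>_. 0"])

text \<open>Two expressions of one element in the generators differ by a relation; the value
  therefore does not depend on the expression that \<open>SOME\<close> picks.\<close>

lemma functional_hom:
 fixes l :: "'a \<Rightarrow> 'k::ring_1"
 assumes l: "\<And>v. v \<in> relations \<Longrightarrow> (\<Sum>g\<in>A. of_int (v g) * l g) = 0"
 obtains L where "\<And>c. L (mon c) = (\<Sum>g\<in>A. of_nat (c g) * l g)"
  "\<And>p q. p \<in> carrier P \<Longrightarrow> q \<in> carrier P \<Longrightarrow> L (p \<otimes> q) = L p + L q" "L \<one> = 0"
proof -
 define L where "L p = (\<Sum>g\<in>A. of_nat ((SOME c. p = mon c) g) * l g)" for p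
 have L: "L (mon c) = (\<Sum>g\<in>A. of_nat (c g) * l g)" for c
 proof -
  define d where "d = (SOME d. mon c = mon d)"
  have "mon c = mon d" unfolding d_def by (rule someI[of "\<lambda>d. mon c = mon d" c]) (rule refl)
  then have "(\<lambda>g. int (c g) - int (d g)) \<in> relations" unfolding relations_def by blast
  from l[OF this] have "(\<Sum>g\<in>A. of_nat (c g) * l g) = (\<Sum>g\<in>A. of_nat (d g) * l g)"
   by (simp add: algebra_simps sum_subtractf)
  then show ?thesis by (simp add: L_def d_def)
 qed
 have "L (p \<otimes> q) = L p + L q" if "p \<in> carrier P" "q \<in> carrier P" for p q
 proof -
  obtain c d where "p = mon c" "q = mon d" using mon_surj \<open>p \<in> _\<close> \<open>q \<in> _\<close> by blast
  then show ?thesis by (simp add: L flip: mon_add) (simp add: algebra_simps sum.distrib)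
 qed
 moreover have "L \<one> = 0" using L[of "\<lambda>_. 0"] by (simp add: mon_zero)
 ultimately show thesis using L that by blast
qed

end

section \<open>Faces, functionals and biduality\<close>

lemma mon_faceD:
 assumes "mon_face T P"
 shows "submonoid T P" "T \<subseteq> carrier P" "p \<in> carrier P \<Longrightarrow> q \<in> carrier P \<Longrightarrow> p \<otimes>\<^bsub>P\<^esub> q \<in> T \<Longrightarrow> p \<in> T"
  "p \<in> carrier P \<Longrightarrow> q \<in> carrier P \<Longrightarrow> p \<otimes>\<^bsub>P\<^esub> q \<in> T \<Longrightarrow> q \<in> T" "p \<in> T \<Longrightarrow> q \<in> T \<Longrightarrow> p \<otimes>\<^bsub>P\<^esub> q \<in> T" "\<one>\<^bsub>P\<^esub> \<in> T"
 using assms unfolding mon_face_def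
 by (auto dest: submonoid.subset submonoid.m_closed submonoid.one_closed)

text \<open>A sum of natural numbers vanishes only if both summands do.\<close>

lemma zero_face:
 assumes "comm_monoid P" "\<And>\<phi>. \<phi> \<in> \<Phi> \<Longrightarrow> \<phi> \<in> duals P"
 shows "mon_face {p \<in> carrier P. \<forall>\<phi>\<in>\<Phi>. \<phi> p = 0} P"
proof -
 interpret comm_monoid P by fact
 have \<Phi>: "\<phi> \<one>\<^bsub>P\<^esub> = 0" "p \<in> carrier P \<Longrightarrow> q \<in> carrier P \<Longrightarrow> \<phi> (p \<otimes>\<^bsub>P\<^esub> q) = \<phi> p + \<phi> q"
  if "\<phi> \<in> \<Phi>" for \<phi> p q using assms(2)[OF that] by (auto simp: dual_carrier_iff)
 have "submonoid {p \<in> carrier P. \<forall>\<phi>\<in>\<Phi>. \<phi> p = 0} P" by unfold_locales (auto simp: \<Phi>)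
 then show ?thesis unfolding mon_face_def by (auto simp: \<Phi>)
qed

text \<open>For a facet \<open>T\<close> this is the primitive functional vanishing on \<open>T\<close>.\<close>

definition ord_along :: "'a monoid \<Rightarrow> 'a set \<Rightarrow> 'a \<Rightarrow> nat" where
 "ord_along P T p = (LEAST n. \<exists>\<phi>\<in>duals P. (\<forall>t\<in>T. \<phi> t = 0) \<and> (\<exists>q\<in>carrier P. \<phi> q \<noteq> 0) \<and> \<phi> p = n)"

context fg_monoid
begin

lemma comm_quot_face: "mon_face T P \<Longrightarrow> comm_quot P T"
 by (intro comm_quot.intro comm_monoid_axioms mon_faceD(1))

lemma pow_mult: "p \<in> carrier P \<Longrightarrow> q \<in> carrier P \<Longrightarrow> (p \<otimes> q) [^] (n::nat) = p [^] n \<otimes> q [^] n"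
 by (rule pow_mult_distrib[OF m_comm])

lemma face_pow_iff:
 assumes "mon_face T P" "p \<in> carrier P" "n > 0"
 shows "p [^] (n::nat) \<in> T \<longleftrightarrow> p \<in> T"
proof
 note T = mon_faceD[OF assms(1)]
 show "p \<in> T" if "p [^] n \<in> T" using that assms(2,3) T(4)[of "p [^] (n - 1)" p] by (cases n) auto
 show "p [^] n \<in> T" if "p \<in> T" using that by (induction n) (auto intro: T(5,6))
qed

lemma mon_in_face:
 assumes "mon_face T P"
 shows "mon c \<in> T \<longleftrightarrow> (\<forall>g\<in>A. c g > 0 \<longrightarrow> g \<in> T)"
proof
 note T = mon_faceD[OF assms]
 show "\<forall>g\<in>A. c g > 0 \<longrightarrow> g \<in> T" if "mon c \<in> T"
 proof (intro ballI impI)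
  fix a assume a: "a \<in> A" "c a > 0"
  define c' where "c' = c(a := c a - 1)"
  have "mon c = mon (\<lambda>g. (if g = a then 1 else 0) + c' g)"
   using a by (intro mon_cong) (auto simp: c'_def)
  then have "mon c = a \<otimes> mon c'" using mon_single[OF a(1)] by (simp add: mon_add)
  then show "a \<in> T" using T(3)[of a "mon c'"] that a gens by auto
 qed
 show "mon c \<in> T" if "\<forall>g\<in>A. c g > 0 \<longrightarrow> g \<in> T"
  by (rule hom_mon_on(1)[OF T(1), of "\<lambda>_. 0::nat"]) (use that in auto)
qed

text \<open>A face is spanned by the generators it contains, by \<open>mon_in_face\<close>;
  inclusion of faces is thus a finite condition.\<close>

lemma face_mono:
 assumes "mon_face T P" "mon_face T' P" "T \<inter> A \<subseteq> T'"
 shows "T \<subseteq> T'"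
proof
 fix p assume "p \<in> T"
 moreover then have "p \<in> carrier P" using mon_faceD(2)[OF assms(1)] by blast
 ultimately obtain c where c: "p = mon c" "mon c \<in> T" using mon_surj by blast
 then show "p \<in> T'"
  using c mon_in_face[OF assms(1), of c] mon_in_face[OF assms(2), of c] assms(3) by auto
qed

lemma dual_le:
 assumes R: "presents P T \<kappa> R" and \<phi>: "\<phi> \<in> duals R" "\<psi> \<in> duals R"
  and le: "\<And>g. g \<in> A \<Longrightarrow> \<phi> (\<kappa> g) \<le> \<psi> (\<kappa> g)" and r: "r \<in> carrier R"
 shows "\<phi> r \<le> \<psi> r"
proof -
 note R = presentsD[OF R]
 obtain p where p: "p \<in> carrier P" "r = \<kappa> p" using r R(3) by auto
 have "\<phi> (\<kappa> p) \<le> \<psi> (\<kappa> p)" by (rule gens_induct[OF p(1), where Q = "\<lambda>p. \<phi> (\<kappa> p) \<le> \<psi> (\<kappa> p)"])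
   (use le \<phi> R in \<open>auto simp: dual_carrier_iff intro: add_mono\<close>)
 with p show ?thesis by simp
qed

lemma fin_gen_presented:
 assumes "presents P T \<kappa> R"
 shows "fin_gen R" unfolding fin_gen_def
proof (intro exI[of _ "\<kappa> ` A"] conjI allI impI)
 note R = presentsD[OF assms]
 show "finite (\<kappa> ` A)" "\<kappa> ` A \<subseteq> carrier R" using finite_gens gens R(4) by auto
 fix H assume H: "submonoid H R \<and> \<kappa> ` A \<subseteq> H"
 then have "\<kappa> p \<in> H" if "p \<in> carrier P" for p by (intro gens_induct[OF that, where Q = "\<lambda>p. \<kappa> p \<in> H"])
   (use R H in \<open>auto dest: submonoid.one_closed submonoid.m_closed\<close>)
 then have "carrier R \<subseteq> H" unfolding R(3) by auto
 moreover have "H \<subseteq> carrier R" using H submonoid.subset by metis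
 ultimately show "H = carrier R" by blast
qed

text \<open>Farkas' lemma modulo \<open>relations\<close> for the cone of the generators, those in T
  counted with both signs. If the asserted identity fails, the separating functional is nonnegative
  on P, zero on T and smaller on a than on b, against \<open>le\<close>.\<close>

lemma cone_separation:
 assumes T: "mon_face T P" and ab: "a \<in> carrier P" "b \<in> carrier P"
  and le: "\<And>\<phi>. \<phi> \<in> duals P \<Longrightarrow> (\<forall>t\<in>T. \<phi> t = 0) \<Longrightarrow> \<phi> b \<le> \<phi> a"
 shows "\<exists>n>0. \<exists>p\<in>carrier P. \<exists>t\<in>T. a [^] (n::nat) \<otimes> t = b [^] n \<otimes> p"
proof -
 obtain ca cb where c: "a = mon ca" "b = mon cb" using mon_surj ab by blast
 define v :: "'a + 'a \<Rightarrow> 'a \<Rightarrow> int" where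
  "v = (\<lambda>i g. case i of Inl a \<Rightarrow> if g = a then 1 else 0 | Inr a \<Rightarrow> if g = a then - 1 else 0)"
 have sumv: "(\<Sum>i\<in>A <+> (A \<inter> T). c i * v i g) = c (Inl g) - (if g \<in> T then c (Inr g) else 0)"
  if "g \<in> A" for c g
 proof -
  have "(\<Sum>i\<in>A. c (Inr i) * (if g = i then - 1 else 0)) = - c (Inr g)"
   using that finite_gens by (simp add: if_distrib sum.delta cong: if_cong)
  moreover have "(\<Sum>i\<in>A \<inter> T. c (Inr i) * (if g = i then - 1 else 0)) = (if g \<in> T then - c (Inr g) else 0)"
   using that finite_gens by (simp add: if_distrib sum.delta cong: if_cong)
  moreover have "(\<Sum>i\<in>A. c (Inl i) * (if g = i then 1 else 0)) = c (Inl g)"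
   using that finite_gens by (simp add: if_distrib sum.delta cong: if_cong)
  ultimately show ?thesis using finite_gens by (simp add: sum.Plus v_def)
 qed
 have valv: "(\<Sum>g\<in>A. v (Inl a) g * l g) = l a" "(\<Sum>g\<in>A. v (Inr a) g * l g) = - l a"
  if "a \<in> A" for a and l :: "'a \<Rightarrow> int"
  using that finite_gens by (simp_all add: v_def if_distrib[of "\<lambda>x. x * _"] sum.delta cong: if_cong)
 have "finite (A <+> (A \<inter> T))" using finite_gens by simp
 then have "(\<exists>n>0. \<exists>c. (\<forall>i\<in>A <+> (A \<inter> T). c i \<ge> 0) \<and>
    (\<lambda>g. n * (int (ca g) - int (cb g)) - (\<Sum>i\<in>A <+> (A \<inter> T). c i * v i g)) \<in> relations) \<or>
   (\<exists>l::'a \<Rightarrow> int. (\<forall>e\<in>relations. (\<Sum>g\<in>A. e g * l g) = 0) \<and>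
    (\<forall>i\<in>A <+> (A \<inter> T). (\<Sum>g\<in>A. v i g * l g) \<ge> 0) \<and>
    (\<Sum>g\<in>A. (int (ca g) - int (cb g)) * l g) < 0)"
 proof (intro Farkas finite_gens)
  show "(\<lambda>g. m * u g + k * v g) \<in> relations" if "u \<in> relations" "v \<in> relations" for u v m k
   by (rule relations_comb[OF that])
  show "v \<in> relations" if "\<forall>g\<in>A. v g = 0" for v by (rule relations_zero[OF that])
 qed
 then show ?thesis
 proof (elim disjE exE conjE)
  fix n c assume n: "n > 0" "\<forall>i\<in>A <+> (A \<inter> T). c i \<ge> 0"
   "(\<lambda>g. n * (int (ca g) - int (cb g)) - (\<Sum>i\<in>A <+> (A \<inter> T). c i * v i g)) \<in> relations"
  define x where "x g = nat (c (Inl g))" for g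
  define y where "y g = (if g \<in> T then nat (c (Inr g)) else 0)" for g
  define k where "k = nat n"
  have k: "k > 0" "n = int k" using n(1) by (simp_all add: k_def)
  have xy: "c (Inl g) = int (x g)" "(if g \<in> T then c (Inr g) else 0) = int (y g)" if "g \<in> A" for g
   using n(2) that by (auto simp: x_def y_def)
  have "mon (\<lambda>g. k * ca g + y g) = mon (\<lambda>g. k * cb g + x g)"
  proof (rule relationsD[OF n(3)])
   fix g assume g: "g \<in> A"
   show "n * (int (ca g) - int (cb g)) - (\<Sum>i\<in>A <+> (A \<inter> T). c i * v i g) =
     int (k * ca g + y g) - int (k * cb g + x g)"
    unfolding sumv[OF g] xy[OF g] k(2) by (simp add: algebra_simps)
  qed
  then have "a [^] k \<otimes> mon y = b [^] k \<otimes> mon x" by (simp add: mon_add mon_pow c)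
  moreover have "mon y \<in> T" unfolding mon_in_face[OF T] by (auto simp: y_def)
  ultimately show ?thesis using k(1) mon_closed by blast
 next
  fix l :: "'a \<Rightarrow> int"
  assume l: "\<forall>e\<in>relations. (\<Sum>g\<in>A. e g * l g) = 0"
   "\<forall>i\<in>A <+> (A \<inter> T). (\<Sum>g\<in>A. v i g * l g) \<ge> 0" "(\<Sum>g\<in>A. (int (ca g) - int (cb g)) * l g) < 0"
  have l0: "l g \<ge> 0" if "g \<in> A" for g using l(2)[rule_format, of "Inl g"] valv[OF that] that by auto
  have lT: "l g = 0" if "g \<in> A" "g \<in> T" for g
   using l(2)[rule_format, of "Inr g"] valv[OF that(1)] that l0[OF that(1)] by auto
  have l1: "(\<Sum>g\<in>A. of_int (e g) * l g) = 0" if "e \<in> relations" for e using l(1) that by simp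
  obtain L where L: "\<And>c. L (mon c) = (\<Sum>g\<in>A. of_nat (c g) * l g)"
   "\<And>p q. p \<in> carrier P \<Longrightarrow> q \<in> carrier P \<Longrightarrow> L (p \<otimes> q) = L p + L q" "L \<one> = 0"
   using functional_hom[of l, OF l1] by metis
  have L0: "L p \<ge> 0" if "p \<in> carrier P" for p
   using mon_surj[OF that] l0 by (auto simp: L(1) intro!: sum_nonneg)
  define \<phi> where "\<phi> = (\<lambda>p\<in>carrier P. nat (L p))"
  have "\<phi> \<in> duals P" using L0 L(2,3) by (auto simp: \<phi>_def dual_carrier_iff nat_add_distrib)
  moreover have "\<phi> t = 0" if t: "t \<in> T" for t
  proof -
   have tP: "t \<in> carrier P" using t mon_faceD(2)[OF T] by blast
   obtain d where d: "t = mon d" using mon_surj[OF tP] by blast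
   have "\<forall>g\<in>A. d g > 0 \<longrightarrow> g \<in> T" using t mon_in_face[OF T, of d] by (simp add: d)
   then have "L t = 0" using lT unfolding d L(1) by (intro sum.neutral) auto
   then show ?thesis using tP by (simp add: \<phi>_def)
  qed
  ultimately have "\<phi> b \<le> \<phi> a" using le by blast
  then have "L b \<le> L a" using ab L0[OF ab(1)] L0[OF ab(2)] by (simp add: \<phi>_def nat_le_eq_zle)
  moreover have "L a - L b < 0" using l(3) by (simp add: c L(1) algebra_simps sum_subtractf)
  ultimately show ?thesis by simp
 qed
qed

text \<open>The case a = 1 of \<open>cone_separation\<close> makes a power of p divide an element of
  T.\<close>

lemma face_bidual:
 assumes T: "mon_face T P" and p: "p \<in> carrier P" and z: "\<And>\<phi>. \<phi> \<in> duals P \<Longrightarrow> (\<forall>t\<in>T. \<phi> t = 0) \<Longrightarrow> \<phi> p = 0"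
 shows "p \<in> T"
proof -
 have "\<exists>n>0. \<exists>q\<in>carrier P. \<exists>t\<in>T. \<one> [^] (n::nat) \<otimes> t = p [^] n \<otimes> q"
  using z by (intro cone_separation[OF T one_closed p]) (metis le0)
 then obtain n q t where *: "n > (0::nat)" "q \<in> carrier P" "t \<in> T" "\<one> [^] n \<otimes> t = p [^] n \<otimes> q" by blast
 then have "t = p [^] n \<otimes> q" using mon_faceD(2)[OF T] by (auto simp: nat_pow_one)
 then have "p [^] n \<in> T" using * p mon_faceD(3)[OF T, of "p [^] n" q] by auto
 then show ?thesis using face_pow_iff[OF T p *(1)] by blast
qed

text \<open>For each generator outside T some functional vanishes on T but not there; their sum
  vanishes exactly on T.\<close>

lemma face_functional:
 assumes T: "mon_face T P"
 obtains \<phi> where "\<phi> \<in> duals P" "\<And>p. p \<in> carrier P \<Longrightarrow> \<phi> p = 0 \<longleftrightarrow> p \<in> T"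
proof -
 have "\<exists>\<phi>. \<phi> \<in> duals P \<and> (\<forall>t\<in>T. \<phi> t = 0) \<and> \<phi> g \<noteq> 0" if "g \<in> A - T" for g
  using face_bidual[OF T, of g] that gens by blast
 then obtain \<Phi> where \<Phi>: "\<And>g. g \<in> A - T \<Longrightarrow> \<Phi> g \<in> duals P \<and> (\<forall>t\<in>T. \<Phi> g t = 0) \<and> \<Phi> g g \<noteq> 0" by metis
 define \<phi> where "\<phi> = (\<lambda>p\<in>carrier P. \<Sum>g\<in>A - T. \<Phi> g p)"
 have \<phi>: "\<phi> \<in> duals P" using \<Phi> by (auto simp: \<phi>_def dual_carrier_iff sum.distrib intro!: sum.neutral)
 have T0: "\<phi> t = 0" if "t \<in> T" for t using that \<Phi> mon_faceD(2)[OF T] by (auto simp: \<phi>_def)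
 have "{p \<in> carrier P. \<forall>\<psi>\<in>{\<phi>}. \<psi> p = 0} \<subseteq> T"
 proof (rule face_mono[OF zero_face T])
  show "{p \<in> carrier P. \<forall>\<psi>\<in>{\<phi>}. \<psi> p = 0} \<inter> A \<subseteq> T"
  proof clarsimp
   fix g assume g: "g \<in> carrier P" "\<phi> g = 0" "g \<in> A"
   show "g \<in> T"
   proof (rule ccontr)
    assume "g \<notin> T"
    moreover have "\<forall>h\<in>A - T. \<Phi> h g = 0" using g finite_gens by (simp add: \<phi>_def)
    ultimately show False using \<Phi>[of g] g by auto
   qed
  qed
 qed (use \<phi> comm_monoid_axioms in auto)
 then show thesis using T0 \<phi> that by blast
qed

text \<open>Serves to extend ln x from the monomials that do not vanish at x to all of P. The
  function f gives a linear form S on vectors supported in T. A relation supported in T has positive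
  and negative parts with the same image in T, so S kills it and descends to classes modulo
  \<open>relations\<close>; \<open>additive_extension\<close> then extends it to the
  lattice.\<close>

lemma real_extension:
 fixes f :: "'a \<Rightarrow> real"
 assumes T: "mon_face T P" and f: "f \<one> = 0" "\<And>p q. p \<in> T \<Longrightarrow> q \<in> T \<Longrightarrow> f (p \<otimes> q) = f p + f q"
 obtains L where "\<And>p q. p \<in> carrier P \<Longrightarrow> q \<in> carrier P \<Longrightarrow> L (p \<otimes> q) = L p + L q" "L \<one> = (0::real)"
  "\<And>t. t \<in> T \<Longrightarrow> L t = f t"
proof -
 define S where "S w = (\<Sum>g\<in>A. of_int (w g) * f g)" for w :: "'a \<Rightarrow> int"
 have S0: "S w = 0" if w: "w \<in> relations" "\<forall>g\<in>A - T. w g = 0" for w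
 proof -
  define c where "c g = nat (w g)" for g
  define d where "d g = nat (- w g)" for g
  have wcd: "w g = int (c g) - int (d g)" for g by (simp add: c_def d_def)
  have "mon c = mon d" by (rule relationsD[OF w(1)]) (simp add: wcd)
  moreover have "f (mon e) = (\<Sum>g\<in>A. of_nat (e g) * f g)" if "e = c \<or> e = d" for e
   by (rule hom_mon_on(2)[OF mon_faceD(1)[OF T] f]) (use that w(2) in \<open>force simp: c_def d_def\<close>)+
  ultimately have "(\<Sum>g\<in>A. of_nat (c g) * f g) = (\<Sum>g\<in>A. of_nat (d g) * f g)" by metis
  then show ?thesis unfolding S_def wcd by (simp add: algebra_simps sum_subtractf)
 qed
 have Scomb: "S (\<lambda>g. m * u g + k * w g) = of_int m * S u + of_int k * S w" for m k u w
  by (simp add: S_def sum_distrib_left sum.distrib algebra_simps)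
 \<comment> \<open>The vector w is supported in T and represents the same element of the group
   completion as v.\<close>
 define good where "good v w \<longleftrightarrow> (\<lambda>g. 1 * v g + (- 1) * w g) \<in> relations \<and> (\<forall>g\<in>A - T. w g = 0)"
  for v w :: "'a \<Rightarrow> int"
 have uniq: "S w = S w'" if "good v w" "good v w'" for v w w'
 proof -
  have "(\<lambda>g. 1 * (1 * v g + (- 1) * w g) + (- 1) * (1 * v g + (- 1) * w' g)) \<in> relations"
   using that unfolding good_def
   by (intro relations_comb[of "\<lambda>g. 1 * v g + (- 1) * w g" "\<lambda>g. 1 * v g + (- 1) * w' g"]) blast+
  then have "(\<lambda>g. 1 * w' g + (- 1) * w g) \<in> relations" by (simp add: algebra_simps)
  then have "S (\<lambda>g. 1 * w' g + (- 1) * w g) = 0" using that by (intro S0) (auto simp: good_def)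
  then show ?thesis unfolding Scomb by simp
 qed
 define H where "H = {v. \<exists>w. good v w}"
 define F where "F v = S (SOME w. good v w)" for v
 have F: "F v = S w" if "good v w" for v w
  unfolding F_def by (rule uniq[OF someI[of "good v", OF that] that])
 have comb: "good (\<lambda>g. m * u g + k * v g) (\<lambda>g. m * a g + k * b g)" if "good u a" "good v b" for u v a b m k
 proof -
  have "(\<lambda>g. m * (1 * u g + (- 1) * a g) + k * (1 * v g + (- 1) * b g)) \<in> relations"
   using that unfolding good_def
   by (intro relations_comb[of "\<lambda>g. 1 * u g + (- 1) * a g" "\<lambda>g. 1 * v g + (- 1) * b g"]) blast+
  then show ?thesis using that by (auto simp: good_def algebra_simps)
 qed
 have "\<exists>l. \<forall>v\<in>H. F v = (\<Sum>g\<in>A. of_int (v g) * l g)"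
 proof (rule additive_extension[OF finite_gens])
  show "(\<lambda>g. m * u g + k * v g) \<in> H" if "u \<in> H" "v \<in> H" for u v m k
   using that comb unfolding H_def by blast
  show "F (\<lambda>g. m * u g + k * v g) = of_int m * F u + of_int k * F v" if uv: "u \<in> H" "v \<in> H" for u v m k
  proof -
   obtain a b where ab: "good u a" "good v b" using uv unfolding H_def by blast
   show ?thesis unfolding F[OF comb[OF ab]] F[OF ab(1)] F[OF ab(2)] by (rule Scomb)
  qed
  show "F v = 0" if "v \<in> H" "\<forall>g\<in>A. v g = 0" for v
  proof -
   have "good v (\<lambda>_. 0)" using that(2) relations_zero[of v] by (simp add: good_def)
   from F[OF this] show ?thesis by (simp add: S_def)
  qed
 qed
 then obtain l where l: "\<And>v. v \<in> H \<Longrightarrow> F v = (\<Sum>g\<in>A. of_int (v g) * l g)" by blast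
 have l0: "(\<Sum>g\<in>A. of_int (v g) * l g) = 0" if "v \<in> relations" for v
 proof -
  have "good v (\<lambda>_. 0)" using that by (simp add: good_def)
  then have "v \<in> H" "F v = 0" using F[of v "\<lambda>_. 0"] by (auto simp: H_def S_def)
  then show ?thesis using l by simp
 qed
 obtain L where L: "\<And>c. L (mon c) = (\<Sum>g\<in>A. of_nat (c g) * l g)"
  "\<And>p q. p \<in> carrier P \<Longrightarrow> q \<in> carrier P \<Longrightarrow> L (p \<otimes> q) = L p + L q" "L \<one> = 0"
  using functional_hom[of l, OF l0] by metis
 have "L t = f t" if t: "t \<in> T" for t
 proof -
  obtain d where d: "t = mon d" using mon_surj t mon_faceD(2)[OF T] by blast
  then have dT: "\<forall>g\<in>A. d g > 0 \<longrightarrow> g \<in> T" using t mon_in_face[OF T] by blast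
  then have "good (\<lambda>g. int (d g)) (\<lambda>g. int (d g))"
   using relations_zero[of "\<lambda>_. 0"] by (force simp: good_def)
  then have "(\<lambda>g. int (d g)) \<in> H" "F (\<lambda>g. int (d g)) = S (\<lambda>g. int (d g))" using F by (auto simp: H_def)
  then have "L t = S (\<lambda>g. int (d g))" using l by (simp add: d L(1))
  also have "\<dots> = f t"
   unfolding d by (subst hom_mon_on(2)[OF mon_faceD(1)[OF T] f]) (use dT in \<open>auto simp: S_def\<close>)
  finally show ?thesis .
 qed
 then show thesis using L that by blast
qed

end

text \<open>Saturation expressed inside P: the quotient a/b of the group completion lies in P as
  soon as its n-th power does.\<close>

locale toric_monoid = fg_monoid +
 assumes saturated: "\<And>a b c n. a \<in> carrier P \<Longrightarrow> b \<in> carrier P \<Longrightarrow> c \<in> carrier P \<Longrightarrow> n > (0::nat) \<Longrightarrow>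
  a [^] n = b [^] n \<otimes> c \<Longrightarrow> \<exists>s\<in>carrier P. a = b \<otimes> s"

lemma toric_monoidI:
 assumes "toric P"
 obtains A where "toric_monoid P A"
proof -
 interpret P: comm_monoid P using assms by (simp add: toric_def)
 interpret G: gp_completion P by unfold_locales
 have int: "p = q" if "p \<in> carrier P" "q \<in> carrier P" "r \<in> carrier P" "p \<otimes>\<^bsub>P\<^esub> r = q \<otimes>\<^bsub>P\<^esub> r" for p q r
  using assms that unfolding toric_def integral_monoid_def by blast
 obtain A where A: "finite A" "A \<subseteq> carrier P" "\<And>H. submonoid H P \<Longrightarrow> A \<subseteq> H \<Longrightarrow> H = carrier P"
  using assms unfolding toric_def fin_gen_def by blast
 have "toric_monoid P A"
 proof unfold_locales
  fix a b c and n :: nat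
  assume *: "a \<in> carrier P" "b \<in> carrier P" "c \<in> carrier P" "n > 0" "a [^]\<^bsub>P\<^esub> n = b [^]\<^bsub>P\<^esub> n \<otimes>\<^bsub>P\<^esub> c"
  have "G.cls a b [^]\<^bsub>gp P\<^esub> n = gp_of P c"
   using * by (simp add: G.cls_pow G.gp_of_cls G.cls_eq_iff P.m_comm) (use P.one_closed in blast)
  moreover have "saturated_monoid P" using assms by (simp add: toric_def)
  ultimately have "G.cls a b \<in> gp_of P ` carrier P"
   unfolding saturated_monoid_def using * G.cls_closed[of a b] by (metis Suc_leI One_nat_def imageI)
  then obtain s where s: "s \<in> carrier P" "G.cls a b = G.cls s \<one>\<^bsub>P\<^esub>" by (auto simp: G.gp_of_cls)
  then obtain k where "k \<in> carrier P" "a \<otimes>\<^bsub>P\<^esub> k = s \<otimes>\<^bsub>P\<^esub> b \<otimes>\<^bsub>P\<^esub> k" using * by (auto simp: G.cls_eq_iff)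
  then have "a = s \<otimes>\<^bsub>P\<^esub> b" using int[of a "s \<otimes>\<^bsub>P\<^esub> b" k] * s by simp
  then show "\<exists>s\<in>carrier P. a = b \<otimes>\<^bsub>P\<^esub> s" using s * P.m_comm by blast
 next
  show "finite A" "A \<subseteq> carrier P" by fact+
 qed (fact A(3), fact int)
 then show thesis by (rule that)
qed

context toric_monoid
begin

text \<open>If no functional separates, \<open>cone_separation\<close> applies in both directions,
  and powers of p and q divide each other up to cofactors x and y, which turn out to lie in T.
  Saturation then extracts the n-th root, giving p t = q r, and r lies in T since r^n does.\<close>

lemma dual_separates:
 assumes T: "mon_face T P" and p: "p \<in> carrier P" "q \<in> carrier P" and ne: "(p, q) \<notin> quot_rel P T"
 obtains \<phi> where "\<phi> \<in> duals P" "\<forall>t\<in>T. \<phi> t = 0" "\<phi> p \<noteq> \<phi> q"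
proof -
 note TD = mon_faceD[OF T]
 interpret T: comm_quot P T by (rule comm_quot_face[OF T])
 have False if eq: "\<And>\<phi>. \<phi> \<in> duals P \<Longrightarrow> (\<forall>t\<in>T. \<phi> t = 0) \<Longrightarrow> \<phi> p = \<phi> q"
 proof -
  obtain n x t where 1: "n > (0::nat)" "x \<in> carrier P" "t \<in> T" "p [^] n \<otimes> t = q [^] n \<otimes> x"
   using cone_separation[OF T p] eq by (metis order_refl)
  obtain m y s where 2: "m > (0::nat)" "y \<in> carrier P" "s \<in> T" "q [^] m \<otimes> s = p [^] m \<otimes> y"
   using cone_separation[OF T p(2,1)] eq by (metis order_refl)
  have c: "t \<in> carrier P" "s \<in> carrier P" using 1 2 TD(2) by auto
  text \<open>Multiplying the \<open>m\<close>-th power of the first relation with the \<open>n\<close>-th power of the second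
   shows that \<open>x\<close> lies in the face.\<close>
  have "(p [^] n \<otimes> t) [^] m \<otimes> (q [^] m \<otimes> s) [^] n =
    (p [^] (n * m) \<otimes> q [^] (n * m)) \<otimes> (t [^] m \<otimes> s [^] n)"
   using p c by (simp add: pow_mult nat_pow_pow mult.commute[of m n] mult_swap4)
  moreover have "(q [^] n \<otimes> x) [^] m \<otimes> (p [^] m \<otimes> y) [^] n =
    (q [^] (n * m) \<otimes> p [^] (n * m)) \<otimes> (x [^] m \<otimes> y [^] n)"
   using p 1(2) 2(2) by (simp add: pow_mult nat_pow_pow mult.commute[of m n] mult_swap4)
  ultimately have "(p [^] (n * m) \<otimes> q [^] (n * m)) \<otimes> (t [^] m \<otimes> s [^] n) =
    (p [^] (n * m) \<otimes> q [^] (n * m)) \<otimes> (x [^] m \<otimes> y [^] n)"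
   using p by (simp add: 1(4) 2(4) m_comm[of "q [^] (n * m)"])
  then have eq: "t [^] m \<otimes> s [^] n = x [^] m \<otimes> y [^] n"
   using integral[of "t [^] m \<otimes> s [^] n" "x [^] m \<otimes> y [^] n" "p [^] (n * m) \<otimes> q [^] (n * m)"] p c 1(2) 2(2)
   by (simp add: m_comm)
  have "t [^] m \<in> T" "s [^] n \<in> T" using 1(1,3) 2(1,3) c by (simp_all add: face_pow_iff[OF T])
  then have "x [^] m \<otimes> y [^] n \<in> T" unfolding eq[symmetric] by (rule TD(5))
  then have "x [^] m \<in> T" by (rule TD(3)[rotated 2]) (use 1(2) 2(2) in auto)
  then have x: "x \<in> T" using face_pow_iff[OF T 1(2) 2(1)] by blast
  \<comment> \<open>The extra factor t^(n-1) turns the left side into an n-th power, as saturation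
    requires.\<close>
  have "(p \<otimes> t) [^] n = q [^] n \<otimes> (x \<otimes> t [^] (n - 1))"
  proof -
   have "t [^] n = t \<otimes> t [^] (n - 1)" using 1(1) c by (cases n) (auto simp: m_comm)
   then show ?thesis using 1 p c by (simp add: pow_mult flip: m_assoc)
  qed
  then obtain r where r: "r \<in> carrier P" "p \<otimes> t = q \<otimes> r"
   using saturated[of "p \<otimes> t" q "x \<otimes> t [^] (n - 1)" n] 1 p c by auto
  have "q [^] n \<otimes> r [^] n = q [^] n \<otimes> (x \<otimes> t [^] (n - 1))"
   using r p \<open>(p \<otimes> t) [^] n = _\<close> by (simp add: pow_mult)
  then have "r [^] n = x \<otimes> t [^] (n - 1)"
   using integral[of "r [^] n" "x \<otimes> t [^] (n - 1)" "q [^] n"] r p c 1 by (simp add: m_comm)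
  moreover have "x \<otimes> t [^] (n - 1) \<in> T"
   using x 1 c TD(5,6) face_pow_iff[OF T c(1), of "n - 1"] by (cases "n - 1") auto
  ultimately have "r \<in> T" using face_pow_iff[OF T r(1) 1(1)] by simp
  then show False using ne r p 1 by (auto simp: T.quot_rel_iff)
 qed
 then show thesis using that by blast
qed

text \<open>A functional of minimal support among those separating \<open>p\<close> and \<open>q\<close> defines a face all of
 whose nonzero functionals separate \<open>p\<close> and \<open>q\<close>, with the same sign.\<close>

lemma ord_separates:
 assumes T: "mon_face T P" and p: "p \<in> carrier P" "q \<in> carrier P" and ne: "(p, q) \<notin> quot_rel P T"
 obtains T' where "mon_face T' P" "T \<subseteq> T'" "ord_along P T' p \<noteq> ord_along P T' q"
proof -
 define sep where "sep \<phi> \<longleftrightarrow> \<phi> \<in> duals P \<and> (\<forall>t\<in>T. \<phi> t = 0) \<and> \<phi> p \<noteq> \<phi> q" for \<phi>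
 define supp where "supp \<phi> = {g \<in> A. \<phi> g \<noteq> 0}" for \<phi> :: "'a \<Rightarrow> nat"
 have "\<exists>\<phi>. sep \<phi>" using dual_separates[OF T p ne] unfolding sep_def by metis
 then obtain \<phi> where \<phi>: "sep \<phi>" "\<And>\<psi>. sep \<psi> \<Longrightarrow> card (supp \<phi>) \<le> card (supp \<psi>)"
  using ex_has_least_nat[of sep _ "\<lambda>\<phi>. card (supp \<phi>)"] by metis
 have \<phi>c: "\<phi> \<in> duals P" using \<phi>(1) by (simp add: sep_def)
 define T' where "T' = {p \<in> carrier P. \<forall>\<psi>\<in>{\<phi>}. \<psi> p = 0}"
 have T': "mon_face T' P" unfolding T'_def by (rule zero_face) (use \<phi>c comm_monoid_axioms in auto)
 have TT': "T \<subseteq> T'" using \<phi>(1) mon_faceD(2)[OF T] by (auto simp: T'_def sep_def)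
 have key: "int (\<psi> p) < int (\<psi> q) \<longleftrightarrow> int (\<phi> p) < int (\<phi> q)" "int (\<psi> p) \<noteq> int (\<psi> q)"
  if \<psi>: "\<psi> \<in> duals P" "\<forall>t\<in>T'. \<psi> t = 0" "\<exists>r\<in>carrier P. \<psi> r \<noteq> 0" for \<psi>
 proof -
  have supp: "supp \<psi> \<subseteq> supp \<phi>" using \<psi>(2) gens by (auto simp: supp_def T'_def)
  have "supp \<psi> \<noteq> {}"
  proof
   assume "supp \<psi> = {}"
   then have e: "\<psi> g = 0" if "g \<in> A" for g using that by (auto simp: supp_def)
   have "\<psi> r = 0" if "r \<in> carrier P" for r by (rule gens_induct[OF that, where Q = "\<lambda>r. \<psi> r = 0"])
     (use \<psi>(1) e in \<open>auto simp: dual_carrier_iff\<close>)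
   then show False using \<psi>(3) by auto
  qed
  moreover have fin: "finite (supp \<psi>)" using finite_gens by (simp add: supp_def)
  \<comment> \<open>At a generator a of least ratio \<phi>/\<psi> the functional \<psi>(a)\<phi> -
    \<phi>(a)\<psi> is nonnegative and vanishes at a. Its support being smaller, it does not
    separate p and q, so their differences under \<phi> and \<psi> are proportional with positive
    factor.\<close>
  ultimately obtain a where a: "a \<in> supp \<psi>"
   "\<And>g. g \<in> supp \<psi> \<Longrightarrow> real (\<phi> a) / real (\<psi> a) \<le> real (\<phi> g) / real (\<psi> g)"
   using arg_min_if_finite(1)[of "supp \<psi>" "\<lambda>g. real (\<phi> g) / real (\<psi> g)"]
    arg_min_least[of "supp \<psi>" _ "\<lambda>g. real (\<phi> g) / real (\<psi> g)"] by metis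
  have a0: "\<psi> a > 0" "\<phi> a > 0" "a \<in> A" using a(1) supp by (auto simp: supp_def)
  define x where "x = (\<lambda>r\<in>carrier P. \<psi> a * \<phi> r)"
  define y where "y = (\<lambda>r\<in>carrier P. \<phi> a * \<psi> r)"
  have xy: "x \<in> duals P" "y \<in> duals P"
   using \<phi>c \<psi>(1) by (auto simp: x_def y_def dual_carrier_iff algebra_simps)
  have leA: "y g \<le> x g" if g: "g \<in> A" for g
  proof (cases "\<psi> g = 0")
   case False
   then have "real (\<phi> a) / real (\<psi> a) \<le> real (\<phi> g) / real (\<psi> g)" using a(2) g by (simp add: supp_def)
   then have "real (\<phi> a * \<psi> g) \<le> real (\<psi> a * \<phi> g)" using False a0 by (simp add: field_simps)
   then show ?thesis using g gens by (auto simp: x_def y_def simp del: of_nat_mult)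
  qed (use g gens in \<open>auto simp: y_def x_def\<close>)
  have le: "y r \<le> x r" if "r \<in> carrier P" for r
   by (rule gens_induct[OF that, where Q = "\<lambda>r. y r \<le> x r"])
    (use xy leA in \<open>auto simp: dual_carrier_iff intro: add_mono\<close>)
  define z where "z = (\<lambda>r\<in>carrier P. x r - y r)"
  have z: "z \<in> duals P" unfolding z_def by (rule dual_diff[OF xy le comm_monoid_axioms])
  have zsupp: "supp z \<subset> supp \<phi>"
  proof
   show "supp z \<subseteq> supp \<phi>"
   proof
    fix g assume "g \<in> supp z"
    then have g: "g \<in> A" "g \<in> carrier P" "z g \<noteq> 0" using gens by (auto simp: supp_def)
    then have "x g \<noteq> 0" by (simp add: z_def)
    then show "g \<in> supp \<phi>" using g by (simp add: x_def supp_def)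
   qed
   have "z a = 0" using a0 gens by (auto simp: z_def x_def y_def)
   then have "a \<notin> supp z" "a \<in> supp \<phi>" using a0 by (simp_all add: supp_def)
   then show "supp z \<noteq> supp \<phi>" by blast
  qed
  then have "card (supp z) < card (supp \<phi>)"
   using finite_gens by (intro psubset_card_mono) (auto simp: supp_def)
  then have "\<not> sep z" using \<phi>(2) by (meson not_le)
  moreover have "\<forall>t\<in>T. z t = 0" using \<phi>(1) TT' mon_faceD(2)[OF T] by (auto simp: z_def x_def sep_def)
  ultimately have "z p = z q" using z by (auto simp: sep_def)
  then have "x p - y p = x q - y q" using p by (simp add: z_def)
  then have "int (x p) - int (y p) = int (x q) - int (y q)" using le[OF p(1)] le[OF p(2)] by linarith
  then have eq: "int (\<psi> a) * (int (\<phi> q) - int (\<phi> p)) = int (\<phi> a) * (int (\<psi> q) - int (\<psi> p))"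
   using p by (simp add: x_def y_def algebra_simps)
  have "int (\<psi> q) - int (\<psi> p) > 0 \<longleftrightarrow> int (\<phi> a) * (int (\<psi> q) - int (\<psi> p)) > 0"
   using a0 by (simp add: zero_less_mult_iff)
  also have "\<dots> \<longleftrightarrow> int (\<phi> q) - int (\<phi> p) > 0"
   unfolding eq[symmetric] using a0 by (simp add: zero_less_mult_iff)
  finally show "int (\<psi> p) < int (\<psi> q) \<longleftrightarrow> int (\<phi> p) < int (\<phi> q)" by simp
  show "int (\<psi> p) \<noteq> int (\<psi> q)"
  proof
   assume "int (\<psi> p) = int (\<psi> q)"
   then have "int (\<psi> a) * (int (\<phi> q) - int (\<phi> p)) = 0" using eq by simp
   then show False using a0 \<phi>(1) by (simp add: sep_def)
  qed
 qed
 define adm where "adm \<psi> \<longleftrightarrow> \<psi> \<in> duals P \<and> (\<forall>t\<in>T'. \<psi> t = 0) \<and> (\<exists>r\<in>carrier P. \<psi> r \<noteq> 0)" for \<psi>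
 have ord: "ord_along P T' r = (LEAST n. \<exists>\<psi>. adm \<psi> \<and> \<psi> r = n)" for r
  unfolding ord_along_def adm_def by (rule arg_cong[where f = Least]) auto
 have "\<phi> p \<noteq> 0 \<or> \<phi> q \<noteq> 0" using \<phi>(1) by (auto simp: sep_def)
 then have adm\<phi>: "adm \<phi>" using \<phi>c p by (auto simp: adm_def T'_def)
 \<comment> \<open>The minimum that defines the order of s is attained, and the functional attaining
   it bounds the order of r.\<close>
 have lt: "ord_along P T' r < ord_along P T' s" if rs: "\<And>\<psi>. adm \<psi> \<Longrightarrow> \<psi> r < \<psi> s" for r s
 proof -
  have "\<exists>\<psi>. adm \<psi> \<and> \<psi> s = ord_along P T' s" unfolding ord by (rule LeastI_ex) (use adm\<phi> in blast)
  then obtain \<psi> where \<psi>: "adm \<psi>" "\<psi> s = ord_along P T' s" by blast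
  have "ord_along P T' r \<le> \<psi> r" unfolding ord by (rule Least_le) (use \<psi> in blast)
  with rs[OF \<psi>(1)] \<psi>(2) show ?thesis by simp
 qed
 have "ord_along P T' p \<noteq> ord_along P T' q"
 proof (cases "\<phi> p < \<phi> q")
  case True
  then have "\<psi> p < \<psi> q" if "adm \<psi>" for \<psi> using key(1)[of \<psi>] that by (simp add: adm_def)
  from lt[of p q, OF this] show ?thesis by simp
 next
  case False
  then have "\<psi> q < \<psi> p" if "adm \<psi>" for \<psi> using key[of \<psi>] that by (auto simp add: adm_def)
  from lt[of q p, OF this] show ?thesis by simp
 qed
 then show thesis using that T' TT' by blast
qed

end

section \<open>Faces and interior of the dual monoid\<close>

context fg_monoid
begin

lemma presented_bidual:
 assumes R: "presents P T \<kappa> R" and T: "mon_face T P" "mon_face T' P" "T \<subseteq> T'" and p: "p \<in> carrier P"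
  and z: "\<And>\<phi>. \<phi> \<in> duals R \<Longrightarrow> (\<forall>t\<in>T'. \<phi> (\<kappa> t) = 0) \<Longrightarrow> \<phi> (\<kappa> p) = 0"
 shows "p \<in> T'"
proof (rule face_bidual[OF T(2) p])
 fix \<phi> assume \<phi>: "\<phi> \<in> duals P" "\<forall>t\<in>T'. \<phi> t = 0"
 obtain \<psi> where \<psi>: "\<psi> \<in> duals R" "\<And>p. p \<in> carrier P \<Longrightarrow> \<psi> (\<kappa> p) = \<phi> p"
  by (rule presents_push[OF R comm_quot_face[OF T(1)] \<phi>(1)]) (use \<phi>(2) T(3) in auto)
 have "\<forall>t\<in>T'. \<psi> (\<kappa> t) = 0"
 proof
  fix t assume "t \<in> T'"
  then show "\<psi> (\<kappa> t) = 0" using \<psi>(2)[of t] \<phi>(2) mon_faceD(2)[OF T(2)] by auto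
 qed
 then show "\<phi> p = 0" using z[OF \<psi>(1)] \<psi>(2)[OF p] by simp
qed

lemma presents_kernel_zero:
 assumes R: "presents P T \<kappa> R" and T: "mon_face T P" and \<phi>: "\<phi> \<in> duals R" and t: "t \<in> T"
 shows "\<phi> (\<kappa> t) = 0" by (rule presents_pull(2)[OF R comm_quot_face[OF T] \<phi> t])

lemma annihilator_face:
 assumes R: "comm_monoid R" and X: "X \<subseteq> carrier R"
 shows "mon_face {\<phi> \<in> duals R. \<forall>x\<in>X. \<phi> x = 0} (dual R)"
proof -
 interpret D: comm_monoid "dual R" by (rule comm_monoid_dual[OF R])
 have "submonoid {\<phi> \<in> duals R. \<forall>x\<in>X. \<phi> x = 0} (dual R)"
 proof
  show "\<phi> \<otimes>\<^bsub>dual R\<^esub> \<psi> \<in> {\<phi> \<in> duals R. \<forall>x\<in>X. \<phi> x = 0}"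
   if "\<phi> \<in> {\<phi> \<in> duals R. \<forall>x\<in>X. \<phi> x = 0}" "\<psi> \<in> {\<phi> \<in> duals R. \<forall>x\<in>X. \<phi> x = 0}" for \<phi> \<psi>
   using that X D.m_closed[of \<phi> \<psi>] by (auto simp: dual_mult)
  show "\<one>\<^bsub>dual R\<^esub> \<in> {\<phi> \<in> duals R. \<forall>x\<in>X. \<phi> x = 0}" using X D.one_closed by (auto simp: dual_one)
 qed auto
 then show ?thesis unfolding mon_face_def using X by (auto simp: dual_mult)
qed

text \<open>An element of the face \<open>S\<close> of largest support dominates, after scaling, every functional
 vanishing on the common zero set of \<open>S\<close>.\<close>

lemma dual_face:
 assumes R: "presents P T \<kappa> R" and T: "mon_face T P" and S: "mon_face S (dual R)"
 defines "T' \<equiv> {p \<in> carrier P. \<forall>\<phi>\<in>S. \<phi> (\<kappa> p) = 0}"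
 shows "mon_face T' P" "T \<subseteq> T'" "S = {\<phi> \<in> duals R. \<forall>t\<in>T'. \<phi> (\<kappa> t) = 0}"
proof -
 note RD = presentsD[OF R] and SD = mon_faceD[OF S]
 interpret D: comm_monoid "dual R" by (rule comm_monoid_dual[OF RD(1)])
 have "T' = {p \<in> carrier P. \<forall>\<phi>\<in>dual_map P \<kappa> ` S. \<phi> p = 0}" by (auto simp: T'_def dual_map_def)
 moreover have "mon_face {p \<in> carrier P. \<forall>\<phi>\<in>dual_map P \<kappa> ` S. \<phi> p = 0} P"
  using presents_pull(1)[OF R comm_quot_face[OF T]] SD(2) by (intro zero_face comm_monoid_axioms) auto
 ultimately show T': "mon_face T' P" by simp
 show "T \<subseteq> T'" using presents_kernel_zero[OF R T] SD(2) mon_faceD(2)[OF T] by (auto simp: T'_def)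
 show "S = {\<phi> \<in> duals R. \<forall>t\<in>T'. \<phi> (\<kappa> t) = 0}"
 proof (intro equalityI subsetI)
  fix \<psi> assume "\<psi> \<in> {\<phi> \<in> duals R. \<forall>t\<in>T'. \<phi> (\<kappa> t) = 0}"
  then have \<psi>: "\<psi> \<in> duals R" "\<And>t. t \<in> T' \<Longrightarrow> \<psi> (\<kappa> t) = 0" by auto
  define Z where "Z \<phi> = {g \<in> A. \<phi> (\<kappa> g) = 0}" for \<phi> :: "'b \<Rightarrow> nat"
  obtain \<phi> where \<phi>: "\<phi> \<in> S" "\<And>\<phi>'. \<phi>' \<in> S \<Longrightarrow> card (Z \<phi>) \<le> card (Z \<phi>')"
   using ex_has_least_nat[of "\<lambda>\<phi>. \<phi> \<in> S" _ "\<lambda>\<phi>. card (Z \<phi>)"] SD(6) by metis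
  have \<phi>c: "\<phi> \<in> duals R" using \<phi>(1) SD(2) by blast
  have ZT: "g \<in> T'" if g: "g \<in> Z \<phi>" for g
  proof (rule ccontr)
   assume "g \<notin> T'"
   then obtain \<phi>' where \<phi>': "\<phi>' \<in> S" "\<phi>' (\<kappa> g) \<noteq> 0" using g gens by (auto simp: T'_def Z_def)
   have sum: "(\<phi> \<otimes>\<^bsub>dual R\<^esub> \<phi>') (\<kappa> h) = \<phi> (\<kappa> h) + \<phi>' (\<kappa> h)" if "h \<in> A" for h
    using that gens RD(4) by (auto simp: dual_mult)
   have "Z (\<phi> \<otimes>\<^bsub>dual R\<^esub> \<phi>') \<subset> Z \<phi>"
   proof
    show "Z (\<phi> \<otimes>\<^bsub>dual R\<^esub> \<phi>') \<subseteq> Z \<phi>" using sum by (auto simp: Z_def)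
    have "g \<notin> Z (\<phi> \<otimes>\<^bsub>dual R\<^esub> \<phi>')" using sum[of g] \<phi>' g by (auto simp: Z_def)
    then show "Z (\<phi> \<otimes>\<^bsub>dual R\<^esub> \<phi>') \<noteq> Z \<phi>" using g by blast
   qed
   then have "card (Z (\<phi> \<otimes>\<^bsub>dual R\<^esub> \<phi>')) < card (Z \<phi>)"
    using finite_gens by (intro psubset_card_mono) (auto simp: Z_def)
   moreover have "\<phi> \<otimes>\<^bsub>dual R\<^esub> \<phi>' \<in> S" by (rule SD(5)[OF \<phi>(1) \<phi>'(1)])
   ultimately show False using \<phi>(2) by (meson not_le)
  qed
  \<comment> \<open>Where \<phi> is nonzero on a generator it is at least 1, so n times \<phi> is at
    least the value of \<psi> there.\<close>
  define n where "n = (\<Sum>g\<in>A. \<psi> (\<kappa> g))"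
  define \<theta> where "\<theta> = \<phi> [^]\<^bsub>dual R\<^esub> n"
  have \<theta>: "\<theta> \<in> duals R" "\<And>r. r \<in> carrier R \<Longrightarrow> \<theta> r = n * \<phi> r"
   using \<phi>c dual_pow[OF RD(1) \<phi>c] by (auto simp: \<theta>_def)
  have "\<theta> \<in> S" unfolding \<theta>_def
  proof (induction n)
   case (Suc k)
   then show ?case using SD(5) \<phi>(1) by simp
  qed (simp add: SD(6))
  have le: "\<psi> r \<le> \<theta> r" if "r \<in> carrier R" for r
  proof (rule dual_le[OF R \<psi>(1) \<theta>(1) _ that])
   fix g assume g: "g \<in> A"
   show "\<psi> (\<kappa> g) \<le> \<theta> (\<kappa> g)"
   proof (cases "\<phi> (\<kappa> g) = 0")
    case True
    then show ?thesis using ZT[of g] \<psi>(2)[of g] g by (simp add: Z_def)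
   next
    case False
    have "\<psi> (\<kappa> g) \<le> n" unfolding n_def using g finite_gens by (intro member_le_sum) auto
    also have "n \<le> \<theta> (\<kappa> g)" using False \<theta>(2)[OF RD(4)] g gens by auto
    finally show ?thesis .
   qed
  qed
  define d where "d = (\<lambda>r\<in>carrier R. \<theta> r - \<psi> r)"
  have d: "d \<in> duals R" unfolding d_def by (rule dual_diff[OF \<theta>(1) \<psi>(1) le RD(1)])
  have "d \<otimes>\<^bsub>dual R\<^esub> \<psi> = \<theta>"
   by (rule dual_ext[OF D.m_closed[OF d \<psi>(1)] \<theta>(1)]) (simp add: dual_mult d_def le)
  then show "\<psi> \<in> S" using SD(4)[OF d \<psi>(1)] \<open>\<theta> \<in> S\<close> by simp
 qed (use SD(2) in \<open>auto simp: T'_def\<close>)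
qed

text \<open>By \<open>dual_face\<close> every face of the dual is an annihilator, so a functional
  lies on no proper face precisely if it kills nothing but T.\<close>

lemma dual_interior_iff:
 assumes R: "presents P T \<kappa> R" and T: "mon_face T P" and \<phi>: "\<phi> \<in> duals R"
 shows "\<phi> \<in> mon_interior (dual R) \<longleftrightarrow> (\<forall>p\<in>carrier P. \<phi> (\<kappa> p) = 0 \<longrightarrow> p \<in> T)"
proof
 note RD = presentsD[OF R]
 assume int: "\<phi> \<in> mon_interior (dual R)"
 show "\<forall>p\<in>carrier P. \<phi> (\<kappa> p) = 0 \<longrightarrow> p \<in> T"
 proof (intro ballI impI)
  fix p assume p: "p \<in> carrier P" "\<phi> (\<kappa> p) = 0"
  let ?S = "{\<psi> \<in> duals R. \<forall>x\<in>{\<kappa> p}. \<psi> x = 0}"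
  have "mon_face ?S (dual R)" using RD(4)[OF p(1)] by (intro annihilator_face RD(1)) simp
  moreover have "\<phi> \<in> ?S" using \<phi> p by simp
  ultimately have "?S = duals R" using int by (auto simp: mon_interior_def)
  then show "p \<in> T" by (intro presented_bidual[OF R T T subset_refl p(1)]) auto
 qed
next
 assume *: "\<forall>p\<in>carrier P. \<phi> (\<kappa> p) = 0 \<longrightarrow> p \<in> T"
 have "S = duals R" if S: "mon_face S (dual R)" "\<phi> \<in> S" for S
 proof -
  have "{p \<in> carrier P. \<forall>\<phi>\<in>S. \<phi> (\<kappa> p) = 0} \<subseteq> T" using * S(2) by auto
  then have "duals R \<subseteq> {\<phi> \<in> duals R. \<forall>t\<in>{p \<in> carrier P. \<forall>\<phi>\<in>S. \<phi> (\<kappa> p) = 0}. \<phi> (\<kappa> t) = 0}"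
   using presents_kernel_zero[OF R T] by blast
  then show ?thesis using dual_face(3)[OF R T S(1)] by blast
 qed
 then show "\<phi> \<in> mon_interior (dual R)" using \<phi> by (auto simp: mon_interior_def)
qed

end

subsection \<open>Ranks\<close>

text \<open>Elimination without fractions: with a pivot j, the vectors \<open>?w b\<close> vanish in
  the coordinate a, and the coefficient of j completes a relation among them to one among the
  v.\<close>

lemma int_dependent:
 fixes v :: "'b \<Rightarrow> 'a \<Rightarrow> int"
 assumes "finite A" "finite B" "card A < card B"
 shows "\<exists>c. (\<exists>b\<in>B. c b \<noteq> 0) \<and> (\<forall>a\<in>A. (\<Sum>b\<in>B. c b * v b a) = 0)" using assms
proof (induction A arbitrary: B v)
 case empty
 then show ?case by (intro exI[of _ "\<lambda>_. 1"]) (auto simp: card_gt_0_iff)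
next
 case (insert a A)
 show ?case
 proof (cases "\<forall>b\<in>B. v b a = 0")
  case True
  obtain c where "\<exists>b\<in>B. c b \<noteq> 0" "\<forall>x\<in>A. (\<Sum>b\<in>B. c b * v b x) = 0"
   using insert.IH[of B v] insert.prems insert.hyps by auto
  then show ?thesis using True by (intro exI[of _ c]) auto
 next
  case False
  then obtain j where j: "j \<in> B" "v j a \<noteq> 0" by blast
  let ?B = "B - {j}" and ?w = "\<lambda>b x. v j a * v b x - v b a * v j x"
  have "card A < card ?B" "finite ?B" using insert.prems insert.hyps j by auto
  then obtain c where c: "\<exists>b\<in>?B. c b \<noteq> 0" "\<forall>x\<in>A. (\<Sum>b\<in>?B. c b * ?w b x) = 0"
   using insert.IH[of ?B ?w] by blast
  define d where "d b = (if b = j then - (\<Sum>b\<in>?B. c b * v b a) else v j a * c b)" for b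
  have "(\<Sum>b\<in>B. d b * v b x) = (\<Sum>b\<in>?B. c b * ?w b x)" for x
  proof -
   have "(\<Sum>b\<in>B. d b * v b x) = d j * v j x + (\<Sum>b\<in>?B. d b * v b x)"
    using j insert.prems by (simp add: sum.remove)
   also have "(\<Sum>b\<in>?B. d b * v b x) = (\<Sum>b\<in>?B. v j a * c b * v b x)"
    by (intro sum.cong) (auto simp: d_def)
   finally have "(\<Sum>b\<in>B. d b * v b x) = - (\<Sum>b\<in>?B. c b * v b a) * v j x + (\<Sum>b\<in>?B. v j a * c b * v b x)"
    by (simp add: d_def)
   also have "\<dots> = (\<Sum>b\<in>?B. c b * ?w b x)"
    by (simp add: sum_distrib_left sum_distrib_right algebra_simps sum_subtractf)
   finally show ?thesis .
  qed
  moreover have "?w b a = 0" for b by simp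
  ultimately have "\<forall>x\<in>insert a A. (\<Sum>b\<in>B. d b * v b x) = 0" using c(2) by simp
  moreover have "\<exists>b\<in>B. d b \<noteq> 0" using c(1) j by (auto simp: d_def)
  ultimately show ?thesis by blast
 qed
qed

lemma hom_finprod:
 assumes "comm_group G" "comm_group H" "h \<in> hom G H" "f \<in> B \<rightarrow> carrier G" "finite B"
 shows "h (finprod G f B) = finprod H (\<lambda>b. h (f b)) B"
proof -
 interpret G: comm_group G by fact
 interpret H: comm_group H by fact
 interpret h: group_hom G H h using assms(3) by unfold_locales
 show ?thesis using assms(5,4)
 proof induction
  case (insert b B)
  then have "(\<lambda>b. h (f b)) \<in> B \<rightarrow> carrier H" "f b \<in> carrier G" "h (f b) \<in> carrier H" "f \<in> B \<rightarrow> carrier G"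
   by (auto simp: Pi_iff)
  then show ?case using insert by simp
 qed simp
qed

lemma (in comm_group) finprod_pow_add:
 assumes "\<And>g. g \<in> A \<Longrightarrow> \<gamma> g \<in> carrier G"
 shows "finprod G (\<lambda>g. \<gamma> g [^] (u g + v g :: int)) A =
  finprod G (\<lambda>g. \<gamma> g [^] u g) A \<otimes> finprod G (\<lambda>g. \<gamma> g [^] v g) A"
proof -
 have "finprod G (\<lambda>g. \<gamma> g [^] (u g + v g)) A = finprod G (\<lambda>g. \<gamma> g [^] u g \<otimes> \<gamma> g [^] v g) A"
  using assms by (intro finprod_cong') (auto simp: int_pow_mult)
 also have "\<dots> = finprod G (\<lambda>g. \<gamma> g [^] u g) A \<otimes> finprod G (\<lambda>g. \<gamma> g [^] v g) A"
  using assms by (intro finprod_multf) auto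
 finally show ?thesis .
qed

lemma int_independent_card_le:
 assumes G: "comm_group G" and A: "finite A" "\<gamma> \<in> A \<rightarrow> carrier G"
  and gen: "\<And>x. x \<in> carrier G \<Longrightarrow> \<exists>v::'a \<Rightarrow> int. x = finprod G (\<lambda>g. \<gamma> g [^]\<^bsub>G\<^esub> v g) A"
  and B: "int_independent G B"
 shows "card B \<le> card A"
proof (rule ccontr)
 interpret G: comm_group G by fact
 assume "\<not> card B \<le> card A"
 have B': "finite B" "B \<subseteq> carrier G" using B by (auto simp: int_independent_def)
 define \<Phi> where "\<Phi> v = finprod G (\<lambda>g. \<gamma> g [^]\<^bsub>G\<^esub> (v g :: int)) A" for v
 have \<gamma>: "\<gamma> g \<in> carrier G" if "g \<in> A" for g using A that by auto
 have \<Phi>c: "\<Phi> v \<in> carrier G" for v unfolding \<Phi>_def using \<gamma> by (intro G.finprod_closed) auto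
 have \<Phi>0: "\<Phi> (\<lambda>_. 0) = \<one>\<^bsub>G\<^esub>" unfolding \<Phi>_def by (intro G.finprod_one_eqI) simp
 have \<Phi>add: "\<Phi> (\<lambda>g. u g + v g) = \<Phi> u \<otimes>\<^bsub>G\<^esub> \<Phi> v" for u v
  unfolding \<Phi>_def using \<gamma> by (rule G.finprod_pow_add)
 have \<Phi>cong: "\<Phi> u = \<Phi> v" if "\<And>g. g \<in> A \<Longrightarrow> u g = v g" for u v
  unfolding \<Phi>_def using \<gamma> that by (intro G.finprod_cong') auto
 have \<Phi>mult: "\<Phi> (\<lambda>g. k * v g) = \<Phi> v [^]\<^bsub>G\<^esub> k" for k v
 proof -
  have "(\<lambda>x. x [^]\<^bsub>G\<^esub> k) \<in> hom G G" by (auto simp: hom_def G.int_pow_distrib)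
  from hom_finprod[OF G G this _ A(1), of "\<lambda>g. \<gamma> g [^]\<^bsub>G\<^esub> v g"] show ?thesis
   unfolding \<Phi>_def using \<gamma> by (auto intro!: G.finprod_cong' simp: G.int_pow_pow mult.commute)
 qed
 have "\<forall>b\<in>B. \<exists>v. b = \<Phi> v" using gen B' unfolding \<Phi>_def by blast
 then obtain v where v: "\<And>b. b \<in> B \<Longrightarrow> b = \<Phi> (v b)" by metis
 obtain c where c: "\<exists>b\<in>B. c b \<noteq> 0" "\<forall>a\<in>A. (\<Sum>b\<in>B. c b * v b a) = 0"
  using int_dependent[OF A(1) B'(1), of v] \<open>\<not> card B \<le> card A\<close> by auto
 have "finprod G (\<lambda>b. b [^]\<^bsub>G\<^esub> c b) B' = \<Phi> (\<lambda>g. \<Sum>b\<in>B'. c b * v b g)" if "finite B'" "B' \<subseteq> B" for B'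
  using that
 proof induction
  case (insert b B')
  then have "(\<lambda>b. b [^]\<^bsub>G\<^esub> c b) \<in> B' \<rightarrow> carrier G" "b \<in> carrier G" using B' by auto
  then have "finprod G (\<lambda>b. b [^]\<^bsub>G\<^esub> c b) (insert b B') = b [^]\<^bsub>G\<^esub> c b \<otimes>\<^bsub>G\<^esub> \<Phi> (\<lambda>g. \<Sum>b\<in>B'. c b * v b g)"
   using insert by simp
  also have "b [^]\<^bsub>G\<^esub> c b = \<Phi> (\<lambda>g. c b * v b g)" using v[of b] insert.prems by (simp add: \<Phi>mult)
  finally show ?case using insert.hyps by (simp add: \<Phi>add[symmetric])
 qed (simp add: \<Phi>0)
 from this[OF B'(1) subset_refl] have "finprod G (\<lambda>b. b [^]\<^bsub>G\<^esub> c b) B = \<Phi> (\<lambda>g. \<Sum>b\<in>B. c b * v b g)" .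
 also have "\<dots> = \<Phi> (\<lambda>_. 0)" using c(2) by (intro \<Phi>cong) auto
 finally have "finprod G (\<lambda>b. b [^]\<^bsub>G\<^esub> c b) B = \<one>\<^bsub>G\<^esub>" by (simp add: \<Phi>0)
 then show False using B c(1) unfolding int_independent_def by blast
qed

text \<open>A relation among lifts maps to a relation in H. An element of infinite order in the
  kernel can be added to the lifts, which is what makes an inequality of ranks strict.\<close>

lemma int_independent_lift:
 assumes G: "comm_group G" and H: "comm_group H" and h: "h \<in> hom G H" and s: "\<And>y. y \<in> carrier H \<Longrightarrow> s y \<in> carrier G \<and> h (s y) = y"
  and B: "int_independent H B"
 shows "int_independent G (s ` B)" "inj_on s B"
  "u \<in> carrier G \<Longrightarrow> h u = \<one>\<^bsub>H\<^esub> \<Longrightarrow> (\<And>n. n > 0 \<Longrightarrow> u [^]\<^bsub>G\<^esub> (n::nat) \<noteq> \<one>\<^bsub>G\<^esub>) \<Longrightarrow>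
   int_independent G (insert u (s ` B)) \<and> u \<notin> s ` B"
proof -
 interpret G: comm_group G by fact
 interpret H: comm_group H by fact
 have B': "finite B" "B \<subseteq> carrier H" using B by (auto simp: int_independent_def)
 show inj: "inj_on s B" using s B' by (metis inj_onI subsetD)
 have sc: "s b \<in> carrier G" if "b \<in> B" for b using s B' that by blast
 have pr: "h (finprod G (\<lambda>a. a [^]\<^bsub>G\<^esub> (c a :: int)) (s ` B)) = finprod H (\<lambda>b. b [^]\<^bsub>H\<^esub> c (s b)) B" for c
 proof -
  have "finprod G (\<lambda>a. a [^]\<^bsub>G\<^esub> c a) (s ` B) = finprod G (\<lambda>b. s b [^]\<^bsub>G\<^esub> c (s b)) B"
   using sc by (intro G.finprod_reindex inj) auto
  also have "h \<dots> = finprod H (\<lambda>b. h (s b [^]\<^bsub>G\<^esub> c (s b))) B"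
   using sc by (intro hom_finprod[OF G H h _ B'(1)]) auto
  also have "\<dots> = finprod H (\<lambda>b. b [^]\<^bsub>H\<^esub> c (s b)) B"
   using s B' sc hom_int_pow[OF h _ G.is_group H.is_group] by (intro H.finprod_cong') auto
  finally show ?thesis .
 qed
 have zero: "\<forall>b\<in>B. c (s b) = 0" if "h (finprod G (\<lambda>a. a [^]\<^bsub>G\<^esub> (c a :: int)) (s ` B)) = \<one>\<^bsub>H\<^esub>" for c
 proof -
  have "\<forall>c::_ \<Rightarrow> int. finprod H (\<lambda>b. b [^]\<^bsub>H\<^esub> c b) B = \<one>\<^bsub>H\<^esub> \<longrightarrow> (\<forall>b\<in>B. c b = 0)"
   using B by (simp add: int_independent_def)
  from this[rule_format, of "\<lambda>b. c (s b)"] that show ?thesis unfolding pr by blast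
 qed
 have h1: "h \<one>\<^bsub>G\<^esub> = \<one>\<^bsub>H\<^esub>" by (rule hom_one[OF h G.is_group H.is_group])
 show "int_independent G (s ` B)" unfolding int_independent_def using B' sc zero h1 by auto
 assume u: "u \<in> carrier G" "h u = \<one>\<^bsub>H\<^esub>" "\<And>n. n > 0 \<Longrightarrow> u [^]\<^bsub>G\<^esub> (n::nat) \<noteq> \<one>\<^bsub>G\<^esub>"
 have nin: "u \<notin> s ` B"
 proof
  assume "u \<in> s ` B"
  then obtain b where b: "b \<in> B" "u = s b" by blast
  then have b1: "b = \<one>\<^bsub>H\<^esub>" using u(2) s B' by force
  \<comment> \<open>If u were the lift of some b in B, then b would be the unit, and a set
    containing the unit is dependent.\<close>
  have f1: "finprod H (\<lambda>a. a [^]\<^bsub>H\<^esub> (if a = \<one>\<^bsub>H\<^esub> then 1 else 0 :: int)) B = \<one>\<^bsub>H\<^esub>"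
   by (intro H.finprod_one_eqI) auto
  have "\<forall>c::_ \<Rightarrow> int. finprod H (\<lambda>a. a [^]\<^bsub>H\<^esub> c a) B = \<one>\<^bsub>H\<^esub> \<longrightarrow> (\<forall>a\<in>B. c a = 0)"
   using B by (simp add: int_independent_def)
  from this[rule_format, of "\<lambda>a. if a = \<one>\<^bsub>H\<^esub> then 1 else 0" b]
  show False using b(1) b1 f1 by simp
 qed
 have "\<forall>a\<in>insert u (s ` B). c a = 0"
  if c: "finprod G (\<lambda>a. a [^]\<^bsub>G\<^esub> (c a :: int)) (insert u (s ` B)) = \<one>\<^bsub>G\<^esub>" for c
 proof -
  let ?p = "finprod G (\<lambda>a. a [^]\<^bsub>G\<^esub> c a) (s ` B)"
  have pc: "?p \<in> carrier G" using sc by (intro G.finprod_closed) auto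
  have "finprod G (\<lambda>a. a [^]\<^bsub>G\<^esub> c a) (insert u (s ` B)) = u [^]\<^bsub>G\<^esub> c u \<otimes>\<^bsub>G\<^esub> ?p"
   using nin u(1) sc B'(1) by (intro G.finprod_insert) auto
  with c have eq: "u [^]\<^bsub>G\<^esub> c u \<otimes>\<^bsub>G\<^esub> ?p = \<one>\<^bsub>G\<^esub>" by simp
  have "h (u [^]\<^bsub>G\<^esub> c u) = \<one>\<^bsub>H\<^esub>"
   using hom_int_pow[OF h u(1) G.is_group H.is_group] u(2) by (simp add: H.int_pow_one)
  moreover have "h (u [^]\<^bsub>G\<^esub> c u) \<otimes>\<^bsub>H\<^esub> h ?p = \<one>\<^bsub>H\<^esub>"
   using eq h pc u(1) h1 by (auto simp: hom_def simp flip: eq)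
  moreover have "h ?p \<in> carrier H" using h pc by (auto simp: hom_def)
  ultimately have "h ?p = \<one>\<^bsub>H\<^esub>" by simp
  then have z: "\<forall>b\<in>B. c (s b) = 0" by (rule zero)
  then have "?p = \<one>\<^bsub>G\<^esub>" by (intro G.finprod_one_eqI) auto
  then have u1: "u [^]\<^bsub>G\<^esub> c u = \<one>\<^bsub>G\<^esub>" using eq u(1) by simp
  have "c u = 0"
  proof (rule ccontr)
   assume "c u \<noteq> 0"
   have "u [^]\<^bsub>G\<^esub> \<bar>c u\<bar> = \<one>\<^bsub>G\<^esub>" using u1 u(1) by (cases "c u \<ge> 0") (auto simp: G.int_pow_neg abs_if)
   then have "u [^]\<^bsub>G\<^esub> nat \<bar>c u\<bar> = \<one>\<^bsub>G\<^esub>" by (simp add: int_pow_int[symmetric])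
   then show False using u(3)[of "nat \<bar>c u\<bar>"] \<open>c u \<noteq> 0\<close> by simp
  qed
  with z show ?thesis by auto
 qed
 then show "int_independent G (insert u (s ` B)) \<and> u \<notin> s ` B"
  unfolding int_independent_def using B' sc u(1) nin by auto
qed

lemma group_rank_mono:
 assumes G: "comm_group G" and H: "comm_group H" and h: "h \<in> hom G H" "h ` carrier G = carrier H"
  and bound: "\<And>B. int_independent G B \<Longrightarrow> card B \<le> n"
 shows "group_rank H \<le> group_rank G"
  and "u \<in> carrier G \<Longrightarrow> h u = \<one>\<^bsub>H\<^esub> \<Longrightarrow> (\<And>n. n > 0 \<Longrightarrow> u [^]\<^bsub>G\<^esub> (n::nat) \<noteq> \<one>\<^bsub>G\<^esub>) \<Longrightarrow>
   group_rank H < group_rank G"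
proof -
 have "\<forall>y\<in>carrier H. \<exists>x. x \<in> carrier G \<and> h x = y" unfolding h(2)[symmetric] by blast
 then obtain s where s: "\<And>y. y \<in> carrier H \<Longrightarrow> s y \<in> carrier G \<and> h (s y) = y" by metis
 note lift = int_independent_lift[OF G H h(1) s]
 interpret G: comm_group G by fact
 interpret H: comm_group H by fact
 have ind0: "int_independent H {}" by (simp add: int_independent_def)
 have le: "card B \<le> group_rank G" if "int_independent G B" for B unfolding group_rank_def
  by (rule cSup_upper) (use that bound in \<open>auto intro!: bdd_aboveI[of _ n]\<close>)
 show "group_rank H \<le> group_rank G" unfolding group_rank_def[of H]
 proof (rule cSup_least)
  fix k assume "k \<in> {card B |B. int_independent H B}"
  then obtain B where B: "k = card B" "int_independent H B" by blast
  then show "k \<le> group_rank G" using le[OF lift(1)[OF _ B(2)]] lift(2)[OF _ B(2)] by (simp add: card_image)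
 qed (use ind0 in blast)
 assume u: "u \<in> carrier G" "h u = \<one>\<^bsub>H\<^esub>" "\<And>n. n > 0 \<Longrightarrow> u [^]\<^bsub>G\<^esub> (n::nat) \<noteq> \<one>\<^bsub>G\<^esub>"
 have Suc: "Suc (card B) \<le> group_rank G" if B: "int_independent H B" for B
 proof -
  have ins: "int_independent G (insert u (s ` B))" "u \<notin> s ` B" using lift(3)[OF _ B u] by auto
  then have "finite (s ` B)" by (simp add: int_independent_def)
  then show ?thesis using le[OF ins(1)] ins(2) lift(2)[OF _ B] by (simp add: card_image)
 qed
 have "group_rank H \<le> group_rank G - 1" unfolding group_rank_def[of H]
 proof (rule cSup_least)
  fix k assume "k \<in> {card B |B. int_independent H B}"
  then show "k \<le> group_rank G - 1" using Suc by fastforce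
 qed (use ind0 in blast)
 moreover have "group_rank G > 0" using Suc[OF ind0] by simp
 ultimately show "group_rank H < group_rank G" by simp
qed

context fg_monoid
begin

text \<open>The rank is a \<open>Sup\<close> of natural numbers, which is meaningful only for
  bounded sets.\<close>

lemma gp_rank_bound:
 assumes R: "presents P T \<kappa> R" and B: "int_independent (gp R) B"
 shows "card B \<le> card A"
proof -
 note RD = presentsD[OF R]
 interpret G: gp_completion R unfolding gp_completion_def by (rule RD(1))
 interpret GG: comm_group "gp R" by (rule G.comm_group_gp)
 define \<gamma> where "\<gamma> g = G.cls (\<kappa> g) \<one>\<^bsub>R\<^esub>" for g
 have \<gamma>c: "\<gamma> p \<in> carrier (gp R)" if "p \<in> carrier P" for p unfolding \<gamma>_def using RD(4)[OF that] by simp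
 have \<gamma>A: "\<gamma> g \<in> carrier (gp R)" if "g \<in> A" for g using \<gamma>c gens that by auto
 define \<Phi> where "\<Phi> v = finprod (gp R) (\<lambda>g. \<gamma> g [^]\<^bsub>gp R\<^esub> (v g :: int)) A" for v
 have \<Phi>0: "\<Phi> (\<lambda>_. 0) = \<one>\<^bsub>gp R\<^esub>" unfolding \<Phi>_def by (intro GG.finprod_one_eqI) simp
 have \<Phi>c: "\<Phi> v \<in> carrier (gp R)" for v unfolding \<Phi>_def using \<gamma>A by (intro GG.finprod_closed) auto
 have \<Phi>add: "\<Phi> (\<lambda>g. u g + v g) = \<Phi> u \<otimes>\<^bsub>gp R\<^esub> \<Phi> v" for u v
  unfolding \<Phi>_def using \<gamma>A by (rule GG.finprod_pow_add)
 have pos: "\<exists>v. \<gamma> p = \<Phi> v" if "p \<in> carrier P" for p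
 proof (rule gens_induct[OF that, where Q = "\<lambda>p. \<exists>v. \<gamma> p = \<Phi> v"])
  show "\<exists>v. \<gamma> \<one> = \<Phi> v" using \<Phi>0 RD(2) G.one_gp unfolding \<gamma>_def by metis
  show "\<exists>v. \<gamma> a = \<Phi> v" if a: "a \<in> A" for a
  proof -
   have "\<Phi> (\<lambda>g. if g = a then 1 else 0) = finprod (gp R) (\<lambda>g. if a = g then \<gamma> g else \<one>\<^bsub>gp R\<^esub>) A"
    unfolding \<Phi>_def using \<gamma>A by (intro GG.finprod_cong') auto
   also have "\<dots> = \<gamma> a" using GG.finprod_singleton[OF a finite_gens, of \<gamma>] \<gamma>A by auto
   finally show ?thesis by metis
  qed
  show "\<exists>v. \<gamma> (p \<otimes> q) = \<Phi> v"
   if pq: "p \<in> carrier P" "q \<in> carrier P" "\<exists>v. \<gamma> p = \<Phi> v" "\<exists>v. \<gamma> q = \<Phi> v" for p q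
  proof -
   have "\<gamma> (p \<otimes> q) = \<gamma> p \<otimes>\<^bsub>gp R\<^esub> \<gamma> q" unfolding \<gamma>_def using RD(4,5) pq(1,2) by (simp add: G.cls_mult)
   then show ?thesis using pq(3,4) \<Phi>add by metis
  qed
 qed
 show ?thesis
 proof (rule int_independent_card_le[OF G.comm_group_gp finite_gens _ _ B])
  show "\<gamma> \<in> A \<rightarrow> carrier (gp R)" using \<gamma>A by auto
  fix x assume "x \<in> carrier (gp R)"
  then obtain a b where ab: "x = G.cls a b" "a \<in> carrier R" "b \<in> carrier R" unfolding G.carrier_gp by blast
  obtain p q where pq: "p \<in> carrier P" "q \<in> carrier P" "a = \<kappa> p" "b = \<kappa> q" using ab RD(3) by auto
  obtain u v where uv: "\<gamma> p = \<Phi> u" "\<gamma> q = \<Phi> v" using pos[OF pq(1)] pos[OF pq(2)] by (elim exE) (rule that)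
  have "\<Phi> (\<lambda>g. u g + - v g) \<otimes>\<^bsub>gp R\<^esub> \<gamma> q = \<gamma> p" unfolding uv \<Phi>add[symmetric] by simp
  moreover have "x \<otimes>\<^bsub>gp R\<^esub> \<gamma> q = \<gamma> p" unfolding \<gamma>_def ab(1) pq(3,4) using RD(4) pq(1,2)
   by (auto simp: G.cls_mult G.cls_eq_iff G.m_comm intro!: bexI[of _ "\<one>\<^bsub>R\<^esub>"])
  ultimately have "x = \<Phi> (\<lambda>g. u g + - v g)"
   using GG.right_cancel[of "\<gamma> q" x "\<Phi> (\<lambda>g. u g + - v g)"] \<open>x \<in> carrier (gp R)\<close> \<gamma>c pq \<Phi>c by metis
  then show "\<exists>v::'a \<Rightarrow> int. x = finprod (gp R) (\<lambda>g. \<gamma> g [^]\<^bsub>gp R\<^esub> v g) A" unfolding \<Phi>_def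
   by (rule exI[of _ "\<lambda>g. u g + - v g"])
 qed
qed

text \<open>P/T maps onto P/T'. An element p of T' outside T gives a kernel element of infinite
  order in the group completion: if a power of it were trivial, a power of p and hence p itself
  would lie in T.\<close>

lemma mon_dim_mono:
 assumes R: "presents P T \<kappa> R" and R': "presents P T' \<kappa>' R'" and T: "mon_face T P" "mon_face T' P" "T \<subseteq> T'"
 shows "mon_dim R' \<le> mon_dim R" and "T \<noteq> T' \<Longrightarrow> mon_dim R' < mon_dim R"
proof -
 note RD = presentsD[OF R] and RD' = presentsD[OF R']
 interpret G: gp_completion R unfolding gp_completion_def by (rule RD(1))
 interpret G': gp_completion R' unfolding gp_completion_def by (rule RD'(1))
 interpret T: comm_quot P T by (rule comm_quot_face[OF T(1)])
 interpret T': comm_quot P T' by (rule comm_quot_face[OF T(2)])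
 have eq: "\<kappa>' p = \<kappa>' q" if "(p, q) \<in> quot_rel P T" for p q
  using that T(3) RD'(6) unfolding T.quot_rel_iff T'.quot_rel_iff by blast
 have "\<kappa>' \<in> hom P R'" "\<kappa>' \<one> = \<one>\<^bsub>R'\<^esub>" using R' by (auto simp: presents_def)
 then obtain g where g: "g \<in> mon_hom R R'" "\<forall>p\<in>carrier P. g (\<kappa> p) = \<kappa>' p"
  by (rule presents_factor[OF R comm_monoid_axioms _ _ eq])
 have gh: "g \<one>\<^bsub>R\<^esub> = \<one>\<^bsub>R'\<^esub>" "\<And>x. x \<in> carrier R \<Longrightarrow> g x \<in> carrier R'"
  "\<And>x y. x \<in> carrier R \<Longrightarrow> y \<in> carrier R \<Longrightarrow> g (x \<otimes>\<^bsub>R\<^esub> y) = g x \<otimes>\<^bsub>R'\<^esub> g y"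
  using g(1) by (auto simp: mon_hom_def hom_def)
 define h0 where "h0 x = (case x of (a, b) \<Rightarrow> G'.cls (g a) (g b))" for x
 \<comment> \<open>Read as a quotient by the diagonal, the group completion is presented as well, so
   \<open>presents_factor\<close> induces h on it.\<close>
 have pres: "presents (R \<times>\<times> R) ((\<lambda>q. (q, q)) ` carrier R) (\<lambda>x. case x of (a, b) \<Rightarrow> G.cls a b) (gp R)"
 proof -
  have "presents (R \<times>\<times> R) ((\<lambda>q. (q, q)) ` carrier R)
    (quot_class (R \<times>\<times> R) ((\<lambda>q. (q, q)) ` carrier R)) (gp R)" unfolding gp_eq_quot[OF RD(1)]
   by (rule presents_quot[where k = "\<lambda>x. x"])
    (use G.diag.comm_quot_axioms G.diag.comm_monoid_axioms G.diag.quot_rel_refl in \<open>auto simp: hom_def\<close>)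
  then show ?thesis by (simp add: G.cls_quot fun_eq_iff case_prod_unfold)
 qed
 have h0: "h0 \<in> hom (R \<times>\<times> R) (gp R')" using gh by (auto simp: hom_def DirProd_def h0_def G'.cls_mult)
 have h01: "h0 \<one>\<^bsub>R \<times>\<times> R\<^esub> = \<one>\<^bsub>gp R'\<^esub>" by (simp add: DirProd_def h0_def gh G'.one_gp)
 have h0eq: "h0 x = h0 y" if "(x, y) \<in> quot_rel (R \<times>\<times> R) ((\<lambda>q. (q, q)) ` carrier R)" for x y
 proof -
  obtain a b c d where xy: "x = (a, b)" "y = (c, d)" by (cases x, cases y) auto
  have "((a, b), (c, d)) \<in> gp_rel R" using that unfolding xy gp_rel_diag[OF RD(1)] .
  then obtain k where k: "a \<in> carrier R" "b \<in> carrier R" "c \<in> carrier R" "d \<in> carrier R" "k \<in> carrier R"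
   "a \<otimes>\<^bsub>R\<^esub> d \<otimes>\<^bsub>R\<^esub> k = c \<otimes>\<^bsub>R\<^esub> b \<otimes>\<^bsub>R\<^esub> k" by (auto simp: gp_rel_def)
  have "g (a \<otimes>\<^bsub>R\<^esub> d \<otimes>\<^bsub>R\<^esub> k) = g (c \<otimes>\<^bsub>R\<^esub> b \<otimes>\<^bsub>R\<^esub> k)" using k(6) by simp
  then have "g a \<otimes>\<^bsub>R'\<^esub> g d \<otimes>\<^bsub>R'\<^esub> g k = g c \<otimes>\<^bsub>R'\<^esub> g b \<otimes>\<^bsub>R'\<^esub> g k" using k(1-5) by (simp add: gh)
  then show ?thesis unfolding xy h0_def using k gh by (auto simp: G'.cls_eq_iff)
 qed
 obtain h where h: "h \<in> mon_hom (gp R) (gp R')"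
  "\<forall>x\<in>carrier (R \<times>\<times> R). h (case x of (a, b) \<Rightarrow> G.cls a b) = h0 x"
  by (rule presents_factor[OF pres G.diag.comm_monoid_axioms h0 h01 h0eq])
 have hcls: "h (G.cls a b) = G'.cls (g a) (g b)" if "a \<in> carrier R" "b \<in> carrier R" for a b
  using h(2) that by (auto simp: DirProd_def h0_def)
 have surj: "\<exists>y\<in>carrier R. x = g y" if "x \<in> carrier R'" for x using that g(2) RD(3,4) RD'(3) by force
 have "h ` carrier (gp R) = carrier (gp R')"
 proof (intro equalityI subsetI)
  fix z assume "z \<in> carrier (gp R')"
  then obtain a b where "z = G'.cls a b" "a \<in> carrier R'" "b \<in> carrier R'" unfolding G'.carrier_gp by blast
  moreover then obtain c d where "a = g c" "b = g d" "c \<in> carrier R" "d \<in> carrier R" using surj by metis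
  ultimately have "z = h (G.cls c d)" "G.cls c d \<in> carrier (gp R)" using hcls by auto
  then show "z \<in> h ` carrier (gp R)" by blast
 qed (use h(1) in \<open>auto simp: mon_hom_def hom_def\<close>)
 moreover have "h \<in> hom (gp R) (gp R')" using h(1) by (simp add: mon_hom_def)
 ultimately have mono: "group_rank (gp R') \<le> group_rank (gp R)"
  "\<And>u. u \<in> carrier (gp R) \<Longrightarrow> h u = \<one>\<^bsub>gp R'\<^esub> \<Longrightarrow> (\<And>n. n > 0 \<Longrightarrow> u [^]\<^bsub>gp R\<^esub> (n::nat) \<noteq> \<one>\<^bsub>gp R\<^esub>) \<Longrightarrow>
   group_rank (gp R') < group_rank (gp R)"
  using group_rank_mono[OF G.comm_group_gp G'.comm_group_gp _ _ gp_rank_bound[OF R]] by blast+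
 show "mon_dim R' \<le> mon_dim R" using mono(1) by (simp add: mon_dim_def)
 assume "T \<noteq> T'"
 then obtain p where p: "p \<in> T'" "p \<notin> T" "p \<in> carrier P" using T(3) mon_faceD(2)[OF T(2)] by blast
 let ?u = "G.cls (\<kappa> p) \<one>\<^bsub>R\<^esub>"
 have "group_rank (gp R') < group_rank (gp R)"
 proof (rule mono(2)[of ?u])
  show "?u \<in> carrier (gp R)" using RD(4)[OF p(3)] by simp
  have "\<kappa>' p = \<kappa>' \<one>" using p RD'(6)[of p \<one>] T'.one_closed by (auto simp: T'.quot_rel_iff m_comm)
  then show "h ?u = \<one>\<^bsub>gp R'\<^esub>" using RD(4)[OF p(3)] g(2) p(3) by (simp add: hcls gh RD'(2) G'.one_gp)
  fix n :: nat assume n: "n > 0"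
  show "?u [^]\<^bsub>gp R\<^esub> n \<noteq> \<one>\<^bsub>gp R\<^esub>"
  proof
   assume "?u [^]\<^bsub>gp R\<^esub> n = \<one>\<^bsub>gp R\<^esub>"
   then have "G.cls (\<kappa> p [^]\<^bsub>R\<^esub> n) \<one>\<^bsub>R\<^esub> = G.cls \<one>\<^bsub>R\<^esub> \<one>\<^bsub>R\<^esub>"
    using RD(4)[OF p(3)] by (simp add: G.cls_pow G.one_gp)
   then obtain k where k: "k \<in> carrier R" "\<kappa> p [^]\<^bsub>R\<^esub> n \<otimes>\<^bsub>R\<^esub> k = k"
    using RD(4)[OF p(3)] by (auto simp: G.cls_eq_iff)
   obtain q where q: "q \<in> carrier P" "k = \<kappa> q" using k(1) RD(3) by auto
   have "\<kappa> (p [^] n) = \<kappa> p [^]\<^bsub>R\<^esub> n" using p(3) RD by (induction n) auto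
   then have "\<kappa> (p [^] n \<otimes> q) = \<kappa> q" using k q p(3) RD(5) by simp
   then have "(p [^] n \<otimes> q, q) \<in> quot_rel P T" using RD(6) p(3) q by simp
   then obtain s s' where s: "s \<in> T" "s' \<in> T" "p [^] n \<otimes> q \<otimes> s = q \<otimes> s'" by (auto simp: T.quot_rel_iff)
   then have sc: "s \<in> carrier P" "s' \<in> carrier P" using T.S_carrier by auto
   have "(p [^] n \<otimes> s) \<otimes> q = s' \<otimes> q" using s(3) sc p(3) q(1) by (simp add: m_ac)
   then have "p [^] n \<otimes> s = s'" by (rule integral[rotated 3]) (use sc p(3) q(1) in auto)
   then have "p [^] n \<in> T" using mon_faceD(3)[OF T(1), of "p [^] n" s] s(2) sc p(3) by simp
   then show False using face_pow_iff[OF T(1) p(3) n] p(2) by simp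
  qed
 qed
 then show "mon_dim R' < mon_dim R" by (simp add: mon_dim_def)
qed

end

section \<open>Local structure of model spaces\<close>

lemma model_space_iff:
 "y \<in> model_space P \<longleftrightarrow> y \<in> extensional (carrier P) \<and> y \<one>\<^bsub>P\<^esub> = 1 \<and> (\<forall>p\<in>carrier P. y p \<ge> 0) \<and>
  (\<forall>p\<in>carrier P. \<forall>q\<in>carrier P. y (p \<otimes>\<^bsub>P\<^esub> q) = y p * y q)"
 by (auto simp: model_space_def mon_hom_def hom_def nonneg_real_monoid_def)

definition support_face :: "'p monoid \<Rightarrow> ('p \<Rightarrow> real) \<Rightarrow> 'p set" where
 "support_face P y = {p \<in> carrier P. y p \<noteq> 0}"

lemma support_face:
 assumes "comm_monoid P" "y \<in> model_space P"
 shows "mon_face (support_face P y) P"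
proof -
 interpret comm_monoid P by fact
 have "submonoid (support_face P y) P"
  by unfold_locales (use assms in \<open>auto simp: support_face_def model_space_iff\<close>)
 then show ?thesis using assms by (auto simp: mon_face_def support_face_def model_space_iff)
qed

text \<open>Convexity of intervals in logarithmic coordinates; the lower bound has to be positive to
  have a logarithm.\<close>

lemma geometric_mean_bounds:
 fixes a b l u t :: real
 assumes "0 < l" "l < a" "a < u" "l < b" "b < u" "0 \<le> t" "t \<le> 1"
 shows "l < a powr (1 - t) * b powr t" "a powr (1 - t) * b powr t < u"
proof -
 have eq: "a powr (1 - t) * b powr t = exp ((1 - t) * ln a + t * ln b)"
  using assms by (simp add: powr_def exp_add)
 have "- ((1 - t) * ln a + t * ln b) < - ln l"
  using convex_bound_lt[of "- ln a" "- ln l" "- ln b" "1 - t" t] assms by simp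
 then have "exp (ln l) < exp ((1 - t) * ln a + t * ln b)" by simp
 then show "l < a powr (1 - t) * b powr t" using assms eq by simp
 have "(1 - t) * ln a + t * ln b < ln u"
  using convex_bound_lt[of "ln a" "ln u" "ln b" "1 - t" t] assms by simp
 then have "exp ((1 - t) * ln a + t * ln b) < exp (ln u)" by simp
 then show "a powr (1 - t) * b powr t < u" using assms eq by simp
qed

section \<open>Logarithmically convex neighbourhoods and curves in strata\<close>

context fg_monoid
begin

text \<open>In logarithmic coordinates, in which the vanishing coordinates of \<open>x\<close> are at \<open>-\<infinity>\<close>, this
 neighbourhood of \<open>x\<close> is convex.\<close>

definition box :: "('a \<Rightarrow> real) \<Rightarrow> real \<Rightarrow> ('a \<Rightarrow> real) set" where
 "box x e = {y \<in> model_space P. \<forall>g\<in>A. y g \<in> (if x g = 0 then {..<e} else {x g * exp (- e)<..<x g * exp e})}"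

lemma openin_box: "mopn P (box x e)"
proof -
 have "mopn P {y \<in> topspace (model_top P). y g \<in> S}" if "g \<in> A" "open S" for g S
  using that gens by (intro openin_continuous_map_preimage[OF continuous_map_model_eval]) auto
 then have *: "mopn P (topspace (model_top P) \<inter> (\<Inter>g\<in>A. {y \<in> topspace (model_top P).
   y g \<in> (if x g = 0 then {..<e} else {x g * exp (- e)<..<x g * exp e})}))"
  using finite_gens by (cases "A = {}") (auto intro!: openin_Int openin_INT)
 have "box x e = topspace (model_top P) \<inter> (\<Inter>g\<in>A. {y \<in> topspace (model_top P).
   y g \<in> (if x g = 0 then {..<e} else {x g * exp (- e)<..<x g * exp e})})"
  unfolding box_def topspace_model_top by blast
 then show ?thesis using * by simp
qed

lemma box_mono: "e \<le> e' \<Longrightarrow> x \<in> model_space P \<Longrightarrow> box x e \<subseteq> box x e'"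
proof
 fix y assume *: "e \<le> e'" "x \<in> model_space P" "y \<in> box x e"
 have "y g \<in> (if x g = 0 then {..<e'} else {x g * exp (- e')<..<x g * exp e'})" if g: "g \<in> A" for g
 proof (cases "x g = 0")
  case False
  then have x: "x g > 0" using * g gens by (force simp: model_space_iff)
  have "x g * exp (- e') \<le> x g * exp (- e)" "x g * exp e \<le> x g * exp e'" using x *(1) by simp_all
  moreover have "y g > x g * exp (- e)" "y g < x g * exp e" using *(3) g False by (auto simp: box_def)
  ultimately show ?thesis using False by (simp add: order_le_less_trans order_less_le_trans)
 qed (use * g in \<open>auto simp: box_def\<close>)
 then show "y \<in> box x e'" using * by (auto simp: box_def)
qed

lemma mem_box: "x \<in> model_space P \<Longrightarrow> e > 0 \<Longrightarrow> x \<in> box x e"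
 using gens by (force simp: box_def model_space_iff)

lemma support_box:
 assumes "x \<in> model_space P" "y \<in> box x e"
 shows "support_face P x \<subseteq> support_face P y"
proof (rule face_mono[OF support_face support_face])
 show "support_face P x \<inter> A \<subseteq> support_face P y"
 proof
  fix g assume g: "g \<in> support_face P x \<inter> A"
  then have "x g \<noteq> 0" "x g \<ge> 0" "g \<in> A" "g \<in> carrier P"
   using assms by (auto simp: support_face_def model_space_iff)
  moreover then have "y g > x g * exp (- e)" using assms by (auto simp: box_def)
  moreover have "x g * exp (- e) \<ge> 0" using \<open>x g \<ge> 0\<close> by simp
  ultimately have "y g > 0" by linarith
  then show "g \<in> support_face P y" using \<open>g \<in> carrier P\<close> by (simp add: support_face_def)
 qed
qed (use assms comm_monoid_axioms in \<open>auto simp: box_def\<close>)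

text \<open>Boxes control the generators only. Limits along this filter are compatible with
  products, which carries the control over to every coordinate p.\<close>

definition box_filter :: "('a \<Rightarrow> real) \<Rightarrow> ('a \<Rightarrow> real) filter" where
 "box_filter x = (INF e\<in>{0<..}. principal (box x e))"

lemma eventually_box_filter:
 assumes "x \<in> model_space P"
 shows "eventually Q (box_filter x) \<longleftrightarrow> (\<exists>e>0. \<forall>y\<in>box x e. Q y)" unfolding box_filter_def
proof (subst eventually_INF_base)
 fix a b :: real assume "a \<in> {0<..}" "b \<in> {0<..}"
 then show "\<exists>c\<in>{0<..}. principal (box x c) \<le> inf (principal (box x a)) (principal (box x b))"
  using box_mono[OF _ assms, of "min a b"] by (intro bexI[of _ "min a b"]) auto
qed (auto simp: eventually_principal Ball_def)

lemma box_tendsto: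
 assumes x: "x \<in> model_space P" and p: "p \<in> carrier P"
 shows "((\<lambda>y. y p) \<longlongrightarrow> x p) (box_filter x)"
proof -
 have ms: "\<forall>\<^sub>F y in box_filter x. y \<in> model_space P"
  unfolding eventually_box_filter[OF x] by (intro exI[of _ 1]) (auto simp: box_def)
 show ?thesis
 proof (rule gens_induct[OF p, where Q = "\<lambda>p. ((\<lambda>y. y p) \<longlongrightarrow> x p) (box_filter x)"])
  have "\<forall>\<^sub>F y in box_filter x. 1 = y \<one>" using ms by eventually_elim (simp add: model_space_iff)
  moreover have "x \<one> = 1" using x by (simp add: model_space_iff)
  ultimately show "((\<lambda>y. y \<one>) \<longlongrightarrow> x \<one>) (box_filter x)" by (auto intro: Lim_transform_eventually)
 next
  fix p q assume pq: "p \<in> carrier P" "q \<in> carrier P" "((\<lambda>y. y p) \<longlongrightarrow> x p) (box_filter x)"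
   "((\<lambda>y. y q) \<longlongrightarrow> x q) (box_filter x)"
  have "\<forall>\<^sub>F y in box_filter x. y p * y q = y (p \<otimes> q)"
   using ms by eventually_elim (use pq in \<open>simp add: model_space_iff\<close>)
  moreover have "x (p \<otimes> q) = x p * x q" using x pq by (simp add: model_space_iff)
  ultimately show "((\<lambda>y. y (p \<otimes> q)) \<longlongrightarrow> x (p \<otimes> q)) (box_filter x)"
   using tendsto_mult[OF pq(3,4)] by (auto intro: Lim_transform_eventually)
 next
  fix g assume g: "g \<in> A"
  then have xg: "x g \<ge> 0" using x gens by (auto simp: model_space_iff)
  show "((\<lambda>y. y g) \<longlongrightarrow> x g) (box_filter x)"
  proof (cases "x g = 0")
   case True
   show ?thesis unfolding True
   proof (rule tendstoI)
    fix e :: real assume "e > 0"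
    then show "\<forall>\<^sub>F y in box_filter x. dist (y g) 0 < e"
     unfolding eventually_box_filter[OF x] using g gens True
     by (intro exI[of _ e]) (force simp: box_def model_space_iff)
   qed
  next
   case False
   show ?thesis
   proof (rule order_tendstoI)
    fix a assume a: "a < x g"
    have "((\<lambda>e. x g * exp (- e)) \<longlongrightarrow> x g * exp (- 0)) (at_right 0)" by (intro tendsto_intros)
    then have "\<forall>\<^sub>F e in at_right 0. a < x g * exp (- e)" by (rule order_tendstoD) (use a in simp)
    then obtain e where "e > 0" "a < x g * exp (- e)"
     unfolding eventually_at_right_field by (metis dense)
    then show "\<forall>\<^sub>F y in box_filter x. a < y g" unfolding eventually_box_filter[OF x] using g False
     by (intro exI[of _ e]) (auto simp: box_def)
   next
    fix a assume a: "x g < a"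
    have "((\<lambda>e. x g * exp e) \<longlongrightarrow> x g * exp 0) (at_right 0)" by (intro tendsto_intros)
    then have "\<forall>\<^sub>F e in at_right 0. x g * exp e < a" by (rule order_tendstoD) (use a in simp)
    then obtain e where "e > 0" "x g * exp e < a"
     unfolding eventually_at_right_field by (metis dense)
    then show "\<forall>\<^sub>F y in box_filter x. y g < a" unfolding eventually_box_filter[OF x] using g False
     by (intro exI[of _ e]) (auto simp: box_def)
   qed
  qed
 qed
qed

text \<open>A basic open set of the product restricts finitely many coordinates, and
  \<open>box_tendsto\<close> handles each of them.\<close>

lemma box_basis:
 assumes "mopn P D" "x \<in> D"
 obtains e where "e > 0" "box x e \<subseteq> D"
proof -
 have x: "x \<in> model_space P" using assms openin_subset topspace_model_top by blast
 obtain V where V: "openin (product_topology (\<lambda>_. euclideanreal) (carrier P)) V" "D = V \<inter> model_space P"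
  using assms(1) unfolding model_top_def openin_subtopology by blast
 then have "x \<in> V" using assms by blast
 then obtain X where X: "x \<in> (\<Pi>\<^sub>E i\<in>carrier P. X i)" "\<And>i. open (X i)" "finite {i. X i \<noteq> UNIV}"
  "(\<Pi>\<^sub>E i\<in>carrier P. X i) \<subseteq> V"
  using product_topology_open_contains_basis[OF V(1)] by (metis open_openin topspace_euclidean)
 have "\<forall>\<^sub>F y in box_filter x. y i \<in> X i" if i: "i \<in> carrier P" for i
  by (rule topological_tendstoD[OF box_tendsto[OF x i] X(2)]) (use X(1) i in auto)
 then have "\<forall>\<^sub>F y in box_filter x. \<forall>i\<in>{i. X i \<noteq> UNIV} \<inter> carrier P. y i \<in> X i"
  using X(3) by (subst eventually_ball_finite_distrib) auto
 then obtain e where e: "e > 0" "\<forall>y\<in>box x e. \<forall>i\<in>{i. X i \<noteq> UNIV} \<inter> carrier P. y i \<in> X i"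
  unfolding eventually_box_filter[OF x] by blast
 have "box x e \<subseteq> D"
 proof
  fix y assume y: "y \<in> box x e"
  then have ym: "y \<in> model_space P" by (simp add: box_def)
  have "y i \<in> X i" if "i \<in> carrier P" for i using e(2) y that by (cases "X i = UNIV") auto
  then have "y \<in> (\<Pi>\<^sub>E i\<in>carrier P. X i)" using ym by (auto simp: PiE_def model_space_iff)
  then show "y \<in> D" using X(4) V(2) ym by blast
 qed
 with e(1) that show thesis by blast
qed

text \<open>The path is the straight segment in logarithmic coordinates; it stays in the box, and it
  stays in the stratum because both ends have the same vanishing coordinates.\<close>

lemma connected_box_piece:
 assumes x: "x \<in> model_space P" and e: "e > 0"
 shows "connectedin (model_top P) {y \<in> box x e. support_face P y = T}" (is "connectedin _ ?S")
proof (rule path_connectedin_imp_connectedin, unfold path_connectedin, intro conjI ballI)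
 show "?S \<subseteq> topspace (model_top P)" by (auto simp: box_def topspace_model_top)
 fix a b assume ab: "a \<in> ?S" "b \<in> ?S"
 then have am: "a \<in> model_space P" "b \<in> model_space P" by (auto simp: box_def)
 have zero: "a p = 0 \<longleftrightarrow> b p = 0" if "p \<in> carrier P" for p using ab that by (auto simp: support_face_def)
 have nonneg: "a p \<ge> 0" "b p \<ge> 0" if "p \<in> carrier P" for p
  using am that by (auto simp: model_space_iff)
 \<comment> \<open>As \<open>0 powr t\<close> is 0 for every t, including t = 0, common vanishing
   coordinates vanish all along the path, end points included.\<close>
 define z where "z t = (\<lambda>p\<in>carrier P. a p powr (1 - t) * b p powr t)" for t :: real
 have zm: "z t \<in> model_space P" for t using am by (auto simp: model_space_iff z_def powr_mult)
 have "continuous_map (top_of_set {0..1}) (model_top P) z"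
  unfolding model_top_def continuous_map_in_subtopology continuous_map_componentwise
 proof (intro conjI ballI)
  show "z ` topspace (top_of_set {0..1}) \<subseteq> extensional (carrier P)" by (auto simp: z_def)
  show "z \<in> topspace (top_of_set {0..1}) \<rightarrow> model_space P" using zm by auto
  fix p assume p: "p \<in> carrier P"
  have "continuous_on {0..1} (\<lambda>t. a p powr (1 - t) * b p powr t)"
  proof (cases "a p = 0")
   case False
   then show ?thesis using zero[OF p] by (intro continuous_intros) auto
  qed simp
  then show "continuous_map (top_of_set {0..1}) euclideanreal (\<lambda>t. z t p)" using p by (simp add: z_def)
 qed
 moreover have "z t \<in> ?S" if t: "t \<in> {0..1}" for t
 proof -
  have "z t g \<in> (if x g = 0 then {..<e} else {x g * exp (- e)<..<x g * exp e})" if g: "g \<in> A" for g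
  proof -
   have gP: "g \<in> carrier P" using g gens by blast
   have xg: "x g \<ge> 0" using x gP by (simp add: model_space_iff)
   have ag: "a g \<in> (if x g = 0 then {..<e} else {x g * exp (- e)<..<x g * exp e})"
    "b g \<in> (if x g = 0 then {..<e} else {x g * exp (- e)<..<x g * exp e})"
    using ab g by (auto simp: box_def)
   consider "a g = 0" | "a g \<noteq> 0" "x g = 0" | "x g \<noteq> 0" by blast
   then show ?thesis
   proof cases
    case 1
    have "x g = 0"
    proof (rule ccontr)
     assume "x g \<noteq> 0"
     then have "x g * exp (- e) < 0" using ag 1 by simp
     then show False using xg by (simp add: mult_less_0_iff)
    qed
    then show ?thesis using 1 gP e by (simp add: z_def)
   next
    case 2
    \<comment> \<open>\<open>geometric_mean_bounds\<close> wants a positive lower bound; where x g =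
      0 the box gives none, so one is made up.\<close>
    then have "min (a g) (b g) / 2 > 0" using zero[OF gP] nonneg[OF gP] by auto
    moreover have "min (a g) (b g) / 2 < a g" "min (a g) (b g) / 2 < b g"
     using 2 zero[OF gP] nonneg[OF gP] by (auto simp: min_def)
    ultimately have "a g powr (1 - t) * b g powr t < e"
     using geometric_mean_bounds(2)[of "min (a g) (b g) / 2" "a g" e "b g" t] ag 2 t by auto
    then show ?thesis using 2 gP by (simp add: z_def)
   next
    case 3
    then have "x g * exp (- e) > 0" using xg by simp
    then show ?thesis
     using geometric_mean_bounds[of "x g * exp (- e)" "a g" "x g * exp e" "b g" t] ag 3 t gP
     by (auto simp: z_def)
   qed
  qed
  moreover have "support_face P (z t) = T" using ab zero by (auto simp: support_face_def z_def)
  ultimately show ?thesis using zm by (auto simp: box_def)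
 qed
 moreover have "z 0 = a" "z 1 = b"
  using am zero nonneg by (auto simp: z_def model_space_iff fun_eq_iff extensional_def)
 ultimately show "\<exists>g. pathin (model_top P) g \<and> g \<in> {0..1} \<rightarrow> ?S \<and> g 0 = a \<and> g 1 = b"
  unfolding pathin_def by (intro exI[of _ z]) auto
qed

text \<open>L extends ln x from the monomials with \<phi> = 0, on which the curve keeps the values
  of x. All other monomials of T decay exponentially, at speeds prescribed by \<phi>; so the curve
  approaches x inside the stratum of T while its rates remain free to choose.\<close>

lemma stratum_curve:
 assumes x: "x \<in> model_space P" and \<phi>: "\<phi> \<in> duals P"
  "\<And>p. p \<in> carrier P \<Longrightarrow> \<phi> p = 0 \<longleftrightarrow> p \<in> support_face P x" and T: "mon_face T P" "support_face P x \<subseteq> T"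
 obtains L c where "\<And>s p. p \<in> T \<Longrightarrow> c s p = exp (L p - s * real (\<phi> p))"
  "\<And>s. c s \<in> model_space P" "\<And>s. support_face P (c s) = T"
  "\<And>e. e > 0 \<Longrightarrow> \<forall>\<^sub>F s in at_top. c s \<in> box x e"
proof -
 note X = support_face[OF comm_monoid_axioms x] and TD = mon_faceD[OF T(1)]
 have ln: "ln (x (p \<otimes> q)) = ln (x p) + ln (x q)" if "p \<in> support_face P x" "q \<in> support_face P x" for p q
  using that x by (auto simp: support_face_def model_space_iff ln_mult)
 have ln1: "ln (x \<one>) = 0" using x by (simp add: model_space_iff)
 obtain L where L: "\<And>p q. p \<in> carrier P \<Longrightarrow> q \<in> carrier P \<Longrightarrow> L (p \<otimes> q) = L p + L q"
  "L \<one> = 0" "\<And>t. t \<in> support_face P x \<Longrightarrow> L t = ln (x t)"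
 proof (rule real_extension[OF X, of "\<lambda>p. ln (x p)", OF ln1 ln])
  fix L assume L: "\<And>p q. p \<in> carrier P \<Longrightarrow> q \<in> carrier P \<Longrightarrow> L (p \<otimes> q) = L p + L q"
   "L \<one> = (0::real)" "\<And>t. t \<in> support_face P x \<Longrightarrow> L t = ln (x t)"
  show thesis by (rule that[OF L])
 qed
 define c where "c s = (\<lambda>p\<in>carrier P. if p \<in> T then exp (L p - s * real (\<phi> p)) else 0)" for s
 have Tiff: "p \<otimes> q \<in> T \<longleftrightarrow> p \<in> T \<and> q \<in> T" if "p \<in> carrier P" "q \<in> carrier P" for p q
  using TD(3)[OF that] TD(4)[OF that] TD(5) by blast
 have c: "c s p = exp (L p - s * real (\<phi> p))" if "p \<in> T" for s p using that TD(2) by (auto simp: c_def)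
 have cm: "c s \<in> model_space P" for s using Tiff TD(6) L \<phi>(1)
  by (auto simp: model_space_iff c_def dual_carrier_iff algebra_simps simp flip: exp_add)
 have "support_face P (c s) = T" for s using TD(2) by (auto simp: support_face_def c_def)
 moreover have "\<forall>\<^sub>F s in at_top. c s \<in> box x e" if e: "e > 0" for e
 proof -
  have "\<forall>\<^sub>F s in at_top. c s g \<in> (if x g = 0 then {..<e} else {x g * exp (- e)<..<x g * exp e})" if g: "g \<in> A" for g
  proof -
   have gP: "g \<in> carrier P" using g gens by blast
   consider "g \<notin> T" | "g \<in> T" "x g = 0" | "x g \<noteq> 0" by blast
   then show ?thesis
   proof cases
    case 1
    then have "x g = 0" using T(2) gP by (auto simp: support_face_def)
    then show ?thesis using 1 gP e by (simp add: c_def)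
   next
    case 2
    then have "\<phi> g > 0" using \<phi>(2)[OF gP] by (auto simp: support_face_def)
    then have "((\<lambda>s. exp (L g - s * real (\<phi> g))) \<longlongrightarrow> 0) at_top" by real_asymp
    then have "\<forall>\<^sub>F s in at_top. exp (L g - s * real (\<phi> g)) < e" using e by (rule order_tendstoD)
    then show ?thesis using 2 by (simp add: c)
   next
    case 3
    then have gs: "g \<in> support_face P x" using gP by (simp add: support_face_def)
    then have gT: "g \<in> T" using T(2) by blast
    have xg: "x g > 0" using 3 x gP by (force simp: model_space_iff)
    have "\<phi> g = 0" using \<phi>(2)[OF gP] gs by simp
    then have "c s g = x g" for s using c[OF gT] L(3)[OF gs] xg by simp
    then show ?thesis using 3 e xg by simp
   qed
  qed
  then have "\<forall>\<^sub>F s in at_top. \<forall>g\<in>A. c s g \<in> (if x g = 0 then {..<e} else {x g * exp (- e)<..<x g * exp e})"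
   using finite_gens by (subst eventually_ball_finite_distrib) auto
  then show ?thesis by eventually_elim (simp add: box_def cm)
 qed
 ultimately show thesis using that c cm by blast
qed

lemma box_piece_nonempty:
 assumes x: "x \<in> model_space P" and e: "e > 0" and T: "mon_face T P" "support_face P x \<subseteq> T"
 shows "\<exists>y\<in>box x e. support_face P y = T"
proof -
 obtain \<phi> where \<phi>: "\<phi> \<in> duals P" "\<And>p. p \<in> carrier P \<Longrightarrow> \<phi> p = 0 \<longleftrightarrow> p \<in> support_face P x"
  using face_functional[OF support_face[OF comm_monoid_axioms x]] by metis
 obtain L c where c: "\<And>s. support_face P (c s) = T" "\<And>e. e > 0 \<Longrightarrow> \<forall>\<^sub>F s in at_top. c (s::real) \<in> box x e"
  using stratum_curve[OF x \<phi> T] by metis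
 from c(2)[OF e] have "\<exists>s. c s \<in> box x e" by (rule eventually_happens'[rotated]) simp
 then show ?thesis using c(1) by blast
qed

end

context toric_monoid
begin

text \<open>Otherwise the quotient of the two positive factors would tend to zero or infinity along a
 curve.\<close>

lemma monomial_unique:
 assumes x: "x \<in> D" and D: "mopn P D" and h: "mcont P D h" "mcont P D h'"
  and pos: "\<And>y. y \<in> D \<Longrightarrow> h y > 0" "\<And>y. y \<in> D \<Longrightarrow> h' y > 0"
  and p: "p \<in> carrier P" "p' \<in> carrier P" and eq: "\<And>y. y \<in> D \<Longrightarrow> h y * y p = h' y * y p'"
 shows "(p, p') \<in> quot_rel P (support_face P x)"
proof (rule ccontr)
 assume ne: "(p, p') \<notin> quot_rel P (support_face P x)"
 have xm: "x \<in> model_space P" using x D openin_subset topspace_model_top by blast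
 note X = support_face[OF comm_monoid_axioms xm]
 obtain \<phi> where \<phi>: "\<phi> \<in> duals P" "\<And>p. p \<in> carrier P \<Longrightarrow> \<phi> p = 0 \<longleftrightarrow> p \<in> support_face P x"
  using face_functional[OF X] by metis
 obtain \<psi> where \<psi>: "\<psi> \<in> duals P" "\<forall>t\<in>support_face P x. \<psi> t = 0" "\<psi> p \<noteq> \<psi> p'"
  by (rule dual_separates[OF X p ne])
 interpret D: comm_monoid "dual P" by (rule comm_monoid_dual[OF comm_monoid_axioms])
 \<comment> \<open>The speeds must vanish only on the support face and also separate p from p'. If
   \<phi> fails to separate, adding \<psi> mends this without enlarging the zero set.\<close>
 obtain \<theta> where \<theta>: "\<theta> \<in> duals P" "\<And>p. p \<in> carrier P \<Longrightarrow> \<theta> p = 0 \<longleftrightarrow> p \<in> support_face P x" "\<theta> p \<noteq> \<theta> p'"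
 proof (cases "\<phi> p = \<phi> p'")
  case True
  have *: "(\<phi> \<otimes>\<^bsub>dual P\<^esub> \<psi>) q = \<phi> q + \<psi> q" if "q \<in> carrier P" for q using that by (simp add: dual_mult)
  show ?thesis by (rule that[OF D.m_closed[OF \<phi>(1) \<psi>(1)]]) (use * \<phi>(2) \<psi>(2,3) p True in auto)
 qed (use \<phi> that in blast)
 have carr: "mon_face (carrier P) P" unfolding mon_face_def by (auto intro!: submonoid.intro)
 have sub: "support_face P x \<subseteq> carrier P" by (auto simp: support_face_def)
 obtain L c where c: "\<And>s p. p \<in> carrier P \<Longrightarrow> c s p = exp (L p - s * real (\<theta> p))"
  "\<And>e. e > 0 \<Longrightarrow> \<forall>\<^sub>F s in at_top. c s \<in> box x e" using stratum_curve[OF xm \<theta>(1,2) carr sub] by metis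
 have cD: "\<forall>\<^sub>F s in at_top. c s \<in> V" if V: "mopn P V" "x \<in> V" for V
 proof -
  obtain e where "e > 0" "box x e \<subseteq> V" by (rule box_basis[OF V])
  from c(2)[OF this(1)] show ?thesis by eventually_elim (use \<open>box x e \<subseteq> V\<close> in blast)
 qed
 have top: "topspace (subtopology (model_top P) D) = D" using openin_subset[OF D] by auto
 have lim: "((\<lambda>s. k (c s)) \<longlongrightarrow> k x) at_top"
  if k: "mcont P D k" for k
 proof (rule topological_tendstoI)
  fix S assume S: "open S" "k x \<in> S"
  have "openin (subtopology (model_top P) D) {y \<in> topspace (subtopology (model_top P) D). k y \<in> S}"
   by (rule openin_continuous_map_preimage[OF k]) (use S in simp)
  then have "mopn P {y \<in> D. k y \<in> S}" unfolding top using openin_trans_full D by blast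
  from cD[OF this] x S show "\<forall>\<^sub>F s in at_top. k (c s) \<in> S" by (auto elim: eventually_mono)
 qed
 have contra: False if hk: "\<And>y. y \<in> D \<Longrightarrow> k y > 0" "\<And>y. y \<in> D \<Longrightarrow> k' y > 0" "mcont P D k" "mcont P D k'"
   "q \<in> carrier P" "q' \<in> carrier P" "\<And>y. y \<in> D \<Longrightarrow> k y * y q = k' y * y q'" "\<theta> q < \<theta> q'" for k k' q q'
 proof -
  have "((\<lambda>s. k (c s) / k' (c s)) \<longlongrightarrow> k x / k' x) at_top"
   using hk(2)[OF x] by (intro tendsto_divide lim hk) simp
  moreover have "\<forall>\<^sub>F s in at_top. k (c s) / k' (c s) = exp (L q' - L q - s * (real (\<theta> q') - real (\<theta> q)))"
   using cD[OF D x]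
  proof eventually_elim
   case (elim s)
   have "k (c s) * exp (L q - s * real (\<theta> q)) = k' (c s) * exp (L q' - s * real (\<theta> q'))"
    using hk(7)[OF elim] c(1) hk(5,6) by simp
   then have "k (c s) / k' (c s) = exp (L q' - s * real (\<theta> q')) / exp (L q - s * real (\<theta> q))"
    using hk(2)[OF elim] by (simp add: field_simps)
   also have "\<dots> = exp (L q' - L q - s * (real (\<theta> q') - real (\<theta> q)))"
    by (simp add: exp_diff[symmetric] algebra_simps)
   finally show ?case .
  qed
  ultimately have "((\<lambda>s. exp (L q' - L q - s * (real (\<theta> q') - real (\<theta> q)))) \<longlongrightarrow> k x / k' x) at_top"
   by (rule Lim_transform_eventually)
  moreover have "((\<lambda>s. exp (L q' - L q - s * (real (\<theta> q') - real (\<theta> q)))) \<longlongrightarrow> 0) at_top"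
  proof -
   define d where "d = real (\<theta> q') - real (\<theta> q)"
   have "d > 0" using hk(8) by (simp add: d_def)
   then have "((\<lambda>s. exp (L q' - L q - s * d)) \<longlongrightarrow> 0) at_top" by real_asymp
   then show ?thesis by (simp add: d_def)
  qed
  ultimately have "k x / k' x = 0" by (rule tendsto_unique[rotated]) simp
  then show False using hk(1)[OF x] hk(2)[OF x] by simp
 qed
 show False
 proof (cases "\<theta> p < \<theta> p'")
  case True
  then show ?thesis using contra[of h h' p p'] h pos p eq by blast
 next
  case False
  then have "\<theta> p' < \<theta> p" using \<theta>(3) by simp
  then show ?thesis using contra[of h' h p' p] h pos p eq by metis
 qed
qed

end

section \<open>Charts, germs and stalks\<close>

lemma model_bfun_subset:
 assumes "model_bfun P D b" "mopn P D'" "D' \<subseteq> D"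
 shows "model_bfun P D' b" unfolding model_bfun_iff
proof
 fix x assume x: "x \<in> D'"
 then have "x \<in> D" using assms(3) by blast
 with assms(1) obtain V p h where V: "mopn P V" "x \<in> V" "V \<subseteq> D" "p \<in> carrier P" "sm P V h"
  "\<forall>y\<in>V. h y > 0 \<and> b y = h y * y p" by (rule model_bfunE)
 show "\<exists>V p h. mopn P V \<and> x \<in> V \<and> V \<subseteq> D' \<and> p \<in> carrier P \<and> sm P V h \<and>
   (\<forall>y\<in>V. h y > 0 \<and> b y = h y * y p)"
  by (rule exI[of _ "V \<inter> D'"], rule exI[of _ p], rule exI[of _ h])
   (use V x assms(2) in \<open>auto intro: sm_subset\<close>)
qed

lemma model_bfun_cong:
 assumes "model_bfun P D b" "\<And>y. y \<in> D \<Longrightarrow> b' y = b y"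
 shows "model_bfun P D b'" unfolding model_bfun_iff
proof
 fix x assume x: "x \<in> D"
 with assms(1) obtain V p h where V: "mopn P V" "x \<in> V" "V \<subseteq> D" "p \<in> carrier P" "sm P V h"
  "\<forall>y\<in>V. h y > 0 \<and> b y = h y * y p" by (rule model_bfunE)
 show "\<exists>V p h. mopn P V \<and> x \<in> V \<and> V \<subseteq> D \<and> p \<in> carrier P \<and> sm P V h \<and>
   (\<forall>y\<in>V. h y > 0 \<and> b' y = h y * y p)" by (rule exI[of _ V], rule exI[of _ p], rule exI[of _ h])
   (use V assms(2) in \<open>auto simp: subset_iff\<close>)
qed

lemma model_bfun_sm:
 assumes "mopn P D" "sm P D h" "\<And>y. y \<in> D \<Longrightarrow> h y > 0" "p \<in> carrier P"
 shows "model_bfun P D (\<lambda>y. h y * y p)" unfolding model_bfun_iff using assms by blast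

lemma model_bfun_mult:
 assumes "comm_monoid P" "model_bfun P D a" "model_bfun P D b"
 shows "model_bfun P D (\<lambda>y. a y * b y)" unfolding model_bfun_iff
proof
 interpret comm_monoid P by fact
 fix x assume x: "x \<in> D"
 with assms(2) obtain V p h where V: "mopn P V" "x \<in> V" "V \<subseteq> D" "p \<in> carrier P" "sm P V h"
  "\<forall>y\<in>V. h y > 0 \<and> a y = h y * y p" by (rule model_bfunE)
 from assms(3) x obtain W q k where W: "mopn P W" "x \<in> W" "W \<subseteq> D" "q \<in> carrier P" "sm P W k"
  "\<forall>y\<in>W. k y > 0 \<and> b y = k y * y q" by (rule model_bfunE)
 have "y \<in> model_space P" if "y \<in> V" for y using that V(1) openin_subset topspace_model_top by blast
 then have "y (p \<otimes>\<^bsub>P\<^esub> q) = y p * y q" if "y \<in> V" for y using that V(4) W(4) by (auto simp: model_space_iff)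
 then show "\<exists>V p h. mopn P V \<and> x \<in> V \<and> V \<subseteq> D \<and> p \<in> carrier P \<and> sm P V h \<and>
   (\<forall>y\<in>V. h y > 0 \<and> a y * b y = h y * y p)"
  by (intro exI[of _ "V \<inter> W"] exI[of _ "p \<otimes>\<^bsub>P\<^esub> q"] exI[of _ "\<lambda>y. h y * k y"])
   (use V W in \<open>auto intro!: sm_mult elim!: sm_subset\<close>)
qed

lemma model_bfun_const:
 assumes "comm_monoid P" "mopn P D"
 shows "model_bfun P D (\<lambda>_. 1)"
proof -
 interpret comm_monoid P by fact
 have "model_bfun P D (\<lambda>y. 1 * y \<one>\<^bsub>P\<^esub>)" by (rule model_bfun_sm[OF assms(2) sm_const]) auto
 moreover have "y \<one>\<^bsub>P\<^esub> = 1" if "y \<in> D" for y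
  using that assms(2) openin_subset topspace_model_top by (fastforce simp: model_space_iff)
 ultimately show ?thesis by (elim model_bfun_cong) simp
qed

text \<open>A positive b-function is itself smooth near each point, so its inverse is a positive
  smooth factor times the trivial monomial.\<close>

lemma model_bfun_inverse:
 assumes "comm_monoid P" "model_bfun P D b" "\<And>y. y \<in> D \<Longrightarrow> b y > 0"
 shows "model_bfun P D (\<lambda>y. inverse (b y))" unfolding model_bfun_iff
proof
 interpret comm_monoid P by fact
 fix x assume x: "x \<in> D"
 with assms(2) obtain V p h where V: "mopn P V" "x \<in> V" "V \<subseteq> D" "p \<in> carrier P" "sm P V h"
  "\<forall>y\<in>V. h y > 0 \<and> b y = h y * y p" by (rule model_bfunE)
 have bV: "b y > 0" "b y = h y * y p" if "y \<in> V" for y using that V(6) assms(3)[of y] V(3) by blast+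
 have "sm P V b" by (rule sm_cong[OF sm_mult[OF V(5) sm_eval[OF V(4)]]]) (simp add: bV)
 then have "sm P V (\<lambda>y. inverse (b y))" by (rule sm_inverse) (use bV in force)
 moreover have "y \<one>\<^bsub>P\<^esub> = 1" if "y \<in> V" for y
  using that V(1) openin_subset topspace_model_top by (fastforce simp: model_space_iff)
 ultimately show "\<exists>V p h. mopn P V \<and> x \<in> V \<and> V \<subseteq> D \<and> p \<in> carrier P \<and> sm P V h \<and>
   (\<forall>y\<in>V. h y > 0 \<and> inverse (b y) = h y * y p)"
  by (intro exI[of _ V] exI[of _ "\<one>\<^bsub>P\<^esub>"] exI[of _ "\<lambda>y. inverse (b y)"]) (use V(1-3) bV(1) in auto)
qed

lemma model_bmap_subset:
 assumes "model_bmap P D Q f" "mopn P D'" "D' \<subseteq> D"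
 shows "model_bmap P D' Q f" using assms model_bfun_subset unfolding model_bmap_def by blast

locale gc_chart0 =
 fixes M :: "('m, 'p) gc_space" and U :: "'m set" and P :: "'p monoid" and \<phi> :: "'m \<Rightarrow> 'p \<Rightarrow> real"
 assumes atlas: "max_atlas M" and chart: "(U, P, \<phi>) \<in> charts M"
begin

lemma chart_facts:
 shows openU: "opn M U" and ext: "\<phi> \<in> extensional U" and toricP: "toric P"
  and open_range: "mopn P (\<phi> ` U)"
  and homeo: "homeomorphic_map (subtopology (gtop M) U) (subtopology (model_top P) (\<phi> ` U)) \<phi>"
proof -
 have "is_chart (gtop M) (U, P, \<phi>)" using atlas chart unfolding max_atlas_def by blast
 then show "opn M U" "\<phi> \<in> extensional U" "toric P" "mopn P (\<phi> ` U)"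
  "homeomorphic_map (subtopology (gtop M) U) (subtopology (model_top P) (\<phi> ` U)) \<phi>"
  by (simp_all add: is_chart_def)
qed

lemma comm_monoid_P: "comm_monoid P"
 using toricP by (simp add: toric_def)

lemma topU: "topspace (subtopology (gtop M) U) = U"
 using openin_subset[OF openU] by auto

lemma inj: "inj_on \<phi> U"
 using homeo topU by (metis homeomorphic_imp_injective_map)

lemma inv [simp]: "y \<in> U \<Longrightarrow> inv_into U \<phi> (\<phi> y) = y"
 using inj by simp

lemma chart_model_space: "y \<in> U \<Longrightarrow> \<phi> y \<in> model_space P"
 using openin_subset[OF open_range] topspace_model_top by blast

lemma open_image:
 assumes "opn M V" "V \<subseteq> U"
 shows "mopn P (\<phi> ` V)"
proof -
 have "openin (subtopology (gtop M) U) V" using assms openU by (simp add: openin_open_subtopology)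
 then have "openin (subtopology (model_top P) (\<phi> ` U)) (\<phi> ` V)"
  using homeomorphic_imp_open_map[OF homeo] unfolding open_map_def by blast
 then show ?thesis using open_range openin_trans_full by blast
qed

lemma open_preimage:
 assumes "mopn P D"
 shows "opn M {y \<in> U. \<phi> y \<in> D}"
proof -
 have "openin (subtopology (model_top P) (\<phi> ` U)) (D \<inter> \<phi> ` U)"
  using assms by (auto simp: openin_subtopology)
 from openin_continuous_map_preimage[OF homeomorphic_imp_continuous_map[OF homeo] this]
 have "openin (subtopology (gtop M) U) {y \<in> U. \<phi> y \<in> D \<inter> \<phi> ` U}" unfolding topU .
 moreover have "{y \<in> U. \<phi> y \<in> D \<inter> \<phi> ` U} = {y \<in> U. \<phi> y \<in> D}" by auto
 ultimately show ?thesis using openU openin_trans_full by metis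
qed

lemma continuous_inverse:
 "continuous_map (subtopology (model_top P) (\<phi> ` U)) (gtop M) (inv_into U \<phi>)"
proof -
 obtain g where g: "homeomorphic_maps (subtopology (gtop M) U) (subtopology (model_top P) (\<phi> ` U)) \<phi> g"
  using homeo homeomorphic_map_maps by blast
 have "continuous_map (subtopology (model_top P) (\<phi> ` U)) (gtop M) g"
  using g unfolding homeomorphic_maps_def by (auto dest: continuous_map_into_fulltopology)
 moreover have "g z = inv_into U \<phi> z" if "z \<in> \<phi> ` U" for z
  using that g topU by (auto simp: homeomorphic_maps_def)
 ultimately show ?thesis by (elim continuous_map_eq) auto
qed

lemma bfunD: "bfun M D b \<Longrightarrow> model_bfun P (\<phi> ` (D \<inter> U)) (b \<circ> inv_into U \<phi>)"
 using chart unfolding bfun_def by blast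

end

lemma compatible_model_bmap:
 assumes "gc_chart0 M U P \<phi>" "gc_chart0 M V Q \<psi>"
 shows "model_bmap P (\<phi> ` (U \<inter> V)) Q (\<psi> \<circ> inv_into U \<phi>)"
proof -
 have "compatible (U, P, \<phi>) (V, Q, \<psi>)" using assms unfolding gc_chart0_def max_atlas_def by blast
 then show ?thesis by (simp add: compatible_def model_diffeo_def)
qed

context gc_chart0
begin

text \<open>\<open>bfun\<close> quantifies over all charts; one chart suffices because transition
  maps are b-maps and pull b-functions back.\<close>

lemma bfun_chartI:
 assumes D: "opn M D" "D \<subseteq> U" and k: "model_bfun P (\<phi> ` D) k" and b: "\<And>y. y \<in> D \<Longrightarrow> b y = k (\<phi> y)"
 shows "bfun M D b" unfolding bfun_def
proof clarify
 fix V Q \<psi> assume "(V, Q, \<psi>) \<in> charts M"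
 then interpret V: gc_chart0 M V Q \<psi> by unfold_locales (rule atlas)
 let ?f = "\<phi> \<circ> inv_into V \<psi>"
 have DV: "mopn Q (\<psi> ` (D \<inter> V))" by (rule V.open_image) (use D V.openU in auto)
 have "model_bmap Q (\<psi> ` (V \<inter> U)) P ?f" by (rule compatible_model_bmap) unfold_locales
 then have "model_bmap Q (\<psi> ` (D \<inter> V)) P ?f" by (rule model_bmap_subset[OF _ DV]) (use D in auto)
 then have "model_bfun Q (\<psi> ` (D \<inter> V)) (k \<circ> ?f)" by (rule model_bfun_pullback[OF _ DV k]) auto
 then show "model_bfun Q (\<psi> ` (D \<inter> V)) (b \<circ> inv_into V \<psi>)" by (rule model_bfun_cong) (auto simp: b)
qed

text \<open>The positive factor u is obtained as a b-function on M, so that it has a germ, which is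
  a unit of the stalk.\<close>

lemma bfun_localE:
 assumes "bfun M D b" "y \<in> D" "y \<in> U"
 obtains V p u where "opn M V" "y \<in> V" "V \<subseteq> D \<inter> U" "p \<in> carrier P"
  "bfun M V u" "\<forall>z\<in>V. u z > 0 \<and> b z = u z * \<phi> z p"
proof -
 have "\<phi> y \<in> \<phi> ` (D \<inter> U)" using assms by blast
 with bfunD[OF assms(1)] obtain W p h where W: "mopn P W" "\<phi> y \<in> W" "W \<subseteq> \<phi> ` (D \<inter> U)"
  "p \<in> carrier P" "sm P W h" "\<forall>z\<in>W. h z > 0 \<and> (b \<circ> inv_into U \<phi>) z = h z * z p" by (rule model_bfunE)
 define V where "V = {z \<in> U. \<phi> z \<in> W}"
 have V: "opn M V" unfolding V_def by (rule open_preimage[OF W(1)])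
 have VD: "V \<subseteq> D \<inter> U"
 proof
  fix z assume "z \<in> V"
  then obtain z' where "z \<in> U" "z' \<in> D \<inter> U" "\<phi> z = \<phi> z'" using W(3) by (auto simp: V_def)
  then show "z \<in> D \<inter> U" using inj by (auto dest: inj_onD)
 qed
 have VW: "\<phi> ` V \<subseteq> W" by (auto simp: V_def)
 have "model_bfun P (\<phi> ` V) (\<lambda>z. h z * z \<one>\<^bsub>P\<^esub>)"
  by (rule model_bfun_sm[OF open_image[OF V] sm_subset[OF W(5) VW]])
   (use VW VD W(6) comm_monoid_P in \<open>auto intro: monoid.one_closed comm_monoid.axioms\<close>)
 then have "bfun M V (\<lambda>z. h (\<phi> z))"
  by (rule bfun_chartI[OF V, rotated]) (use VD chart_model_space in \<open>auto simp: model_space_iff\<close>)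
 moreover have "\<forall>z\<in>V. h (\<phi> z) > 0 \<and> b z = h (\<phi> z) * \<phi> z p" using W(6) by (auto simp: V_def)
 ultimately show thesis using that[OF V _ VD W(4)] assms(3) W(2) by (auto simp: V_def)
qed

lemma bfun_monomial:
 assumes "p \<in> carrier P"
 shows "bfun M U (\<lambda>z. \<phi> z p)"
proof (rule bfun_chartI[OF openU subset_refl])
 have "model_bfun P (\<phi> ` U) (\<lambda>y. 1 * y p)"
  by (rule model_bfun_sm[OF open_range sm_const]) (use assms in auto)
 then show "model_bfun P (\<phi> ` U) (\<lambda>y. y p)" by simp
qed simp

end

lemma chart_at:
 assumes "max_atlas M" "x \<in> points M"
 obtains U P \<phi> where "gc_chart0 M U P \<phi>" "x \<in> U"
proof -
 have "x \<in> (\<Union>(U, P, \<phi>)\<in>charts M. U)" using assms unfolding max_atlas_def by blast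
 then obtain U P \<phi> where "(U, P, \<phi>) \<in> charts M" "x \<in> U" by auto
 then show thesis using that[of U P \<phi>] assms(1) by (simp add: gc_chart0_def)
qed

lemma bfun_subset:
 assumes M: "max_atlas M" and "bfun M D b" "opn M D'" "D' \<subseteq> D"
 shows "bfun M D' b" unfolding bfun_def
proof clarify
 fix V Q \<psi> assume "(V, Q, \<psi>) \<in> charts M"
 then interpret V: gc_chart0 M V Q \<psi> by unfold_locales (rule M)
 show "model_bfun Q (\<psi> ` (D' \<inter> V)) (b \<circ> inv_into V \<psi>)"
  by (rule model_bfun_subset[OF V.bfunD[OF assms(2)] V.open_image]) (use assms V.openU in auto)
qed

lemma bfun_mult:
 assumes M: "max_atlas M" and "bfun M D a" "bfun M D b"
 shows "bfun M D (\<lambda>y. a y * b y)" unfolding bfun_def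
proof clarify
 fix V Q \<psi> assume "(V, Q, \<psi>) \<in> charts M"
 then interpret V: gc_chart0 M V Q \<psi> by unfold_locales (rule M)
 show "model_bfun Q (\<psi> ` (D \<inter> V)) ((\<lambda>y. a y * b y) \<circ> inv_into V \<psi>)"
  using model_bfun_mult[OF V.comm_monoid_P V.bfunD[OF assms(2)] V.bfunD[OF assms(3)]] by (simp add: o_def)
qed

lemma bfun_one:
 assumes M: "max_atlas M" and "opn M D"
 shows "bfun M D (\<lambda>_. 1)" unfolding bfun_def
proof clarify
 fix V Q \<psi> assume "(V, Q, \<psi>) \<in> charts M"
 then interpret V: gc_chart0 M V Q \<psi> by unfold_locales (rule M)
 show "model_bfun Q (\<psi> ` (D \<inter> V)) ((\<lambda>_. 1) \<circ> inv_into V \<psi>)"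
  unfolding o_def by (rule model_bfun_const[OF V.comm_monoid_P V.open_image]) (use assms V.openU in auto)
qed

lemma bfun_inverse:
 assumes M: "max_atlas M" and "bfun M D b" "\<And>y. y \<in> D \<Longrightarrow> b y > 0"
 shows "bfun M D (\<lambda>y. inverse (b y))" unfolding bfun_def
proof clarify
 fix V Q \<psi> assume "(V, Q, \<psi>) \<in> charts M"
 then interpret V: gc_chart0 M V Q \<psi> by unfold_locales (rule M)
 have "model_bfun Q (\<psi> ` (D \<inter> V)) (\<lambda>y. inverse ((b \<circ> inv_into V \<psi>) y))"
  by (rule model_bfun_inverse[OF V.comm_monoid_P V.bfunD[OF assms(2)]]) (use assms(3) in auto)
 then show "model_bfun Q (\<psi> ` (D \<inter> V)) ((\<lambda>y. inverse (b y)) \<circ> inv_into V \<psi>)" by (simp add: o_def)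
qed

lemma bfun_cong:
 assumes "max_atlas M" "bfun M D b" "\<And>y. y \<in> D \<Longrightarrow> b' y = b y"
 shows "bfun M D b'" unfolding bfun_def
proof clarify
 fix V Q \<psi> assume "(V, Q, \<psi>) \<in> charts M"
 then interpret V: gc_chart0 M V Q \<psi> using assms(1) by unfold_locales
 show "model_bfun Q (\<psi> ` (D \<inter> V)) (b' \<circ> inv_into V \<psi>)"
  by (rule model_bfun_cong[OF V.bfunD[OF assms(2)]]) (use assms(3) in auto)
qed

subsection \<open>Stalks\<close>

lemma germ_eq_iff: "germ M x a = germ M x b \<longleftrightarrow> (\<forall>\<^sub>F y in nbh M x. a y = b y)"
proof
 assume "germ M x a = germ M x b"
 moreover have "a \<in> germ M x a" by (simp add: germ_def)
 ultimately show "\<forall>\<^sub>F y in nbh M x. a y = b y" by (simp add: germ_def)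
next
 assume *: "\<forall>\<^sub>F y in nbh M x. a y = b y"
 show "germ M x a = germ M x b" unfolding germ_def using * by (auto elim: eventually_elim2)
qed

lemma germ_eqI:
 assumes "opn M V" "x \<in> V" "\<And>y. y \<in> V \<Longrightarrow> a y = b y"
 shows "germ M x a = germ M x b" unfolding germ_eq_iff eventually_nhdsin using assms by blast

lemma germ_eqE:
 assumes "germ M x a = germ M x b" "x \<in> points M"
 obtains V where "opn M V" "x \<in> V" "\<forall>y\<in>V. a y = b y"
 using assms unfolding germ_eq_iff eventually_nhdsin by blast

lemma mem_germ: "c \<in> germ M x b \<longleftrightarrow> germ M x c = germ M x b"
 unfolding germ_eq_iff by (simp add: germ_def)

lemma stalk_iff:
 "B \<in> germs M x \<longleftrightarrow> (\<exists>b D. B = germ M x b \<and> opn M D \<and> x \<in> D \<and> bfun M D b)" by (auto simp: stalk_def)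

lemma germ_in_stalk: "opn M D \<Longrightarrow> x \<in> D \<Longrightarrow> bfun M D b \<Longrightarrow> germ M x b \<in> germs M x"
 unfolding stalk_iff by blast

lemma stalk_mult: "germ M x a \<otimes>\<^bsub>stalk M x\<^esub> germ M x b = germ M x (\<lambda>y. a y * b y)"
proof -
 have eq: "germ M x (\<lambda>y. a' y * b' y) = germ M x (\<lambda>y. a y * b y)" if "a' \<in> germ M x a" "b' \<in> germ M x b" for a' b'
  unfolding germ_eq_iff using that by (auto simp: germ_def elim: eventually_elim2)
 have "a \<in> germ M x a" "b \<in> germ M x b" by (auto simp: germ_def)
 then have "(\<Union>a'\<in>germ M x a. \<Union>b'\<in>germ M x b. germ M x (\<lambda>y. a' y * b' y)) = germ M x (\<lambda>y. a y * b y)"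
 proof (intro equalityI subsetI)
  fix c assume "c \<in> (\<Union>a'\<in>germ M x a. \<Union>b'\<in>germ M x b. germ M x (\<lambda>y. a' y * b' y))"
  then obtain a' b' where "a' \<in> germ M x a" "b' \<in> germ M x b" "c \<in> germ M x (\<lambda>y. a' y * b' y)"
   by (elim UN_E)
  then show "c \<in> germ M x (\<lambda>y. a y * b y)" by (simp only: eq)
 qed (rule UN_I, assumption, rule UN_I)
 then show ?thesis by (simp add: stalk_def)
qed

lemma stalk_one: "\<one>\<^bsub>stalk M x\<^esub> = germ M x (\<lambda>_. 1)"
 by (simp add: stalk_def)

lemma comm_monoid_stalk:
 assumes M: "max_atlas M" and x: "x \<in> points M"
 shows "comm_monoid (stalk M x)"
proof -
 have closed: "A \<otimes>\<^bsub>stalk M x\<^esub> B \<in> germs M x"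
  if AB: "A \<in> germs M x" "B \<in> germs M x" for A B
 proof -
  obtain a D b D' where *: "A = germ M x a" "opn M D" "x \<in> D" "bfun M D a"
   "B = germ M x b" "opn M D'" "x \<in> D'" "bfun M D' b" using AB unfolding stalk_iff by blast
  have D: "opn M (D \<inter> D')" using * by blast
  have "bfun M (D \<inter> D') (\<lambda>y. a y * b y)" using * by (intro bfun_mult[OF M] bfun_subset[OF M _ D]) auto
  then show ?thesis unfolding *(1,5) stalk_mult using * D by (intro germ_in_stalk[of M "D \<inter> D'"]) auto
 qed
 show ?thesis
 proof
  show "\<one>\<^bsub>stalk M x\<^esub> \<in> germs M x"
   unfolding stalk_one by (rule germ_in_stalk[OF openin_topspace x bfun_one[OF M openin_topspace]])
 qed (auto simp: closed, auto simp: stalk_iff stalk_mult stalk_one ac_simps)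
qed

subsection \<open>The stalk in a chart\<close>

locale gc_chart = gc_chart0 M U P \<phi> + toric_monoid P A
 for M :: "('m, 'p) gc_space" and U :: "'m set" and P :: "'p monoid" (structure)
  and \<phi> :: "'m \<Rightarrow> 'p \<Rightarrow> real" and A :: "'p set"
begin

abbreviation "tau y \<equiv> support_face P (\<phi> y)"
abbreviation "mnl p \<equiv> (\<lambda>z. \<phi> z p)"

lemma tau_face: "y \<in> U \<Longrightarrow> mon_face (tau y) P"
 by (rule support_face[OF comm_monoid_axioms chart_model_space])

lemma tau_iff: "p \<in> carrier P \<Longrightarrow> p \<in> tau y \<longleftrightarrow> \<phi> y p \<noteq> 0"
 by (simp add: support_face_def)

lemma mono_nonneg: "y \<in> U \<Longrightarrow> p \<in> carrier P \<Longrightarrow> \<phi> y p \<ge> 0"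
 using chart_model_space by (auto simp: model_space_iff)

lemma mono_mult: "y \<in> U \<Longrightarrow> p \<in> carrier P \<Longrightarrow> q \<in> carrier P \<Longrightarrow> \<phi> y (p \<otimes> q) = \<phi> y p * \<phi> y q"
 using chart_model_space by (auto simp: model_space_iff)

lemma mono_one: "y \<in> U \<Longrightarrow> \<phi> y \<one> = 1"
 using chart_model_space by (auto simp: model_space_iff)

text \<open>What later arguments use of a box: the strata in V correspond to the faces of P above
  \<open>tau y\<close>, each of them connected and nonempty.\<close>

definition basic :: "'m \<Rightarrow> 'm set \<Rightarrow> bool" where
 "basic y V \<longleftrightarrow> opn M V \<and> y \<in> V \<and> V \<subseteq> U \<and> (\<forall>z\<in>V. tau y \<subseteq> tau z) \<and>
  (\<forall>T. mon_face T P \<and> tau y \<subseteq> T \<longrightarrow>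
   connectedin (gtop M) {z \<in> V. tau z = T} \<and> {z \<in> V. tau z = T} \<noteq> {})"

lemma basic_exists:
 assumes D: "opn M D" "y \<in> D" "y \<in> U"
 obtains V where "basic y V" "V \<subseteq> D"
proof -
 have "mopn P (\<phi> ` (D \<inter> U))" by (rule open_image) (use D openU in auto)
 moreover have "\<phi> y \<in> \<phi> ` (D \<inter> U)" using D by blast
 ultimately obtain e where e: "e > 0" "box (\<phi> y) e \<subseteq> \<phi> ` (D \<inter> U)" by (rule box_basis)
 note my = chart_model_space[OF D(3)]
 define V where "V = {z \<in> U. \<phi> z \<in> box (\<phi> y) e}"
 have VD: "V \<subseteq> D"
 proof
  fix z assume "z \<in> V"
  then obtain z' where "z \<in> U" "z' \<in> D \<inter> U" "\<phi> z = \<phi> z'" using e(2) by (auto simp: V_def)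
  then show "z \<in> D" using inj by (auto dest: inj_onD)
 qed
 have image: "{z \<in> V. tau z = T} = inv_into U \<phi> ` {w \<in> box (\<phi> y) e. support_face P w = T}" for T
 proof (intro equalityI subsetI)
  fix z assume z: "z \<in> {z \<in> V. tau z = T}"
  then have "z = inv_into U \<phi> (\<phi> z)" by (simp add: V_def)
  then show "z \<in> inv_into U \<phi> ` {w \<in> box (\<phi> y) e. support_face P w = T}"
   by (rule image_eqI[of _ "inv_into U \<phi>" "\<phi> z"]) (use z in \<open>simp add: V_def\<close>)
 next
  fix z assume "z \<in> inv_into U \<phi> ` {w \<in> box (\<phi> y) e. support_face P w = T}"
  then obtain w where w: "z = inv_into U \<phi> w" "w \<in> box (\<phi> y) e" "support_face P w = T" by blast
  then obtain z' where "z' \<in> U" "w = \<phi> z'" using e(2) by auto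
  then show "z \<in> {z \<in> V. tau z = T}" using w by (simp add: V_def)
 qed
 have "basic y V" unfolding basic_def
 proof (intro conjI allI impI ballI; (elim conjE)?)
  show "opn M V" unfolding V_def by (rule open_preimage[OF openin_box])
  show "y \<in> V" using D(3) mem_box[OF my e(1)] by (simp add: V_def)
  show "tau y \<subseteq> tau z" if "z \<in> V" for z using that by (intro support_box[OF my, where e = e]) (simp add: V_def)
  fix T assume T: "mon_face T P" "tau y \<subseteq> T"
  show "{z \<in> V. tau z = T} \<noteq> {}" unfolding image using box_piece_nonempty[OF my e(1) T] by auto
  have "connectedin (subtopology (model_top P) (\<phi> ` U)) {w \<in> box (\<phi> y) e. support_face P w = T}"
   using connected_box_piece[OF my e(1), of T] e(2) by (auto simp: connectedin_subtopology)
  then show "connectedin (gtop M) {z \<in> V. tau z = T}"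
   unfolding image by (rule connectedin_continuous_map_image[OF continuous_inverse])
 qed (auto simp: V_def)
 with VD that show thesis by blast
qed

lemma positive_near:
 assumes D: "opn M D" "y \<in> D" "y \<in> U" and b: "bfun M D b" "b y \<noteq> 0"
 obtains V where "opn M V" "y \<in> V" "V \<subseteq> D" "\<forall>z\<in>V. b z > 0"
proof -
 obtain V p u where V: "opn M V" "y \<in> V" "V \<subseteq> D \<inter> U" "p \<in> carrier P"
  "bfun M V u" "\<forall>z\<in>V. u z > 0 \<and> b z = u z * \<phi> z p" by (rule bfun_localE[OF b(1) D(2,3)])
 obtain V' where V': "basic y V'" "V' \<subseteq> V" by (rule basic_exists[OF V(1,2) D(3)])
 have "p \<in> tau y" using b(2) V by (auto simp: tau_iff)
 then have "\<phi> z p > 0" if "z \<in> V'" for z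
 proof -
  have "z \<in> U" "p \<in> tau z" using V' that \<open>p \<in> tau y\<close> unfolding basic_def by blast+
  then show ?thesis using mono_nonneg[of z p] V(4) by (simp add: tau_iff order_less_le)
 qed
 then have "\<forall>z\<in>V'. b z > 0" using V V' by auto
 then show thesis using that[of V'] V V' by (auto simp: basic_def)
qed

lemma germ_form:
 assumes y: "y \<in> U" and B: "B \<in> germs M y"
 obtains V p u where "opn M V" "y \<in> V" "V \<subseteq> U" "p \<in> carrier P"
  "bfun M V u" "\<forall>z\<in>V. u z > 0" "B = germ M y (\<lambda>z. u z * \<phi> z p)"
proof -
 obtain b D where b: "B = germ M y b" "opn M D" "y \<in> D" "bfun M D b"
  using B unfolding stalk_iff by blast
 obtain V p u where V: "opn M V" "y \<in> V" "V \<subseteq> D \<inter> U" "p \<in> carrier P"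
  "bfun M V u" "\<forall>z\<in>V. u z > 0 \<and> b z = u z * \<phi> z p" by (rule bfun_localE[OF b(4,3) y])
 have "B = germ M y (\<lambda>z. u z * \<phi> z p)" unfolding b(1) by (rule germ_eqI[OF V(1,2)]) (use V in auto)
 then show thesis using that[of V p u] V by auto
qed

lemma germ_monomial_unique:
 assumes y: "y \<in> U" and u: "opn M V" "y \<in> V" "bfun M V u" "\<forall>z\<in>V. u z > 0"
  and u': "opn M V'" "y \<in> V'" "bfun M V' u'" "\<forall>z\<in>V'. u' z > 0" and p: "p \<in> carrier P" "p' \<in> carrier P"
  and eq: "germ M y (\<lambda>z. u z * \<phi> z p) = germ M y (\<lambda>z. u' z * \<phi> z p')"
 shows "(p, p') \<in> quot_rel P (tau y)"
proof -
 have "y \<in> points M" using u openin_subset by blast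
 with eq obtain W where W: "opn M W" "y \<in> W" "\<forall>z\<in>W. u z * \<phi> z p = u' z * \<phi> z p'" by (rule germ_eqE)
 define D where "D = V \<inter> V' \<inter> W \<inter> U"
 have D: "opn M D" "y \<in> D" "D \<subseteq> U" using y u u' W openU by (auto simp: D_def)
 have cont: "mcont P (\<phi> ` D) (b \<circ> inv_into U \<phi>)"
  if "bfun M V'' b" "D \<subseteq> V''" for V'' b
 proof (rule model_bfun_continuous)
  have "bfun M D b" by (rule bfun_subset[OF atlas that(1) D(1) that(2)])
  from bfunD[OF this] show "model_bfun P (\<phi> ` D) (b \<circ> inv_into U \<phi>)" using D(3) by (simp add: Int_absorb2)
 qed
 show ?thesis
 proof (rule monomial_unique[of "\<phi> y" "\<phi> ` D"])
  show "mcont P (\<phi> ` D) (u \<circ> inv_into U \<phi>)" by (rule cont[OF u(3)]) (auto simp: D_def)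
  show "mcont P (\<phi> ` D) (u' \<circ> inv_into U \<phi>)" by (rule cont[OF u'(3)]) (auto simp: D_def)
 qed (use D p u u' W open_image[OF D(1,3)] in \<open>auto simp: D_def\<close>)
qed

text \<open>The face T of P carried over to the stalk. T = \<open>tau y\<close> gives the units, T =
  \<open>tface F y\<close> the germs that do not vanish on F.\<close>

definition stalk_face :: "'m \<Rightarrow> 'p set \<Rightarrow> ('m \<Rightarrow> real) set set" where
 "stalk_face y T = {germ M y (\<lambda>z. u z * \<phi> z p) | u p V. opn M V \<and> y \<in> V \<and> bfun M V u \<and>
   (\<forall>z\<in>V. u z > 0) \<and> p \<in> T}"

lemma stalk_faceI:
 "opn M V \<Longrightarrow> y \<in> V \<Longrightarrow> bfun M V u \<Longrightarrow> (\<forall>z\<in>V. u z > 0) \<Longrightarrow> p \<in> T \<Longrightarrow>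
  germ M y (\<lambda>z. u z * \<phi> z p) \<in> stalk_face y T" unfolding stalk_face_def by blast

lemma mono_stalk: "y \<in> U \<Longrightarrow> p \<in> carrier P \<Longrightarrow> germ M y (mnl p) \<in> germs M y"
 by (rule germ_in_stalk[OF openU _ bfun_monomial])

lemma topspace_U: "y \<in> U \<Longrightarrow> y \<in> points M"
 using openin_subset[OF openU] by blast

lemma mono_germ_mult:
 assumes "y \<in> U" "p \<in> carrier P" "q \<in> carrier P"
 shows "germ M y (mnl (p \<otimes> q)) = germ M y (mnl p) \<otimes>\<^bsub>stalk M y\<^esub> germ M y (mnl q)"
 unfolding stalk_mult by (rule germ_eqI[OF openU assms(1)]) (simp add: mono_mult assms)

lemma mono_germ_one: "y \<in> U \<Longrightarrow> germ M y (mnl \<one>) = \<one>\<^bsub>stalk M y\<^esub>"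
 unfolding stalk_one by (rule germ_eqI[OF openU]) (simp_all add: mono_one)

lemma mono_in_stalk_face:
 assumes y: "y \<in> U" and p: "p \<in> T"
 shows "germ M y (mnl p) \<in> stalk_face y T"
 using stalk_faceI[OF openU y bfun_one[OF atlas openU], of p T] p by simp

lemma unit_in_stalk_face:
 assumes T: "mon_face T P" and y: "y \<in> U" and u: "opn M V" "y \<in> V" "bfun M V u" "\<forall>z\<in>V. u z > 0"
 shows "germ M y u \<in> stalk_face y T"
proof -
 have "germ M y u = germ M y (\<lambda>z. u z * \<phi> z \<one>)" by (rule germ_eqI[OF openU y]) (simp add: mono_one)
 then show ?thesis using stalk_faceI[OF u mon_faceD(6)[OF T]] by simp
qed

lemma comm_quot_stalk_face:
 assumes y: "y \<in> U" and T: "mon_face T P"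
 shows "comm_quot (stalk M y) (stalk_face y T)"
proof -
 interpret S: comm_monoid "stalk M y" by (rule comm_monoid_stalk[OF atlas topspace_U[OF y]])
 note TD = mon_faceD[OF T]
 show ?thesis
 proof
  show "stalk_face y T \<subseteq> germs M y"
  proof
   fix B assume "B \<in> stalk_face y T"
   then obtain u p V where *: "B = germ M y (\<lambda>z. u z * \<phi> z p)" "opn M V" "y \<in> V" "bfun M V u" "p \<in> T"
    unfolding stalk_face_def by blast
   have "B = germ M y u \<otimes>\<^bsub>stalk M y\<^esub> germ M y (mnl p)" by (simp add: *(1) stalk_mult)
   then show "B \<in> germs M y" using germ_in_stalk[OF *(2-4)] mono_stalk[OF y] TD(2) *(5) by auto
  qed
  fix B B' assume "B \<in> stalk_face y T" "B' \<in> stalk_face y T"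
  then obtain u p V u' p' V' where *: "B = germ M y (\<lambda>z. u z * \<phi> z p)" "opn M V" "y \<in> V" "bfun M V u"
   "\<forall>z\<in>V. u z > 0" "p \<in> T" "B' = germ M y (\<lambda>z. u' z * \<phi> z p')" "opn M V'" "y \<in> V'" "bfun M V' u'"
   "\<forall>z\<in>V'. u' z > 0" "p' \<in> T" unfolding stalk_face_def by blast
  have VV: "opn M (V \<inter> V')" using * by blast
  have "B \<otimes>\<^bsub>stalk M y\<^esub> B' = germ M y (\<lambda>z. (u z * u' z) * \<phi> z (p \<otimes> p'))" unfolding *(1,7) stalk_mult
   by (rule germ_eqI[OF openU y]) (use * TD(2) in \<open>auto simp: mono_mult subset_iff\<close>)
  moreover have "bfun M (V \<inter> V') (\<lambda>z. u z * u' z)"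
   using * by (intro bfun_mult[OF atlas] bfun_subset[OF atlas _ VV]) auto
  ultimately show "B \<otimes>\<^bsub>stalk M y\<^esub> B' \<in> stalk_face y T"
   using * TD(5) by (auto intro!: stalk_faceI[OF VV])
 next
  show "\<one>\<^bsub>stalk M y\<^esub> \<in> stalk_face y T"
   using mono_in_stalk_face[OF y TD(6)] by (simp add: mono_germ_one[OF y])
 qed
qed

text \<open>Every germ is a positive unit times a monomial, and by
  \<open>germ_monomial_unique\<close> the exponent is determined modulo \<open>tau y\<close>, hence
  modulo T.\<close>

lemma stalk_presents:
 assumes y: "y \<in> U" and T: "mon_face T P" "tau y \<subseteq> T"
 shows "presents P T (\<lambda>p. quot_class (stalk M y) (stalk_face y T) (germ M y (mnl p)))
  (mon_quot (stalk M y) (stalk_face y T))"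
proof (rule presents_quot)
 note TD = mon_faceD[OF T(1)]
 show cq: "comm_quot (stalk M y) (stalk_face y T)" by (rule comm_quot_stalk_face[OF y T(1)])
 interpret S: comm_quot "stalk M y" "stalk_face y T" by (rule cq)
 interpret T: comm_quot P T by (rule comm_quot_face[OF T(1)])
 interpret Y: comm_quot P "tau y" by (rule comm_quot_face[OF tau_face[OF y]])
 show "(\<lambda>p. germ M y (mnl p)) \<in> hom P (stalk M y)"
  using mono_stalk[OF y] mono_germ_mult[OF y] by (auto simp: hom_def)
 show "germ M y (mnl \<one>) = \<one>\<^bsub>stalk M y\<^esub>" by (rule mono_germ_one[OF y])
 fix B assume B: "B \<in> germs M y"
 then obtain V p u where V: "opn M V" "y \<in> V" "V \<subseteq> U" "p \<in> carrier P"
  "bfun M V u" "\<forall>z\<in>V. u z > 0" "B = germ M y (\<lambda>z. u z * \<phi> z p)" by (rule germ_form[OF y])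
 have "germ M y (mnl p) \<otimes>\<^bsub>stalk M y\<^esub> germ M y u = B \<otimes>\<^bsub>stalk M y\<^esub> \<one>\<^bsub>stalk M y\<^esub>"
  using B by (simp add: V(7) stalk_mult mult.commute)
 then have "(germ M y (mnl p), B) \<in> quot_rel (stalk M y) (stalk_face y T)"
  unfolding S.quot_rel_iff using B mono_stalk[OF y V(4)] S.one_closed
   unit_in_stalk_face[OF T(1) y V(1,2,5,6)] by blast
 then show "\<exists>p\<in>carrier P. (germ M y (mnl p), B) \<in> quot_rel (stalk M y) (stalk_face y T)" using V(4) by blast
next
 interpret S: comm_quot "stalk M y" "stalk_face y T" by (rule comm_quot_stalk_face[OF y T(1)])
 interpret T: comm_quot P T by (rule comm_quot_face[OF T(1)])
 interpret Y: comm_quot P "tau y" by (rule comm_quot_face[OF tau_face[OF y]])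
 fix p p' assume p: "p \<in> carrier P" "p' \<in> carrier P"
 show "(germ M y (mnl p), germ M y (mnl p')) \<in> quot_rel (stalk M y) (stalk_face y T) \<longleftrightarrow>
   (p, p') \<in> quot_rel P T"
 proof
  assume "(germ M y (mnl p), germ M y (mnl p')) \<in> quot_rel (stalk M y) (stalk_face y T)"
  then obtain B B' where B: "B \<in> stalk_face y T" "B' \<in> stalk_face y T"
   "germ M y (mnl p) \<otimes>\<^bsub>stalk M y\<^esub> B = germ M y (mnl p') \<otimes>\<^bsub>stalk M y\<^esub> B'"
   unfolding S.quot_rel_iff by blast
  then obtain u t V u' t' V' where *: "B = germ M y (\<lambda>z. u z * \<phi> z t)" "opn M V" "y \<in> V" "bfun M V u"
   "\<forall>z\<in>V. u z > 0" "t \<in> T" "B' = germ M y (\<lambda>z. u' z * \<phi> z t')" "opn M V'" "y \<in> V'" "bfun M V' u'"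
   "\<forall>z\<in>V'. u' z > 0" "t' \<in> T" unfolding stalk_face_def by blast
  have tc: "t \<in> carrier P" "t' \<in> carrier P" using * T.S_carrier by auto
  have "germ M y (\<lambda>z. u z * \<phi> z (p \<otimes> t)) = germ M y (mnl p) \<otimes>\<^bsub>stalk M y\<^esub> B"
   unfolding *(1) stalk_mult by (rule germ_eqI[OF openU y]) (simp add: mono_mult p tc)
  also have "\<dots> = germ M y (\<lambda>z. u' z * \<phi> z (p' \<otimes> t'))"
   unfolding B(3) *(7) stalk_mult by (rule germ_eqI[OF openU y]) (simp add: mono_mult p tc)
  finally have "(p \<otimes> t, p' \<otimes> t') \<in> quot_rel P (tau y)"
   using * p tc by (intro germ_monomial_unique[OF y *(2-5) *(8-11)]) auto
  from this[unfolded Y.quot_rel_iff]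
  obtain r r' where r: "r \<in> tau y" "r' \<in> tau y" "p \<otimes> t \<otimes> r = p' \<otimes> t' \<otimes> r'"
   by (elim conjE bexE) (rule that)
  have rc: "r \<in> carrier P" "r' \<in> carrier P" using r(1,2) by (simp_all only: support_face_def mem_Collect_eq)
  have "p \<otimes> (t \<otimes> r) = p' \<otimes> (t' \<otimes> r')" using r(3) by (simp only: m_assoc rc tc p)
  moreover have "t \<otimes> r \<in> T" "t' \<otimes> r' \<in> T"
   using T.S_closed[OF *(6), of r] T.S_closed[OF *(12), of r'] r(1,2) T(2) by blast+
  ultimately show "(p, p') \<in> quot_rel P T" unfolding T.quot_rel_iff using p by blast
 next
  assume "(p, p') \<in> quot_rel P T"
  then obtain t t' where t: "t \<in> T" "t' \<in> T" "p \<otimes> t = p' \<otimes> t'" unfolding T.quot_rel_iff by blast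
  then have tc: "t \<in> carrier P" "t' \<in> carrier P" using T.S_carrier by auto
  have "germ M y (mnl p) \<otimes>\<^bsub>stalk M y\<^esub> germ M y (mnl t) = germ M y (mnl p') \<otimes>\<^bsub>stalk M y\<^esub> germ M y (mnl t')"
   using mono_germ_mult[OF y p(1) tc(1)] mono_germ_mult[OF y p(2) tc(2)] t(3) by simp
  then show "(germ M y (mnl p), germ M y (mnl p')) \<in> quot_rel (stalk M y) (stalk_face y T)"
   unfolding S.quot_rel_iff using mono_stalk[OF y] p mono_in_stalk_face[OF y] t by blast
 qed
qed (rule comm_monoid_axioms)

lemma unit_germ_iff:
 assumes y: "y \<in> U" and D: "opn M D" "y \<in> D" "bfun M D b"
 shows "germ M y b \<in> Units (stalk M y) \<longleftrightarrow> b y \<noteq> 0"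
proof
 assume "germ M y b \<in> Units (stalk M y)"
 then obtain B where B: "B \<in> germs M y" "germ M y b \<otimes>\<^bsub>stalk M y\<^esub> B = \<one>\<^bsub>stalk M y\<^esub>"
  by (auto simp: Units_def)
 then obtain c where "B = germ M y c" unfolding stalk_iff by blast
 then have "germ M y (\<lambda>z. b z * c z) = germ M y (\<lambda>_. 1)" using B(2) by (simp add: stalk_mult stalk_one)
 then obtain V where "y \<in> V" "\<forall>z\<in>V. b z * c z = 1" using topspace_U[OF y] by (rule germ_eqE)
 then show "b y \<noteq> 0" by auto
next
 assume "b y \<noteq> 0"
 then obtain V where V: "opn M V" "y \<in> V" "V \<subseteq> D" "\<forall>z\<in>V. b z > 0"
  by (rule positive_near[OF D(1,2) y D(3)])
 have bV: "bfun M V b" by (rule bfun_subset[OF atlas D(3) V(1,3)])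
 have "bfun M V (\<lambda>z. inverse (b z))" by (rule bfun_inverse[OF atlas bV]) (use V in auto)
 then have "germ M y (\<lambda>z. inverse (b z)) \<in> germs M y" by (rule germ_in_stalk[OF V(1,2)])
 moreover have "germ M y (\<lambda>z. b z * inverse (b z)) = germ M y (\<lambda>_. 1)"
  by (rule germ_eqI[OF V(1,2)]) (use V in force)
 moreover have "germ M y (\<lambda>z. inverse (b z) * b z) = germ M y (\<lambda>_. 1)"
  by (rule germ_eqI[OF V(1,2)]) (use V in force)
 ultimately show "germ M y b \<in> Units (stalk M y)" unfolding Units_def using germ_in_stalk[OF D]
  by (auto simp: stalk_mult stalk_one intro!: bexI[of _ "germ M y (\<lambda>z. inverse (b z))"])
qed

lemma Units_stalk:
 assumes y: "y \<in> U"
 shows "Units (stalk M y) = stalk_face y (tau y)"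
proof (intro equalityI subsetI)
 interpret S: comm_quot "stalk M y" "stalk_face y (tau y)" by (rule comm_quot_stalk_face[OF y tau_face[OF y]])
 have *: "germ M y (\<lambda>z. u z * \<phi> z p) \<in> Units (stalk M y) \<longleftrightarrow> p \<in> tau y"
  if V: "opn M V" "y \<in> V" "bfun M V u" "\<forall>z\<in>V. u z > 0" "p \<in> carrier P" for u p V
 proof -
  have UV: "opn M (V \<inter> U)" using V openU by blast
  have "bfun M (V \<inter> U) (\<lambda>z. u z * \<phi> z p)"
   using V by (intro bfun_mult[OF atlas] bfun_subset[OF atlas V(3) UV] bfun_subset[OF atlas bfun_monomial UV]) auto
  from unit_germ_iff[OF y UV _ this] V y show ?thesis by (auto simp: tau_iff)
 qed
 show "B \<in> stalk_face y (tau y)" if B: "B \<in> Units (stalk M y)" for B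
 proof -
  have "B \<in> germs M y" using B by (simp add: Units_def)
  then obtain V p u where V: "opn M V" "y \<in> V" "V \<subseteq> U" "p \<in> carrier P"
   "bfun M V u" "\<forall>z\<in>V. u z > 0" "B = germ M y (\<lambda>z. u z * \<phi> z p)" by (rule germ_form[OF y])
  then have "p \<in> tau y" using * B by blast
  then show ?thesis unfolding V(7) by (rule stalk_faceI[OF V(1,2,5,6)])
 qed
 show "B \<in> Units (stalk M y)" if "B \<in> stalk_face y (tau y)" for B
  using that * unfolding stalk_face_def by (auto simp: support_face_def)
qed

text \<open>A positive factor does not affect zeros, so nonvanishing on F is a property of the
  exponent.\<close>

lemma nonvanishing_stalk:
 assumes y: "y \<in> U" and T: "T = {p \<in> carrier P. \<not> (\<exists>V. opn M V \<and> y \<in> V \<and> (\<forall>z\<in>V \<inter> F. \<phi> z p = 0))}"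
 shows "nonvanishing M F y = stalk_face y T"
proof (intro equalityI subsetI)
 have *: "germ M y (\<lambda>z. u z * \<phi> z p) \<in> nonvanishing M F y \<longleftrightarrow> p \<in> T"
  if V: "opn M V" "y \<in> V" "bfun M V u" "\<forall>z\<in>V. u z > 0" "p \<in> carrier P" for u p V
 proof -
  let ?b = "\<lambda>z. u z * \<phi> z p"
  have st: "germ M y ?b \<in> germs M y"
  proof -
   interpret S: comm_monoid "stalk M y" by (rule comm_monoid_stalk[OF atlas topspace_U[OF y]])
   show ?thesis using S.m_closed[OF germ_in_stalk[OF V(1-3)] mono_stalk[OF y V(5)]] by (simp add: stalk_mult)
  qed
  have ev: "(\<exists>W. opn M W \<and> y \<in> W \<and> (\<forall>z\<in>W \<inter> F. c z = 0)) \<longleftrightarrow>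
    (\<forall>\<^sub>F z in nbh M y. z \<in> F \<longrightarrow> c z = 0)" for c :: "'m \<Rightarrow> real"
   unfolding eventually_nhdsin using topspace_U[OF y] by (auto simp: Ball_def)
  define K where "K \<longleftrightarrow> (\<forall>\<^sub>F z in nbh M y. z \<in> F \<longrightarrow> \<phi> z p = 0)"
  have eqv: "(\<forall>\<^sub>F z in nbh M y. z \<in> F \<longrightarrow> c z = 0) \<longleftrightarrow> K" if c: "c \<in> germ M y ?b" for c unfolding K_def
  proof (rule eventually_cong)
   have "\<forall>\<^sub>F z in nbh M y. z \<in> V" unfolding eventually_nhdsin using V by blast
   moreover have "\<forall>\<^sub>F z in nbh M y. c z = ?b z" using c by (simp add: germ_def)
   ultimately show "\<forall>\<^sub>F z in nbh M y. c z = 0 \<longleftrightarrow> \<phi> z p = 0" by eventually_elim (use V(4) in force)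
  qed simp
  have "germ M y ?b \<in> nonvanishing M F y \<longleftrightarrow> (\<forall>c\<in>germ M y ?b. \<not> K)"
   unfolding nonvanishing_def ev using st eqv by (simp cong: ball_cong)
  moreover have "?b \<in> germ M y ?b" by (simp add: mem_germ)
  moreover have "p \<in> T \<longleftrightarrow> \<not> K" unfolding T K_def ev using V(5) by simp
  ultimately show ?thesis by auto
 qed
 show "B \<in> stalk_face y T" if B: "B \<in> nonvanishing M F y" for B
 proof -
  have "B \<in> germs M y" using B by (simp add: nonvanishing_def)
  then obtain V p u where V: "opn M V" "y \<in> V" "V \<subseteq> U" "p \<in> carrier P"
   "bfun M V u" "\<forall>z\<in>V. u z > 0" "B = germ M y (\<lambda>z. u z * \<phi> z p)" by (rule germ_form[OF y])
  then have "p \<in> T" using * B by blast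
  then show ?thesis unfolding V(7) by (rule stalk_faceI[OF V(1,2,5,6)])
 qed
 show "B \<in> nonvanishing M F y" if "B \<in> stalk_face y T" for B
  using that * unfolding stalk_face_def by (auto simp: T)
qed

definition kappa :: "'m \<Rightarrow> 'p \<Rightarrow> ('m \<Rightarrow> real) set set" where
 "kappa y p = quot_class (stalk M y) (Units (stalk M y)) (germ M y (mnl p))"

lemma kappa_presents:
 assumes "y \<in> U"
 shows "presents P (tau y) (kappa y) (sharp (stalk M y))"
 unfolding kappa_def sharp_def Units_stalk[OF assms]
 by (rule stalk_presents[OF assms tau_face[OF assms] subset_refl])

lemma codim_mono:
 assumes "y \<in> U" "z \<in> U" "tau y \<subseteq> tau z"
 shows "codim M z \<le> codim M y" "tau y \<noteq> tau z \<Longrightarrow> codim M z < codim M y" unfolding codim_def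
 using mon_dim_mono[OF kappa_presents kappa_presents tau_face tau_face] assms by blast+

lemma codim_eq: "y \<in> U \<Longrightarrow> z \<in> U \<Longrightarrow> tau y = tau z \<Longrightarrow> codim M y = codim M z"
 using codim_mono(1)[of y z] codim_mono(1)[of z y] by simp

end

lemma gc_chart_at:
 assumes "max_atlas M" "x \<in> points M"
 obtains U P \<phi> A where "gc_chart M U P \<phi> A" "x \<in> U"
proof -
 obtain U P \<phi> where c: "gc_chart0 M U P \<phi>" "x \<in> U" by (rule chart_at[OF assms])
 interpret gc_chart0 M U P \<phi> by (rule c(1))
 obtain A where "toric_monoid P A" by (rule toric_monoidI[OF toricP])
 then show thesis using that[of U P \<phi> A] c by (simp add: gc_chart_def)
qed

section \<open>Boundary faces\<close>

text \<open>The bridge from charts to whole strata. The value may be a truth value: a statement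
  whose truth is locally constant spreads over a connected set.\<close>

lemma locally_constant_on_connected:
 assumes S: "connectedin X S" and loc: "\<And>x. x \<in> S \<Longrightarrow> \<exists>D. openin X D \<and> x \<in> D \<and> (\<forall>y\<in>D \<inter> S. g y = g x)"
  and ab: "a \<in> S" "b \<in> S"
 shows "g a = g b"
proof (rule ccontr)
 assume ne: "g a \<noteq> g b"
 obtain D where D: "\<And>x. x \<in> S \<Longrightarrow> openin X (D x) \<and> x \<in> D x \<and> (\<forall>y\<in>D x \<inter> S. g y = g x)" using loc by metis
 define E1 where "E1 = (\<Union>x\<in>{x \<in> S. g x = g a}. D x)"
 define E2 where "E2 = (\<Union>x\<in>{x \<in> S. g x \<noteq> g a}. D x)"
 have D1: "openin X (D x)" and D2: "x \<in> D x" and D3: "y \<in> D x \<Longrightarrow> y \<in> S \<Longrightarrow> g y = g x"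
  if "x \<in> S" for x y using D[OF that] by blast+
 have "openin X E1" "openin X E2" unfolding E1_def E2_def using D1 by (intro openin_Union; blast)+
 moreover have "S \<subseteq> E1 \<union> E2" unfolding E1_def E2_def using D2 by blast
 moreover have "E1 \<inter> E2 \<inter> S = {}"
 proof -
  have "g y = g a" if "y \<in> E1" "y \<in> S" for y
  proof -
   obtain x where "x \<in> S" "g x = g a" "y \<in> D x" using \<open>y \<in> E1\<close> unfolding E1_def by blast
   then show ?thesis using D3[of x y] that(2) by simp
  qed
  moreover have "g y \<noteq> g a" if "y \<in> E2" "y \<in> S" for y
  proof -
   obtain x where "x \<in> S" "g x \<noteq> g a" "y \<in> D x" using \<open>y \<in> E2\<close> unfolding E2_def by blast
   then show ?thesis using D3[of x y] that(2) by simp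
  qed
  ultimately show ?thesis by blast
 qed
 moreover have "a \<in> E1 \<inter> S" "b \<in> E2 \<inter> S" unfolding E1_def E2_def using D2 ab ne by (blast, force)
 ultimately show False using S unfolding connectedin by blast
qed

lemma components_inD:
 assumes C: "C \<in> components_in M S" and S: "S \<subseteq> points M"
 shows "connectedin (gtop M) C" "C \<subseteq> S" "C \<noteq> {}" "connectedin (gtop M) D \<Longrightarrow> D \<subseteq> S \<Longrightarrow> D \<inter> C \<noteq> {} \<Longrightarrow> D \<subseteq> C"
  "x \<in> S \<Longrightarrow> x \<in> gtop M closure_of C \<Longrightarrow> x \<in> C"
proof -
 note C' = C[unfolded components_in_def]
 have "connectedin (subtopology (gtop M) S) C" by (rule connectedin_connected_components_of[OF C'])
 then show "connectedin (gtop M) C" "C \<subseteq> S" by (auto simp: connectedin_subtopology)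
 show "C \<noteq> {}" by (rule nonempty_connected_components_of[OF C'])
 show "D \<subseteq> C" if "connectedin (gtop M) D" "D \<subseteq> S" "D \<inter> C \<noteq> {}"
  by (rule connected_components_of_maximal[OF C'])
   (use that in \<open>auto simp: connectedin_subtopology disjnt_def\<close>)
 show "x \<in> C" if "x \<in> S" "x \<in> gtop M closure_of C"
 proof -
  obtain K where K: "closedin (gtop M) K" "C = K \<inter> S"
   using closedin_connected_components_of[OF C'] unfolding closedin_subtopology by blast
  then have "gtop M closure_of C \<subseteq> K" by (intro closure_of_minimal) auto
  then show ?thesis using that K(2) by blast
 qed
qed

lemma components_in_exists:
 assumes "x \<in> S" "S \<subseteq> points M"
 obtains C where "C \<in> components_in M S" "x \<in> C"
proof -
 have "x \<in> \<Union>(components_in M S)"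
  unfolding components_in_def Union_connected_components_of using assms by auto
 then show thesis using that by blast
qed

lemma components_in_overlap:
 assumes "C \<in> components_in M S" "C' \<in> components_in M S" "C \<inter> C' \<noteq> {}"
 shows "C = C'" using assms unfolding components_in_def by (simp add: connected_components_of_overlap)

lemma stratum_topspace: "stratum M l \<subseteq> points M"
 by (auto simp: stratum_def)

section \<open>Strata and boundary faces\<close>

locale gcm =
 fixes M :: "('m, 'p) gc_space"
 assumes mfd: "gc_manifold M"
begin

lemma max_atlas: "max_atlas M" and embedded: "embedded_faces M"
 using mfd by (simp_all add: gc_manifold_def)

lemma codim_near:
 assumes "x \<in> points M"
 obtains D where "opn M D" "x \<in> D" "\<forall>y\<in>D. codim M y \<le> codim M x"
proof -
 obtain U P \<phi> A where c: "gc_chart M U P \<phi> A" "x \<in> U" by (rule gc_chart_at[OF max_atlas assms])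
 interpret gc_chart M U P \<phi> A by (rule c(1))
 obtain V where V: "basic x V" by (rule basic_exists[OF openU c(2) c(2)])
 then have "codim M y \<le> codim M x" if "y \<in> V" for y
  using that c(2) unfolding basic_def by (intro codim_mono(1)) blast+
 then show thesis using that[of V] V unfolding basic_def by blast
qed

text \<open>Justifies the description in \<open>face_interior\<close>. A point of C lies in the
  closure of C', and codimension is upper semicontinuous, so the level of C' is at most that of C;
  by symmetry the levels agree. Components are closed in their stratum, so the point lies in
  C'.\<close>

lemma component_closure_unique:
 assumes C: "C \<in> components_in M (stratum M l)" "C' \<in> components_in M (stratum M l')"
  and eq: "gtop M closure_of C = gtop M closure_of C'"
 shows "C = C'"
proof -
 have le: "l2 \<le> l1 \<and> (\<exists>x. x \<in> C1 \<and> x \<in> gtop M closure_of C2)"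
  if C12: "C1 \<in> components_in M (stratum M l1)" "C2 \<in> components_in M (stratum M l2)"
   "gtop M closure_of C1 = gtop M closure_of C2" for C1 C2 l1 l2
 proof -
  note 1 = components_inD[OF C12(1) stratum_topspace] and 2 = components_inD[OF C12(2) stratum_topspace]
  obtain x where x: "x \<in> C1" using 1(3) by blast
  have xt: "x \<in> points M" using x subset_trans[OF 1(2) stratum_topspace] by blast
  have "C1 \<subseteq> gtop M closure_of C1" by (rule closure_of_subset[OF subset_trans[OF 1(2) stratum_topspace]])
  then have xc: "x \<in> gtop M closure_of C2" using x C12(3) by blast
  obtain D where D: "opn M D" "x \<in> D" "\<forall>y\<in>D. codim M y \<le> codim M x" by (rule codim_near[OF xt])
  then obtain y where "y \<in> C2" "y \<in> D" using xc unfolding in_closure_of by blast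
  then have "codim M y \<le> codim M x" "codim M y = l2" using D(3) 2(2) by (auto simp: stratum_def)
  moreover have "codim M x = l1" using x 1(2) by (auto simp: stratum_def)
  ultimately show ?thesis using x xc by blast
 qed
 have ll: "l = l'" using le[OF C eq] le[OF C(2,1) eq[symmetric]] by simp
 obtain x where x: "x \<in> C" "x \<in> gtop M closure_of C'" using le[OF C eq] by blast
 have "x \<in> stratum M l'" using components_inD(2)[OF C(1) stratum_topspace] x ll by blast
 then have "x \<in> C'" using components_inD(5)[OF C(2) stratum_topspace] x by blast
 then show ?thesis using components_in_overlap[of C M _ C'] C ll x by blast
qed

lemma face_interior_closure:
 assumes "C \<in> components_in M (stratum M l)"
 shows "fint M (gtop M closure_of C) = C" unfolding face_interior_def
 by (rule the_equality) (use assms component_closure_unique in blast)+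

lemma facesE:
 assumes "F \<in> faces M"
 obtains l where "fint M F \<in> components_in M (stratum M l)" "F = gtop M closure_of fint M F"
proof -
 obtain C l where C: "F = gtop M closure_of C" "C \<in> components_in M (stratum M l)"
  using assms unfolding faces_def by blast
 show thesis by (rule that[of l]) (simp_all add: C face_interior_closure[OF C(2)])
qed

lemma face_facts:
 assumes F: "F \<in> faces M"
 shows interior_subset: "fint M F \<subseteq> F" and interior_nonempty: "fint M F \<noteq> {}"
  and interior_connected: "connectedin (gtop M) (fint M F)"
  and face_closure: "F = gtop M closure_of fint M F" and face_closed: "closedin (gtop M) F"
  and face_topspace: "F \<subseteq> points M" and face_connected: "connectedin (gtop M) F"
  and interior_codim: "x \<in> fint M F \<Longrightarrow> y \<in> fint M F \<Longrightarrow> codim M x = codim M y"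
  and interior_maximal: "connectedin (gtop M) D \<Longrightarrow> x \<in> fint M F \<Longrightarrow> x \<in> D \<Longrightarrow>
   (\<forall>y\<in>D. codim M y = codim M x) \<Longrightarrow> D \<subseteq> fint M F"
proof -
 obtain l where l: "fint M F \<in> components_in M (stratum M l)" "F = gtop M closure_of fint M F"
  by (rule facesE[OF F])
 note C = components_inD[OF l(1) stratum_topspace]
 show "F = gtop M closure_of fint M F" by (rule l(2))
 then show "closedin (gtop M) F" by (metis closedin_closure_of)
 then show "F \<subseteq> points M" by (rule closedin_subset)
 have "fint M F \<subseteq> points M" by (rule subset_trans[OF C(2) stratum_topspace])
 then show "fint M F \<subseteq> F" using closure_of_subset l(2) by metis
 show "fint M F \<noteq> {}" by (rule C(3))
 show "connectedin (gtop M) (fint M F)" by (rule C(1))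
 from connectedin_closure_of[OF this] show "connectedin (gtop M) F" using l(2) by simp
 show "codim M x = codim M y" if "x \<in> fint M F" "y \<in> fint M F"
  using that C(2) by (auto simp: stratum_def)
 show "D \<subseteq> fint M F" if "connectedin (gtop M) D" "x \<in> fint M F" "x \<in> D" "\<forall>y\<in>D. codim M y = codim M x"
 proof (rule C(4)[OF that(1)])
  show "D \<subseteq> stratum M l"
   using that C(2) connectedin_subset_topspace[OF that(1)] by (auto simp: stratum_def)
 qed (use that in blast)
qed

lemma face_at:
 assumes "x \<in> points M"
 obtains F where "F \<in> faces M" "x \<in> fint M F"
proof -
 have "x \<in> stratum M (codim M x)" using assms by (simp add: stratum_def)
 then obtain C where C: "C \<in> components_in M (stratum M (codim M x))" "x \<in> C"
  using components_in_exists[OF _ stratum_topspace] by metis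
 then show thesis using that[of "gtop M closure_of C"] face_interior_closure[OF C(1)]
  by (auto simp: faces_def)
qed

lemma face_eqI:
 assumes "F \<in> faces M" "G \<in> faces M" "x \<in> fint M F" "x \<in> fint M G"
 shows "F = G"
proof -
 have "fint M F \<subseteq> fint M G"
  by (rule interior_maximal[OF assms(2) interior_connected[OF assms(1)] assms(4,3)])
   (use interior_codim[OF assms(1)] assms(3) in blast)
 moreover have "fint M G \<subseteq> fint M F"
  by (rule interior_maximal[OF assms(1) interior_connected[OF assms(2)] assms(3,4)])
   (use interior_codim[OF assms(2)] assms(4) in blast)
 ultimately show ?thesis using face_closure assms by (metis subset_antisym)
qed

end

section \<open>Boundary faces in a chart\<close>

locale gcm_chart = gcm M + gc_chart M U P \<phi> A
 for M :: "('m, 'p) gc_space" and U :: "'m set" and P :: "'p monoid" (structure)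
  and \<phi> :: "'m \<Rightarrow> 'p \<Rightarrow> real" and A :: "'p set"
begin

lemma basicD:
 assumes "basic y V"
 shows "opn M V" "y \<in> V" "V \<subseteq> U" "z \<in> V \<Longrightarrow> tau y \<subseteq> tau z"
  "mon_face T P \<Longrightarrow> tau y \<subseteq> T \<Longrightarrow> connectedin (gtop M) {z \<in> V. tau z = T}"
  "mon_face T P \<Longrightarrow> tau y \<subseteq> T \<Longrightarrow> \<exists>z\<in>V. tau z = T" using assms unfolding basic_def by blast+

text \<open>Codimension drops strictly where \<open>tau\<close> grows, so in a basic neighbourhood
  it alone recognizes the stratum of y.\<close>

lemma tau_locally_constant:
 assumes V: "basic y V" and z: "z \<in> V" "codim M z = codim M y"
 shows "tau z = tau y" using codim_mono(2)[of y z] basicD(2-4)[OF V] z by (metis less_irrefl subsetD)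

text \<open>Two different local strata adherent to \<open>x\<close> give two consistent choices of local components,
 which embeddedness forbids to lie in the same face.\<close>

lemma embedded_strata:
 assumes F: "F \<in> faces M" and V: "basic x V"
  and T: "mon_face T1 P" "tau x \<subseteq> T1" "mon_face T2 P" "tau x \<subseteq> T2"
  and sub: "{z \<in> V. tau z = T1} \<subseteq> fint M F" "{z \<in> V. tau z = T2} \<subseteq> fint M F"
 shows "T1 = T2"
proof (rule ccontr)
 assume ne: "T1 \<noteq> T2"
 obtain l where l: "fint M F \<in> components_in M (stratum M l)" by (rule facesE[OF F])
 note VD = basicD[OF V]
 have xU: "x \<in> U" using VD by blast
 have xt: "x \<in> points M" by (rule topspace_U[OF xU])
 \<comment> \<open>C is the component of the stratum in D that contains the stratum of T near
   x.\<close>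
 define Q where "Q T D C \<longleftrightarrow> C \<in> components_in M (stratum M l \<inter> D) \<and>
  (\<exists>V'. basic x V' \<and> V' \<subseteq> D \<inter> V \<and> {z \<in> V'. tau z = T} \<subseteq> C)" for T D C
 have St: "stratum M l \<inter> D \<subseteq> points M" for D by (rule subset_trans[OF Int_lower1 stratum_topspace])
 have small: "\<exists>V'. basic x V' \<and> V' \<subseteq> D \<and> V' \<subseteq> W" if "opn M D" "x \<in> D" "basic x W" for D W
 proof -
  have "opn M (D \<inter> W)" "x \<in> D \<inter> W" using that basicD(1,2)[OF that(3)] by auto
  then obtain V' where "basic x V'" "V' \<subseteq> D \<inter> W" using basic_exists[OF _ _ xU] by metis
  then show ?thesis by blast
 qed
 have strat: "{z \<in> V. tau z = T} \<subseteq> stratum M l" if "{z \<in> V. tau z = T} \<subseteq> fint M F" for T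
  using that components_inD(2)[OF l stratum_topspace] by blast
 have ex: "\<exists>C. Q T D C" if D: "opn M D" "x \<in> D" and T: "mon_face T P" "tau x \<subseteq> T"
   "{z \<in> V. tau z = T} \<subseteq> fint M F" for T D
 proof -
  obtain V' where V': "basic x V'" "V' \<subseteq> D" "V' \<subseteq> V" using small[OF D V] by blast
  let ?p = "{z \<in> V'. tau z = T}"
  obtain z where z: "z \<in> ?p" using basicD(6)[OF V'(1) T(1,2)] by blast
  have sub': "?p \<subseteq> stratum M l \<inter> D" using strat[OF T(3)] V' by blast
  obtain C where C: "C \<in> components_in M (stratum M l \<inter> D)" "z \<in> C"
   using components_in_exists[OF _ St] sub' z by blast
  have "?p \<subseteq> C"
   by (rule components_inD(4)[OF C(1) St basicD(5)[OF V'(1) T(1,2)] sub']) (use z C in blast)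
  then show ?thesis unfolding Q_def using C V' by blast
 qed
 \<comment> \<open>Components belonging to the same T share the stratum of T in a smaller
   neighbourhood. This yields consistency of the choice as well as its value on the whole
   space.\<close>
 have meet: "C \<inter> C' \<noteq> {}" if "Q T D C" "Q T D' C'" and TT: "mon_face T P" "tau x \<subseteq> T" for T D C D' C'
 proof -
  obtain V1 where V1: "basic x V1" "{z \<in> V1. tau z = T} \<subseteq> C" using \<open>Q T D C\<close> unfolding Q_def by blast
  obtain V2 where V2: "basic x V2" "{z \<in> V2. tau z = T} \<subseteq> C'" using \<open>Q T D' C'\<close> unfolding Q_def by blast
  obtain V3 where V3: "basic x V3" "V3 \<subseteq> V1" "V3 \<subseteq> V2" using small[OF basicD(1,2)[OF V1(1)] V2(1)] by blast
  obtain z where "z \<in> V3" "tau z = T" using basicD(6)[OF V3(1) TT] by blast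
  then show ?thesis using V1 V2 V3 by blast
 qed
 define c where "c T D = (SOME C. Q T D C)" for T D
 have cQ: "Q T D (c T D)" if D: "opn M D" "x \<in> D" and T: "mon_face T P" "tau x \<subseteq> T"
   "{z \<in> V. tau z = T} \<subseteq> fint M F" for T D unfolding c_def by (rule someI_ex[OF ex[OF D T]])
 have cF: "c T (points M) = fint M F" if T: "mon_face T P" "tau x \<subseteq> T"
   "{z \<in> V. tau z = T} \<subseteq> fint M F" for T
 proof -
  have "stratum M l \<inter> points M = stratum M l" by (rule Int_absorb2[OF stratum_topspace])
  then have "Q T (points M) (fint M F)" unfolding Q_def using l V T(3) openin_subset[OF VD(1)] by auto
  with cQ[OF openin_topspace xt T] have "c T (points M) \<inter> fint M F \<noteq> {}" by (rule meet[OF _ _ T(1,2)])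
  then show ?thesis
   by (rule components_in_overlap[where M = M and S = "stratum M l \<inter> points M", rotated 2])
    (use cQ[OF openin_topspace xt T] \<open>Q T (points M) (fint M F)\<close> in \<open>simp_all add: Q_def\<close>)
 qed
 have choice: "local_choice M l x (c T)" if T: "mon_face T P" "tau x \<subseteq> T"
   "{z \<in> V. tau z = T} \<subseteq> fint M F" for T unfolding local_choice_def
 proof (intro conjI allI impI; elim conjE)
  fix D assume D: "opn M D" "x \<in> D"
  note q = cQ[OF D T]
  show "c T D \<in> components_in M (stratum M l \<inter> D)" using q by (simp add: Q_def)
  show "x \<in> gtop M closure_of c T D" unfolding in_closure_of
  proof (intro conjI xt allI impI; elim conjE)
   fix D' assume D': "x \<in> D'" "opn M D'"
   obtain V1 where V1: "basic x V1" "{z \<in> V1. tau z = T} \<subseteq> c T D" using q unfolding Q_def by blast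
   obtain V3 where V3: "basic x V3" "V3 \<subseteq> D'" "V3 \<subseteq> V1" using small[OF D'(2,1) V1(1)] by blast
   obtain z where "z \<in> V3" "tau z = T" using basicD(6)[OF V3(1) T(1,2)] by blast
   then show "\<exists>y. y \<in> c T D \<and> y \<in> D'" using V1 V3 by blast
  qed
 next
  fix D D' assume D: "opn M D" "opn M D'" "x \<in> D'" "D' \<subseteq> D"
  have xD: "x \<in> D" using D by blast
  note q = cQ[OF D(1) xD T] and q' = cQ[OF D(2,3) T]
  have c1: "c T D \<in> components_in M (stratum M l \<inter> D)" and c2: "c T D' \<in> components_in M (stratum M l \<inter> D')"
   using q q' by (simp_all add: Q_def)
  show "c T D' \<subseteq> c T D" by (rule components_inD(4)[OF c1 St components_inD(1)[OF c2 St]])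
    (use components_inD(2)[OF c2 St] D(4) meet[OF q' q T(1,2)] in blast)+
 qed
 \<comment> \<open>On the connected set \<open>c T V\<close> the codimension and hence
   \<open>tau\<close> is constant. So the choices for T1 and T2 differ on V, whereas on the whole
   space both are the interior of F.\<close>
 have tauc: "tau z = T" if T: "mon_face T P" "tau x \<subseteq> T" "{z \<in> V. tau z = T} \<subseteq> fint M F"
   and z: "z \<in> c T V" for T z
 proof -
  have q: "Q T V (c T V)" by (rule cQ[OF VD(1,2) T])
  then have cc: "c T V \<in> components_in M (stratum M l \<inter> V)" by (simp add: Q_def)
  obtain V1 where V1: "basic x V1" "{z \<in> V1. tau z = T} \<subseteq> c T V" using q unfolding Q_def by blast
  obtain z1 where z1: "z1 \<in> V1" "tau z1 = T" using basicD(6)[OF V1(1) T(1,2)] by blast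
  have "tau z = tau z1"
  proof (rule locally_constant_on_connected[OF components_inD(1)[OF cc St]])
   fix y assume y: "y \<in> c T V"
   then have ys: "y \<in> stratum M l \<inter> V" using components_inD(2)[OF cc St] by blast
   then have "y \<in> U" using VD by blast
   then obtain W where W: "basic y W" using basic_exists[OF openU] by metis
   have "tau z = tau y" if "z \<in> W \<inter> c T V" for z
   proof (rule tau_locally_constant[OF W])
    have "z \<in> stratum M l" using that components_inD(2)[OF cc St] by blast
    then show "codim M z = codim M y" using ys by (simp add: stratum_def)
   qed (use that in blast)
   then show "\<exists>D. opn M D \<and> y \<in> D \<and> (\<forall>z\<in>D \<inter> c T V. tau z = tau y)" using basicD(1,2)[OF W] by blast
  qed (use z z1 V1 in blast)+
  then show ?thesis using z1 by simp
 qed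
 have "c T1 V \<noteq> c T2 V"
 proof
  assume eq: "c T1 V = c T2 V"
  have "c T1 V \<in> components_in M (stratum M l \<inter> V)" using cQ[OF VD(1,2) T(1,2) sub(1)] by (simp add: Q_def)
  then obtain z where z: "z \<in> c T1 V" using components_inD(3)[OF _ St] by blast
  then show False using tauc[OF T(1,2) sub(1) z] tauc[OF T(3,4) sub(2), of z] eq ne by simp
 qed
 moreover have "local_choice M l x (c T1)" "local_choice M l x (c T2)"
  by (rule choice[OF T(1,2) sub(1)], rule choice[OF T(3,4) sub(2)])
 ultimately have "c T1 (points M) \<noteq> c T2 (points M)"
  using embedded VD(1,2) xt unfolding embedded_faces_def by blast
 then show False using cF[OF T(1,2) sub(1)] cF[OF T(3,4) sub(2)] by simp
qed

text \<open>The face of P that corresponds to the submonoid T(F,x) of the stalk.\<close>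

definition tface :: "'m set \<Rightarrow> 'm \<Rightarrow> 'p set" where
 "tface F x = {p \<in> carrier P. \<not> (\<exists>V. opn M V \<and> x \<in> V \<and> (\<forall>z\<in>V \<inter> F. \<phi> z p = 0))}"

lemma nonvanishing_tface: "x \<in> U \<Longrightarrow> nonvanishing M F x = stalk_face x (tface F x)"
 by (rule nonvanishing_stalk[OF _ tface_def])

text \<open>By \<open>embedded_strata\<close> the interior of F meets V in one stratum only, namely
  that of any of its points y0 in V. Monomials not vanishing on F near x are those not vanishing on
  this stratum, and F near x is its closure.\<close>

lemma tface:
 assumes F: "F \<in> faces M" "x \<in> F" and V: "basic x V"
 shows "mon_face (tface F x) P" "tau x \<subseteq> tface F x" "y \<in> V \<Longrightarrow> y \<in> fint M F \<longleftrightarrow> tau y = tface F x"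
  "y \<in> V \<Longrightarrow> y \<in> F \<longleftrightarrow> tau y \<subseteq> tface F x"
proof -
 note VD = basicD[OF V]
 have xc: "x \<in> gtop M closure_of fint M F" using F face_closure by blast
 then obtain y0 where y0: "y0 \<in> fint M F" "y0 \<in> V" using VD(1,2) unfolding in_closure_of by blast
 define T where "T = tau y0"
 have T: "mon_face T P" "tau x \<subseteq> T" using y0 VD tau_face by (auto simp: T_def)
 have piece: "{z \<in> V. tau z = T'} \<subseteq> fint M F"
  if "z0 \<in> V" "tau z0 = T'" "z0 \<in> fint M F" for z0 T'
 proof (rule interior_maximal[OF F(1) _ that(3)])
  show "connectedin (gtop M) {z \<in> V. tau z = T'}" using that VD tau_face by (intro VD(5)) auto
  show "\<forall>y\<in>{z \<in> V. tau z = T'}. codim M y = codim M z0" using that VD(3) by (auto intro!: codim_eq)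
 qed (use that in simp)
 have int: "y \<in> fint M F \<longleftrightarrow> tau y = T" if y: "y \<in> V" for y
 proof
  assume yF: "y \<in> fint M F"
  show "tau y = T"
  proof (rule embedded_strata[OF F(1) V])
   show "mon_face (tau y) P" "tau x \<subseteq> tau y" using y VD tau_face by auto
  qed (use T piece y yF y0 in \<open>auto simp: T_def\<close>)
 next
  assume "tau y = T"
  then show "y \<in> fint M F" using piece[of y0 T] y y0 by (auto simp: T_def)
 qed
 have TF: "T = tface F x"
 proof (intro equalityI subsetI)
  fix p assume p: "p \<in> T"
  then have pc: "p \<in> carrier P" using mon_faceD(2)[OF T(1)] by blast
  have "\<exists>z\<in>W \<inter> F. \<phi> z p \<noteq> 0" if W: "opn M W" "x \<in> W" for W
  proof -
   have "opn M (W \<inter> V)" "x \<in> W \<inter> V" using W VD by auto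
   then obtain z where z: "z \<in> fint M F" "z \<in> W \<inter> V" using xc unfolding in_closure_of by blast
   then have "\<phi> z p \<noteq> 0" using int[of z] p pc by (auto simp: tau_iff)
   then show ?thesis using z interior_subset[OF F(1)] by blast
  qed
  then show "p \<in> tface F x" using pc unfolding tface_def by blast
 next
  fix p assume p: "p \<in> tface F x"
  then have pc: "p \<in> carrier P" by (simp add: tface_def)
  obtain z where z: "z \<in> V" "z \<in> F" "\<phi> z p \<noteq> 0" using p VD(1,2) unfolding tface_def by blast
  then have "z \<in> U" using VD by blast
  then obtain W where W: "basic z W" "W \<subseteq> V" using basic_exists[OF VD(1) z(1)] by metis
  have "z \<in> gtop M closure_of fint M F" using z face_closure[OF F(1)] by blast
  then obtain z' where z': "z' \<in> fint M F" "z' \<in> W"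
   using basicD(1,2)[OF W(1)] unfolding in_closure_of by blast
  have "p \<in> tau z" using z(3) pc by (simp add: tau_iff)
  then have "p \<in> tau z'" using basicD(4)[OF W(1) z'(2)] by blast
  moreover have "tau z' = T" using int[of z'] z' W(2) by blast
  ultimately show "p \<in> T" by simp
 qed
 show "mon_face (tface F x) P" "tau x \<subseteq> tface F x" using T TF by simp_all
 show "y \<in> fint M F \<longleftrightarrow> tau y = tface F x" if "y \<in> V" using int[OF that] TF by simp
 show "y \<in> F \<longleftrightarrow> tau y \<subseteq> tface F x" if y: "y \<in> V"
 proof
  have yU: "y \<in> U" using y VD by blast
  show "tau y \<subseteq> tface F x" if "y \<in> F"
  proof -
   obtain W where W: "basic y W" "W \<subseteq> V" using basic_exists[OF VD(1) y yU] by metis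
   have "y \<in> gtop M closure_of fint M F" using that face_closure[OF F(1)] by blast
   then obtain z' where z': "z' \<in> fint M F" "z' \<in> W"
    using basicD(1,2)[OF W(1)] unfolding in_closure_of by blast
   then show ?thesis using int[of z'] W basicD(4)[OF W(1), of z'] TF by auto
  qed
  show "y \<in> F" if sub: "tau y \<subseteq> tface F x"
  proof -
   have "\<exists>z. z \<in> fint M F \<and> z \<in> D" if D: "y \<in> D" "opn M D" for D
   proof -
    have "opn M (D \<inter> V)" "y \<in> D \<inter> V" using D VD y by auto
    then obtain W where W: "basic y W" "W \<subseteq> D \<inter> V" using basic_exists[OF _ _ yU] by metis
    obtain z where "z \<in> W" "tau z = T" using basicD(6)[OF W(1) T(1)] sub TF by blast
    then show ?thesis using int[of z] W by blast
   qed
   then have "y \<in> gtop M closure_of fint M F"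
    unfolding in_closure_of using topspace_U[OF yU] by blast
   then show ?thesis using face_closure[OF F(1)] by blast
  qed
 qed
qed

lemma basic_at: "x \<in> U \<Longrightarrow> \<exists>V. basic x V"
 using basic_exists[OF openU] by metis

lemma tface_near:
 assumes F: "F \<in> faces M" "x \<in> F" and V: "basic x V" and y: "y \<in> V" "y \<in> F"
 shows "tface F y = tface F x"
proof -
 have yU: "y \<in> U" using y basicD(3)[OF V] by blast
 obtain W where W: "basic y W" "W \<subseteq> V" using basic_exists[OF basicD(1)[OF V] y(1) yU] by metis
 obtain z where z: "z \<in> W" "tau z = tface F y"
  using basicD(6)[OF W(1)] tface(1,2)[OF F(1) y(2) W(1)] by metis
 then have "z \<in> fint M F" using tface(3)[OF F(1) y(2) W(1)] by blast
 then show ?thesis using tface(3)[OF F V, of z] z W by auto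
qed

lemma tface_interior:
 assumes "F \<in> faces M" "x \<in> fint M F" "x \<in> U"
 shows "tface F x = tau x"
 using basic_at[OF assms(3)] tface(3)[OF assms(1)] interior_subset[OF assms(1)] assms(2) basicD(2) by blast

text \<open>With \<open>tface_inj\<close> this makes the boundary faces through x correspond to the
  faces of P above \<open>tau x\<close>.\<close>

lemma tface_exists:
 assumes x: "x \<in> U" and T: "mon_face T P" "tau x \<subseteq> T"
 obtains F where "F \<in> faces M" "x \<in> F" "tface F x = T"
proof -
 obtain V where V: "basic x V" using basic_at[OF x] by blast
 note VD = basicD[OF V]
 obtain z where z: "z \<in> V" "tau z = T" using VD(6)[OF T] by blast
 then obtain F where F: "F \<in> faces M" "z \<in> fint M F" using face_at topspace_U VD(3) by blast
 have piece: "{y \<in> V. tau y = T} \<subseteq> fint M F"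
 proof (rule interior_maximal[OF F(1) VD(5)[OF T] F(2)])
  show "\<forall>y\<in>{y \<in> V. tau y = T}. codim M y = codim M z" using z VD(3) by (auto intro!: codim_eq)
 qed (use z in simp)
 have "\<exists>z. z \<in> fint M F \<and> z \<in> D" if D: "x \<in> D" "opn M D" for D
 proof -
  have "opn M (D \<inter> V)" "x \<in> D \<inter> V" using D VD by auto
  then obtain W where W: "basic x W" "W \<subseteq> D \<inter> V" using basic_exists[OF _ _ x] by metis
  then obtain y where "y \<in> W" "tau y = T" using basicD(6)[OF W(1) T] by blast
  then show ?thesis using piece W by blast
 qed
 then have "x \<in> gtop M closure_of fint M F" unfolding in_closure_of using topspace_U[OF x] by blast
 then have xF: "x \<in> F" using face_closure[OF F(1)] by blast
 have "tface F x = T" using tface(3)[OF F(1) xF V z(1)] F(2) z(2) by blast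
 then show thesis using that F(1) xF by blast
qed

lemma tface_inj:
 assumes "F \<in> faces M" "G \<in> faces M" "x \<in> F" "x \<in> G" "x \<in> U" "tface F x = tface G x"
 shows "F = G"
proof -
 obtain V where V: "basic x V" using basic_at[OF assms(5)] by blast
 obtain z where z: "z \<in> V" "tau z = tface F x"
  using basicD(6)[OF V] tface(1,2)[OF assms(1,3) V] by metis
 then show ?thesis using tface(3)[OF assms(1,3) V z(1)] tface(3)[OF assms(2,4) V z(1)] assms(6)
  by (intro face_eqI[OF assms(1,2), of z]) auto
qed

end

context gcm
begin

lemma gcm_chart_at:
 assumes "x \<in> points M"
 obtains U P \<phi> A where "gcm_chart M U P \<phi> A" "x \<in> U"
proof -
 obtain U P \<phi> A where "gc_chart M U P \<phi> A" "x \<in> U" by (rule gc_chart_at[OF max_atlas assms])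
 then show thesis using that[of U P \<phi> A] gcm_axioms by (simp add: gcm_chart_def)
qed

text \<open>Membership in F is locally constant along the interior of G: the complement of F is
  open, and near a point of F membership depends on \<open>tau\<close> only, which is constant along
  a stratum.\<close>

lemma frontier:
 assumes F: "F \<in> faces M" and G: "G \<in> faces M" and x: "x \<in> fint M G" "x \<in> F"
 shows "G \<subseteq> F"
proof -
 have "(y \<in> F) = (x \<in> F)" if y: "y \<in> fint M G" for y
 proof (rule locally_constant_on_connected[OF interior_connected[OF G] _ y x(1)])
  fix y assume y: "y \<in> fint M G"
  then have yt: "y \<in> points M" using interior_subset[OF G] face_topspace[OF G] by blast
  show "\<exists>D. opn M D \<and> y \<in> D \<and> (\<forall>z\<in>D \<inter> fint M G. (z \<in> F) = (y \<in> F))"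
  proof (cases "y \<in> F")
   case True
   obtain U P \<phi> A where c: "gcm_chart M U P \<phi> A" "y \<in> U" by (rule gcm_chart_at[OF yt])
   interpret gcm_chart M U P \<phi> A by (rule c(1))
   obtain V where V: "basic y V" using basic_at[OF c(2)] by blast
   have "z \<in> F" if z: "z \<in> V \<inter> fint M G" for z
   proof -
    have "z \<in> fint M G" "z \<in> V" using z by blast+
    then have "tau z = tau y" by (intro tau_locally_constant[OF V] interior_codim[OF G _ y])
    then show ?thesis using tface(2)[OF F True V] tface(4)[OF F True V, of z] z by auto
   qed
   then show ?thesis using True basicD(1,2)[OF V] by blast
  next
   case False
   have "opn M (points M - F)" using face_closed[OF F] by (simp add: closedin_def)
   then show ?thesis using False yt by (intro exI[of _ "points M - F"]) auto
  qed
 qed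
 then have "fint M G \<subseteq> F" using x(2) by blast
 then have "gtop M closure_of fint M G \<subseteq> F" by (intro closure_of_minimal face_closed[OF F])
 then show ?thesis using face_closure[OF G] by simp
qed

end

text \<open>The records of \<open>Defs\<close> shadow the map \<open>extend\<close> into \<open>W(F)\<close>.\<close>

hide_const (open) cat.extend complex_data.extend gc_space.extend
hide_fact (open) cat.extend_def complex_data.extend_def gc_space.extend_def

section \<open>Sections of the sharpened stalks\<close>

definition cls :: "('m, 'p) gc_space \<Rightarrow> 'm \<Rightarrow> ('m \<Rightarrow> real) \<Rightarrow> ('m \<Rightarrow> real) set set" where
 "cls M y b = quot_class (stalk M y) (Units (stalk M y)) (germ M y b)"

abbreviation (input) "repr M F x w b \<equiv> \<forall>\<^sub>F y in nbh M x. y \<in> fint M F \<longrightarrow> w y = cls M y b"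

lemma W_iff:
 "w \<in> carrier (W M F) \<longleftrightarrow> w \<in> extensional (fint M F) \<and>
  (\<forall>x\<in>fint M F. \<exists>D b. opn M D \<and> x \<in> D \<and> bfun M D b \<and>
    (\<forall>y\<in>D \<inter> fint M F. w y = cls M y b))" by (simp add: W_def cls_def)

lemma W_mult: "v \<otimes>\<^bsub>W M F\<^esub> w = (\<lambda>x\<in>fint M F. v x \<otimes>\<^bsub>sharp (stalk M x)\<^esub> w x)"
 by (simp add: W_def)

lemma W_one: "\<one>\<^bsub>W M F\<^esub> = (\<lambda>x\<in>fint M F. \<one>\<^bsub>sharp (stalk M x)\<^esub>)"
 by (simp add: W_def)

lemma W_ext:
 "v \<in> carrier (W M F) \<Longrightarrow> w \<in> carrier (W M F) \<Longrightarrow> (\<And>x. x \<in> fint M F \<Longrightarrow> v x = w x) \<Longrightarrow> v = w"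
 by (auto simp: W_iff intro: extensionalityI)

lemma quot_rel_mono: "S \<subseteq> T \<Longrightarrow> quot_rel P S \<subseteq> quot_rel P T"
 by (auto simp: quot_rel_def)

context gcm
begin

lemma comm_quot_units:
 assumes "y \<in> points M"
 shows "comm_quot (stalk M y) (Units (stalk M y))"
proof -
 obtain U P \<phi> A where c: "gcm_chart M U P \<phi> A" "y \<in> U" by (rule gcm_chart_at[OF assms])
 interpret gcm_chart M U P \<phi> A by (rule c(1))
 show ?thesis unfolding Units_stalk[OF c(2)] by (rule comm_quot_stalk_face[OF c(2) tau_face[OF c(2)]])
qed

lemma comm_monoid_sharp: "y \<in> points M \<Longrightarrow> comm_monoid (sharp (stalk M y))"
 unfolding sharp_def by (rule comm_quot.comm_monoid_mon_quot[OF comm_quot_units])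

lemma cls_mult:
 assumes "y \<in> points M" "opn M D" "y \<in> D" "bfun M D a" "opn M D'" "y \<in> D'" "bfun M D' b"
 shows "cls M y (\<lambda>z. a z * b z) = cls M y a \<otimes>\<^bsub>sharp (stalk M y)\<^esub> cls M y b" unfolding cls_def sharp_def
 by (subst comm_quot.mult_mon_quot[OF comm_quot_units])
  (use assms in \<open>auto simp: stalk_mult intro: germ_in_stalk\<close>)

lemma cls_one:
 assumes "y \<in> points M"
 shows "cls M y (\<lambda>_. 1) = \<one>\<^bsub>sharp (stalk M y)\<^esub>"
 unfolding cls_def sharp_def comm_quot.one_mon_quot[OF comm_quot_units[OF assms]] stalk_one ..

lemma cls_carrier:
 assumes "y \<in> points M" "opn M D" "y \<in> D" "bfun M D a"
 shows "cls M y a \<in> carrier (sharp (stalk M y))"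
 unfolding cls_def sharp_def comm_quot.carrier_mon_quot[OF comm_quot_units[OF assms(1)]]
 using germ_in_stalk[OF assms(2-4)] by blast

lemma interior_topspace: "F \<in> faces M \<Longrightarrow> y \<in> fint M F \<Longrightarrow> y \<in> points M"
 using interior_subset face_topspace by blast

lemma W_value:
 assumes F: "F \<in> faces M" and w: "w \<in> carrier (W M F)" and y: "y \<in> fint M F"
 shows "w y \<in> carrier (sharp (stalk M y))"
proof -
 obtain D b where "opn M D" "y \<in> D" "bfun M D b" "\<forall>z\<in>D \<inter> fint M F. w z = cls M z b"
  using w y unfolding W_iff by blast
 then show ?thesis using cls_carrier[OF interior_topspace[OF F y]] y by auto
qed

lemma comm_monoid_W:
 assumes F: "F \<in> faces M"
 shows "comm_monoid (W M F)"
proof -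
 have closed: "v \<otimes>\<^bsub>W M F\<^esub> w \<in> carrier (W M F)" if vw: "v \<in> carrier (W M F)" "w \<in> carrier (W M F)" for v w
  unfolding W_iff
 proof (intro conjI ballI)
  show "v \<otimes>\<^bsub>W M F\<^esub> w \<in> extensional (fint M F)" by (simp add: W_mult)
  fix x assume x: "x \<in> fint M F"
  obtain D b where D: "opn M D" "x \<in> D" "bfun M D b" "\<forall>z\<in>D \<inter> fint M F. v z = cls M z b"
   using vw(1) x unfolding W_iff by blast
  obtain D' b' where D': "opn M D'" "x \<in> D'" "bfun M D' b'" "\<forall>z\<in>D' \<inter> fint M F. w z = cls M z b'"
   using vw(2) x unfolding W_iff by blast
  have o: "opn M (D \<inter> D')" using D D' by blast
  have "bfun M (D \<inter> D') (\<lambda>z. b z * b' z)"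
   using D D' by (intro bfun_mult[OF max_atlas] bfun_subset[OF max_atlas _ o]) auto
  moreover have "(v \<otimes>\<^bsub>W M F\<^esub> w) z = cls M z (\<lambda>z. b z * b' z)" if "z \<in> (D \<inter> D') \<inter> fint M F" for z
   using that D D' cls_mult[of z D b D' b'] interior_topspace[OF F, of z] by (auto simp: W_mult)
  ultimately show "\<exists>D b. opn M D \<and> x \<in> D \<and> bfun M D b \<and>
    (\<forall>y\<in>D \<inter> fint M F. (v \<otimes>\<^bsub>W M F\<^esub> w) y = cls M y b)" using o D(2) D'(2) by blast
 qed
 have one: "\<one>\<^bsub>W M F\<^esub> \<in> carrier (W M F)" unfolding W_iff
 proof (intro conjI ballI)
  show "\<one>\<^bsub>W M F\<^esub> \<in> extensional (fint M F)" by (simp add: W_one)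
  fix x assume x: "x \<in> fint M F"
  show "\<exists>D b. opn M D \<and> x \<in> D \<and> bfun M D b \<and> (\<forall>y\<in>D \<inter> fint M F. \<one>\<^bsub>W M F\<^esub> y = cls M y b)"
   using interior_topspace[OF F] x bfun_one[OF max_atlas openin_topspace]
   by (intro exI[of _ "points M"] exI[of _ "\<lambda>_. 1"]) (auto simp: W_one cls_one)
 qed
 note S = comm_monoid_sharp[OF interior_topspace[OF F]] and V = W_value[OF F]
 show ?thesis
 proof
  fix x y assume x: "x \<in> carrier (W M F)" and y: "y \<in> carrier (W M F)"
  show "x \<otimes>\<^bsub>W M F\<^esub> y \<in> carrier (W M F)" by (rule closed[OF x y])
  show "x \<otimes>\<^bsub>W M F\<^esub> y = y \<otimes>\<^bsub>W M F\<^esub> x"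
   unfolding W_mult using comm_monoid.m_comm[OF S V[OF x] V[OF y]] by (auto simp: fun_eq_iff restrict_def)
  fix z assume z: "z \<in> carrier (W M F)"
  show "x \<otimes>\<^bsub>W M F\<^esub> y \<otimes>\<^bsub>W M F\<^esub> z = x \<otimes>\<^bsub>W M F\<^esub> (y \<otimes>\<^bsub>W M F\<^esub> z)"
   unfolding W_mult using monoid.m_assoc[OF comm_monoid.axioms(1)[OF S] V[OF x] V[OF y] V[OF z]]
   by (auto simp: fun_eq_iff restrict_def)
 next
  fix x assume x: "x \<in> carrier (W M F)"
  show "\<one>\<^bsub>W M F\<^esub> \<otimes>\<^bsub>W M F\<^esub> x = x" by (rule W_ext[OF closed[OF one x] x])
    (use monoid.l_one[OF comm_monoid.axioms(1)[OF S] V[OF x]] in \<open>simp add: W_mult W_one\<close>)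
  show "x \<otimes>\<^bsub>W M F\<^esub> \<one>\<^bsub>W M F\<^esub> = x" by (rule W_ext[OF closed[OF x one] x])
    (use monoid.r_one[OF comm_monoid.axioms(1)[OF S] V[OF x]] in \<open>simp add: W_mult W_one\<close>)
 qed (rule one)
qed

end

text \<open>Orders of vanishing of a class along the faces \<open>H\<close> through \<open>y\<close>. Since embeddedness makes them
 comparable at different points, they exclude monodromy of \<open>W\<close>.\<close>

definition ord_at :: "('m, 'p) gc_space \<Rightarrow> 'm \<Rightarrow> 'm set \<Rightarrow> ('m \<Rightarrow> real) set set \<Rightarrow> nat" where
 "ord_at M y H B = (LEAST n. \<exists>\<psi>\<in>duals (conormal M H y).
   (\<exists>q\<in>carrier (conormal M H y). \<psi> q \<noteq> 0) \<and>
   (\<exists>\<beta>\<in>B. \<psi> (quot_class (stalk M y) (nonvanishing M H y) \<beta>) = n))"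

context gcm_chart
begin

lemma cls_mono: "cls M y (mnl p) = kappa y p"
 by (simp add: cls_def kappa_def)

lemma cls_form:
 assumes y: "y \<in> U" and V: "opn M V" "y \<in> V" "bfun M V u" "\<forall>z\<in>V. u z > 0 \<and> b z = u z * \<phi> z p"
  and p: "p \<in> carrier P"
 shows "cls M y b = kappa y p"
proof -
 interpret S: comm_quot "stalk M y" "stalk_face y (tau y)" by (rule comm_quot_stalk_face[OF y tau_face[OF y]])
 have gb: "germ M y b = germ M y u \<otimes>\<^bsub>stalk M y\<^esub> germ M y (mnl p)"
  unfolding stalk_mult by (rule germ_eqI[OF V(1,2)]) (use V(4) in simp)
 have gu: "germ M y u \<in> stalk_face y (tau y)"
  using V(4) by (intro unit_in_stalk_face[OF tau_face[OF y] y V(1-3)]) simp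
 have gm: "germ M y (mnl p) \<in> germs M y" by (rule mono_stalk[OF y p])
 have "germ M y b \<otimes>\<^bsub>stalk M y\<^esub> \<one>\<^bsub>stalk M y\<^esub> = germ M y (mnl p) \<otimes>\<^bsub>stalk M y\<^esub> germ M y u"
  unfolding gb using gm S.S_carrier[OF gu] by (simp add: S.m_comm)
 moreover have "germ M y b \<in> germs M y" unfolding gb using gm S.S_carrier[OF gu] by (intro S.P_closed)
 ultimately have "(germ M y b, germ M y (mnl p)) \<in> quot_rel (stalk M y) (stalk_face y (tau y))"
  unfolding S.quot_rel_iff using gm gu S.one_closed by blast
 then show ?thesis unfolding cls_def kappa_def Units_stalk[OF y] by (rule S.quot_class_cong)
qed

lemma kappa_eq_iff:
 "y \<in> U \<Longrightarrow> p \<in> carrier P \<Longrightarrow> q \<in> carrier P \<Longrightarrow> kappa y p = kappa y q \<longleftrightarrow> (p, q) \<in> quot_rel P (tau y)"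
 by (rule presentsD(6)[OF kappa_presents])

lemma W_localE:
 assumes w: "w \<in> carrier (W M F)" and y: "y \<in> fint M F" "y \<in> U"
 obtains V p where "opn M V" "y \<in> V" "V \<subseteq> U" "p \<in> carrier P" "\<forall>z\<in>V \<inter> fint M F. w z = kappa z p"
proof -
 obtain D b where D: "opn M D" "y \<in> D" "bfun M D b" "\<forall>z\<in>D \<inter> fint M F. w z = cls M z b"
  using w y unfolding W_iff by blast
 obtain V p u where V: "opn M V" "y \<in> V" "V \<subseteq> D \<inter> U" "p \<in> carrier P"
  "bfun M V u" "\<forall>z\<in>V. u z > 0 \<and> b z = u z * \<phi> z p" by (rule bfun_localE[OF D(3,2) y(2)])
 have "w z = kappa z p" if "z \<in> V \<inter> fint M F" for z
 proof -
  have "z \<in> U" "z \<in> V" "z \<in> D \<inter> fint M F" using that V(3) by blast+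
  then show ?thesis using D(4) cls_form[OF _ V(1) _ V(5,6,4)] by simp
 qed
 then show thesis using that V by blast
qed

end

context gcm
begin

text \<open>An identity theorem. Near each point the sections are monomials p and p', and their
  classes at z agree or not according to \<open>tau z\<close>, which is constant along the interior
  of F.\<close>

lemma W_eqI:
 assumes F: "F \<in> faces M" and w: "w \<in> carrier (W M F)" "w' \<in> carrier (W M F)"
  and y: "y \<in> fint M F" "w y = w' y"
 shows "w = w'"
proof (rule W_ext[OF w])
 fix x assume x: "x \<in> fint M F"
 have "(w x = w' x) = (w y = w' y)"
 proof (rule locally_constant_on_connected[OF interior_connected[OF F] _ x y(1)])
  fix x assume x: "x \<in> fint M F"
  obtain U P \<phi> A where c: "gcm_chart M U P \<phi> A" "x \<in> U" by (rule gcm_chart_at[OF interior_topspace[OF F x]])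
  interpret gcm_chart M U P \<phi> A by (rule c(1))
  obtain V p where V: "opn M V" "x \<in> V" "V \<subseteq> U" "p \<in> carrier P"
   "\<forall>z\<in>V \<inter> fint M F. w z = kappa z p" by (rule W_localE[OF w(1) x c(2)])
  obtain V' p' where V': "opn M V'" "x \<in> V'" "V' \<subseteq> U" "p' \<in> carrier P"
   "\<forall>z\<in>V' \<inter> fint M F. w' z = kappa z p'" by (rule W_localE[OF w(2) x c(2)])
  have "opn M (V \<inter> V')" "x \<in> V \<inter> V'" using V V' by auto
  then obtain N where N: "basic x N" "N \<subseteq> V \<inter> V'" using basic_exists[OF _ _ c(2)] by metis
  have eq: "w z = w' z \<longleftrightarrow> (p, p') \<in> quot_rel P (tau x)" if z: "z \<in> N" "z \<in> fint M F" for z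
  proof -
   have "tau z = tau x" by (rule tau_locally_constant[OF N(1) z(1) interior_codim[OF F z(2) x]])
   moreover have "w z = kappa z p" "w' z = kappa z p'" "z \<in> U" using V V' N z by blast+
   ultimately show ?thesis using kappa_eq_iff[of z p p'] V(4) V'(4) by simp
  qed
  have "(w z = w' z) = (w x = w' x)" if "z \<in> N \<inter> fint M F" for z
   using eq[of z] eq[OF basicD(2)[OF N(1)] x] that by blast
  then show "\<exists>D. opn M D \<and> x \<in> D \<and> (\<forall>y\<in>D \<inter> fint M F. (w y = w' y) = (w x = w' x))"
   using basicD(1,2)[OF N(1)] by blast
 qed
 then show "w x = w' x" using y(2) by simp
qed

end

section \<open>Orders of vanishing in a chart\<close>

context gcm_chart
begin

definition chi :: "'m set \<Rightarrow> 'm \<Rightarrow> 'p \<Rightarrow> ('m \<Rightarrow> real) set set" where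
 "chi F x p = ncls M F x (mnl p)"

lemma tface_face:
 assumes "F \<in> faces M" "x \<in> F" "x \<in> U"
 shows "mon_face (tface F x) P" "tau x \<subseteq> tface F x"
 using basic_at[OF assms(3)] tface(1,2)[OF assms(1,2)] by blast+

lemma chi_presents:
 assumes "F \<in> faces M" "x \<in> F" "x \<in> U"
 shows "presents P (tface F x) (chi F x) (conormal M F x)"
 unfolding chi_def conormal_def nonvanishing_tface[OF assms(3)]
 by (rule stalk_presents[OF assms(3) tface_face[OF assms]])

lemma comm_quot_nonvanishing:
 assumes "F \<in> faces M" "x \<in> F" "x \<in> U"
 shows "comm_quot (stalk M x) (nonvanishing M F x)" unfolding nonvanishing_tface[OF assms(3)]
 by (rule comm_quot_stalk_face[OF assms(3) tface_face(1)[OF assms]])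

text \<open>Functionals on the conormal monoid of H are those on P that vanish on
  \<open>tface H y\<close>; the order, defined without charts, thus becomes one of P that varies
  with y only through \<open>tface H y\<close>.\<close>

lemma ord_at_kappa:
 assumes H: "H \<in> faces M" "y \<in> H" "y \<in> U" and p: "p \<in> carrier P"
 shows "ord_at M y H (kappa y p) = ord_along P (tface H y) p"
proof -
 note T = tface_face[OF H] and X = chi_presents[OF H]
 note XD = presentsD[OF X]
 interpret S: comm_quot "stalk M y" "stalk_face y (tau y)" by (rule comm_quot_stalk_face[OF H(3) tau_face[OF H(3)]])
 interpret N: comm_quot "stalk M y" "nonvanishing M H y" by (rule comm_quot_nonvanishing[OF H])
 have sub: "stalk_face y (tau y) \<subseteq> nonvanishing M H y"
  unfolding nonvanishing_tface[OF H(3)] stalk_face_def using T(2) by blast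
 \<comment> \<open>\<open>ord_at\<close> admits all representatives of a class modulo units; units
   do not vanish on H, so all of them have the same class modulo
   \<open>nonvanishing\<close>.\<close>
 have cls\<beta>: "quot_class (stalk M y) (nonvanishing M H y) \<beta> = chi H y p" if "\<beta> \<in> kappa y p" for \<beta>
 proof -
  have "(germ M y (mnl p), \<beta>) \<in> quot_rel (stalk M y) (stalk_face y (tau y))"
   using that unfolding kappa_def Units_stalk[OF H(3)] S.mem_quot_class .
  then have "(germ M y (mnl p), \<beta>) \<in> nrel M H y"
   unfolding S.quot_rel_iff N.quot_rel_iff using sub by blast
  then show ?thesis unfolding chi_def by (rule N.quot_class_cong[symmetric])
 qed
 have mem: "germ M y (mnl p) \<in> kappa y p"
  unfolding kappa_def Units_stalk[OF H(3)] S.mem_quot_class by (rule S.quot_rel_refl[OF mono_stalk[OF H(3) p]])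
 have B: "(\<exists>\<beta>\<in>kappa y p. \<psi> (quot_class (stalk M y) (nonvanishing M H y) \<beta>) = n) \<longleftrightarrow> \<psi> (chi H y p) = n" for \<psi> and n :: nat
  using cls\<beta> mem by (metis (no_types))
 have "(\<exists>\<psi>\<in>duals (conormal M H y). (\<exists>q\<in>carrier (conormal M H y). \<psi> q \<noteq> 0) \<and> \<psi> (chi H y p) = n) \<longleftrightarrow>
   (\<exists>\<theta>\<in>duals P. (\<forall>t\<in>tface H y. \<theta> t = 0) \<and> (\<exists>q\<in>carrier P. \<theta> q \<noteq> 0) \<and> \<theta> p = n)" for n
 proof
  assume "\<exists>\<psi>\<in>duals (conormal M H y). (\<exists>q\<in>carrier (conormal M H y). \<psi> q \<noteq> 0) \<and> \<psi> (chi H y p) = n"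
  then obtain \<psi> q where \<psi>: "\<psi> \<in> duals (conormal M H y)" "q \<in> carrier P" "\<psi> (chi H y q) \<noteq> 0" "\<psi> (chi H y p) = n"
   unfolding XD(3) by blast
  show "\<exists>\<theta>\<in>duals P. (\<forall>t\<in>tface H y. \<theta> t = 0) \<and> (\<exists>q\<in>carrier P. \<theta> q \<noteq> 0) \<and> \<theta> p = n"
  proof (rule bexI[of _ "dual_map P (chi H y) \<psi>"])
   show "dual_map P (chi H y) \<psi> \<in> duals P"
    by (rule presents_pull(1)[OF X comm_quot_face[OF T(1)] \<psi>(1)])
   show "(\<forall>t\<in>tface H y. dual_map P (chi H y) \<psi> t = 0) \<and> (\<exists>q\<in>carrier P. dual_map P (chi H y) \<psi> q \<noteq> 0) \<and>
     dual_map P (chi H y) \<psi> p = n"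
    using presents_kernel_zero[OF X T(1) \<psi>(1)] \<psi>(2-4) p mon_faceD(2)[OF T(1)]
    by (auto simp: dual_map_def)
  qed
 next
  assume "\<exists>\<theta>\<in>duals P. (\<forall>t\<in>tface H y. \<theta> t = 0) \<and> (\<exists>q\<in>carrier P. \<theta> q \<noteq> 0) \<and> \<theta> p = n"
  then obtain \<theta> q where \<theta>: "\<theta> \<in> duals P" "\<forall>t\<in>tface H y. \<theta> t = 0" "q \<in> carrier P" "\<theta> q \<noteq> 0" "\<theta> p = n" by blast
  obtain \<psi> where \<psi>: "\<psi> \<in> duals (conormal M H y)" "\<And>p. p \<in> carrier P \<Longrightarrow> \<psi> (chi H y p) = \<theta> p"
   by (rule presents_push[OF X comm_quot_face[OF T(1)] \<theta>(1)]) (use \<theta>(2) in auto)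
  then show "\<exists>\<psi>\<in>duals (conormal M H y). (\<exists>q\<in>carrier (conormal M H y). \<psi> q \<noteq> 0) \<and> \<psi> (chi H y p) = n"
   using \<theta>(3-5) p XD(4) by (intro bexI[of _ \<psi>] conjI bexI[of _ "chi H y q"]) auto
 qed
 then show ?thesis unfolding ord_at_def ord_along_def B by simp
qed

text \<open>The face T' found by \<open>ord_separates\<close> is that of a boundary face H, by
  \<open>tface_exists\<close>, and H contains F by \<open>frontier\<close>.\<close>

lemma ord_at_separates:
 assumes F: "F \<in> faces M" and y: "y \<in> fint M F" "y \<in> U" and p: "p \<in> carrier P" "q \<in> carrier P"
  and eq: "\<And>H. H \<in> faces M \<Longrightarrow> F \<subseteq> H \<Longrightarrow> ord_at M y H (kappa y p) = ord_at M y H (kappa y q)"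
 shows "kappa y p = kappa y q"
proof (rule ccontr)
 assume "kappa y p \<noteq> kappa y q"
 then have "(p, q) \<notin> quot_rel P (tau y)" using kappa_eq_iff y(2) p by blast
 then obtain T' where T': "mon_face T' P" "tau y \<subseteq> T'" "ord_along P T' p \<noteq> ord_along P T' q"
  by (rule ord_separates[OF tau_face[OF y(2)] p])
 obtain H where H: "H \<in> faces M" "y \<in> H" "tface H y = T'" by (rule tface_exists[OF y(2) T'(1,2)])
 have "F \<subseteq> H" by (rule frontier[OF H(1) F y(1) H(2)])
 from eq[OF H(1) this] T'(3) show False
  unfolding ord_at_kappa[OF H(1,2) y(2) p(1)] ord_at_kappa[OF H(1,2) y(2) p(2)] H(3) by simp
qed

lemma kappa_surj: "y \<in> U \<Longrightarrow> B \<in> carrier (sharp (stalk M y)) \<Longrightarrow> \<exists>p\<in>carrier P. B = kappa y p"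
 using presentsD(3)[OF kappa_presents] by blast

lemma ord_at_near:
 assumes F: "F \<in> faces M" and y: "y \<in> fint M F" and V: "basic y V" and z: "z \<in> V" "z \<in> fint M F"
  and H: "H \<in> faces M" "F \<subseteq> H" and p: "p \<in> carrier P"
 shows "ord_at M z H (kappa z p) = ord_at M y H (kappa y p)"
proof -
 have yH: "y \<in> H" "z \<in> H" using interior_subset[OF F] y z H by blast+
 have U: "y \<in> U" "z \<in> U" using basicD(2,3)[OF V] z by blast+
 show ?thesis unfolding ord_at_kappa[OF H(1) yH(1) U(1) p] ord_at_kappa[OF H(1) yH(2) U(2) p]
  by (simp add: tface_near[OF H(1) yH(1) V z(1) yH(2)])
qed

end

context gcm
begin

lemma ord_at_inj:
 assumes F: "F \<in> faces M" and y: "y \<in> fint M F"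
  and B: "B \<in> carrier (sharp (stalk M y))" "B' \<in> carrier (sharp (stalk M y))"
  and eq: "\<And>H. H \<in> faces M \<Longrightarrow> F \<subseteq> H \<Longrightarrow> ord_at M y H B = ord_at M y H B'"
 shows "B = B'"
proof -
 obtain U P \<phi> A where c: "gcm_chart M U P \<phi> A" "y \<in> U" by (rule gcm_chart_at[OF interior_topspace[OF F y]])
 interpret gcm_chart M U P \<phi> A by (rule c(1))
 obtain p q where "p \<in> carrier P" "B = kappa y p" "q \<in> carrier P" "B' = kappa y q"
  using kappa_surj[OF c(2)] B by metis
 then show ?thesis using ord_at_separates[OF F y c(2)] eq by metis
qed

text \<open>The value at y is defined outright as the class with the orders of B, without
  continuation along paths. Such a class is unique by \<open>ord_at_inj\<close>, and its existence
  spreads over the connected interior of F.\<close>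

lemma W_exists:
 assumes F: "F \<in> faces M" and x: "x \<in> fint M F" and B: "B \<in> carrier (sharp (stalk M x))"
 obtains w where "w \<in> carrier (W M F)" "w x = B"
proof -
 define match where "match y B' \<longleftrightarrow> B' \<in> carrier (sharp (stalk M y)) \<and>
  (\<forall>H\<in>faces M. F \<subseteq> H \<longrightarrow> ord_at M y H B' = ord_at M x H B)" for y B'
 have uniq: "B1 = B2" if "match y B1" "match y B2" "y \<in> fint M F" for y B1 B2
  by (rule ord_at_inj[OF F that(3)]) (use that(1,2) in \<open>simp_all add: match_def\<close>)
 \<comment> \<open>In a basic neighbourhood a fixed monomial has the same orders at y and at z, so
   the same exponents match at both points.\<close>
 have near: "match z (kappa z p) \<longleftrightarrow> match y (kappa y p)"
  if "gcm_chart M U P \<phi> A" "gc_chart.basic M U P \<phi> y V" "y \<in> fint M F" "z \<in> V" "z \<in> fint M F" "p \<in> carrier P"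
   "kappa = gc_chart.kappa M \<phi>" for U P \<phi> A V y z p kappa
 proof -
  interpret gcm_chart M U P \<phi> A by (rule that(1))
  have U: "y \<in> U" "z \<in> U" using basicD(2,3)[OF that(2)] that(4) by blast+
  show ?thesis unfolding that(7) match_def
   using ord_at_near[OF F that(3,2,4,5) _ _ that(6)] presentsD(4)[OF kappa_presents that(6)] U by auto
 qed
 have ex: "\<exists>B'. match y B'" if y: "y \<in> fint M F" for y
 proof -
  have "(\<exists>B'. match y B') = (\<exists>B'. match x B')"
  proof (rule locally_constant_on_connected[OF interior_connected[OF F] _ y x])
   fix y assume y: "y \<in> fint M F"
   obtain U P \<phi> A where c: "gcm_chart M U P \<phi> A" "y \<in> U" by (rule gcm_chart_at[OF interior_topspace[OF F y]])
   interpret gcm_chart M U P \<phi> A by (rule c(1))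
   obtain V where V: "basic y V" using basic_at[OF c(2)] by blast
   have k: "(\<exists>B'. match z B') = (\<exists>p\<in>carrier P. match z (kappa z p))" if "z \<in> U" for z
    using kappa_surj[OF that] unfolding match_def by metis
   have "(\<exists>B'. match z B') = (\<exists>B'. match y B')" if z: "z \<in> V \<inter> fint M F" for z
   proof -
    have "z \<in> U" using z basicD(3)[OF V] by blast
    then show ?thesis using near[OF c(1) V y _ _ _ refl, of z] z by (simp add: k c(2))
   qed
   then show "\<exists>D. opn M D \<and> y \<in> D \<and> (\<forall>z\<in>D \<inter> fint M F. (\<exists>B'. match z B') = (\<exists>B'. match y B'))"
    using basicD(1,2)[OF V] by blast
  qed
  moreover have "match x B" using B by (simp add: match_def)
  ultimately show ?thesis by blast
 qed
 define w where "w = (\<lambda>y\<in>fint M F. THE B'. match y B')"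
 have w: "w y = B'" if "match y B'" "y \<in> fint M F" for y B'
  unfolding w_def using that uniq by (simp add: the_equality)
 have wm: "match y (w y)" if y: "y \<in> fint M F" for y using ex[OF y] w[OF _ y] by metis
 have "w \<in> carrier (W M F)" unfolding W_iff
 proof (intro conjI ballI)
  show "w \<in> extensional (fint M F)" by (simp add: w_def)
  fix y assume y: "y \<in> fint M F"
  obtain U P \<phi> A where c: "gcm_chart M U P \<phi> A" "y \<in> U" by (rule gcm_chart_at[OF interior_topspace[OF F y]])
  interpret gcm_chart M U P \<phi> A by (rule c(1))
  obtain V where V: "basic y V" using basic_at[OF c(2)] by blast
  have "w y \<in> carrier (sharp (stalk M y))" using wm[OF y] by (simp add: match_def)
  then obtain p where p: "p \<in> carrier P" "w y = kappa y p" using kappa_surj[OF c(2)] by blast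
  have "w z = cls M z (mnl p)" if z: "z \<in> V \<inter> fint M F" for z
   unfolding cls_mono using near[OF c(1) V y _ _ p(1) refl, of z] wm[OF y] z p(2) by (intro w) auto
  moreover have "bfun M V (mnl p)"
   by (rule bfun_subset[OF max_atlas bfun_monomial[OF p(1)] basicD(1,3)[OF V]])
  ultimately show "\<exists>D b. opn M D \<and> y \<in> D \<and> bfun M D b \<and> (\<forall>z\<in>D \<inter> fint M F. w z = cls M z b)"
   using basicD(1,2)[OF V] by blast
 qed
 moreover have "w x = B" using B x by (intro w) (simp_all add: match_def)
 ultimately show thesis by (rule that)
qed

lemma near_interior:
 assumes F: "F \<in> faces M" "x \<in> F" and ev: "\<forall>\<^sub>F z in nbh M x. Q z"
 shows "\<exists>z\<in>fint M F. Q z"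
proof -
 have xt: "x \<in> points M" using F face_topspace by blast
 then obtain D where D: "opn M D" "x \<in> D" "\<forall>z\<in>D. Q z" using ev unfolding eventually_nhdsin by blast
 have "x \<in> gtop M closure_of fint M F" using F face_closure by blast
 then obtain z where "z \<in> fint M F" "z \<in> D" using D(1,2) unfolding in_closure_of by blast
 then show ?thesis using D(3) by blast
qed

text \<open>x may lie on the boundary of F; the interior still accumulates there, so agreement near
  x includes a point to which \<open>W_eqI\<close> applies.\<close>

lemma section_unique_near:
 assumes F: "F \<in> faces M" "x \<in> F" and w: "w \<in> carrier (W M F)" "w' \<in> carrier (W M F)"
  and ev: "\<forall>\<^sub>F z in nbh M x. z \<in> fint M F \<longrightarrow> w z = w' z"
 shows "w = w'"
proof -
 obtain z where "z \<in> fint M F" "z \<in> fint M F \<longrightarrow> w z = w' z" using near_interior[OF F ev] by blast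
 then show ?thesis using W_eqI[OF F(1) w] by blast
qed

lemma eventually_germ:
 assumes "\<forall>\<^sub>F z in nbh M x. a z = b z"
 shows "\<forall>\<^sub>F z in nbh M x. germ M z a = germ M z b"
proof (cases "x \<in> points M")
 case True
 then obtain D where D: "opn M D" "x \<in> D" "\<forall>z\<in>D. a z = b z"
  using assms unfolding eventually_nhdsin by blast
 have "germ M z a = germ M z b" if "z \<in> D" for z using D that by (intro germ_eqI[OF D(1)]) auto
 then show ?thesis unfolding eventually_nhdsin using D(1,2) by blast
qed (simp add: eventually_nhdsin)

end

section \<open>Global sections from monomials, and the trivialization\<close>

context gcm_chart
begin

text \<open>The classes of a monomial exist only within the chart; this is the section over the
  whole interior of F that continues them, also for x on the boundary of F.\<close>

definition omega :: "'m set \<Rightarrow> 'm \<Rightarrow> 'p \<Rightarrow> 'm \<Rightarrow> ('m \<Rightarrow> real) set set" where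
 "omega F x p = (THE w. w \<in> carrier (W M F) \<and>
  (\<forall>\<^sub>F z in nbh M x. z \<in> fint M F \<longrightarrow> w z = kappa z p))"

text \<open>In V the interior of F is a single stratum and hence connected, and whether w agrees
  with the monomial p is locally constant on it.\<close>

lemma section_monomial:
 assumes F: "F \<in> faces M" "x \<in> F" and V: "basic x V" and w: "w \<in> carrier (W M F)" and p: "p \<in> carrier P"
  and z0: "z0 \<in> V" "z0 \<in> fint M F" "w z0 = kappa z0 p" and z: "z \<in> V" "z \<in> fint M F"
 shows "w z = kappa z p"
proof -
 note VD = basicD[OF V] and T = tface[OF F(1,2) V]
 have VF: "V \<inter> fint M F = {z \<in> V. tau z = tface F x}" using T(3) by blast
 have conn: "connectedin (gtop M) (V \<inter> fint M F)" unfolding VF by (rule VD(5)[OF T(1,2)])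
 have "(w z = kappa z p) = (w z0 = kappa z0 p)"
 proof (rule locally_constant_on_connected[OF conn])
  fix y assume y: "y \<in> V \<inter> fint M F"
  then have yU: "y \<in> U" and yF: "y \<in> fint M F" using VD(3) by blast+
  obtain D q where D: "opn M D" "y \<in> D" "D \<subseteq> U" "q \<in> carrier P"
   "\<forall>z\<in>D \<inter> fint M F. w z = kappa z q" by (rule W_localE[OF w yF yU])
  have iff: "(w z = kappa z p) = ((q, p) \<in> quot_rel P (tface F x))" if "z \<in> D \<inter> (V \<inter> fint M F)" for z
  proof -
   have "z \<in> U" "w z = kappa z q" "tau z = tface F x" using that D VF by blast+
   then show ?thesis using kappa_eq_iff[of z q p] D(4) p by simp
  qed
  have "y \<in> D \<inter> (V \<inter> fint M F)" using D(2) y by blast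
  then show "\<exists>D. opn M D \<and> y \<in> D \<and>
    (\<forall>z\<in>D \<inter> (V \<inter> fint M F). (w z = kappa z p) = (w y = kappa y p))"
   using iff D(1,2) by (intro exI[of _ D] conjI ballI) simp_all
 qed (use z z0 in simp_all)
 then show ?thesis using z0 by simp
qed

lemma omega:
 assumes F: "F \<in> faces M" "x \<in> F" "x \<in> U" and p: "p \<in> carrier P"
 shows "omega F x p \<in> carrier (W M F)" and "\<forall>\<^sub>F z in nbh M x. z \<in> fint M F \<longrightarrow> omega F x p z = kappa z p"
  and "w \<in> carrier (W M F) \<Longrightarrow> \<forall>\<^sub>F z in nbh M x. z \<in> fint M F \<longrightarrow> w z = kappa z p \<Longrightarrow> omega F x p = w"
proof -
 obtain V where V: "basic x V" using basic_at[OF F(3)] by blast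
 note VD = basicD[OF V] and T = tface[OF F(1,2) V]
 obtain z0 where z0: "z0 \<in> V" "z0 \<in> fint M F" using VD(6)[OF T(1,2)] T(3) by blast
 have z0U: "z0 \<in> U" using z0 VD(3) by blast
 have "kappa z0 p \<in> carrier (sharp (stalk M z0))" by (rule presentsD(4)[OF kappa_presents[OF z0U] p])
 then obtain w where w: "w \<in> carrier (W M F)" "w z0 = kappa z0 p" by (rule W_exists[OF F(1) z0(2)])
 have "\<forall>z\<in>V \<inter> fint M F. w z = kappa z p" using section_monomial[OF F(1,2) V w(1) p z0 w(2)] by blast
 then have ev: "\<forall>\<^sub>F z in nbh M x. z \<in> fint M F \<longrightarrow> w z = kappa z p"
  unfolding eventually_nhdsin using VD(1,2) by blast
 have uniq: "w' = w" if "w' \<in> carrier (W M F)"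
   "\<forall>\<^sub>F z in nbh M x. z \<in> fint M F \<longrightarrow> w' z = kappa z p" for w'
  by (rule section_unique_near[OF F(1,2) that(1) w(1)]) (use that(2) ev in eventually_elim, simp)
 have om: "omega F x p = w" unfolding omega_def by (rule the_equality) (use w ev uniq in blast)+
 show "omega F x p \<in> carrier (W M F)" "\<forall>\<^sub>F z in nbh M x. z \<in> fint M F \<longrightarrow> omega F x p z = kappa z p"
  unfolding om using w ev by blast+
 show "omega F x p = w'" if "w' \<in> carrier (W M F)"
   "\<forall>\<^sub>F z in nbh M x. z \<in> fint M F \<longrightarrow> w' z = kappa z p" for w' using uniq[OF that] om by simp
qed

lemma eventually_U: "x \<in> U \<Longrightarrow> \<forall>\<^sub>F z in nbh M x. z \<in> U"
 unfolding eventually_nhdsin using openU by blast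

lemma eventually_tface:
 assumes F: "F \<in> faces M" "x \<in> F" "x \<in> U"
 shows "\<forall>\<^sub>F z in nbh M x. z \<in> U \<and> (z \<in> fint M F \<longrightarrow> tau z = tface F x)"
proof -
 obtain V where V: "basic x V" using basic_at[OF F(3)] by blast
 then have "\<forall>z\<in>V. z \<in> U \<and> (z \<in> fint M F \<longrightarrow> tau z = tface F x)"
  using tface(3)[OF F(1,2) V] basicD(3)[OF V] by blast
 then show ?thesis unfolding eventually_nhdsin using basicD(1,2)[OF V] by blast
qed

text \<open>P and the face are those of \<open>chi_presents\<close>; this coincidence is what makes
  \<open>extend\<close>, and with it the trivialization, an isomorphism.\<close>

lemma omega_presents:
 assumes F: "F \<in> faces M" "x \<in> F" "x \<in> U"
 shows "presents P (tface F x) (omega F x) (W M F)"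
proof -
 interpret W: comm_monoid "W M F" by (rule comm_monoid_W[OF F(1)])
 note om = omega[OF F]
 have mult: "omega F x (p \<otimes> q) = omega F x p \<otimes>\<^bsub>W M F\<^esub> omega F x q" if pq: "p \<in> carrier P" "q \<in> carrier P" for p q
 proof (rule om(3))
  show "\<forall>\<^sub>F z in nbh M x. z \<in> fint M F \<longrightarrow>
    (omega F x p \<otimes>\<^bsub>W M F\<^esub> omega F x q) z = kappa z (p \<otimes> q)"
   using om(2)[OF pq(1)] om(2)[OF pq(2)] eventually_U[OF F(3)]
   by eventually_elim (use pq presentsD(5)[OF kappa_presents] in \<open>simp add: W_mult\<close>)
 qed (use pq om(1) in auto)
 have one: "omega F x \<one> = \<one>\<^bsub>W M F\<^esub>"
 proof (rule om(3))
  show "\<forall>\<^sub>F z in nbh M x. z \<in> fint M F \<longrightarrow> \<one>\<^bsub>W M F\<^esub> z = kappa z \<one>" using eventually_U[OF F(3)]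
   by eventually_elim (use presentsD(2)[OF kappa_presents] in \<open>simp add: W_one\<close>)
 qed auto
 have surj: "\<exists>p\<in>carrier P. w = omega F x p" if w: "w \<in> carrier (W M F)" for w
 proof -
  obtain V where V: "basic x V" using basic_at[OF F(3)] by blast
  note VD = basicD[OF V] and T = tface[OF F(1,2) V]
  obtain z0 where z0: "z0 \<in> V" "tau z0 = tface F x" using VD(6)[OF T(1,2)] by blast
  then have z0F: "z0 \<in> fint M F" "z0 \<in> U" using T(3) VD(3) by blast+
  obtain p where p: "p \<in> carrier P" "w z0 = kappa z0 p" using kappa_surj[OF z0F(2) W_value[OF F(1) w z0F(1)]] by blast
  have "\<forall>z\<in>V \<inter> fint M F. w z = kappa z p"
   using section_monomial[OF F(1,2) V w p(1) z0(1) z0F(1) p(2)] by blast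
  then have "\<forall>\<^sub>F z in nbh M x. z \<in> fint M F \<longrightarrow> w z = kappa z p"
   unfolding eventually_nhdsin using VD(1,2) by blast
  then show ?thesis using om(3)[OF p(1) w] p(1) by metis
 qed
 have eq: "omega F x p = omega F x q \<longleftrightarrow> (p, q) \<in> quot_rel P (tface F x)" if pq: "p \<in> carrier P" "q \<in> carrier P" for p q
 proof -
  have "\<forall>\<^sub>F z in nbh M x. z \<in> fint M F \<longrightarrow>
    omega F x p z = kappa z p \<and> omega F x q z = kappa z q \<and> z \<in> U \<and> tau z = tface F x"
   using om(2)[OF pq(1)] om(2)[OF pq(2)] eventually_tface[OF F] by eventually_elim simp
  then obtain z where z: "z \<in> fint M F" "omega F x p z = kappa z p" "omega F x q z = kappa z q"
   "z \<in> U" "tau z = tface F x" using near_interior[OF F(1,2)] by blast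
  have "omega F x p = omega F x q \<longleftrightarrow> kappa z p = kappa z q"
   using W_eqI[OF F(1) om(1)[OF pq(1)] om(1)[OF pq(2)] z(1)] z(2,3) by metis
  then show ?thesis using kappa_eq_iff[OF z(4) pq] z(5) by simp
 qed
 have "omega F x ` carrier P = carrier (W M F)" using om(1) surj by blast
 then show ?thesis unfolding presents_def using W.comm_monoid_axioms om(1) mult one eq by (simp add: hom_def)
qed

lemma bfun_near:
 assumes D: "opn M D" "x \<in> D" "bfun M D b" and x: "x \<in> U"
 obtains p where "p \<in> carrier P" "\<forall>\<^sub>F z in nbh M x. cls M z b = kappa z p"
  "(germ M x b, germ M x (mnl p)) \<in> quot_rel (stalk M x) (Units (stalk M x))"
  "\<forall>\<^sub>F z in nbh M x. b z = 0 \<longleftrightarrow> \<phi> z p = 0"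
proof -
 obtain V p u where V: "opn M V" "x \<in> V" "V \<subseteq> D \<inter> U" "p \<in> carrier P"
  "bfun M V u" "\<forall>z\<in>V. u z > 0 \<and> b z = u z * \<phi> z p" by (rule bfun_localE[OF D(3,2) x])
 have "\<forall>z\<in>V. cls M z b = kappa z p"
 proof
  fix z assume z: "z \<in> V"
  have zU: "z \<in> U" using z V(3) by blast
  show "cls M z b = kappa z p" by (rule cls_form[OF zU V(1) z V(5,6,4)])
 qed
 then have 1: "\<forall>\<^sub>F z in nbh M x. cls M z b = kappa z p"
  unfolding eventually_nhdsin using V(1,2) by blast
 have "\<forall>z\<in>V. b z = 0 \<longleftrightarrow> \<phi> z p = 0" using V(6) by (metis mult_eq_0_iff less_irrefl)
 then have 2: "\<forall>\<^sub>F z in nbh M x. b z = 0 \<longleftrightarrow> \<phi> z p = 0" unfolding eventually_nhdsin using V(1,2) by blast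
 interpret S: comm_quot "stalk M x" "Units (stalk M x)" by (rule comm_quot_units[OF topspace_U[OF x]])
 have "kappa x p = cls M x b" using cls_form[OF x V(1,2,5,6,4)] by simp
 then have "quot_class (stalk M x) (Units (stalk M x)) (germ M x b) =
   quot_class (stalk M x) (Units (stalk M x)) (germ M x (mnl p))"
  unfolding kappa_def cls_def by (rule sym)
 then have "(germ M x b, germ M x (mnl p)) \<in> quot_rel (stalk M x) (Units (stalk M x))"
  using S.quot_class_eq_iff[OF germ_in_stalk[OF D] mono_stalk[OF x V(4)]] by blast
 then show thesis by (rule that[OF V(4) 1 _ 2])
qed

lemma bfun_chi:
 assumes F: "F \<in> faces M" "x \<in> F" "x \<in> U" and D: "opn M D" "x \<in> D" "bfun M D b"
 obtains p where "p \<in> carrier P" "\<forall>\<^sub>F z in nbh M x. cls M z b = kappa z p" "ncls M F x b = chi F x p"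
  "\<forall>\<^sub>F z in nbh M x. b z = 0 \<longleftrightarrow> \<phi> z p = 0"
proof -
 interpret S: comm_quot "stalk M x" "Units (stalk M x)" by (rule comm_quot_units[OF topspace_U[OF F(3)]])
 interpret N: comm_quot "stalk M x" "nonvanishing M F x" by (rule comm_quot_nonvanishing[OF F])
 obtain p where p: "p \<in> carrier P" "\<forall>\<^sub>F z in nbh M x. cls M z b = kappa z p"
  "(germ M x b, germ M x (mnl p)) \<in> quot_rel (stalk M x) (Units (stalk M x))"
  "\<forall>\<^sub>F z in nbh M x. b z = 0 \<longleftrightarrow> \<phi> z p = 0" by (rule bfun_near[OF D F(3)])
 have "Units (stalk M x) \<subseteq> nonvanishing M F x"
  unfolding nonvanishing_tface[OF F(3)] Units_stalk[OF F(3)] stalk_face_def using tface_face(2)[OF F] by blast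
 then have "(germ M x b, germ M x (mnl p)) \<in> nrel M F x" using p(3) quot_rel_mono by blast
 from N.quot_class_cong[OF this] show thesis unfolding chi_def[symmetric] by (rule that[OF p(1,2) _ p(4)])
qed

text \<open>The description in \<open>extend\<close> admits every representative of the class. Its
  exponent q may differ from p by elements of \<open>tface F x\<close>; on the interior of F near x
  this is \<open>tau\<close>, so q and p define the same section.\<close>

lemma extend_chi:
 assumes F: "F \<in> faces M" "x \<in> F" "x \<in> U" and p: "p \<in> carrier P"
 shows "extend M F x (chi F x p) = omega F x p" unfolding extend_def
proof (rule the_equality)
 interpret N: comm_quot "stalk M x" "nonvanishing M F x" by (rule comm_quot_nonvanishing[OF F])
 have mem: "germ M x (mnl p) \<in> chi F x p"
  unfolding chi_def N.mem_quot_class by (rule N.quot_rel_refl[OF mono_stalk[OF F(3) p]])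
 show "omega F x p \<in> carrier (W M F) \<and> (\<exists>B\<in>chi F x p. \<exists>b\<in>B. \<forall>\<^sub>F y in nbh M x.
   y \<in> fint M F \<longrightarrow> omega F x p y = quot_class (stalk M y) (Units (stalk M y)) (germ M y b))"
  using omega(1,2)[OF F p] by (intro conjI bexI[OF _ mem] bexI[of _ "mnl p"]) (simp_all add: kappa_def mem_germ)
 fix w assume "w \<in> carrier (W M F) \<and> (\<exists>B\<in>chi F x p. \<exists>b\<in>B. \<forall>\<^sub>F y in nbh M x.
   y \<in> fint M F \<longrightarrow> w y = quot_class (stalk M y) (Units (stalk M y)) (germ M y b))"
 then obtain B b where w: "w \<in> carrier (W M F)" "B \<in> chi F x p" "b \<in> B"
  "repr M F x w b" unfolding cls_def by blast
 have rel: "(germ M x (mnl p), B) \<in> nrel M F x" using w(2) unfolding chi_def N.mem_quot_class .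
 then have Bs: "B \<in> germs M x" unfolding N.quot_rel_iff by blast
 then obtain b' D where D: "B = germ M x b'" "opn M D" "x \<in> D" "bfun M D b'"
  unfolding stalk_iff by (elim exE conjE) (rule that)
 obtain q where q: "q \<in> carrier P" "\<forall>\<^sub>F z in nbh M x. cls M z b' = kappa z q"
  "ncls M F x b' = chi F x q" by (rule bfun_chi[OF F D(2-4)])
 have "chi F x p = chi F x q" using N.quot_class_cong[OF rel] D(1) q(3) by (simp add: chi_def)
 then have pq: "(p, q) \<in> quot_rel P (tface F x)" using presentsD(6)[OF chi_presents[OF F]] p q(1) by blast
 have "\<forall>\<^sub>F z in nbh M x. b z = b' z" using w(3) unfolding D(1) mem_germ germ_eq_iff .
 from eventually_germ[OF this] w(4) q(2) eventually_tface[OF F]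
 have "\<forall>\<^sub>F z in nbh M x. z \<in> fint M F \<longrightarrow> w z = kappa z p"
  by eventually_elim (metis cls_def pq kappa_eq_iff p q(1))
 then show "w = omega F x p" by (rule omega(3)[OF F p w(1), symmetric])
qed

lemma extend_iso:
 assumes F: "F \<in> faces M" "x \<in> F" "x \<in> U"
 shows "extend M F x \<in> iso (conormal M F x) (W M F)" "extend M F x \<one>\<^bsub>conormal M F x\<^esub> = \<one>\<^bsub>W M F\<^esub>"
 using presents_iso[OF chi_presents[OF F] omega_presents[OF F] comm_monoid_axioms extend_chi[OF F]] by auto

lemma triv_iso:
 assumes F: "F \<in> faces M" "x \<in> F" "x \<in> U"
 shows "triv M F x \<in> iso (dual (W M F)) (normal_monoid M F x)" unfolding triv_def normal_monoid_def
 by (rule dual_map_iso[OF presentsD(1)[OF chi_presents[OF F]] comm_monoid_W[OF F(1)] extend_iso[OF F]])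

text \<open>At interior points \<open>tface\<close> is \<open>tau\<close>, so sections and sharpened
  stalk are presented by P with the same face.\<close>

lemma eval_iso:
 assumes F: "F \<in> faces M" "x \<in> fint M F" "x \<in> U"
 shows "(\<lambda>w. w x) \<in> iso (W M F) (sharp (stalk M x))"
proof -
 have xF: "x \<in> F" using interior_subset F by blast
 have "omega F x p x = kappa x p" if p: "p \<in> carrier P" for p
 proof -
  have "\<forall>\<^sub>F z in nbh M x. z \<in> fint M F \<longrightarrow> omega F x p z = kappa z p"
   by (rule omega(2)[OF F(1) xF F(3) p])
  then show ?thesis unfolding eventually_nhdsin using F(2) topspace_U[OF F(3)] by blast
 qed
 then show ?thesis
  using presents_iso(1)[OF omega_presents[OF F(1) xF F(3)] _ comm_monoid_axioms, of "kappa x" _ "\<lambda>w. w x"]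
   kappa_presents[OF F(3)] tface_interior[OF F] by metis
qed

end

section \<open>Pull-back of sections\<close>

context gcm
begin

lemma face_chart:
 assumes "F \<in> faces M" "x \<in> F"
 obtains U P \<phi> A where "gcm_chart M U P \<phi> A" "x \<in> U"
proof -
 have "x \<in> points M" using assms face_topspace by blast
 then show thesis using gcm_chart_at that by blast
qed

lemma comm_quot_face_stalk:
 assumes F: "F \<in> faces M" "x \<in> F"
 shows "comm_quot (stalk M x) (nonvanishing M F x)"
proof -
 obtain U P \<phi> A where c: "gcm_chart M U P \<phi> A" "x \<in> U" by (rule face_chart[OF F])
 interpret gcm_chart M U P \<phi> A by (rule c(1))
 show ?thesis by (rule comm_quot_nonvanishing[OF F c(2)])
qed

lemma extend_class:
 assumes F: "F \<in> faces M" "x \<in> F" and D: "opn M D" "x \<in> D" "bfun M D b"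
 defines "w \<equiv> extend M F x (ncls M F x b)"
 shows "w \<in> carrier (W M F)" "repr M F x w b"
proof -
 obtain U P \<phi> A where c: "gcm_chart M U P \<phi> A" "x \<in> U" by (rule face_chart[OF F])
 interpret gcm_chart M U P \<phi> A by (rule c(1))
 obtain p where p: "p \<in> carrier P" "\<forall>\<^sub>F z in nbh M x. cls M z b = kappa z p"
  "ncls M F x b = chi F x p" by (rule bfun_chi[OF F c(2) D])
 have w: "w = omega F x p" unfolding w_def p(3) by (rule extend_chi[OF F c(2) p(1)])
 show "w \<in> carrier (W M F)" unfolding w by (rule omega(1)[OF F c(2) p(1)])
 show "repr M F x w b" unfolding w using omega(2)[OF F c(2) p(1)] p(2) by eventually_elim simp
qed

lemma section_local:
 assumes F: "F \<in> faces M" "x \<in> F" and w: "w \<in> carrier (W M F)"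
 obtains D b where "opn M D" "x \<in> D" "bfun M D b" "repr M F x w b"
proof -
 obtain U P \<phi> A where c: "gcm_chart M U P \<phi> A" "x \<in> U" by (rule face_chart[OF F])
 interpret gcm_chart M U P \<phi> A by (rule c(1))
 obtain p where p: "p \<in> carrier P" "w = omega F x p"
  using presentsD(3)[OF omega_presents[OF F c(2)]] w by blast
 show thesis by (rule that[OF openU c(2) bfun_monomial[OF p(1)]])
   (use omega(2)[OF F c(2) p(1)] in \<open>simp add: p(2) cls_mono\<close>)
qed

lemma conormal_class:
 assumes A: "A \<in> carrier (conormal M F x)" and F: "F \<in> faces M" "x \<in> F"
 obtains D b where "opn M D" "x \<in> D" "bfun M D b" "A = ncls M F x b"
proof -
 interpret N: comm_quot "stalk M x" "nonvanishing M F x" by (rule comm_quot_face_stalk[OF F])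
 obtain B where "B \<in> germs M x" "A = quot_class (stalk M x) (nonvanishing M F x) B"
  using A unfolding conormal_def N.carrier_mon_quot by blast
 then show thesis unfolding stalk_iff using that by blast
qed

lemma extend_bij:
 assumes F: "F \<in> faces M" "x \<in> F"
 shows "bij_betw (extend M F x) (carrier (conormal M F x)) (carrier (W M F))"
proof -
 obtain U P \<phi> A where c: "gcm_chart M U P \<phi> A" "x \<in> U" by (rule face_chart[OF F])
 interpret gcm_chart M U P \<phi> A by (rule c(1))
 show ?thesis using extend_iso(1)[OF F c(2)] by (simp add: iso_def)
qed

lemma class_in_conormal:
 assumes F: "F \<in> faces M" "x \<in> F" and D: "opn M D" "x \<in> D" "bfun M D b"
 shows "ncls M F x b \<in> carrier (conormal M F x)"
 unfolding conormal_def comm_quot.carrier_mon_quot[OF comm_quot_face_stalk[OF F]]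
 using germ_in_stalk[OF D] by blast

lemma extend_eqI:
 assumes F: "F \<in> faces M" "x \<in> F" and D: "opn M D" "x \<in> D" "bfun M D b" and w: "w \<in> carrier (W M F)"
  and ev: "repr M F x w b"
 shows "extend M F x (ncls M F x b) = w" by (rule section_unique_near[OF F extend_class(1)[OF F D] w])
  (use extend_class(2)[OF F D] ev in eventually_elim, simp)

text \<open>Injectivity of \<open>extend\<close> in terms of functions: classes along the interior
  of F determine the germ at x modulo \<open>nonvanishing\<close>, even if x lies on the boundary of
  F.\<close>

lemma cls_eq_quot_rel:
 assumes F: "F \<in> faces M" "x \<in> F" and D: "opn M D" "x \<in> D" "bfun M D b"
  and D': "opn M D'" "x \<in> D'" "bfun M D' b'"
  and ev: "\<forall>\<^sub>F z in nbh M x. z \<in> fint M F \<longrightarrow> cls M z b = cls M z b'"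
 shows "(germ M x b, germ M x b') \<in> nrel M F x"
proof -
 interpret N: comm_quot "stalk M x" "nonvanishing M F x" by (rule comm_quot_face_stalk[OF F])
 have "extend M F x (ncls M F x b) =
   extend M F x (ncls M F x b')" by (rule extend_eqI[OF F D extend_class(1)[OF F D']])
   (use extend_class(2)[OF F D'] ev in eventually_elim, simp)
 then have "ncls M F x b =
   ncls M F x b'"
  using bij_betw_imp_inj_on[OF extend_bij[OF F]] class_in_conormal[OF F D] class_in_conormal[OF F D']
  by (simp add: inj_on_def)
 then show ?thesis using N.quot_class_eq_iff[OF germ_in_stalk[OF D] germ_in_stalk[OF D']] by blast
qed

text \<open>By definition such a germ is only not identically zero on F near x. A monomial vanishes
  either everywhere or nowhere on a stratum, so b has no zeros on the interior of F near x.\<close>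

lemma nonvanishing_near:
 assumes F: "F \<in> faces M" "x \<in> F" and b: "germ M x b \<in> nonvanishing M F x"
 shows "\<forall>\<^sub>F z in nbh M x. z \<in> fint M F \<longrightarrow> b z \<noteq> 0"
proof -
 obtain U P \<phi> A where c: "gcm_chart M U P \<phi> A" "x \<in> U" by (rule face_chart[OF F])
 interpret gcm_chart M U P \<phi> A by (rule c(1))
 obtain u p V where V: "germ M x b = germ M x (\<lambda>z. u z * \<phi> z p)" "opn M V" "x \<in> V" "\<forall>z\<in>V. u z > 0"
   "p \<in> tface F x" using b unfolding nonvanishing_tface[OF c(2)] stalk_face_def by blast
 have p: "p \<in> carrier P" using V(5) by (simp add: tface_def)
 have 1: "\<forall>\<^sub>F z in nbh M x. b z = u z * \<phi> z p" using V(1) unfolding germ_eq_iff .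
 have 2: "\<forall>\<^sub>F z in nbh M x. u z > 0" unfolding eventually_nhdsin using V(2-4) by blast
 show ?thesis using 1 2 eventually_tface[OF F c(2)]
 proof eventually_elim
  case (elim z)
  show ?case
  proof
   assume "z \<in> fint M F"
   then have "p \<in> tau z" using elim(3) V(5) by simp
   then show "b z \<noteq> 0" using tau_iff[OF p] elim(1,2) by simp
  qed
 qed
qed

lemma nonvanishing_bfun:
 assumes "B \<in> nonvanishing M F x"
 obtains D b where "opn M D" "x \<in> D" "bfun M D b" "B = germ M x b"
 using assms unfolding nonvanishing_def stalk_iff by blast

lemma cls_unit:
 assumes a: "opn M D" "z \<in> D" "bfun M D a" and c: "opn M E" "z \<in> E" "bfun M E c" "c z \<noteq> 0"
 shows "cls M z (\<lambda>y. a y * c y) = cls M z a"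
proof -
 have zt: "z \<in> points M" using a openin_subset by blast
 interpret S: comm_quot "stalk M z" "Units (stalk M z)" by (rule comm_quot_units[OF zt])
 obtain U P \<phi> A where k: "gcm_chart M U P \<phi> A" "z \<in> U" by (rule gcm_chart_at[OF zt])
 interpret gcm_chart M U P \<phi> A by (rule k(1))
 have gc: "germ M z c \<in> Units (stalk M z)" using unit_germ_iff[OF k(2) c(1-3)] c(4) by blast
 have ga: "germ M z a \<in> germs M z" by (rule germ_in_stalk[OF a])
 have p: "germ M z (\<lambda>y. a y * c y) = germ M z a \<otimes>\<^bsub>stalk M z\<^esub> germ M z c" by (rule stalk_mult[symmetric])
 have pc: "germ M z (\<lambda>y. a y * c y) \<in> germs M z" unfolding p using ga S.S_carrier[OF gc] by (rule S.P_closed)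
 have "germ M z (\<lambda>y. a y * c y) \<otimes>\<^bsub>stalk M z\<^esub> \<one>\<^bsub>stalk M z\<^esub> = germ M z a \<otimes>\<^bsub>stalk M z\<^esub> germ M z c"
  using pc by (simp add: p)
 then have "(germ M z (\<lambda>y. a y * c y), germ M z a) \<in> quot_rel (stalk M z) (Units (stalk M z))"
  unfolding S.quot_rel_iff using pc ga gc S.one_closed by blast
 then show ?thesis unfolding cls_def by (rule S.quot_class_cong)
qed

end

section \<open>Interior b-maps\<close>

lemma model_bfun_local:
 assumes "\<And>x. x \<in> D \<Longrightarrow> \<exists>E. x \<in> E \<and> E \<subseteq> D \<and> model_bfun P E b"
 shows "model_bfun P D b" unfolding model_bfun_def
proof
 fix x assume "x \<in> D"
 then obtain E where E: "x \<in> E" "E \<subseteq> D" "model_bfun P E b" using assms by blast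
 from E(3)[unfolded model_bfun_def, rule_format, OF E(1)]
 show "\<exists>V p h. mopn P V \<and> x \<in> V \<and> V \<subseteq> D \<and> p \<in> carrier P \<and> model_smooth P V h \<and>
   (\<forall>y\<in>V. h y > 0 \<and> b y = h y * y p)"
  by (elim exE conjE) (intro exI conjI; (rule subset_trans[OF _ E(2)])?; assumption)
qed

text \<open>Frees the condition from the charts of M, so that composites can be treated by pulling
  b-functions back twice.\<close>

lemma interior_bmapI:
 assumes M: "max_atlas M" and N: "max_atlas N"
  and f: "f \<in> extensional (points M)" "continuous_map (gtop M) (gtop N) f"
  and loc: "\<And>x V Q \<psi> q. x \<in> points M \<Longrightarrow> (V, Q, \<psi>) \<in> charts N \<Longrightarrow> f x \<in> V \<Longrightarrow> q \<in> carrier Q \<Longrightarrow>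
   \<exists>D. opn M D \<and> x \<in> D \<and> bfun M D (\<lambda>z. \<psi> (f z) q)"
 shows "f \<in> interior_bmap M N"
proof -
 have "model_bmap P (\<phi> ` (U \<inter> f -` V)) Q (\<psi> \<circ> f \<circ> inv_into U \<phi>)"
  if c: "(U, P, \<phi>) \<in> charts M" "(V, Q, \<psi>) \<in> charts N" for U P \<phi> V Q \<psi>
 proof -
  interpret C: gc_chart0 M U P \<phi> by unfold_locales (rule M c)+
  interpret E: gc_chart0 N V Q \<psi> by unfold_locales (rule N c)+
  show ?thesis unfolding model_bmap_def
  proof (intro conjI ballI)
   show "(\<psi> \<circ> f \<circ> inv_into U \<phi>) ` \<phi> ` (U \<inter> f -` V) \<subseteq> model_space Q" using E.chart_model_space by auto
   fix q assume q: "q \<in> carrier Q"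
   show "model_bfun P (\<phi> ` (U \<inter> f -` V)) (\<lambda>y. (\<psi> \<circ> f \<circ> inv_into U \<phi>) y q)"
   proof (rule model_bfun_local)
    fix y assume "y \<in> \<phi> ` (U \<inter> f -` V)"
    then obtain x where x: "y = \<phi> x" "x \<in> U" "f x \<in> V" by blast
    have xt: "x \<in> points M" using x(2) openin_subset[OF C.openU] by blast
    obtain D where D: "opn M D" "x \<in> D" "bfun M D (\<lambda>z. \<psi> (f z) q)" using loc[OF xt c(2) x(3) q] by blast
    have o: "opn M {z \<in> points M. f z \<in> V}"
     by (rule openin_continuous_map_preimage[OF f(2) E.openU])
    then have o': "opn M (D \<inter> {z \<in> points M. f z \<in> V})" using D(1) by blast
    have "model_bfun P (\<phi> ` (D \<inter> {z \<in> points M. f z \<in> V} \<inter> U)) ((\<lambda>z. \<psi> (f z) q) \<circ> inv_into U \<phi>)"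
     by (rule C.bfunD[OF bfun_subset[OF M D(3) o' Int_lower1]])
    moreover have "((\<lambda>z. \<psi> (f z) q) \<circ> inv_into U \<phi>) = (\<lambda>y. (\<psi> \<circ> f \<circ> inv_into U \<phi>) y q)" by (simp add: fun_eq_iff)
    ultimately show "\<exists>E. y \<in> E \<and> E \<subseteq> \<phi> ` (U \<inter> f -` V) \<and> model_bfun P E (\<lambda>y. (\<psi> \<circ> f \<circ> inv_into U \<phi>) y q)"
     using x xt D(2) by (intro exI[of _ "\<phi> ` (D \<inter> {z \<in> points M. f z \<in> V} \<inter> U)"] conjI) auto
   qed
  qed
 qed
 then show ?thesis unfolding interior_bmap_def using f by blast
qed

lemma identity_bmap:
 assumes M: "max_atlas M"
 shows "(\<lambda>x\<in>points M. x) \<in> interior_bmap M M"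
proof (rule interior_bmapI[OF M M])
 show "continuous_map (gtop M) (gtop M) (\<lambda>x\<in>points M. x)"
  by (rule continuous_map_eq[OF continuous_map_id]) simp
 fix x V Q \<psi> q assume x: "x \<in> points M" "(V, Q, \<psi>) \<in> charts M" "(\<lambda>x\<in>points M. x) x \<in> V" "q \<in> carrier Q"
 interpret gc_chart0 M V Q \<psi> by unfold_locales (rule M x)+
 have "bfun M V (\<lambda>z. \<psi> ((\<lambda>x\<in>points M. x) z) q)"
  by (rule bfun_cong[OF M bfun_monomial[OF x(4)]]) (use openin_subset[OF openU] in auto)
 then show "\<exists>D. opn M D \<and> x \<in> D \<and> bfun M D (\<lambda>z. \<psi> ((\<lambda>x\<in>points M. x) z) q)" using x openU by auto
qed simp

section \<open>Interior b-maps acting on germs\<close>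

locale gcm_map = M: gcm M + N: gcm N
 for M :: "('m, 'p) gc_space" and N :: "('n, 'q) gc_space" +
 fixes f :: "'m \<Rightarrow> 'n"
 assumes bmap: "f \<in> interior_bmap M N"
begin

lemma cont: "continuous_map (gtop M) (gtop N) f"
 using bmap by (simp add: interior_bmap_def)

lemma f_ext: "f \<in> extensional (points M)"
 using bmap by (simp add: interior_bmap_def)

lemma f_top: "x \<in> points M \<Longrightarrow> f x \<in> points N"
 using continuous_map_image_subset_topspace[OF cont] by blast

lemma open_pre: "opn N D \<Longrightarrow> opn M {z \<in> points M. f z \<in> D}"
 by (rule openin_continuous_map_preimage[OF cont])

lemma eventually_pull:
 assumes x: "x \<in> points M" and ev: "\<forall>\<^sub>F y in nbh N (f x). Q y"
 shows "\<forall>\<^sub>F z in nbh M x. Q (f z)"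
proof -
 obtain D where D: "opn N D" "f x \<in> D" "\<forall>y\<in>D. Q y"
  using ev f_top[OF x] unfolding eventually_nhdsin by blast
 then show ?thesis unfolding eventually_nhdsin
  using open_pre[OF D(1)] x by (intro disjI2 exI[of _ "{z \<in> points M. f z \<in> D}"]) auto
qed

lemma pull_germ_germ:
 assumes x: "x \<in> points M"
 shows "pull_germ M f x (germ N (f x) b) = germ M x (b \<circ> f)"
proof -
 have "germ M x (c \<circ> f) = germ M x (b \<circ> f)" if "c \<in> germ N (f x) b" for c
  unfolding germ_eq_iff using eventually_pull[OF x, of "\<lambda>y. c y = b y"] that by (simp add: germ_def)
 moreover have "b \<in> germ N (f x) b" by (simp add: mem_germ)
 ultimately show ?thesis unfolding pull_germ_def by blast
qed

lemma bfun_pull: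
 assumes D: "opn N D" "f x \<in> D" "bfun N D b" and x: "x \<in> points M"
 obtains E where "opn M E" "x \<in> E" "f ` E \<subseteq> D" "bfun M E (b \<circ> f)"
proof -
 obtain U P \<phi> where c: "gc_chart0 M U P \<phi>" "x \<in> U" by (rule chart_at[OF M.max_atlas x])
 obtain V Q \<psi> where d: "gc_chart0 N V Q \<psi>" "f x \<in> V" by (rule chart_at[OF N.max_atlas f_top[OF x]])
 interpret C: gc_chart0 M U P \<phi> by (rule c(1))
 interpret E: gc_chart0 N V Q \<psi> by (rule d(1))
 define E where "E = U \<inter> {z \<in> points M. f z \<in> D \<inter> V}"
 have "opn N (D \<inter> V)" using D(1) E.openU by blast
 from open_pre[OF this] C.openU have E: "opn M E" unfolding E_def by blast
 have EU: "E \<subseteq> U" "E \<subseteq> U \<inter> f -` V" unfolding E_def by blast+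
 have oE: "mopn P (\<phi> ` E)" by (rule C.open_image[OF E EU(1)])
 have "model_bmap P (\<phi> ` (U \<inter> f -` V)) Q (\<psi> \<circ> f \<circ> inv_into U \<phi>)"
  using bmap C.chart E.chart unfolding interior_bmap_def by blast
 from model_bmap_subset[OF this oE image_mono[OF EU(2)]]
 have m: "model_bmap P (\<phi> ` E) Q (\<psi> \<circ> f \<circ> inv_into U \<phi>)" .
 have "(\<psi> \<circ> f \<circ> inv_into U \<phi>) ` \<phi> ` E \<subseteq> \<psi> ` (D \<inter> V)" unfolding E_def by auto
 from model_bfun_pullback[OF m oE E.bfunD[OF D(3)] this]
 have k: "model_bfun P (\<phi> ` E) (b \<circ> inv_into V \<psi> \<circ> (\<psi> \<circ> f \<circ> inv_into U \<phi>))" .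
 have "bfun M E (b \<circ> f)" by (rule C.bfun_chartI[OF E EU(1) k]) (auto simp: E_def)
 then show thesis using E x c(2) d(2) D(2) by (intro that[of E]) (auto simp: E_def)
qed

lemma pull_in_stalk:
 assumes x: "x \<in> points M" and B: "B \<in> germs N (f x)"
 shows "pull_germ M f x B \<in> germs M x"
proof -
 obtain b D where D: "B = germ N (f x) b" "opn N D" "f x \<in> D" "bfun N D b" using B unfolding stalk_iff by blast
 obtain E where E: "opn M E" "x \<in> E" "bfun M E (b \<circ> f)" by (rule bfun_pull[OF D(2-4) x])
 show ?thesis unfolding D(1) pull_germ_germ[OF x] by (rule germ_in_stalk[OF E])
qed

end

context gcm
begin

lemma triv_inj:
 assumes F: "F \<in> faces M" "x \<in> F" and \<phi>: "\<phi> \<in> duals (W M F)" "\<psi> \<in> duals (W M F)"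
  and eq: "triv M F x \<phi> = triv M F x \<psi>"
 shows "\<phi> = \<psi>"
proof -
 obtain U P \<xi> A where c: "gcm_chart M U P \<xi> A" "x \<in> U" by (rule face_chart[OF F])
 interpret gcm_chart M U P \<xi> A by (rule c(1))
 have "inj_on (triv M F x) (duals (W M F))"
  using triv_iso[OF F c(2)] by (simp add: iso_def bij_betw_def)
 then show ?thesis using \<phi> eq by (simp add: inj_on_def)
qed

lemma interior_face: "F \<in> faces M \<Longrightarrow> x \<in> fint M F \<Longrightarrow> x \<in> F"
 using interior_subset by blast

end

definition dual_hom :: "'a monoid \<Rightarrow> 'b monoid \<Rightarrow> ('a \<Rightarrow> 'b) \<Rightarrow> ('b \<Rightarrow> nat) \<Rightarrow> 'a \<Rightarrow> nat" where
 "dual_hom R R' h = (\<lambda>\<phi>\<in>duals R'. dual_map R h \<phi>)"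

lemma mon_homD:
 assumes "h \<in> mon_hom P Q"
 shows "h \<in> hom P Q" "h \<one>\<^bsub>P\<^esub> = \<one>\<^bsub>Q\<^esub>" "h \<in> extensional (carrier P)" "p \<in> carrier P \<Longrightarrow> h p \<in> carrier Q"
 using assms by (auto simp: mon_hom_def hom_def)

section \<open>Uniqueness and existence of the pull-back of sections\<close>

context gcm_map
begin

text \<open>The image of the interior of \<open>F\<close> need not meet that of \<open>G\<close>, so sections over the two are
 compared through b-functions.\<close>

definition sect where
 "sect F G x w v \<longleftrightarrow> (\<exists>D b. opn N D \<and> f x \<in> D \<and> bfun N D b \<and>
   (repr N G (f x) w b) \<and>
   (repr M F x v (b \<circ> f)))"

text \<open>The condition for the pull-back of germs to descend to B/T(G, f x) and B/T(F, x). It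
  holds for F and its image face, for the identity if G is contained in F, and it is inherited by
  smaller G.\<close>

definition adm where
 "adm F G x \<longleftrightarrow> F \<in> faces M \<and> G \<in> faces N \<and> x \<in> F \<and> f x \<in> G \<and>
   (\<forall>B\<in>nonvanishing N G (f x). pull_germ M f x B \<in> nonvanishing M F x)"

lemma admD:
 assumes "adm F G x"
 shows "F \<in> faces M" "G \<in> faces N" "x \<in> F" "f x \<in> G" "x \<in> points M"
  "B \<in> nonvanishing N G (f x) \<Longrightarrow> pull_germ M f x B \<in> nonvanishing M F x"
 using assms M.face_topspace[of F] by (auto simp: adm_def)

lemma sect_by:
 assumes a: "adm F G x" and D: "opn N D" "f x \<in> D" "bfun N D b" and w: "repr N G (f x) w b"
 shows "extend M F x (ncls M F x (b \<circ> f)) \<in> carrier (W M F)"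
  "sect F G x w (extend M F x (ncls M F x (b \<circ> f)))"
proof -
 note A = admD[OF a]
 obtain E where E: "opn M E" "x \<in> E" "bfun M E (b \<circ> f)" by (rule bfun_pull[OF D A(5)])
 note X = M.extend_class[OF A(1,3) E]
 show "extend M F x (ncls M F x (b \<circ> f)) \<in> carrier (W M F)" by (rule X(1))
 show "sect F G x w (extend M F x (ncls M F x (b \<circ> f)))" unfolding sect_def using D w X(2) by blast
qed

lemma sect_exists:
 assumes a: "adm F G x" and w: "w \<in> carrier (W N G)"
 shows "\<exists>v\<in>carrier (W M F). sect F G x w v"
proof -
 obtain D b where D: "opn N D" "f x \<in> D" "bfun N D b" "repr N G (f x) w b"
  by (rule N.section_local[OF admD(2,4)[OF a] w])
 show ?thesis using sect_by[OF a D] by blast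
qed

text \<open>Two b-functions representing w agree after multiplication with factors c and c' that do
  not vanish on G, by \<open>cls_eq_quot_rel\<close>. Admissibility keeps c and c', composed with f,
  free of zeros on the interior of F near x; there they are units and do not change the
  classes.\<close>

lemma sect_unique:
 assumes a: "adm F G x" and s: "sect F G x w v" "sect F G x w v'" and v: "v \<in> carrier (W M F)" "v' \<in> carrier (W M F)"
 shows "v = v'"
proof -
 note A = admD[OF a]
 obtain D b where D: "opn N D" "f x \<in> D" "bfun N D b" and wb: "repr N G (f x) w b"
  and vb: "repr M F x v (b \<circ> f)" using s(1) unfolding sect_def by blast
 obtain D' b' where D': "opn N D'" "f x \<in> D'" "bfun N D' b'" and wb': "repr N G (f x) w b'"
  and vb': "repr M F x v' (b' \<circ> f)" using s(2) unfolding sect_def by blast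
 have "\<forall>\<^sub>F y in nbh N (f x). y \<in> fint N G \<longrightarrow> cls N y b = cls N y b'"
  using wb wb' by eventually_elim simp
 from N.cls_eq_quot_rel[OF A(2,4) D D' this]
 obtain C C' where C: "C \<in> nonvanishing N G (f x)" "C' \<in> nonvanishing N G (f x)"
  "germ N (f x) b \<otimes>\<^bsub>stalk N (f x)\<^esub> C = germ N (f x) b' \<otimes>\<^bsub>stalk N (f x)\<^esub> C'"
  unfolding quot_rel_def by blast
 obtain E c where E: "opn N E" "f x \<in> E" "bfun N E c" "C = germ N (f x) c" by (rule N.nonvanishing_bfun[OF C(1)])
 obtain E' c' where E': "opn N E'" "f x \<in> E'" "bfun N E' c'" "C' = germ N (f x) c'" by (rule N.nonvanishing_bfun[OF C(2)])
 have "germ N (f x) (\<lambda>y. b y * c y) = germ N (f x) (\<lambda>y. b' y * c' y)" using C(3) unfolding E(4) E'(4) stalk_mult .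
 then have "germ M x ((\<lambda>y. b y * c y) \<circ> f) = germ M x ((\<lambda>y. b' y * c' y) \<circ> f)"
  unfolding pull_germ_germ[OF A(5), symmetric] by simp
 then have "\<forall>\<^sub>F z in nbh M x. b (f z) * c (f z) = b' (f z) * c' (f z)" unfolding germ_eq_iff by simp
 from M.eventually_germ[OF this]
 have g: "\<forall>\<^sub>F z in nbh M x. germ M z (\<lambda>z. b (f z) * c (f z)) = germ M z (\<lambda>z. b' (f z) * c' (f z))" .
 have nv: "\<forall>\<^sub>F z in nbh M x. z \<in> fint M F \<longrightarrow> c (f z) \<noteq> 0"
  using M.nonvanishing_near[OF A(1,3), of "c \<circ> f"] A(6)[OF C(1)] unfolding E(4) pull_germ_germ[OF A(5)] by simp
 have nv': "\<forall>\<^sub>F z in nbh M x. z \<in> fint M F \<longrightarrow> c' (f z) \<noteq> 0"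
  using M.nonvanishing_near[OF A(1,3), of "c' \<circ> f"] A(6)[OF C(2)] unfolding E'(4) pull_germ_germ[OF A(5)] by simp
 have unit: "\<forall>\<^sub>F z in nbh M x. z \<in> fint M F \<longrightarrow> cls M z (\<lambda>z. b (f z) * c (f z)) = cls M z (b \<circ> f)"
  if D: "opn N D" "f x \<in> D" "bfun N D b" and E: "opn N E" "f x \<in> E" "bfun N E c"
   and nv: "\<forall>\<^sub>F z in nbh M x. z \<in> fint M F \<longrightarrow> c (f z) \<noteq> 0" for D b E c
 proof -
  obtain D1 where D1: "opn M D1" "x \<in> D1" "bfun M D1 (b \<circ> f)" by (rule bfun_pull[OF D A(5)])
  obtain E1 where E1: "opn M E1" "x \<in> E1" "bfun M E1 (c \<circ> f)" by (rule bfun_pull[OF E A(5)])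
  have "\<forall>\<^sub>F z in nbh M x. z \<in> D1" "\<forall>\<^sub>F z in nbh M x. z \<in> E1"
   unfolding eventually_nhdsin using D1 E1 by blast+
  then show ?thesis using nv
  proof eventually_elim
   case (elim z)
   show ?case
   proof
    assume "z \<in> fint M F"
    then have "(c \<circ> f) z \<noteq> 0" using elim by simp
    from M.cls_unit[OF D1(1) elim(1) D1(3) E1(1) elim(2) E1(3) this]
    show "cls M z (\<lambda>z. b (f z) * c (f z)) = cls M z (b \<circ> f)" by simp
   qed
  qed
 qed
 have "\<forall>\<^sub>F z in nbh M x. z \<in> fint M F \<longrightarrow> v z = v' z"
  using vb vb' g unit[OF D E(1-3) nv] unit[OF D' E'(1-3) nv'] by eventually_elim (simp add: cls_def)
 then show ?thesis by (rule M.section_unique_near[OF A(1,3) v])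
qed

text \<open>The same b-function serves at all nearby base points.\<close>

lemma sect_near:
 assumes x: "x \<in> points M" and s: "sect F G x w v"
 shows "\<exists>E. opn M E \<and> x \<in> E \<and> (\<forall>x'\<in>E. sect F G x' w v)"
proof -
 obtain D b where D: "opn N D" "f x \<in> D" "bfun N D b" and wb: "repr N G (f x) w b"
  and vb: "repr M F x v (b \<circ> f)" using s unfolding sect_def by blast
 obtain O1 where O1: "opn N O1" "f x \<in> O1" "\<forall>y\<in>O1. y \<in> fint N G \<longrightarrow> w y = cls N y b"
  using wb f_top[OF x] unfolding eventually_nhdsin by blast
 obtain O2 where O2: "opn M O2" "x \<in> O2" "\<forall>z\<in>O2. z \<in> fint M F \<longrightarrow> v z = cls M z (b \<circ> f)"
  using vb x unfolding eventually_nhdsin by blast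
 define E where "E = O2 \<inter> {z \<in> points M. f z \<in> D \<inter> O1}"
 have E: "opn M E" "x \<in> E" unfolding E_def using O2 open_pre[of "D \<inter> O1"] D O1 x by auto
 have "sect F G x' w v" if "x' \<in> E" for x'
 proof -
  have "f x' \<in> D" "f x' \<in> O1" "x' \<in> O2" using that unfolding E_def by blast+
  then show ?thesis unfolding sect_def eventually_nhdsin using D(1,3) O1(1,3) O2(1,3) by blast
 qed
 then show ?thesis using E by blast
qed

lemma sect_mult:
 assumes F: "F \<in> faces M" "G \<in> faces N" and x: "x \<in> points M"
  and s: "sect F G x w v" and s': "sect F G x w' v'"
 shows "sect F G x (w \<otimes>\<^bsub>W N G\<^esub> w') (v \<otimes>\<^bsub>W M F\<^esub> v')"
proof -
 obtain D b where D: "opn N D" "f x \<in> D" "bfun N D b" and wb: "repr N G (f x) w b"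
  and vb: "repr M F x v (b \<circ> f)" using s unfolding sect_def by blast
 obtain D' b' where D': "opn N D'" "f x \<in> D'" "bfun N D' b'" and wb': "repr N G (f x) w' b'"
  and vb': "repr M F x v' (b' \<circ> f)" using s' unfolding sect_def by blast
 obtain E where E: "opn M E" "x \<in> E" "bfun M E (b \<circ> f)" by (rule bfun_pull[OF D x])
 obtain E' where E': "opn M E'" "x \<in> E'" "bfun M E' (b' \<circ> f)" by (rule bfun_pull[OF D' x])
 have o: "opn N (D \<inter> D')" using D D' by blast
 have b: "bfun N (D \<inter> D') (\<lambda>y. b y * b' y)"
  by (rule bfun_mult[OF N.max_atlas bfun_subset[OF N.max_atlas D(3) o] bfun_subset[OF N.max_atlas D'(3) o]]) simp_all
 have "\<forall>\<^sub>F y in nbh N (f x). y \<in> D \<inter> D'" unfolding eventually_nhdsin using o D(2) D'(2) by blast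
 then have w: "repr N G (f x) (w \<otimes>\<^bsub>W N G\<^esub> w') (\<lambda>y. b y * b' y)" using wb wb'
 proof eventually_elim
  case (elim y)
  show ?case
  proof
   assume y: "y \<in> fint N G"
   have "y \<in> points N" by (rule N.interior_topspace[OF F(2) y])
   from N.cls_mult[OF this D(1) _ D(3) D'(1) _ D'(3)]
   show "(w \<otimes>\<^bsub>W N G\<^esub> w') y = cls N y (\<lambda>y. b y * b' y)" using y elim by (simp add: W_mult)
  qed
 qed
 have "\<forall>\<^sub>F z in nbh M x. z \<in> E" "\<forall>\<^sub>F z in nbh M x. z \<in> E'"
  unfolding eventually_nhdsin using E E' by blast+
 then have v: "repr M F x (v \<otimes>\<^bsub>W M F\<^esub> v') ((\<lambda>y. b y * b' y) \<circ> f)" using vb vb'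
 proof eventually_elim
  case (elim y)
  show ?case
  proof
   assume y: "y \<in> fint M F"
   have "y \<in> points M" by (rule M.interior_topspace[OF F(1) y])
   from M.cls_mult[OF this E(1) _ E(3) E'(1) _ E'(3)]
   show "(v \<otimes>\<^bsub>W M F\<^esub> v') y = cls M y ((\<lambda>y. b y * b' y) \<circ> f)" using y elim by (simp add: W_mult o_def)
  qed
 qed
 show ?thesis unfolding sect_def using o D(2) D'(2) b w v by blast
qed

lemma sect_one:
 assumes F: "F \<in> faces M" "G \<in> faces N" and x: "x \<in> points M"
 shows "sect F G x \<one>\<^bsub>W N G\<^esub> \<one>\<^bsub>W M F\<^esub>"
proof -
 have 1: "\<one>\<^bsub>W N G\<^esub> y = cls N y (\<lambda>_. 1)" if "y \<in> fint N G" for y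
  using N.cls_one[OF N.interior_topspace[OF F(2) that]] that by (simp add: W_one)
 have 2: "\<one>\<^bsub>W M F\<^esub> y = cls M y ((\<lambda>_. 1) \<circ> f)" if "y \<in> fint M F" for y
  using M.cls_one[OF M.interior_topspace[OF F(1) that]] that by (simp add: W_one o_def)
 show ?thesis unfolding sect_def
  by (intro exI[of _ "points N"] exI[of _ "\<lambda>_. 1"] conjI f_top[OF x] bfun_one[OF N.max_atlas openin_topspace])
   (simp_all add: 1 2)
qed

definition pulls where
 "pulls F G x r \<longleftrightarrow> r \<in> mon_hom (W N G) (W M F) \<and> (\<forall>w\<in>carrier (W N G). sect F G x w (r w))"

lemma pulls_unique:
 assumes a: "adm F G x" and r: "pulls F G x r" "pulls F G x r'"
 shows "r = r'"
proof (rule extensionalityI)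
 note 1 = mon_homD[OF conjunct1[OF r(1)[unfolded pulls_def]]] and 2 = mon_homD[OF conjunct1[OF r(2)[unfolded pulls_def]]]
 show "r \<in> extensional (carrier (W N G))" "r' \<in> extensional (carrier (W N G))" by (rule 1 2)+
 fix w assume w: "w \<in> carrier (W N G)"
 show "r w = r' w" by (rule sect_unique[OF a _ _ 1(4)[OF w] 2(4)[OF w], where w = w]) (use r w in \<open>simp_all add: pulls_def\<close>)
qed

text \<open>C is F for \<open>natural_hom\<close>, but only the smaller face G for
  \<open>face_arrow\<close>. On C the pulled back section is locally constant by
  \<open>sect_near\<close>; multiplicativity follows from uniqueness at a single x0.\<close>

lemma pulls_exists:
 assumes C: "connectedin (gtop M) C" "C \<noteq> {}" and a: "\<And>x. x \<in> C \<Longrightarrow> adm F G x"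
 obtains r where "\<forall>x\<in>C. pulls F G x r"
proof -
 obtain x0 where x0: "x0 \<in> C" using C(2) by blast
 note A0 = admD[OF a[OF x0]]
 interpret WN: comm_monoid "W N G" by (rule N.comm_monoid_W[OF A0(2)])
 interpret WM: comm_monoid "W M F" by (rule M.comm_monoid_W[OF A0(1)])
 define g where "g w x = (THE v. v \<in> carrier (W M F) \<and> sect F G x w v)" for w x
 have gI: "g w x = v" if "x \<in> C" "v \<in> carrier (W M F)" "sect F G x w v" for w x v
  unfolding g_def by (rule the_equality) (use that sect_unique[OF a[OF that(1)]] in blast)+
 define r where "r = (\<lambda>w\<in>carrier (W N G). g w x0)"
 have r: "r w \<in> carrier (W M F)" "sect F G x w (r w)" if w: "w \<in> carrier (W N G)" and x: "x \<in> C" for w x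
 proof -
  obtain v where v: "v \<in> carrier (W M F)" "sect F G x w v" using sect_exists[OF a[OF x] w] by blast
  have "g w x = g w x0"
  proof (rule locally_constant_on_connected[OF C(1) _ x x0])
   fix y assume y: "y \<in> C"
   obtain v where v: "v \<in> carrier (W M F)" "sect F G y w v" using sect_exists[OF a[OF y] w] by blast
   obtain E where E: "opn M E" "y \<in> E" "\<forall>x'\<in>E. sect F G x' w v"
    using sect_near[OF admD(5)[OF a[OF y]] v(2)] by blast
   have "g w z = g w y" if "z \<in> E \<inter> C" for z using gI[OF _ v(1), of z w] gI[OF y v] E(3) that by simp
   then show "\<exists>D. opn M D \<and> y \<in> D \<and> (\<forall>z\<in>D \<inter> C. g w z = g w y)" using E(1,2) by blast
  qed
  then have "r w = v" using w gI[OF x v] by (simp add: r_def)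
  then show "r w \<in> carrier (W M F)" "sect F G x w (r w)" using v by simp_all
 qed
 have "r \<in> mon_hom (W N G) (W M F)" unfolding mon_hom_def hom_def
 proof (intro CollectI conjI ballI Pi_I)
  show "r \<in> extensional (carrier (W N G))" by (simp add: r_def)
  show "r \<one>\<^bsub>W N G\<^esub> = \<one>\<^bsub>W M F\<^esub>"
   by (rule sect_unique[OF a[OF x0] r(2)[OF WN.one_closed x0] sect_one[OF A0(1,2,5)] r(1)[OF WN.one_closed x0] WM.one_closed])
  show "r w \<in> carrier (W M F)" if "w \<in> carrier (W N G)" for w by (rule r(1)[OF that x0])
  show "r (w \<otimes>\<^bsub>W N G\<^esub> w') = r w \<otimes>\<^bsub>W M F\<^esub> r w'" if w: "w \<in> carrier (W N G)" "w' \<in> carrier (W N G)" for w w'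
   by (rule sect_unique[OF a[OF x0] r(2)[OF WN.m_closed[OF w] x0]
      sect_mult[OF A0(1,2,5) r(2)[OF w(1) x0] r(2)[OF w(2) x0]] r(1)[OF WN.m_closed[OF w] x0]
      WM.m_closed[OF r(1)[OF w(1) x0] r(1)[OF w(2) x0]]])
 qed
 then have "\<forall>x\<in>C. pulls F G x r" using r(2) by (simp add: pulls_def)
 then show thesis by (rule that)
qed

lemma pull_germ_class:
 assumes a: "adm F G x" and B: "B \<in> germs N (f x)"
 shows "quot_map (stalk M x) (nonvanishing M F x) (pull_germ M f x)
   (quot_class (stalk N (f x)) (nonvanishing N G (f x)) B) =
  quot_class (stalk M x) (nonvanishing M F x) (pull_germ M f x B)"
proof -
 note A = admD[OF a]
 interpret QN: comm_quot "stalk N (f x)" "nonvanishing N G (f x)" by (rule N.comm_quot_face_stalk[OF A(2,4)])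
 interpret QM: comm_quot "stalk M x" "nonvanishing M F x" by (rule M.comm_quot_face_stalk[OF A(1,3)])
 have mult: "pull_germ M f x (B1 \<otimes>\<^bsub>stalk N (f x)\<^esub> B2) = pull_germ M f x B1 \<otimes>\<^bsub>stalk M x\<^esub> pull_germ M f x B2"
  if B12: "B1 \<in> germs N (f x)" "B2 \<in> germs N (f x)" for B1 B2
 proof -
  obtain b1 where "B1 = germ N (f x) b1" using B12(1) unfolding stalk_iff by (elim exE conjE) (rule that)
  moreover obtain b2 where "B2 = germ N (f x) b2" using B12(2) unfolding stalk_iff by (elim exE conjE) (rule that)
  ultimately show ?thesis by (simp add: stalk_mult pull_germ_germ[OF A(5)] o_def)
 qed
 show ?thesis
 proof (rule QN.quot_map_class[OF B])
  fix B' assume "(B, B') \<in> nrel N G (f x)"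
  then obtain C C' where C: "B' \<in> germs N (f x)" "C \<in> nonvanishing N G (f x)" "C' \<in> nonvanishing N G (f x)"
   "B \<otimes>\<^bsub>stalk N (f x)\<^esub> C = B' \<otimes>\<^bsub>stalk N (f x)\<^esub> C'" unfolding QN.quot_rel_iff by blast
  have "pull_germ M f x B \<otimes>\<^bsub>stalk M x\<^esub> pull_germ M f x C = pull_germ M f x B' \<otimes>\<^bsub>stalk M x\<^esub> pull_germ M f x C'"
   using C B QN.S_carrier by (simp add: mult[symmetric])
  then have "(pull_germ M f x B, pull_germ M f x B') \<in> nrel M F x"
   unfolding QM.quot_rel_iff using pull_in_stalk[OF A(5)] B C(1) A(6)[OF C(2)] A(6)[OF C(3)] by blast
  from QM.quot_class_cong[OF this]
  show "quot_class (stalk M x) (nonvanishing M F x) (pull_germ M f x B') =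
    quot_class (stalk M x) (nonvanishing M F x) (pull_germ M f x B)" by simp
 qed
qed

text \<open>A class K, its section over the interior of G and the section pulled back from it are
  all computed from one b-function b; so the trivializations turn \<open>normal_push\<close> into
  precomposition with r.\<close>

lemma push_triv:
 assumes a: "adm F G x" and r: "pulls F G x r" and \<phi>: "\<phi> \<in> duals (W M F)"
 shows "triv N G (f x) (dual_map (W N G) r \<phi>) = normal_push M N f F G x (triv M F x \<phi>)"
proof
 fix K
 note A = admD[OF a]
 show "triv N G (f x) (dual_map (W N G) r \<phi>) K = normal_push M N f F G x (triv M F x \<phi>) K"
 proof (cases "K \<in> carrier (conormal N G (f x))")
  case True
  obtain D b where D: "opn N D" "f x \<in> D" "bfun N D b" and K: "K = ncls N G (f x) b"
   by (rule N.conormal_class[OF True A(2,4)])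
  let ?w = "extend N G (f x) K" and ?v = "extend M F x (ncls M F x (b \<circ> f))"
  note X = N.extend_class[OF A(2,4) D, folded K]
  note v = sect_by[OF a D X(2)]
  have rw: "r ?w = ?v"
  proof (rule sect_unique[OF a _ v(2) _ v(1)])
   show "sect F G x ?w (r ?w)" using r X(1) by (simp add: pulls_def)
   show "r ?w \<in> carrier (W M F)" using r X(1) mon_homD(4)[of r "W N G" "W M F"] unfolding pulls_def by blast
  qed
  have q: "quot_map (stalk M x) (nonvanishing M F x) (pull_germ M f x) K =
    ncls M F x (b \<circ> f)"
   unfolding K pull_germ_class[OF a germ_in_stalk[OF D]] pull_germ_germ[OF A(5)] ..
  obtain E where E: "opn M E" "x \<in> E" "bfun M E (b \<circ> f)" by (rule bfun_pull[OF D A(5)])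
  have qc: "ncls M F x (b \<circ> f) \<in> carrier (conormal M F x)" by (rule M.class_in_conormal[OF A(1,3) E])
  show ?thesis using True X(1) rw qc by (simp add: triv_def normal_push_def dual_map_def q)
 qed (simp add: triv_def normal_push_def dual_map_def)
qed

text \<open>Injectivity of the trivialization at one point gives uniqueness,
  \<open>push_triv\<close> at all points gives existence. The descriptions behind
  \<open>natural_hom\<close> and \<open>face_arrow\<close> are evaluated by this
  equivalence.\<close>

lemma induced_iff:
 assumes C: "C \<noteq> {}" and a: "\<And>x. x \<in> C \<Longrightarrow> adm F G x" and r: "\<forall>x\<in>C. pulls F G x r"
 shows "\<beta> \<in> mon_hom (dual (W M F)) (dual (W N G)) \<and>
   (\<forall>x\<in>C. \<forall>\<phi>\<in>duals (W M F). triv N G (f x) (\<beta> \<phi>) = normal_push M N f F G x (triv M F x \<phi>)) \<longleftrightarrow>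
  \<beta> = dual_hom (W N G) (W M F) r" (is "?L \<longleftrightarrow> ?R")
proof -
 obtain x0 where x0: "x0 \<in> C" using C by blast
 note A = admD[OF a[OF x0]] and rh = mon_homD[OF conjunct1[OF bspec[OF r x0, unfolded pulls_def]]]
 note WM = M.comm_monoid_W[OF A(1)] and WN = N.comm_monoid_W[OF A(2)]
 show ?thesis
 proof
  assume L: ?L
  note bh = mon_homD[OF conjunct1[OF L]]
  show ?R
  proof (rule extensionalityI[OF bh(3)])
   fix \<phi> assume \<phi>: "\<phi> \<in> duals (W M F)"
   have "\<beta> \<phi> = dual_map (W N G) r \<phi>"
   proof (rule N.triv_inj[OF A(2,4) bh(4)[OF \<phi>] dual_map_hom[where h = r, OF WN WM rh(1,2) \<phi>]])
    show "triv N G (f x0) (\<beta> \<phi>) = triv N G (f x0) (dual_map (W N G) r \<phi>)"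
     unfolding push_triv[OF a[OF x0] bspec[OF r x0] \<phi>] using L x0 \<phi> by blast
   qed
   then show "\<beta> \<phi> = dual_hom (W N G) (W M F) r \<phi>" using \<phi> by (simp add: dual_hom_def)
  qed (simp add: dual_hom_def)
 next
  assume R: ?R
  show ?L unfolding R
  proof (intro conjI ballI)
   show "dual_hom (W N G) (W M F) r \<in> mon_hom (dual (W M F)) (dual (W N G))"
    unfolding dual_hom_def by (rule dual_map_mon_hom[where h = r, OF WN WM rh(1,2)])
   fix x \<phi> assume "x \<in> C" "\<phi> \<in> duals (W M F)"
   then show "triv N G (f x) (dual_hom (W N G) (W M F) r \<phi>) = normal_push M N f F G x (triv M F x \<phi>)"
    using push_triv[OF a bspec[OF r]] by (simp add: dual_hom_def)
  qed
 qed
qed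

text \<open>By \<open>nonvanishing_near\<close> the germ has no zeros on the interior of G near f x,
  so its pull-back has none on the interior of F near x, which accumulates at x.\<close>

lemma nonvanishing_pull:
 assumes F: "F \<in> faces M" "x \<in> F" and G: "G \<in> faces N" "f x \<in> G"
  and sub: "f ` fint M F \<subseteq> fint N G" and B: "B \<in> nonvanishing N G (f x)"
 shows "pull_germ M f x B \<in> nonvanishing M F x"
proof -
 have xt: "x \<in> points M" using F M.face_topspace by blast
 obtain D b where D: "opn N D" "f x \<in> D" "bfun N D b" "B = germ N (f x) b" by (rule N.nonvanishing_bfun[OF B])
 obtain E where E: "opn M E" "x \<in> E" "bfun M E (b \<circ> f)" by (rule bfun_pull[OF D(1-3) xt])
 have "\<forall>\<^sub>F y in nbh N (f x). y \<in> fint N G \<longrightarrow> b y \<noteq> 0"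
  by (rule N.nonvanishing_near[OF G]) (use B D(4) in simp)
 from eventually_pull[OF xt this]
 have ev: "\<forall>\<^sub>F z in nbh M x. z \<in> fint M F \<longrightarrow> b (f z) \<noteq> 0" by eventually_elim (use sub in blast)
 show ?thesis unfolding nonvanishing_def D(4) pull_germ_germ[OF xt]
 proof (intro CollectI conjI ballI notI germ_in_stalk[OF E]; elim exE conjE)
  fix c V assume c: "c \<in> germ M x (b \<circ> f)" and V: "opn M V" "x \<in> V" "\<forall>y\<in>V \<inter> F. c y = 0"
  have "\<forall>\<^sub>F z in nbh M x. z \<in> V" unfolding eventually_nhdsin using V by blast
  moreover have "\<forall>\<^sub>F z in nbh M x. c z = b (f z)" using c by (simp add: germ_def)
  ultimately have "\<forall>\<^sub>F z in nbh M x. z \<notin> fint M F"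
   using ev by eventually_elim (use V(3) M.interior_subset[OF F(1)] in force)
  from M.near_interior[OF F this] show False by blast
 qed
qed

end

lemma nonvanishing_mono: "G \<subseteq> F \<Longrightarrow> nonvanishing M G x \<subseteq> nonvanishing M F x"
 unfolding nonvanishing_def by blast

lemma dual_hom_compose:
 assumes R: "comm_monoid R" "comm_monoid R'" "comm_monoid R''" and s: "s \<in> mon_hom R R'" and r: "r \<in> mon_hom R' R''"
 shows "compose (duals R'') (dual_hom R R' s) (dual_hom R' R'' r) = dual_hom R R'' (compose (carrier R) r s)"
proof
 fix \<phi>
 show "compose (duals R'') (dual_hom R R' s) (dual_hom R' R'' r) \<phi> = dual_hom R R'' (compose (carrier R) r s) \<phi>"
 proof (cases "\<phi> \<in> duals R''")
  case True
  have "dual_map R' r \<phi> \<in> duals R'"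
   by (rule dual_map_hom[where h = r, OF R(2,3) mon_homD(1,2)[OF r] True])
  then show ?thesis using True mon_homD(4)[OF s]
   by (simp add: dual_hom_def compose_def dual_map_def restrict_def fun_eq_iff)
 qed (simp add: dual_hom_def compose_def)
qed

lemma compose_mon_hom:
 assumes P: "comm_monoid P" and h: "h \<in> mon_hom P Q" "k \<in> mon_hom Q R"
 shows "compose (carrier P) k h \<in> mon_hom P R"
proof -
 interpret comm_monoid P by fact
 show ?thesis using h unfolding mon_hom_def hom_def by (auto simp: compose_def Pi_iff)
qed

section \<open>Boundary faces under interior b-maps\<close>

locale gcm_map_charts = gcm_map M N f + C: gcm_chart M U P \<phi> A + E: gcm_chart N V Q \<psi> B
 for M :: "('m, 'p) gc_space" and N :: "('n, 'q) gc_space" and f U P \<phi> A V Q \<psi> B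
begin

lemma pull_monomial:
 assumes x: "x \<in> U" "f x \<in> V" and q: "q \<in> carrier Q"
 obtains p where "p \<in> carrier P" "\<forall>\<^sub>F z in nbh M x. cls M z ((\<lambda>y. \<psi> y q) \<circ> f) = C.kappa z p"
  "\<forall>\<^sub>F z in nbh M x. \<psi> (f z) q = 0 \<longleftrightarrow> \<phi> z p = 0"
proof -
 obtain D where D: "opn M D" "x \<in> D" "bfun M D ((\<lambda>y. \<psi> y q) \<circ> f)"
  by (rule bfun_pull[OF E.openU x(2) E.bfun_monomial[OF q] C.topspace_U[OF x(1)]])
 obtain p where p: "p \<in> carrier P" "\<forall>\<^sub>F z in nbh M x. cls M z ((\<lambda>y. \<psi> y q) \<circ> f) = C.kappa z p"
  "\<forall>\<^sub>F z in nbh M x. ((\<lambda>y. \<psi> y q) \<circ> f) z = 0 \<longleftrightarrow> \<phi> z p = 0" by (rule C.bfun_near[OF D x(1)])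
 show thesis by (rule that[OF p(1,2)]) (use p(3) in simp)
qed

lemma pulls_omega:
 assumes a: "adm F G x" and x: "x \<in> U" "f x \<in> V" and r: "pulls F G x r"
  and p: "p \<in> carrier P" and q: "q \<in> carrier Q"
  and ev: "\<forall>\<^sub>F z in nbh M x. cls M z ((\<lambda>y. \<psi> y q) \<circ> f) = C.kappa z p"
 shows "r (E.omega G (f x) q) = C.omega F x p"
proof -
 note A = admD[OF a]
 note w = E.omega[OF A(2,4) x(2) q] and v = C.omega[OF A(1,3) x(1) p]
 have 1: "repr N G (f x) (E.omega G (f x) q) (\<lambda>y. \<psi> y q)" using w(2) by (simp add: E.cls_mono)
 have 2: "repr M F x (C.omega F x p) ((\<lambda>y. \<psi> y q) \<circ> f)" using v(2) ev by eventually_elim simp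
 have s: "sect F G x (E.omega G (f x) q) (C.omega F x p)"
  unfolding sect_def using E.openU x(2) E.bfun_monomial[OF q] 1 2 by blast
 have r': "sect F G x (E.omega G (f x) q) (r (E.omega G (f x) q))" "r (E.omega G (f x) q) \<in> carrier (W M F)"
  using r w(1) mon_homD(4)[of r "W N G" "W M F"] unfolding pulls_def by blast+
 show ?thesis by (rule sect_unique[OF a r'(1) s r'(2) v(1)])
qed

text \<open>A monomial of Q pulls back to a positive factor times a monomial of P, whose vanishing
  is constant along the stratum of y. Testing the finitely many generators of Q keeps the
  neighbourhood open.\<close>

lemma tau_pull_locally_constant:
 assumes F: "F \<in> faces M" "y \<in> fint M F" and y: "y \<in> U" "f y \<in> V"
 shows "\<forall>\<^sub>F z in nbh M y. z \<in> fint M F \<longrightarrow> f z \<in> V \<and> E.tau (f z) = E.tau (f y)"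
proof -
 have yt: "y \<in> points M" by (rule C.topspace_U[OF y(1)])
 have yF: "y \<in> F" using M.interior_subset F by blast
 have g: "\<forall>\<^sub>F z in nbh M y. z \<in> fint M F \<longrightarrow> (\<psi> (f z) q = 0 \<longleftrightarrow> \<psi> (f y) q = 0)"
  if q: "q \<in> carrier Q" for q
 proof -
  obtain p where p: "p \<in> carrier P" "\<forall>\<^sub>F z in nbh M y. \<psi> (f z) q = 0 \<longleftrightarrow> \<phi> z p = 0"
   by (rule pull_monomial[OF y q])
  have 1: "\<psi> (f y) q = 0 \<longleftrightarrow> \<phi> y p = 0" using p(2) yt unfolding eventually_nhdsin by blast
  have 2: "\<phi> z p = 0 \<longleftrightarrow> \<phi> y p = 0" if "C.tau z = C.tau y" for z using C.tau_iff[OF p(1)] that by metis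
  show ?thesis using p(2) C.eventually_tface[OF F(1) yF y(1)]
   by eventually_elim (metis 1 2 C.tface_interior[OF F y(1)])
 qed
 have "\<forall>\<^sub>F z in nbh M y. \<forall>q\<in>B. z \<in> fint M F \<longrightarrow> (\<psi> (f z) q = 0 \<longleftrightarrow> \<psi> (f y) q = 0)"
  using g E.gens by (intro eventually_ball_finite[OF E.finite_gens]) blast
 moreover have "\<forall>\<^sub>F z in nbh M y. f z \<in> V" by (rule eventually_pull[OF yt E.eventually_U[OF y(2)]])
 ultimately show ?thesis
 proof eventually_elim
  case (elim z)
  show ?case
  proof (intro impI conjI elim(2))
   assume z: "z \<in> fint M F"
   have sub: "E.tau a \<subseteq> E.tau b" if "a \<in> V" "b \<in> V" "\<forall>q\<in>B. \<psi> a q = 0 \<longleftrightarrow> \<psi> b q = 0" for a b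
    by (rule E.face_mono[OF E.tau_face[OF that(1)] E.tau_face[OF that(2)]])
     (use that(3) E.gens in \<open>auto simp: support_face_def\<close>)
   show "E.tau (f z) = E.tau (f y)" using elim z by (intro equalityI sub y(2)) auto
  qed
 qed
qed

end

context gcm_map
begin

lemma charts_at:
 assumes "x \<in> points M"
 obtains U P \<phi> A V Q \<psi> B where "gcm_map_charts M N f U P \<phi> A V Q \<psi> B" "x \<in> U" "f x \<in> V"
proof -
 obtain U P \<phi> A where c: "gcm_chart M U P \<phi> A" "x \<in> U" by (rule M.gcm_chart_at[OF assms])
 obtain V Q \<psi> B where d: "gcm_chart N V Q \<psi> B" "f x \<in> V" by (rule N.gcm_chart_at[OF f_top[OF assms]])
 show thesis by (rule that[OF gcm_map_charts.intro[OF gcm_map_axioms c(1) d(1)] c(2) d(2)])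
qed

lemma codim_constant:
 assumes F: "F \<in> faces M" and y: "y \<in> fint M F" "z \<in> fint M F"
 shows "codim N (f z) = codim N (f y)"
proof (rule locally_constant_on_connected[OF M.interior_connected[OF F] _ y(2,1)])
 fix y assume y: "y \<in> fint M F"
 have yt: "y \<in> points M" by (rule M.interior_topspace[OF F y])
 obtain U P \<phi> A V Q \<psi> B where c: "gcm_map_charts M N f U P \<phi> A V Q \<psi> B" "y \<in> U" "f y \<in> V"
  by (rule charts_at[OF yt])
 interpret gcm_map_charts M N f U P \<phi> A V Q \<psi> B by (rule c(1))
 obtain D where D: "opn M D" "y \<in> D" "\<forall>z\<in>D. z \<in> fint M F \<longrightarrow> f z \<in> V \<and> E.tau (f z) = E.tau (f y)"
  using tau_pull_locally_constant[OF F y c(2,3)] yt unfolding eventually_nhdsin by blast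
 have "\<forall>z\<in>D \<inter> fint M F. codim N (f z) = codim N (f y)" using D(3) E.codim_eq[OF _ c(3)] by blast
 then show "\<exists>D. opn M D \<and> y \<in> D \<and> (\<forall>z\<in>D \<inter> fint M F. codim N (f z) = codim N (f y))"
  using D(1,2) by blast
qed

text \<open>The image of \<open>fint M F\<close> is connected and of constant codimension, so a
  single point decides in which component of a stratum it lies.\<close>

lemma face_mapI:
 assumes F: "F \<in> faces M" and G: "G \<in> faces N" and x: "x \<in> fint M F" "f x \<in> fint N G"
 shows "face_map M N f F = G" "f ` fint M F \<subseteq> fint N G"
proof -
 show sub: "f ` fint M F \<subseteq> fint N G"
 proof (rule N.interior_maximal[OF G _ x(2)])
  show "connectedin (gtop N) (f ` fint M F)"
   by (rule connectedin_continuous_map_image[OF cont M.interior_connected[OF F]])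
  show "\<forall>y\<in>f ` fint M F. codim N y = codim N (f x)" using codim_constant[OF F x(1)] by blast
 qed (use x in blast)
 show "face_map M N f F = G" unfolding face_map_def
 proof (rule the_equality)
  fix G' assume "G' \<in> faces N \<and> f ` fint M F \<subseteq> fint N G'"
  then show "G' = G" using N.face_eqI[OF _ G _ x(2), of G'] x(1) by blast
 qed (use G sub in blast)
qed

lemma face_map:
 assumes F: "F \<in> faces M"
 shows "face_map M N f F \<in> faces N" "f ` fint M F \<subseteq> fint N (face_map M N f F)"
proof -
 obtain x where x: "x \<in> fint M F" using M.interior_nonempty[OF F] by blast
 obtain G where G: "G \<in> faces N" "f x \<in> fint N G" by (rule N.face_at[OF f_top[OF M.interior_topspace[OF F x]]])
 note I = face_mapI[OF F G(1) x G(2)]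
 show "face_map M N f F \<in> faces N" "f ` fint M F \<subseteq> fint N (face_map M N f F)"
  unfolding I(1) by (rule G(1), rule I(2))
qed

lemma face_map_image:
 assumes F: "F \<in> faces M" and x: "x \<in> F"
 shows "f x \<in> face_map M N f F"
proof -
 have "x \<in> gtop M closure_of fint M F" using x M.face_closure[OF F] by blast
 then have "f x \<in> gtop N closure_of (f ` fint M F)"
  using continuous_map_image_closure_subset[OF cont] by blast
 then have "f x \<in> gtop N closure_of fint N (face_map M N f F)"
  using closure_of_mono[OF face_map(2)[OF F]] by blast
 then show ?thesis using N.face_closure[OF face_map(1)[OF F]] by blast
qed

lemma face_map_mono:
 assumes F: "F \<in> faces M" "G \<in> faces M" "G \<subseteq> F"
 shows "face_map M N f G \<subseteq> face_map M N f F"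
proof -
 obtain x where x: "x \<in> fint M G" using M.interior_nonempty[OF F(2)] by blast
 have "x \<in> F" using M.interior_subset[OF F(2)] x F(3) by blast
 then show ?thesis
  using N.frontier[OF face_map(1)[OF F(1)] face_map(1)[OF F(2)], of "f x"] face_map(2)[OF F(2)] x
   face_map_image[OF F(1)] by blast
qed

lemma adm_natural:
 assumes F: "F \<in> faces M" "x \<in> F"
 shows "adm F (face_map M N f F) x" unfolding adm_def
 using F face_map[OF F(1)] face_map_image[OF F] nonvanishing_pull[OF F face_map(1)[OF F(1)] face_map_image[OF F] face_map(2)[OF F(1)]]
 by blast

lemma adm_mono:
 assumes "adm F G x" "H \<in> faces N" "f x \<in> H" "H \<subseteq> G"
 shows "adm F H x" using assms nonvanishing_mono[OF assms(4), of N "f x"] unfolding adm_def by blast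

lemma natural_hom:
 assumes F: "F \<in> faces M"
 obtains r where "\<forall>x\<in>F. pulls F (face_map M N f F) x r"
  "natural_hom M N f F = dual_hom (W N (face_map M N f F)) (W M F) r"
  "induces_natural M N f F (natural_hom M N f F)"
proof -
 have ne: "F \<noteq> {}" using M.interior_nonempty[OF F] M.interior_subset[OF F] by blast
 obtain r where r: "\<forall>x\<in>F. pulls F (face_map M N f F) x r"
  by (rule pulls_exists[OF M.face_connected[OF F] ne adm_natural[OF F]])
 have iff: "induces_natural M N f F \<beta> \<longleftrightarrow> \<beta> = dual_hom (W N (face_map M N f F)) (W M F) r" for \<beta>
  unfolding induces_natural_def by (rule induced_iff[OF ne adm_natural[OF F] r])
 have "natural_hom M N f F = dual_hom (W N (face_map M N f F)) (W M F) r"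
  unfolding natural_hom_def by (rule the_equality) (simp_all only: iff)
 with r show thesis using iff that by blast
qed

text \<open>Taking x in the interior of F turns both faces into supports. If the image of \<theta>
  kills the monomial q, then \<theta> kills its pull-back p, so p does not vanish at x as \<theta>
  is interior; hence q does not vanish at f x and lies in the face of the image.\<close>

lemma natural_interior:
 assumes F: "F \<in> faces M"
 shows "natural_hom M N f F \<in> interior_hom (dual (W M F)) (dual (W N (face_map M N f F)))"
proof -
 let ?G = "face_map M N f F"
 obtain r where r: "\<forall>x\<in>F. pulls F ?G x r" "natural_hom M N f F = dual_hom (W N ?G) (W M F) r"
  "induces_natural M N f F (natural_hom M N f F)" by (rule natural_hom[OF F])
 have hom: "natural_hom M N f F \<in> mon_hom (dual (W M F)) (dual (W N ?G))" using r(3) by (simp add: induces_natural_def)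
 obtain x where x: "x \<in> fint M F" using M.interior_nonempty[OF F] by blast
 have xF: "x \<in> F" by (rule M.interior_face[OF F x])
 have xt: "x \<in> points M" by (rule M.interior_topspace[OF F x])
 have G: "?G \<in> faces N" "f x \<in> ?G" "f x \<in> fint N ?G"
  using face_map[OF F] face_map_image[OF F xF] x by blast+
 obtain U P \<phi> A V Q \<psi> B where c: "gcm_map_charts M N f U P \<phi> A V Q \<psi> B" "x \<in> U" "f x \<in> V"
  by (rule charts_at[OF xt])
 interpret gcm_map_charts M N f U P \<phi> A V Q \<psi> B by (rule c(1))
 note presM = C.omega_presents[OF F xF c(2)] and presN = E.omega_presents[OF G(1,2) c(3)]
 have "natural_hom M N f F \<theta> \<in> mon_interior (dual (W N ?G))" if \<theta>: "\<theta> \<in> mon_interior (dual (W M F))" for \<theta>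
 proof -
  have \<theta>c: "\<theta> \<in> duals (W M F)" using \<theta> by (simp add: mon_interior_def)
  have int: "\<theta> (C.omega F x p) = 0 \<Longrightarrow> p \<in> C.tface F x" if "p \<in> carrier P" for p
   using C.dual_interior_iff[OF presM C.tface_face(1)[OF F xF c(2)] \<theta>c] \<theta> that by blast
  show ?thesis
   unfolding E.dual_interior_iff[OF presN E.tface_face(1)[OF G(1,2) c(3)] mon_homD(4)[OF hom \<theta>c]]
  proof (intro ballI impI)
   fix q assume q: "q \<in> carrier Q" and z: "natural_hom M N f F \<theta> (E.omega ?G (f x) q) = 0"
   obtain p where p: "p \<in> carrier P" "\<forall>\<^sub>F z in nbh M x. cls M z ((\<lambda>y. \<psi> y q) \<circ> f) = C.kappa z p"
    "\<forall>\<^sub>F z in nbh M x. \<psi> (f z) q = 0 \<longleftrightarrow> \<phi> z p = 0" by (rule pull_monomial[OF c(2,3) q])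
   have "r (E.omega ?G (f x) q) = C.omega F x p"
    by (rule pulls_omega[OF adm_natural[OF F xF] c(2,3) bspec[OF r(1) xF] p(1) q p(2)])
   then have "\<theta> (C.omega F x p) = 0"
    using z \<theta>c presentsD(4)[OF presN q] by (simp add: r(2) dual_hom_def dual_map_def)
   then have "p \<in> C.tau x" using int[OF p(1)] C.tface_interior[OF F x c(2)] by simp
   moreover have "\<psi> (f x) q = 0 \<longleftrightarrow> \<phi> x p = 0" using p(3) xt unfolding eventually_nhdsin by blast
   ultimately show "q \<in> E.tface ?G (f x)"
    unfolding E.tface_interior[OF G(1,3) c(3)] using C.tau_iff[OF p(1)] E.tau_iff[OF q] by blast
  qed
 qed
 then show ?thesis using hom by (auto simp: interior_hom_def)
qed

end

lemma compose_bmap: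
 assumes f: "gcm_map M N f" and g: "gcm_map N K g"
 shows "gcm_map M K (compose (points M) g f)"
proof -
 interpret F: gcm_map M N f by (rule f)
 interpret G: gcm_map N K g by (rule g)
 have "compose (points M) g f \<in> interior_bmap M K"
 proof (rule interior_bmapI[OF F.M.max_atlas G.N.max_atlas])
  show "continuous_map (gtop M) (gtop K) (compose (points M) g f)"
   by (rule continuous_map_eq[OF continuous_map_compose[OF F.cont G.cont]]) (simp add: compose_def)
  fix x V Q \<psi> q assume x: "x \<in> points M" "(V, Q, \<psi>) \<in> charts K"
   "compose (points M) g f x \<in> V" "q \<in> carrier Q"
  interpret V: gc_chart0 K V Q \<psi> by unfold_locales (rule G.N.max_atlas x)+
  have xV: "g (f x) \<in> V" using x by (simp add: compose_def)
  obtain E where E: "opn N E" "f x \<in> E" "bfun N E ((\<lambda>z. \<psi> z q) \<circ> g)"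
   by (rule G.bfun_pull[OF V.openU xV V.bfun_monomial[OF x(4)] F.f_top[OF x(1)]])
  obtain D where D: "opn M D" "x \<in> D" "bfun M D (((\<lambda>z. \<psi> z q) \<circ> g) \<circ> f)" by (rule F.bfun_pull[OF E x(1)])
  have "bfun M D (\<lambda>z. \<psi> (compose (points M) g f z) q)"
  proof (rule bfun_cong[OF F.M.max_atlas D(3)])
   fix y assume "y \<in> D"
   then have "y \<in> points M" using openin_subset[OF D(1)] by blast
   then show "\<psi> (compose (points M) g f y) q = (((\<lambda>z. \<psi> z q) \<circ> g) \<circ> f) y" by (simp add: compose_def)
  qed
  then show "\<exists>D. opn M D \<and> x \<in> D \<and> bfun M D (\<lambda>z. \<psi> (compose (points M) g f z) q)" using D by blast
 qed simp
 then show ?thesis using F.M.gcm_axioms G.N.gcm_axioms by (simp add: gcm_map_def gcm_map_axioms_def)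
qed

text \<open>A b-function that represents w near g (f x) represents s w after pull-back by g, and
  \<open>sect_unique\<close> lets r (s w) be computed from this very representative. The faces are
  arbitrary admissible ones, so either map may also be an identity.\<close>

lemma pulls_compose:
 assumes f: "gcm_map M N f" and g: "gcm_map N K g" and a: "gcm_map.adm M N f F G x" and H: "H \<in> faces K"
  and r: "gcm_map.pulls M N f F G x r" and s: "gcm_map.pulls N K g G H (f x) s"
 shows "gcm_map.pulls M K (compose (points M) g f) F H x (compose (carrier (W K H)) r s)"
proof -
 interpret F: gcm_map M N f by (rule f)
 interpret G: gcm_map N K g by (rule g)
 interpret GF: gcm_map M K "compose (points M) g f" by (rule compose_bmap[OF f g])
 note A = F.admD[OF a]
 have gf: "compose (points M) g f x = g (f x)" using A(5) by (simp add: compose_def)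
 note sh = conjunct1[OF s[unfolded G.pulls_def]] and rh = conjunct1[OF r[unfolded F.pulls_def]]
 have "GF.sect F H x w (r (s w))" if w: "w \<in> carrier (W K H)" for w
 proof -
  obtain D b where D: "opn K D" "g (f x) \<in> D" "bfun K D b" and wb: "repr K H (g (f x)) w b"
   and vb: "repr N G (f x) (s w) (b \<circ> g)" using s w unfolding G.pulls_def G.sect_def by blast
  obtain E where E: "opn N E" "f x \<in> E" "bfun N E (b \<circ> g)" by (rule G.bfun_pull[OF D F.f_top[OF A(5)]])
  obtain E' where E': "opn M E'" "x \<in> E'" "bfun M E' (b \<circ> g \<circ> f)" by (rule F.bfun_pull[OF E A(5)])
  note v = F.sect_by[OF a E vb]
  have "F.sect F G x (s w) (r (s w))" "r (s w) \<in> carrier (W M F)"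
   using r mon_homD(4)[OF sh w] mon_homD(4)[OF rh] unfolding F.pulls_def by blast+
  from F.sect_unique[OF a this(1) v(2) this(2) v(1)]
  have rs: "r (s w) = extend M F x (ncls M F x (b \<circ> g \<circ> f))" .
  have "\<forall>\<^sub>F z in nbh M x. (b \<circ> g \<circ> f) z = (b \<circ> compose (points M) g f) z"
   unfolding eventually_nhdsin using A(5) by (intro disjI2 exI[of _ "points M"]) (simp add: compose_def)
  from F.M.eventually_germ[OF this] F.M.extend_class(2)[OF A(1,3) E', folded rs]
  have "repr M F x (r (s w)) (b \<circ> compose (points M) g f)"
   by eventually_elim (simp add: cls_def o_def)
  then show ?thesis unfolding GF.sect_def gf using D wb by blast
 qed
 then show ?thesis
  unfolding GF.pulls_def using compose_mon_hom[OF G.N.comm_monoid_W[OF H] sh rh] by (simp add: compose_def)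
qed

section \<open>Arrows between the faces of a manifold\<close>

abbreviation id_map :: "('m, 'p) gc_space \<Rightarrow> 'm \<Rightarrow> 'm" where
 "id_map M \<equiv> (\<lambda>x\<in>points M. x)"

context gcm
begin

lemma id_map: "gcm_map M M (id_map M)"
 using gcm_axioms identity_bmap[OF max_atlas] by (simp add: gcm_map_def gcm_map_axioms_def)

sublocale I: gcm_map M M "id_map M" by (rule id_map)

lemma eventually_id: "x \<in> points M \<Longrightarrow> \<forall>\<^sub>F z in nbh M x. (b \<circ> id_map M) z = b z"
 unfolding eventually_nhdsin by (intro disjI2 exI[of _ "points M"]) simp

lemma cls_id: "z \<in> points M \<Longrightarrow> cls M z (b \<circ> id_map M) = cls M z b"
 using eventually_id[of z b] germ_eq_iff[of M z "b \<circ> id_map M" b] by (simp add: cls_def)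

lemma pull_germ_id:
 assumes "x \<in> points M" "B \<in> germs M x"
 shows "pull_germ M (id_map M) x B = B"
proof -
 obtain b where "B = germ M x b" using assms(2) unfolding stalk_iff by (elim exE conjE) (rule that)
 then show ?thesis
  using I.pull_germ_germ[OF assms(1), of b] eventually_id[OF assms(1), of b] assms(1) by (simp add: germ_eq_iff)
qed

lemma adm_id:
 assumes F: "F \<in> faces M" "G \<in> faces M" "G \<subseteq> F" and x: "x \<in> G"
 shows "I.adm F G x"
proof -
 have xt: "x \<in> points M" using x face_topspace[OF F(2)] by blast
 have "pull_germ M (id_map M) x B \<in> nonvanishing M F x" if "B \<in> nonvanishing M G x" for B
  using that pull_germ_id[OF xt, of B] nonvanishing_mono[OF F(3), of M x] by (auto simp: nonvanishing_def)
 then show ?thesis unfolding I.adm_def using F x xt by auto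
qed

text \<open>Along the identity \<open>pull_germ\<close> changes nothing, so the homomorphism induced
  by the inclusion of faces is a case of the general push-forward.\<close>

lemma incl_push:
 assumes G: "G \<in> faces M" "x \<in> G"
 shows "normal_incl M F G x \<theta> = normal_push M M (id_map M) F G x \<theta>"
proof -
 have xt: "x \<in> points M" using G face_topspace by blast
 interpret Q: comm_quot "stalk M x" "nonvanishing M G x" by (rule comm_quot_face_stalk[OF G])
 have "quot_map (stalk M x) (nonvanishing M F x) (\<lambda>A. A) K =
   quot_map (stalk M x) (nonvanishing M F x) (pull_germ M (id_map M) x) K" if K: "K \<in> carrier (conormal M G x)" for K
 proof -
  obtain C where "K = quot_class (stalk M x) (nonvanishing M G x) C" using K unfolding conormal_def Q.carrier_mon_quot by blast
  then have "a \<in> germs M x" if "a \<in> K" for a using that by (simp add: Q.mem_quot_class Q.quot_rel_iff)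
  then show ?thesis unfolding quot_map_def using pull_germ_id[OF xt] by simp
 qed
 then show ?thesis
  using xt by (simp add: normal_incl_def normal_push_def dual_map_def restrict_def fun_eq_iff)
qed

lemma face_arrow:
 assumes F: "F \<in> faces M" "G \<in> faces M" "G \<subseteq> F"
 obtains r where "\<forall>x\<in>G. I.pulls F G x r"
  "face_arrow M F G = dual_hom (W M G) (W M F) r" "induces_arrow M F G (face_arrow M F G)"
proof -
 have ne: "G \<noteq> {}" using interior_nonempty[OF F(2)] interior_subset[OF F(2)] by blast
 obtain r where r: "\<forall>x\<in>G. I.pulls F G x r"
  by (rule I.pulls_exists[OF face_connected[OF F(2)] ne adm_id[OF F]])
 have "induces_arrow M F G \<alpha> \<longleftrightarrow> \<alpha> \<in> mon_hom (dual (W M F)) (dual (W M G)) \<and>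
   (\<forall>x\<in>G. \<forall>\<phi>\<in>duals (W M F). triv M G (id_map M x) (\<alpha> \<phi>) =
    normal_push M M (id_map M) F G x (triv M F x \<phi>))" for \<alpha>
  unfolding induces_arrow_def using incl_push[OF F(2)] face_topspace[OF F(2)] by (auto simp: subset_iff)
 then have iff: "induces_arrow M F G \<alpha> \<longleftrightarrow> \<alpha> = dual_hom (W M G) (W M F) r" for \<alpha>
  using I.induced_iff[OF ne adm_id[OF F] r, of \<alpha>] by simp
 have "face_arrow M F G = dual_hom (W M G) (W M F) r"
  unfolding face_arrow_def by (rule the_equality) (simp_all only: iff)
 with r show thesis using iff that by blast
qed

lemma pulls_id:
 assumes F: "F \<in> faces M" "x \<in> F"
 shows "I.pulls F F x (\<lambda>w\<in>carrier (W M F). w)"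
proof -
 interpret Wm: comm_monoid "W M F" by (rule comm_monoid_W[OF F(1)])
 have xt: "x \<in> points M" using F face_topspace by blast
 have "I.sect F F x w w" if w: "w \<in> carrier (W M F)" for w
 proof -
  obtain D b where D: "opn M D" "x \<in> D" "bfun M D b"
   and ev: "repr M F x w b" by (rule section_local[OF F w])
  have "repr M F x w (b \<circ> id_map M)"
   using ev by eventually_elim (use cls_id interior_topspace[OF F(1)] in simp)
  then show ?thesis unfolding I.sect_def using D ev xt by (intro exI[of _ D] exI[of _ b]) simp
 qed
 then show ?thesis unfolding I.pulls_def by (simp add: mon_hom_def hom_def)
qed

lemma dual_hom_id: "comm_monoid R \<Longrightarrow> dual_hom R R (\<lambda>w\<in>carrier R. w) = (\<lambda>\<phi>\<in>duals R. \<phi>)"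
 by (auto simp: dual_hom_def dual_map_def fun_eq_iff restrict_def dual_carrier_iff extensional_def)

lemma face_arrow_id:
 assumes F: "F \<in> faces M"
 shows "face_arrow M F F = (\<lambda>\<phi>\<in>duals (W M F). \<phi>)"
proof -
 obtain r where r: "\<forall>x\<in>F. I.pulls F F x r" "face_arrow M F F = dual_hom (W M F) (W M F) r"
  by (rule face_arrow[OF F F subset_refl])
 obtain x where x: "x \<in> F" using interior_nonempty[OF F] interior_subset[OF F] by blast
 have "r = (\<lambda>w\<in>carrier (W M F). w)"
  by (rule I.pulls_unique[OF adm_id[OF F F subset_refl x] bspec[OF r(1) x] pulls_id[OF F x]])
 then show ?thesis using r(2) dual_hom_id[OF comm_monoid_W[OF F]] by simp
qed

end

lemma interior_hom_identity: "(\<lambda>a\<in>carrier P. a) \<in> interior_hom P P" if "comm_monoid P"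
proof -
 interpret comm_monoid P by fact
 show ?thesis by (auto simp: interior_hom_def mon_hom_def hom_def mon_interior_def)
qed

lemma interior_hom_compose:
 assumes P: "comm_monoid P" and h: "h \<in> interior_hom P Q" "k \<in> interior_hom Q R"
 shows "compose (carrier P) k h \<in> interior_hom P R"
proof -
 have "compose (carrier P) k h \<in> mon_hom P R"
  by (rule compose_mon_hom[OF P]) (use h in \<open>auto simp: interior_hom_def\<close>)
 moreover have "compose (carrier P) k h a \<in> mon_interior R" if "a \<in> mon_interior P" for a
 proof -
  have "h a \<in> mon_interior Q" using h(1) that unfolding interior_hom_def by blast
  then have "k (h a) \<in> mon_interior R" using h(2) unfolding interior_hom_def by blast
  then show ?thesis using that by (simp add: compose_def mon_interior_def)
 qed
 ultimately show ?thesis unfolding interior_hom_def by blast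
qed

context gcm_chart
begin

text \<open>Both dual monoids consist of functionals on P, vanishing on \<open>tface F x\<close> and
  on \<open>tface G x\<close>; since the pull-back of \<open>omega G x p\<close> is
  \<open>omega F x p\<close>, the arrow is the inclusion of the former into the latter.\<close>

lemma face_arrow_image:
 assumes F: "F \<in> faces M" "G \<in> faces M" "G \<subseteq> F" and x: "x \<in> G" "x \<in> U"
 shows "inj_on (face_arrow M F G) (duals (W M F))" "face_arrow M F G ` duals (W M F) =
   {\<psi> \<in> duals (W M G). \<forall>t\<in>tface F x. \<psi> (omega G x t) = 0}"
proof -
 interpret J: gcm_map_charts M M "id_map M" U P \<phi> A U P \<phi> A
  by (intro gcm_map_charts.intro id_map gcm_chart_axioms)
 have xF: "x \<in> F" and xt: "x \<in> points M" using x F topspace_U by blast+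
 obtain r where r: "\<forall>x\<in>G. I.pulls F G x r" "face_arrow M F G = dual_hom (W M G) (W M F) r"
  "induces_arrow M F G (face_arrow M F G)" by (rule face_arrow[OF F])
 have hom: "face_arrow M F G \<in> mon_hom (dual (W M F)) (dual (W M G))" using r(3) by (simp add: induces_arrow_def)
 note presF = omega_presents[OF F(1) xF x(2)] and presG = omega_presents[OF F(2) x]
 note TF = tface_face[OF F(1) xF x(2)] and TG = tface_face[OF F(2) x]
 note DF = presentsD[OF presF] and DG = presentsD[OF presG]
 have "\<forall>\<^sub>F z in nbh M x. cls M z (mnl p \<circ> id_map M) = kappa z p" for p
  using eventually_U[OF x(2)] by eventually_elim (use cls_id topspace_U cls_mono in simp)
 then have ro: "r (omega G x p) = omega F x p" if "p \<in> carrier P" for p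
  using J.pulls_omega[OF adm_id[OF F x(1)] x(2) _ bspec[OF r(1) x(1)] that that] x xt by simp
 have val: "face_arrow M F G \<theta> (omega G x p) = \<theta> (omega F x p)" if "\<theta> \<in> duals (W M F)" "p \<in> carrier P" for \<theta> p
  using that DG(4) ro by (simp add: r(2) dual_hom_def dual_map_def)
 show "inj_on (face_arrow M F G) (duals (W M F))"
 proof (rule inj_onI)
  fix \<theta> \<theta>' assume t: "\<theta> \<in> duals (W M F)" "\<theta>' \<in> duals (W M F)" "face_arrow M F G \<theta> = face_arrow M F G \<theta>'"
  show "\<theta> = \<theta>'"
  proof (rule dual_ext[OF t(1,2)])
   fix w assume "w \<in> carrier (W M F)"
   then obtain p where "p \<in> carrier P" "w = omega F x p" using DF(3) by blast
   then show "\<theta> w = \<theta>' w" using val[OF t(1), of p] val[OF t(2), of p] t(3) by simp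
  qed
 qed
 show "face_arrow M F G ` duals (W M F) =
   {\<psi> \<in> duals (W M G). \<forall>t\<in>tface F x. \<psi> (omega G x t) = 0}" (is "?L = ?R")
 proof (intro equalityI subsetI)
  fix \<psi> assume "\<psi> \<in> ?L"
  then obtain \<theta> where t: "\<theta> \<in> duals (W M F)" "\<psi> = face_arrow M F G \<theta>" by blast
  have "\<psi> (omega G x t) = 0" if "t \<in> tface F x" for t
   using val[OF t(1)] presents_kernel_zero[OF presF TF(1) t(1) that] mon_faceD(2)[OF TF(1)] that t(2) by auto
  then show "\<psi> \<in> ?R" using mon_homD(4)[OF hom t(1)] t(2) by simp
 next
  fix \<psi> assume "\<psi> \<in> ?R"
  then have \<psi>: "\<psi> \<in> duals (W M G)" "\<forall>t\<in>tface F x. \<psi> (omega G x t) = 0" by simp_all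
  define \<eta> where "\<eta> = dual_map P (omega G x) \<psi>"
  have \<eta>: "\<eta> \<in> duals P" unfolding \<eta>_def by (rule presents_pull(1)[OF presG comm_quot_face[OF TG(1)] \<psi>(1)])
  have \<eta>v: "\<eta> p = \<psi> (omega G x p)" if "p \<in> carrier P" for p using that by (simp add: \<eta>_def dual_map_def)
  obtain \<theta> where t: "\<theta> \<in> duals (W M F)" "\<And>p. p \<in> carrier P \<Longrightarrow> \<theta> (omega F x p) = \<eta> p"
   by (rule presents_push[OF presF comm_quot_face[OF TF(1)] \<eta>])
    (use \<eta>v \<psi>(2) mon_faceD(2)[OF TF(1)] in auto)
  have "face_arrow M F G \<theta> = \<psi>"
  proof (rule dual_ext[OF mon_homD(4)[OF hom t(1)] \<psi>(1)])
   fix w assume "w \<in> carrier (W M G)"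
   then obtain p where "p \<in> carrier P" "w = omega G x p" using DG(3) by blast
   then show "face_arrow M F G \<theta> w = \<psi> w" using val[OF t(1), of p] t(2)[of p] \<eta>v[of p] by simp
  qed
  then show "\<psi> \<in> ?L" using t(1) by blast
 qed
qed

end

context gcm
begin

lemma face_arrow_compose:
 assumes F: "F \<in> faces M" "G \<in> faces M" "H \<in> faces M" "G \<subseteq> F" "H \<subseteq> G"
 shows "compose (duals (W M F)) (face_arrow M G H) (face_arrow M F G) = face_arrow M F H"
proof -
 have HF: "H \<subseteq> F" using F by blast
 obtain r where r: "\<forall>x\<in>G. I.pulls F G x r" "face_arrow M F G = dual_hom (W M G) (W M F) r"
  by (rule face_arrow[OF F(1,2,4)])
 obtain s where s: "\<forall>x\<in>H. I.pulls G H x s" "face_arrow M G H = dual_hom (W M H) (W M G) s"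
  by (rule face_arrow[OF F(2,3,5)])
 obtain t where t: "\<forall>x\<in>H. I.pulls F H x t" "face_arrow M F H = dual_hom (W M H) (W M F) t"
  by (rule face_arrow[OF F(1,3) HF])
 obtain x where x: "x \<in> H" using interior_nonempty[OF F(3)] interior_subset[OF F(3)] by blast
 have xG: "x \<in> G" and xt: "x \<in> points M" using x F face_topspace[OF F(3)] by blast+
 have idid: "compose (points M) (id_map M) (id_map M) = id_map M" by (auto simp: compose_def fun_eq_iff)
 have "I.pulls F H x (compose (carrier (W M H)) r s)"
  using pulls_compose[OF id_map id_map adm_id[OF F(1,2,4) xG] F(3) bspec[OF r(1) xG], of s] bspec[OF s(1) x] xt
  unfolding idid by simp
 from I.pulls_unique[OF adm_id[OF F(1,3) HF x] bspec[OF t(1) x] this]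
 have "t = compose (carrier (W M H)) r s" .
 moreover have "s \<in> mon_hom (W M H) (W M G)" "r \<in> mon_hom (W M G) (W M F)"
  using bspec[OF s(1) x] bspec[OF r(1) xG] by (simp_all add: I.pulls_def)
 ultimately show ?thesis
  unfolding r(2) s(2) t(2) using dual_hom_compose[OF comm_monoid_W[OF F(3)] comm_monoid_W[OF F(2)] comm_monoid_W[OF F(1)]] by simp
qed

lemma toric_normal:
 assumes F: "F \<in> faces M"
 shows "toric (dual (W M F))"
proof -
 obtain x where x: "x \<in> F" using interior_nonempty[OF F] interior_subset[OF F] by blast
 obtain U P \<phi> A where c: "gcm_chart M U P \<phi> A" "x \<in> U" by (rule face_chart[OF F x])
 interpret gcm_chart M U P \<phi> A by (rule c(1))
 show ?thesis by (rule toric_dual[OF comm_monoid_W[OF F] fin_gen_presented[OF omega_presents[OF F x c(2)]]])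
qed

lemma face_arrow_face:
 assumes F: "F \<in> faces M" "G \<in> faces M" "G \<subseteq> F"
 shows "face_arrow M F G \<in> mon_hom (dual (W M F)) (dual (W M G))"
  "inj_on (face_arrow M F G) (duals (W M F))"
  "mon_face (face_arrow M F G ` duals (W M F)) (dual (W M G))"
proof -
 show "face_arrow M F G \<in> mon_hom (dual (W M F)) (dual (W M G))"
  by (rule face_arrow[OF F]) (simp add: induces_arrow_def)
 obtain x where x: "x \<in> G" using interior_nonempty[OF F(2)] interior_subset[OF F(2)] by blast
 obtain U P \<phi> A where c: "gcm_chart M U P \<phi> A" "x \<in> U" by (rule face_chart[OF F(2) x])
 interpret gcm_chart M U P \<phi> A by (rule c(1))
 have xF: "x \<in> F" using x F(3) by blast
 note image = face_arrow_image[OF F x c(2)]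
 show "inj_on (face_arrow M F G) (duals (W M F))" by (rule image(1))
 have sub: "omega G x ` tface F x \<subseteq> carrier (W M G)"
  using presentsD(4)[OF omega_presents[OF F(2) x c(2)]] mon_faceD(2)[OF tface_face(1)[OF F(1) xF c(2)]] by blast
 have "{\<psi> \<in> duals (W M G). \<forall>t\<in>tface F x. \<psi> (omega G x t) = 0} =
   {\<psi> \<in> duals (W M G). \<forall>w\<in>omega G x ` tface F x. \<psi> w = 0}" by simp
 then show "mon_face (face_arrow M F G ` duals (W M F)) (dual (W M G))"
  unfolding image(2) using annihilator_face[OF comm_monoid_W[OF F(2)] sub] by simp
qed

text \<open>S is the annihilator of a face T of P by \<open>dual_face\<close>, and T is the face of
  some F by \<open>tface_exists\<close>. Conversely S determines T by biduality, and T determines F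
  by \<open>tface_inj\<close>.\<close>

lemma face_arrow_unique:
 assumes G: "G \<in> faces M" and S: "mon_face S (dual (W M G))"
 shows "\<exists>!F. F \<in> faces M \<and> G \<subseteq> F \<and> face_arrow M F G ` duals (W M F) = S"
proof -
 obtain x where x: "x \<in> fint M G" using interior_nonempty[OF G] by blast
 have xG: "x \<in> G" by (rule interior_face[OF G x])
 obtain U P \<phi> A where c: "gcm_chart M U P \<phi> A" "x \<in> U" by (rule face_chart[OF G xG])
 interpret gcm_chart M U P \<phi> A by (rule c(1))
 note pres = omega_presents[OF G xG c(2)] and TG = tface_face[OF G xG c(2)] and tau = tface_interior[OF G x c(2)]
 define T where "T = {p \<in> carrier P. \<forall>\<theta>\<in>S. \<theta> (omega G x p) = 0}"
 have T: "mon_face T P" "tface G x \<subseteq> T" "S = {\<theta> \<in> duals (W M G). \<forall>t\<in>T. \<theta> (omega G x t) = 0}"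
  unfolding T_def by (rule dual_face[OF pres TG(1) S])+
 \<comment> \<open>At an interior point of G, \<open>tface G x\<close> is \<open>tau x\<close>, so
   every face of P above it belongs to a boundary face through x.\<close>
 obtain F where F: "F \<in> faces M" "x \<in> F" "tface F x = T"
  by (rule tface_exists[OF c(2) T(1)]) (use T(2) tau in auto)
 have GF: "G \<subseteq> F" by (rule frontier[OF F(1) G x F(2)])
 have img: "face_arrow M F G ` duals (W M F) = S"
  unfolding face_arrow_image(2)[OF F(1) G GF xG c(2)] F(3) by (rule T(3)[symmetric])
 show ?thesis
 proof (rule ex1I)
  show "F \<in> faces M \<and> G \<subseteq> F \<and> face_arrow M F G ` duals (W M F) = S" using F GF img by blast
  fix F' assume "F' \<in> faces M \<and> G \<subseteq> F' \<and> face_arrow M F' G ` duals (W M F') = S"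
  then have F': "F' \<in> faces M" "G \<subseteq> F'" "face_arrow M F' G ` duals (W M F') = S" by blast+
  have xF': "x \<in> F'" using xG F'(2) by blast
  note TF' = tface_face(1)[OF F'(1) xF' c(2)]
  have S': "{\<theta> \<in> duals (W M G). \<forall>t\<in>tface F' x. \<theta> (omega G x t) = 0} = S"
   using face_arrow_image(2)[OF F'(1) G F'(2) xG c(2)] F'(3) by simp
  have sub': "tface G x \<subseteq> tface F' x" using tface_face(2)[OF F'(1) xF' c(2)] tau by simp
  \<comment> \<open>Biduality reverses inclusions: a larger annihilator belongs to a smaller
    face.\<close>
  have le: "T1 \<subseteq> T2" if T12: "mon_face T1 P" "mon_face T2 P" "tface G x \<subseteq> T2"
   "{\<theta> \<in> duals (W M G). \<forall>t\<in>T2. \<theta> (omega G x t) = 0} \<subseteq>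
    {\<theta> \<in> duals (W M G). \<forall>t\<in>T1. \<theta> (omega G x t) = 0}" for T1 T2
  proof
   fix p assume p: "p \<in> T1"
   then have "p \<in> carrier P" using mon_faceD(2)[OF T12(1)] by blast
   then show "p \<in> T2" by (rule presented_bidual[OF pres TG(1) T12(2,3)]) (use T12(4) p in blast)
  qed
  have SS: "{\<theta> \<in> duals (W M G). \<forall>t\<in>tface F' x. \<theta> (omega G x t) = 0} =
    {\<theta> \<in> duals (W M G). \<forall>t\<in>T. \<theta> (omega G x t) = 0}" by (rule trans[OF S' T(3)])
  have "tface F' x = T"
   by (rule equalityI[OF le[OF TF' T(1,2) equalityD2[OF SS]] le[OF T(1) TF' sub' equalityD1[OF SS]]])
  then have "tface F' x = tface F x" using F(3) by simp
  from tface_inj[OF F'(1) F(1) xF' F(2) c(2) this] show "F' = F" .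
 qed
qed

lemma monoidal_complex: "monoidal_complex (face_complex M)"
 unfolding monoidal_complex_def
proof (intro conjI ballI allI impI)
 fix F assume "F \<in> Obj (face_complex M)"
 then have F: "F \<in> faces M" by (simp add: face_complex_def)
 show "toric (Mon (face_complex M) F)" using toric_normal[OF F] by (simp add: face_complex_def)
 show "(\<lambda>a\<in>carrier (Mon (face_complex M) F). a) \<in> Arr (face_complex M) F F"
  using face_arrow_id[OF F] F by (simp add: face_complex_def)
 fix S assume "mon_face S (Mon (face_complex M) F)"
 then have S: "mon_face S (dual (W M F))" by (simp add: face_complex_def)
 obtain G where G: "G \<in> faces M" "F \<subseteq> G" "face_arrow M G F ` duals (W M G) = S"
  and u: "\<And>G'. G' \<in> faces M \<Longrightarrow> F \<subseteq> G' \<Longrightarrow> face_arrow M G' F ` duals (W M G') = S \<Longrightarrow> G' = G"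
  using face_arrow_unique[OF F S] by (metis (no_types, lifting))
 \<comment> \<open>There is at most one arrow between two faces, so uniqueness of the pair reduces
   to uniqueness of the face.\<close>
 have i: "i = G \<and> \<alpha> = face_arrow M G F"
  if "i \<in> Obj (face_complex M)" "\<alpha> \<in> Arr (face_complex M) i F" "\<alpha> ` carrier (Mon (face_complex M) i) = S" for i \<alpha>
  using that u[of i] by (auto simp: face_complex_def split: if_splits)
 show "\<exists>!(i, \<alpha>). i \<in> Obj (face_complex M) \<and> \<alpha> \<in> Arr (face_complex M) i F \<and> \<alpha> ` carrier (Mon (face_complex M) i) = S"
 proof (rule ex1I[of _ "(G, face_arrow M G F)"])
  show "case (G, face_arrow M G F) of (i, \<alpha>) \<Rightarrow> i \<in> Obj (face_complex M) \<and>
    \<alpha> \<in> Arr (face_complex M) i F \<and> \<alpha> ` carrier (Mon (face_complex M) i) = S"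
   using G F by (simp add: face_complex_def)
  fix j assume "case j of (i, \<alpha>) \<Rightarrow> i \<in> Obj (face_complex M) \<and>
    \<alpha> \<in> Arr (face_complex M) i F \<and> \<alpha> ` carrier (Mon (face_complex M) i) = S"
  then show "j = (G, face_arrow M G F)" using i[of "fst j" "snd j"] by (simp add: case_prod_beta prod_eq_iff)
 qed
next
 fix F G \<alpha> assume "\<alpha> \<in> Arr (face_complex M) F G"
 then have a: "F \<in> faces M" "G \<in> faces M" "G \<subseteq> F" "\<alpha> = face_arrow M F G"
  by (auto simp: face_complex_def split: if_splits)
 note f = face_arrow_face[OF a(1-3)]
 show "F \<in> Obj (face_complex M)" "G \<in> Obj (face_complex M)" "\<alpha> \<in> mon_hom (Mon (face_complex M) F) (Mon (face_complex M) G)"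
  "inj_on \<alpha> (carrier (Mon (face_complex M) F))"
  "mon_face (\<alpha> ` carrier (Mon (face_complex M) F)) (Mon (face_complex M) G)"
  using a f by (simp_all add: face_complex_def)
 fix H \<beta> assume "\<beta> \<in> Arr (face_complex M) G H"
 then have b: "H \<in> faces M" "H \<subseteq> G" "\<beta> = face_arrow M G H" by (auto simp: face_complex_def split: if_splits)
 show "compose (carrier (Mon (face_complex M) F)) \<beta> \<alpha> \<in> Arr (face_complex M) F H"
  using face_arrow_compose[OF a(1,2) b(1) a(3) b(2)] a b by (auto simp: face_complex_def)
qed

end

section \<open>Functoriality and compatibility with arrows\<close>

lemma natural_compose:
 assumes f: "gcm_map M N f" and g: "gcm_map N K g" and F: "F \<in> faces M"
 defines "h \<equiv> compose (points M) g f"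
 shows "face_map M K h F = face_map N K g (face_map M N f F)" "natural_hom M K h F =
   compose (duals (W M F)) (natural_hom N K g (face_map M N f F)) (natural_hom M N f F)"
proof -
 interpret F: gcm_map M N f by (rule f)
 interpret G: gcm_map N K g by (rule g)
 interpret H: gcm_map M K h unfolding h_def by (rule compose_bmap[OF f g])
 let ?G = "face_map M N f F" and ?H = "face_map N K g (face_map M N f F)"
 note G = F.face_map[OF F] and H = G.face_map[OF F.face_map(1)[OF F]]
 obtain x where x: "x \<in> fint M F" using F.M.interior_nonempty[OF F] by blast
 have xF: "x \<in> F" by (rule F.M.interior_face[OF F x])
 have fx: "f x \<in> ?G" by (rule F.face_map_image[OF F xF])
 have hx: "h x = g (f x)" using F.M.interior_topspace[OF F x] by (simp add: h_def compose_def)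
 have "g (f x) \<in> fint K ?H" using G(2) H(2) x by blast
 then show e: "face_map M K h F = ?H" using H.face_mapI(1)[OF F H(1) x] hx by simp
 obtain r where r: "\<forall>x\<in>F. F.pulls F ?G x r" "natural_hom M N f F = dual_hom (W N ?G) (W M F) r" by (rule F.natural_hom[OF F])
 obtain s where s: "\<forall>y\<in>?G. G.pulls ?G ?H y s" "natural_hom N K g ?G = dual_hom (W K ?H) (W N ?G) s" by (rule G.natural_hom[OF G(1)])
 obtain t where t: "\<forall>x\<in>F. H.pulls F ?H x t" "natural_hom M K h F = dual_hom (W K ?H) (W M F) t"
  by (rule H.natural_hom[OF F, unfolded e])
 have p: "H.pulls F ?H x (compose (carrier (W K ?H)) r s)"
  unfolding h_def by (rule pulls_compose[OF f g F.adm_natural[OF F xF] H(1) bspec[OF r(1) xF] bspec[OF s(1) fx]])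
 have "t = compose (carrier (W K ?H)) r s"
  by (rule H.pulls_unique[OF H.adm_natural[OF F xF, unfolded e] bspec[OF t(1) xF] p])
 moreover have "s \<in> mon_hom (W K ?H) (W N ?G)" "r \<in> mon_hom (W N ?G) (W M F)"
  using bspec[OF s(1) fx] bspec[OF r(1) xF] by (simp_all add: G.pulls_def F.pulls_def)
 ultimately show "natural_hom M K h F = compose (duals (W M F)) (natural_hom N K g ?G) (natural_hom M N f F)"
  unfolding r(2) s(2) t(2)
  using dual_hom_compose[OF G.N.comm_monoid_W[OF H(1)] F.N.comm_monoid_W[OF G(1)] F.M.comm_monoid_W[OF F]] by simp
qed

lemma (in gcm) natural_id:
 assumes F: "F \<in> faces M"
 shows "face_map M M (id_map M) F = F" "natural_hom M M (id_map M) F = (\<lambda>\<phi>\<in>duals (W M F). \<phi>)"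
proof -
 obtain x where x: "x \<in> fint M F" using interior_nonempty[OF F] by blast
 have xF: "x \<in> F" by (rule interior_face[OF F x])
 show e: "face_map M M (id_map M) F = F"
  by (rule I.face_mapI(1)[OF F F x]) (use x interior_topspace[OF F x] in simp)
 obtain r where r: "\<forall>x\<in>F. I.pulls F F x r" "natural_hom M M (id_map M) F = dual_hom (W M F) (W M F) r"
  by (rule I.natural_hom[OF F, unfolded e])
 have "r = (\<lambda>w\<in>carrier (W M F). w)"
  by (rule I.pulls_unique[OF adm_id[OF F F subset_refl xF] bspec[OF r(1) xF] pulls_id[OF F xF]])
 then show "natural_hom M M (id_map M) F = (\<lambda>\<phi>\<in>duals (W M F). \<phi>)"
  using r(2) dual_hom_id[OF comm_monoid_W[OF F]] by simp
qed

context gcm_map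
begin

text \<open>Write f as f after the identity of M and as the identity of N after f. Both ways round
  the square are dual to the pull-back for the pair of F and the image face of G, which
  \<open>adm_mono\<close> shows to be admissible.\<close>

lemma natural_square:
 assumes F: "F \<in> faces M" "G \<in> faces M" "G \<subseteq> F" and \<theta>: "\<theta> \<in> duals (W M F)"
 shows "face_arrow N (face_map M N f F) (face_map M N f G) (natural_hom M N f F \<theta>) =
  natural_hom M N f G (face_arrow M F G \<theta>)"
proof -
 let ?F = "face_map M N f F" and ?G = "face_map M N f G"
 note F' = face_map[OF F(1)] and G' = face_map[OF F(2)] and GF = face_map_mono[OF F]
 obtain x where x: "x \<in> G" using M.interior_nonempty[OF F(2)] M.interior_subset[OF F(2)] by blast
 have xF: "x \<in> F" and xt: "x \<in> points M" using x F M.face_topspace[OF F(2)] by blast+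
 have fx: "f x \<in> ?G" by (rule face_map_image[OF F(2) x])
 have a: "adm F ?G x" by (rule adm_mono[OF adm_natural[OF F(1) xF] G'(1) fx GF])
 obtain r where r: "\<forall>x\<in>F. pulls F ?F x r" "natural_hom M N f F = dual_hom (W N ?F) (W M F) r" by (rule natural_hom[OF F(1)])
 obtain s where s: "\<forall>x\<in>G. pulls G ?G x s" "natural_hom M N f G = dual_hom (W N ?G) (W M G) s" by (rule natural_hom[OF F(2)])
 obtain u where u: "\<forall>x\<in>G. M.I.pulls F G x u" "face_arrow M F G = dual_hom (W M G) (W M F) u" by (rule M.face_arrow[OF F])
 obtain v where v: "\<forall>y\<in>?G. N.I.pulls ?F ?G y v" "face_arrow N ?F ?G = dual_hom (W N ?G) (W N ?F) v"
  by (rule N.face_arrow[OF F'(1) G'(1) GF])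
 have idf: "compose (points M) f (id_map M) = f" "compose (points M) (id_map N) f = f"
  using f_ext f_top by (auto simp: compose_def fun_eq_iff extensional_def)
 have 1: "pulls F ?G x (compose (carrier (W N ?G)) u s)"
  using pulls_compose[OF M.id_map gcm_map_axioms M.adm_id[OF F x] G'(1) bspec[OF u(1) x], of s] bspec[OF s(1) x] xt
  unfolding idf by simp
 have 2: "pulls F ?G x (compose (carrier (W N ?G)) r v)"
  using pulls_compose[OF gcm_map_axioms N.id_map adm_natural[OF F(1) xF] G'(1) bspec[OF r(1) xF] bspec[OF v(1) fx]]
  unfolding idf .
 have eq: "compose (carrier (W N ?G)) u s = compose (carrier (W N ?G)) r v" by (rule pulls_unique[OF a 1 2])
 have h: "s \<in> mon_hom (W N ?G) (W M G)" "u \<in> mon_hom (W M G) (W M F)" "v \<in> mon_hom (W N ?G) (W N ?F)" "r \<in> mon_hom (W N ?F) (W M F)"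
  using bspec[OF s(1) x] bspec[OF u(1) x] bspec[OF v(1) fx] bspec[OF r(1) xF]
  by (simp_all add: pulls_def M.I.pulls_def N.I.pulls_def)
 note W = M.comm_monoid_W[OF F(1)] M.comm_monoid_W[OF F(2)] N.comm_monoid_W[OF F'(1)] N.comm_monoid_W[OF G'(1)]
 have "compose (duals (W M F)) (face_arrow N ?F ?G) (natural_hom M N f F) =
   compose (duals (W M F)) (natural_hom M N f G) (face_arrow M F G)"
  unfolding r(2) s(2) u(2) v(2) dual_hom_compose[OF W(4,3,1) h(3,4)] dual_hom_compose[OF W(4,2,1) h(1,2)] eq ..
 from fun_cong[OF this, of \<theta>] show ?thesis using \<theta> by (simp add: compose_def)
qed

lemma natural_morphism: "natural M N f \<in> complex_morphism (face_complex M) (face_complex N)"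
 unfolding natural_def complex_morphism_def mem_Collect_eq prod.case
proof (intro conjI ballI allI)
 show "(\<lambda>F\<in>faces M. face_map M N f F) \<in> extensional (Obj (face_complex M))"
  "(\<lambda>F\<in>faces M. natural_hom M N f F) \<in> extensional (Obj (face_complex M))" by (simp_all add: face_complex_def)
 fix F assume "F \<in> Obj (face_complex M)"
 then have F: "F \<in> faces M" by (simp add: face_complex_def)
 show "(\<lambda>F\<in>faces M. face_map M N f F) F \<in> Obj (face_complex N)"
  using face_map(1)[OF F] F by (simp add: face_complex_def)
 show "(\<lambda>F\<in>faces M. natural_hom M N f F) F \<in>
   interior_hom (Mon (face_complex M) F) (Mon (face_complex N) ((\<lambda>F\<in>faces M. face_map M N f F) F))"
  using natural_interior[OF F] F by (simp add: face_complex_def)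
next
 fix F G \<alpha> assume "\<alpha> \<in> Arr (face_complex M) F G"
 then have F: "F \<in> faces M" "G \<in> faces M" "G \<subseteq> F" "\<alpha> = face_arrow M F G"
  by (auto simp: face_complex_def split: if_splits)
 show "\<exists>\<beta>\<in>Arr (face_complex N) ((\<lambda>F\<in>faces M. face_map M N f F) F) ((\<lambda>F\<in>faces M. face_map M N f F) G).
   \<forall>a\<in>carrier (Mon (face_complex M) F). \<beta> ((\<lambda>F\<in>faces M. natural_hom M N f F) F a) =
    (\<lambda>F\<in>faces M. natural_hom M N f F) G (\<alpha> a)"
  using face_map(1)[OF F(1)] face_map(1)[OF F(2)] face_map_mono[OF F(1-3)] natural_square[OF F(1-3)] F
  by (simp add: face_complex_def)
qed

end

section \<open>The categories\<close>

lemma gcm_map_iff: "gc_manifold M \<Longrightarrow> gc_manifold N \<Longrightarrow> gcm_map M N f \<longleftrightarrow> f \<in> interior_bmap M N"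
 by (simp add: gcm_map_def gcm_map_axioms_def gcm_def)

lemma category_gc: "is_category (gc_category :: (('m, 'p) gc_space, 'm \<Rightarrow> 'm) cat)"
 unfolding is_category_def gc_category_def
proof (simp, intro conjI allI ballI impI)
 fix M :: "('m, 'p) gc_space" assume M: "gc_manifold M"
 show "id_map M \<in> interior_bmap M M"
  using gcm.id_map[of M] gcm_map_iff[OF M M] M by (simp add: gcm_def)
 fix N :: "('m, 'p) gc_space" assume N: "gc_manifold N"
 {
  fix f assume "f \<in> interior_bmap M N"
  then interpret gcm_map M N f using gcm_map_iff[OF M N] by blast
  show "compose (points M) f (id_map M) = f" "compose (points M) (id_map N) f = f"
   using f_ext f_top by (auto simp: compose_def fun_eq_iff extensional_def)
 }
 fix K :: "('m, 'p) gc_space" assume K: "gc_manifold K"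
 fix f assume f: "f \<in> interior_bmap M N"
 show "compose (points M) g f \<in> interior_bmap M K" if "g \<in> interior_bmap N K" for g
  using compose_bmap[of M N f K g] that f gcm_map_iff M N K by blast
 fix L :: "('m, 'p) gc_space" and g h
 interpret gcm_map M N f using gcm_map_iff[OF M N] f by blast
 show "compose (points M) (compose (points N) h g) f =
   compose (points M) h (compose (points M) g f)" using f_top by (auto simp: compose_def fun_eq_iff)
qed

section \<open>The category of monoidal complexes\<close>

lemma monoidal_complexD:
 assumes "monoidal_complex P"
 shows "i \<in> Obj P \<Longrightarrow> comm_monoid (Mon P i)"
  "\<alpha> \<in> Arr P i j \<Longrightarrow> i \<in> Obj P \<and> j \<in> Obj P \<and> \<alpha> \<in> mon_hom (Mon P i) (Mon P j)"
proof -
 have 1: "\<forall>i\<in>Obj P. toric (Mon P i)"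
  and 2: "\<forall>i j. \<forall>\<alpha>\<in>Arr P i j. i \<in> Obj P \<and> j \<in> Obj P \<and> \<alpha> \<in> mon_hom (Mon P i) (Mon P j) \<and>
    inj_on \<alpha> (carrier (Mon P i)) \<and> mon_face (\<alpha> ` carrier (Mon P i)) (Mon P j)"
  using assms unfolding monoidal_complex_def by simp_all
 show "i \<in> Obj P \<Longrightarrow> comm_monoid (Mon P i)" using 1 by (simp add: toric_def)
 show "\<alpha> \<in> Arr P i j \<Longrightarrow> i \<in> Obj P \<and> j \<in> Obj P \<and> \<alpha> \<in> mon_hom (Mon P i) (Mon P j)" using 2 by simp
qed

lemma complex_morphismD:
 assumes "m \<in> complex_morphism P Q"
 shows "fst m \<in> extensional (Obj P)" "snd m \<in> extensional (Obj P)" "i \<in> Obj P \<Longrightarrow> fst m i \<in> Obj Q"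
  "i \<in> Obj P \<Longrightarrow> snd m i \<in> interior_hom (Mon P i) (Mon Q (fst m i))"
  "\<alpha> \<in> Arr P i j \<Longrightarrow> \<exists>\<beta>\<in>Arr Q (fst m i) (fst m j). \<forall>a\<in>carrier (Mon P i). \<beta> (snd m i a) = snd m j (\<alpha> a)"
 using assms unfolding complex_morphism_def by auto

lemma complex_morphismI:
 assumes "\<phi>0 \<in> extensional (Obj P)" "\<phi> \<in> extensional (Obj P)"
  "\<And>i. i \<in> Obj P \<Longrightarrow> \<phi>0 i \<in> Obj Q" "\<And>i. i \<in> Obj P \<Longrightarrow> \<phi> i \<in> interior_hom (Mon P i) (Mon Q (\<phi>0 i))"
  "\<And>i j \<alpha>. \<alpha> \<in> Arr P i j \<Longrightarrow> \<exists>\<beta>\<in>Arr Q (\<phi>0 i) (\<phi>0 j). \<forall>a\<in>carrier (Mon P i). \<beta> (\<phi> i a) = \<phi> j (\<alpha> a)"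
 shows "(\<phi>0, \<phi>) \<in> complex_morphism P Q" using assms unfolding complex_morphism_def by simp

lemma interior_homD:
 assumes "h \<in> interior_hom P Q"
 shows "h \<in> mon_hom P Q" "h \<in> extensional (carrier P)" "p \<in> carrier P \<Longrightarrow> h p \<in> carrier Q"
 using assms mon_homD[of h P Q] by (auto simp: interior_hom_def)

lemma complex_identity:
 assumes P: "monoidal_complex P"
 shows "(\<lambda>i\<in>Obj P. i, \<lambda>i\<in>Obj P. \<lambda>a\<in>carrier (Mon P i). a) \<in> complex_morphism P P"
proof (rule complex_morphismI)
 fix i assume "i \<in> Obj P"
 then show "(\<lambda>i\<in>Obj P. i) i \<in> Obj P"
  "(\<lambda>i\<in>Obj P. \<lambda>a\<in>carrier (Mon P i). a) i \<in> interior_hom (Mon P i) (Mon P ((\<lambda>i\<in>Obj P. i) i))"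
  using interior_hom_identity[OF monoidal_complexD(1)[OF P]] by simp_all
next
 fix i j \<alpha> assume a: "\<alpha> \<in> Arr P i j"
 note D = monoidal_complexD(2)[OF P a]
 show "\<exists>\<beta>\<in>Arr P ((\<lambda>i\<in>Obj P. i) i) ((\<lambda>i\<in>Obj P. i) j). \<forall>c\<in>carrier (Mon P i).
   \<beta> ((\<lambda>i\<in>Obj P. \<lambda>a\<in>carrier (Mon P i). a) i c) = (\<lambda>i\<in>Obj P. \<lambda>a\<in>carrier (Mon P i). a) j (\<alpha> c)"
  using a D mon_homD(4)[of \<alpha>] by (intro bexI[of _ \<alpha>]) auto
qed simp_all

lemma complex_compose:
 assumes P: "monoidal_complex P" and m: "m \<in> complex_morphism P Q" and n: "n \<in> complex_morphism Q R"
 shows "Comp complex_category P Q R n m \<in> complex_morphism P R"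
proof -
 note M = complex_morphismD[OF m] and N = complex_morphismD[OF n]
 have "(compose (Obj P) (fst n) (fst m), \<lambda>i\<in>Obj P. compose (carrier (Mon P i)) (snd n (fst m i)) (snd m i))
   \<in> complex_morphism P R"
 proof (rule complex_morphismI)
  fix i assume i: "i \<in> Obj P"
  show "compose (Obj P) (fst n) (fst m) i \<in> Obj R" using N(3)[OF M(3)[OF i]] i by (simp add: compose_def)
  show "(\<lambda>i\<in>Obj P. compose (carrier (Mon P i)) (snd n (fst m i)) (snd m i)) i
    \<in> interior_hom (Mon P i) (Mon R (compose (Obj P) (fst n) (fst m) i))"
   using interior_hom_compose[OF monoidal_complexD(1)[OF P i] M(4)[OF i] N(4)[OF M(3)[OF i]]] i
   by (simp add: compose_def)
 next
  fix i j \<alpha> assume a: "\<alpha> \<in> Arr P i j"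
  note D = monoidal_complexD(2)[OF P a]
  obtain \<beta> where b: "\<beta> \<in> Arr Q (fst m i) (fst m j)" "\<forall>a\<in>carrier (Mon P i). \<beta> (snd m i a) = snd m j (\<alpha> a)"
   using M(5)[OF a] by blast
  obtain \<gamma> where c: "\<gamma> \<in> Arr R (fst n (fst m i)) (fst n (fst m j))"
   "\<forall>a\<in>carrier (Mon Q (fst m i)). \<gamma> (snd n (fst m i) a) = snd n (fst m j) (\<beta> a)" using N(5)[OF b(1)] by blast
  show "\<exists>\<beta>\<in>Arr R (compose (Obj P) (fst n) (fst m) i) (compose (Obj P) (fst n) (fst m) j). \<forall>a\<in>carrier (Mon P i).
    \<beta> ((\<lambda>i\<in>Obj P. compose (carrier (Mon P i)) (snd n (fst m i)) (snd m i)) i a) =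
    (\<lambda>i\<in>Obj P. compose (carrier (Mon P i)) (snd n (fst m i)) (snd m i)) j (\<alpha> a)"
  proof (intro bexI[of _ \<gamma>] ballI)
   fix a assume a: "a \<in> carrier (Mon P i)"
   have "\<alpha> a \<in> carrier (Mon P j)" using D mon_homD(4)[of \<alpha>] a by blast
   moreover have "snd m i a \<in> carrier (Mon Q (fst m i))" using interior_homD(3)[OF M(4)] D a by blast
   ultimately show "\<gamma> ((\<lambda>i\<in>Obj P. compose (carrier (Mon P i)) (snd n (fst m i)) (snd m i)) i a) =
     (\<lambda>i\<in>Obj P. compose (carrier (Mon P i)) (snd n (fst m i)) (snd m i)) j (\<alpha> a)"
    using D a b(2) c(2) by (simp add: compose_def)
  qed (use c(1) D in \<open>simp add: compose_def\<close>)
 qed (simp_all add: compose_def)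
 then show ?thesis by (simp add: complex_category_def case_prod_beta)
qed

lemma complex_comp_fst: "fst (Comp complex_category P Q R n m) = compose (Obj P) (fst n) (fst m)"
 and complex_comp_snd: "snd (Comp complex_category P Q R n m) =
  (\<lambda>i\<in>Obj P. compose (carrier (Mon P i)) (snd n (fst m i)) (snd m i))"
 by (simp_all add: complex_category_def case_prod_beta)

text \<open>The object map, the family and each of its members are extensional, so agreement on
  objects and on elements is enough.\<close>

lemma complex_morphism_eqI:
 assumes "m \<in> complex_morphism P Q" "n \<in> complex_morphism P Q" "\<And>i. i \<in> Obj P \<Longrightarrow> fst m i = fst n i"
  "\<And>i a. i \<in> Obj P \<Longrightarrow> a \<in> carrier (Mon P i) \<Longrightarrow> snd m i a = snd n i a"
 shows "m = n"
proof (rule prod_eqI)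
 note M = complex_morphismD[OF assms(1)] and N = complex_morphismD[OF assms(2)]
 show "fst m = fst n" by (rule extensionalityI[OF M(1) N(1)]) (rule assms(3))
 show "snd m = snd n"
 proof (rule extensionalityI[OF M(2) N(2)])
  fix i assume i: "i \<in> Obj P"
  show "snd m i = snd n i"
   by (rule extensionalityI[OF interior_homD(2)[OF M(4)[OF i]] interior_homD(2)[OF N(4)[OF i]]]) (rule assms(4)[OF i])
 qed
qed

lemma category_complex: "is_category (complex_category :: (('i, 'a) complex_data, ('i, 'a, 'i, 'a) complex_map) cat)"
proof -
 let ?C = "complex_category :: (('i, 'a) complex_data, ('i, 'a, 'i, 'a) complex_map) cat"
 have Ob: "Ob ?C = {P. monoidal_complex P}" and Hom: "Hom ?C = complex_morphism"
  and Id: "Ident ?C P = (\<lambda>i\<in>Obj P. i, \<lambda>i\<in>Obj P. \<lambda>a\<in>carrier (Mon P i). a)" for P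
  by (simp_all add: complex_category_def)
 note fs = complex_comp_fst complex_comp_snd
 show ?thesis unfolding is_category_def Ob Hom mem_Collect_eq
 proof (intro conjI ballI; (unfold mem_Collect_eq)?)
  fix P :: "('i, 'a) complex_data" assume P: "monoidal_complex P"
  have IP: "Ident ?C P \<in> complex_morphism P P" unfolding Id by (rule complex_identity[OF P])
  then show "Ident ?C P \<in> complex_morphism P P" .
  fix Q :: "('i, 'a) complex_data" assume Q: "monoidal_complex Q"
  have IQ: "Ident ?C Q \<in> complex_morphism Q Q" unfolding Id by (rule complex_identity[OF Q])
  {
   fix m assume m: "m \<in> complex_morphism P Q"
   note M = complex_morphismD[OF m] and H = interior_homD(3)[OF complex_morphismD(4)[OF m]]
   show "Comp ?C P P Q m (Ident ?C P) = m"
    by (rule complex_morphism_eqI[OF complex_compose[OF P IP m] m]) (simp_all add: fs Id compose_def)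
   show "Comp ?C P Q Q (Ident ?C Q) m = m"
    by (rule complex_morphism_eqI[OF complex_compose[OF P m IQ] m]) (use M(3) H in \<open>simp_all add: fs Id compose_def\<close>)
  }
  fix R :: "('i, 'a) complex_data" and m assume m: "m \<in> complex_morphism P Q"
  {
   fix n assume n: "n \<in> complex_morphism Q R"
   show "Comp ?C P Q R n m \<in> complex_morphism P R" by (rule complex_compose[OF P m n])
  }
  fix S :: "('i, 'a) complex_data" and n k
  assume n: "n \<in> complex_morphism Q R" and k: "k \<in> complex_morphism R S"
  note M = complex_morphismD(3)[OF m] and H = interior_homD(3)[OF complex_morphismD(4)[OF m]]
  show "Comp ?C P Q S (Comp ?C Q R S k n) m = Comp ?C P R S k (Comp ?C P Q R n m)"
   by (rule prod_eqI) (use M H in \<open>auto simp: fs compose_def restrict_def fun_eq_iff\<close>)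
 qed
qed

lemma functor_natural:
 "is_functor (gc_category :: (('m, 'p) gc_space, 'm \<Rightarrow> 'm) cat) complex_category face_complex natural"
proof -
 let ?G = "gc_category :: (('m, 'p) gc_space, 'm \<Rightarrow> 'm) cat"
 let ?C = "complex_category :: (('m set, ('m \<Rightarrow> ('m \<Rightarrow> real) set set) \<Rightarrow> nat) complex_data,
  ('m set, ('m \<Rightarrow> ('m \<Rightarrow> real) set set) \<Rightarrow> nat, 'm set, ('m \<Rightarrow> ('m \<Rightarrow> real) set set) \<Rightarrow> nat) complex_map) cat"
 have Ob: "Ob ?G = {M. gc_manifold M}" "Hom ?G = interior_bmap" "Ident ?G M = id_map M"
  "Comp ?G M N K g f = compose (points M) g f" for M N K f g by (simp_all add: gc_category_def)
 have ObC: "Ob ?C = {P. monoidal_complex P}" "Hom ?C = complex_morphism"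
  "Ident ?C P = (\<lambda>i\<in>Obj P. i, \<lambda>i\<in>Obj P. \<lambda>a\<in>carrier (Mon P i). a)" for P by (simp_all add: complex_category_def)
 show ?thesis unfolding is_functor_def Ob ObC
 proof (intro conjI ballI category_gc category_complex; (unfold mem_Collect_eq)?)
  fix M :: "('m, 'p) gc_space" assume M: "gc_manifold M"
  interpret M: gcm M by unfold_locales (rule M)
  show "monoidal_complex (face_complex M)" by (rule M.monoidal_complex)
  have o: "Obj (face_complex M) = faces M" "Mon (face_complex M) F = dual (W M F)" for F
   by (simp_all add: face_complex_def)
  show "natural M M (id_map M) = (\<lambda>i\<in>Obj (face_complex M). i,
    \<lambda>i\<in>Obj (face_complex M). \<lambda>a\<in>carrier (Mon (face_complex M) i). a)"
   unfolding o natural_def using M.natural_id by (simp add: restrict_def fun_eq_iff)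
  fix N :: "('m, 'p) gc_space" assume N: "gc_manifold N"
  {
   fix f assume f: "f \<in> interior_bmap M N"
   show "natural M N f \<in> complex_morphism (face_complex M) (face_complex N)"
    by (rule gcm_map.natural_morphism) (simp add: gcm_map_iff M N f)
  }
  fix K :: "('m, 'p) gc_space" and f g assume K: "gc_manifold K"
   and f: "f \<in> interior_bmap M N" and g: "g \<in> interior_bmap N K"
  have fg: "gcm_map M N f" "gcm_map N K g" using gcm_map_iff M N K f g by blast+
  note C = natural_compose[OF fg] and G = gcm_map.face_map(1)[OF fg(1)]
  show "natural M K (compose (points M) g f) =
    Comp ?C (face_complex M) (face_complex N) (face_complex K) (natural N K g) (natural M N f)"
   by (rule prod_eqI)
    (use C G in \<open>simp_all add: complex_comp_fst complex_comp_snd o natural_def compose_def[of "faces M"]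
     restrict_def fun_eq_iff\<close>)
 qed
qed

text \<open>The isomorphisms certify that \<open>W\<close> and \<open>triv\<close> are what they
  stand for; the clauses \<open>induces_arrow\<close> and \<open>induces_natural\<close> certify
  that the descriptions defining the homomorphisms denote. Morphisms are treated between manifolds
  over different types, whereas the functor has all its points in one type.\<close>

theorem theorem2p16:
  shows
   "(\<forall>M :: ('m, 'p) gc_space. gc_manifold M \<longrightarrow>
       monoidal_complex (face_complex M) \<and>
       (\<forall>F\<in>faces M.
          (\<forall>x\<in>face_interior M F. (\<lambda>w. w x) \<in> iso (W M F) (sharp (stalk M x))) \<and>
          (\<forall>x\<in>F. triv M F x \<in> iso (dual (W M F)) (normal_monoid M F x)) \<and>
          (\<forall>G\<in>faces M. G \<subseteq> F \<longrightarrow> induces_arrow M F G (face_arrow M F G)))) \<and>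
    (\<forall>(M :: ('m, 'p) gc_space) (N :: ('n, 'q) gc_space).
       gc_manifold M \<and> gc_manifold N \<longrightarrow> (\<forall>f\<in>interior_bmap M N.
         natural M N f \<in> complex_morphism (face_complex M) (face_complex N) \<and>
         (\<forall>F\<in>faces M.
            f ` face_interior M F \<subseteq> face_interior N (face_map M N f F) \<and>
            induces_natural M N f F (natural_hom M N f F)))) \<and>
    is_functor (gc_category :: (('m, 'p) gc_space, 'm \<Rightarrow> 'm) cat) complex_category face_complex natural"
proof (intro conjI allI impI ballI)
 fix M :: "('m, 'p) gc_space" assume M: "gc_manifold M"
 interpret gcm M by unfold_locales (rule M)
 show "monoidal_complex (face_complex M)" by (rule monoidal_complex)
 fix F assume F: "F \<in> faces M"
 have isos: "triv M F x \<in> iso (dual (W M F)) (normal_monoid M F x) \<and>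
   (x \<in> fint M F \<longrightarrow> (\<lambda>w. w x) \<in> iso (W M F) (sharp (stalk M x)))" if x: "x \<in> F" for x
 proof -
  obtain U P \<phi> A where c: "gcm_chart M U P \<phi> A" "x \<in> U" by (rule face_chart[OF F x])
  interpret gcm_chart M U P \<phi> A by (rule c(1))
  show ?thesis using triv_iso[OF F x c(2)] eval_iso[OF F _ c(2)] by blast
 qed
 show "(\<lambda>w. w x) \<in> iso (W M F) (sharp (stalk M x))" if "x \<in> fint M F" for x
  using isos[OF interior_face[OF F that]] that by blast
 show "triv M F x \<in> iso (dual (W M F)) (normal_monoid M F x)" if "x \<in> F" for x using isos[OF that] by blast
 show "induces_arrow M F G (face_arrow M F G)" if "G \<in> faces M" "G \<subseteq> F" for G
  by (rule face_arrow[OF F that])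
next
 fix M :: "('m, 'p) gc_space" and N :: "('n, 'q) gc_space" and f
 assume "gc_manifold M \<and> gc_manifold N" "f \<in> interior_bmap M N"
 then interpret gcm_map M N f using gcm_map_iff by blast
 show "natural M N f \<in> complex_morphism (face_complex M) (face_complex N)" by (rule natural_morphism)
 fix F assume F: "F \<in> faces M"
 show "f ` fint M F \<subseteq> fint N (face_map M N f F)" by (rule face_map(2)[OF F])
 show "induces_natural M N f F (natural_hom M N f F)" by (rule natural_hom[OF F])
qed (rule functor_natural)


end
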